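(* Define the meromorphic function on $\mathbb C$ $$C(s):=Q(s)-Q_{\rm rat}(s)+\cot\frac{\pi s}2\;T(s).$$ Then $C\equiv0$. Equivalently: on every step-two lattice $\{s_0-2k\}_{k\ge0}$ (real or complex) avoiding the poles, the constant $c(s_0)$ in the decomposition $$Q(s)=c(s_0)+Q_{\rm rat}(s)-\cot\frac{\pi s}{2}\,T(s)\qquad(s\in\{s_0-2k\}_{k\ge0})$$ vanishes; and, for real $s<0$ with $2s\notin\mathbb Z$, the identity $$\operatorname{Im}\frac ND=-\frac12\,T(s)+\tan\frac{\pi s}{2}\,\mathcal E(s),\qquad \mathcal E(s)=\frac{c(s_0)}2+\frac{Q_{\rm rat}(s)}2-\operatorname{Re}\frac ND-\frac{\psi'(s)}4,$$ holds with $c(s_0)=0$.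
   Context: $\mathsf K(\alpha;s)={}_2F_1(s-\frac\alpha2,s+\frac\alpha2;1;-1)$ (principal branch; entire in $(\alpha,s)$), $\mathsf K_0(s)=\mathsf K(0;s)=\dfrac{\Gamma(1+\frac s2)}{\Gamma(1+s)\Gamma(1-\frac s2)}$, $\mathsf K_2(s)=\partial_\alpha^2\mathsf K(\alpha;s)|_{\alpha=0}$, and $Q=\mathsf K_2/\mathsf K_0$. $Q_{\rm rat}(s)=\frac18\bigl[\psi'(\frac{1-s}2)-\psi'(1-\frac s2)\bigr]$, with $\psi'$ the trigamma function. $\widehat{\mathsf r}(s)=s\left[\dfrac{\Gamma(s/2)}{\Gamma((1+s)/2)}\right]^2$, $\ \widehat{\mathsf f}_\Gamma(s)=-\dfrac{(2s-1)\,\widehat{\mathsf r}(s)}{4s^2(s-1)}$, $\ T(s)=\sum_{k\ge0}\widehat{\mathsf f}_\Gamma(s-1-2k)$ (a meromorphic function on $\mathbb C$ with poles in $\mathbb Z$). With $Z=1-2s$, $\mathcal H(\alpha;Z)$ is the boundary value at $z=2+i0$ (limit from $\operatorname{Im}z>0$) of the principal branch of ${}_2F_1(s-\frac\alpha2,s+\frac\alpha2;2s;z)$, and $\dfrac ND=\dfrac12\,\dfrac{\partial_\alpha^2\mathcal H(0;Z)}{\mathcal H(0;Z)}$. *)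

theory Defs
  imports "HOL-Complex_Analysis.Complex_Analysis"
begin

text \<open>
  The principal branch of the Gauss function is the holomorphic function on the plane cut along
  \<open>[1, \<infinity>)\<close> that agrees with the hypergeometric series on the open unit disc. It is unique
  because the slit plane is connected. Nothing is said about values on the cut; boundary values
  there are taken as explicit limits.
\<close>
definition slit_plane :: "complex set" where
  "slit_plane = - {of_real x |x. x \<ge> (1::real)}"

definition hyp2F1 :: "complex \<Rightarrow> complex \<Rightarrow> complex \<Rightarrow> complex \<Rightarrow> complex" where
  "hyp2F1 a b c z = (THE w. \<exists>f. f holomorphic_on slit_plane \<and>
     (\<forall>u\<in>ball 0 1. f u = eval_fps (fps_hypergeo [a, b] [c] 1) u) \<and> w = f z)"

definition Kfun :: "complex \<Rightarrow> complex \<Rightarrow> complex" where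
  "Kfun \<alpha> s = hyp2F1 (s - \<alpha>/2) (s + \<alpha>/2) 1 (-1)"

definition Kfun0 :: "complex \<Rightarrow> complex" where
  "Kfun0 s = Kfun 0 s"

definition Kfun2 :: "complex \<Rightarrow> complex" where
  "Kfun2 s = (deriv ^^ 2) (\<lambda>\<alpha>. Kfun \<alpha> s) 0"

definition Qfun :: "complex \<Rightarrow> complex" where
  "Qfun s = Kfun2 s / Kfun0 s"

definition Qrat :: "complex \<Rightarrow> complex" where
  "Qrat s = (1/8) * (Polygamma 1 ((1 - s)/2) - Polygamma 1 (1 - s/2))"

definition rhat :: "complex \<Rightarrow> complex" where
  "rhat s = s * (Gamma (s/2) / Gamma ((1 + s)/2))\<^sup>2"

definition fhat :: "complex \<Rightarrow> complex" where
  "fhat s = - ((2 * s - 1) * rhat s) / (4 * s\<^sup>2 * (s - 1))"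

definition Tfun :: "complex \<Rightarrow> complex" where
  "Tfun s = (\<Sum>k. fhat (s - 1 - 2 * of_nat k))"

definition cotT :: "complex \<Rightarrow> complex" where
  "cotT s = cot (of_real pi * s / 2) * Tfun s"

definition Cfun :: "complex \<Rightarrow> complex" where
  "Cfun s = Qfun s - Qrat s + cotT s"

text \<open>
  Boundary value from the upper half plane at the point 2 of the cut, with the parameter \<open>s\<close>
  recovered from \<open>Z = 1 - 2 s\<close>.
\<close>
definition Hfun :: "complex \<Rightarrow> complex \<Rightarrow> complex" where
  "Hfun \<alpha> Z = (let s = (1 - Z)/2 in
     Lim (at 2 within {z. Im z > 0}) (hyp2F1 (s - \<alpha>/2) (s + \<alpha>/2) (2 * s)))"

definition ND :: "complex \<Rightarrow> complex" where
  "ND s = (1/2) * ((deriv ^^ 2) (\<lambda>\<alpha>. Hfun \<alpha> (1 - 2 * s)) 0 / Hfun 0 (1 - 2 * s))"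

definition Efun :: "complex \<Rightarrow> complex \<Rightarrow> complex" where
  "Efun c s = c/2 + Qrat s / 2 - of_real (Re (ND s)) - Polygamma 1 s / 4"

definition lattice2 :: "complex \<Rightarrow> complex set" where
  "lattice2 s0 = {s0 - 2 * of_nat k |k. True}"

end

theory Submission
  imports Defs "HOL-Real_Asymp.Real_Asymp"
begin

text \<open>
  Let \<open>s = -\<nu>\<close> with \<open>\<nu> > 0\<close>. On the unit circle the Parseval pairing of two binomial series turns the value at
  \<open>-1\<close> into an integral (lemma \<open>hyp2F1_minus_one_circle\<close>), and folding the circle gives
  \<open>2\<pi> K(\<alpha>;-\<nu>) = e^(-i\<pi>\<nu>/2) W\<^sub>+(\<alpha>) + e^(i\<pi>\<nu>/2) W\<^sub>-(\<alpha>)\<close>, where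
  \<open>W\<^sub>\<plusminus>(\<alpha>) = \<integral>\<^sub>0\<^sup>\<pi> (2 sin \<theta>)^\<nu> exp(\<alpha> (L \<plusminus> i\<Phi>)/2) d\<theta>\<close> with \<open>L = ln tan(\<theta>/2)\<close> and \<open>\<Phi> = \<theta> - \<pi>/2\<close>
  (lemma \<open>Kfun_Wint\<close>). Differentiating twice at \<open>\<alpha> = 0\<close> expresses \<open>Q(-\<nu>)\<close> through the means
  \<open>\<langle>L\<^sup>2\<rangle>\<close>, \<open>\<langle>\<Phi>\<^sup>2\<rangle>\<close>, \<open>\<langle>L\<Phi>\<rangle>\<close> with respect to the weight \<open>sin^\<nu> \<theta>\<close>:
  \<open>Q = (\<langle>L\<^sup>2\<rangle> - \<langle>\<Phi>\<^sup>2\<rangle>)/4 + tan(\<pi>\<nu>/2) \<langle>L\<Phi>\<rangle>/2\<close>.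

  Each mean satisfies a first order recurrence under \<open>\<nu> \<mapsto> \<nu> + 2\<close>, found by integration by parts, and tends to
  zero because \<open>|L|\<close> and \<open>|\<Phi>|\<close> are bounded by \<open>|cot \<theta>|\<close>. Telescoping identifies \<open>(\<langle>L\<^sup>2\<rangle> - \<langle>\<Phi>\<^sup>2\<rangle>)/4\<close> with the trigamma
  series of \<open>Q_rat\<close>, and, after the reflection formula, \<open>\<langle>L\<Phi>\<rangle>/2\<close> with the series of \<open>T\<close> up to the factor
  \<open>tan\<^sup>2(\<pi>\<nu>/2)\<close> (lemmas \<open>Qrat_neg\<close> and \<open>Tfun_neg\<close>). It is the decay of the means that fixes the constant on each
  lattice to be zero. So \<open>C\<close> vanishes on the negative reals off the integers, and since all its constituents are
  holomorphic off the integers it vanishes identically (theorem \<open>Cfun_eq_0\<close>).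

  For \<open>N/D\<close> the boundary value at \<open>2 + i0\<close> is needed where the parameters have negative real part, beyond the range
  of Euler's integral. The integral is cut at \<open>\<rho> = Re (1/z)\<close>; a Moebius map sends each half to the radius
  \<open>[0,1]\<close> of the unit disc, and a keyhole contour replaces the radius by a circle, which makes the formula valid for all
  non-integral parameters (theorem \<open>keyrep_eq\<close>). As \<open>z \<rightarrow> 2\<close> the circle becomes the unit circle, and
  the same folded integrals \<open>W\<^sub>\<plusminus>\<close> appear (theorem \<open>Hfun_neg\<close>):
  \<open>H(\<alpha>) \<Gamma>(a)\<Gamma>(b)/\<Gamma>(2s) = \<pi> (cot \<pi>a + cot \<pi>b) K(\<alpha>;s) + i e^(i\<pi>\<nu>/2) W\<^sub>-(\<alpha>)\<close> with \<open>a, b = s -/+ \<alpha>/2\<close>.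
  Two derivatives at \<open>\<alpha> = 0\<close> then give \<open>N/D\<close> in closed form, and its imaginary part is read off.
\<close>

section \<open>Integrals depending holomorphically on a parameter\<close>

text \<open>Local boundedness, uniform in \<open>t\<close>, replaces joint continuity, which is awkward to verify for powers whose base
  vanishes at an end point of the interval.\<close>
definition holo_integrand :: "complex set \<Rightarrow> real \<Rightarrow> real \<Rightarrow> (complex \<Rightarrow> real \<Rightarrow> complex) \<Rightarrow> bool" where
  "holo_integrand U a b f \<longleftrightarrow> open U \<and> (\<forall>t\<in>{a..b}. (\<lambda>x. f x t) holomorphic_on U) \<and>
     (\<forall>x\<in>U. f x integrable_on {a..b}) \<and>
     (\<forall>x\<in>U. \<exists>e>0. \<exists>M. cball x e \<subseteq> U \<and> (\<forall>y\<in>cball x e. \<forall>t\<in>{a..b}. norm (f y t) \<le> M))"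

lemma holo_integrand_deriv_bound:
  assumes "holo_integrand U a b f" "x \<in> U"
  obtains r M where "r > 0" "cball x r \<subseteq> U" 
    "\<And>y t. y \<in> cball x r \<Longrightarrow> t \<in> {a..b} \<Longrightarrow> norm (deriv (\<lambda>y. f y t) y) \<le> M"
proof -
  from assms obtain e M where e: "e > 0" "cball x e \<subseteq> U" "\<forall>y\<in>cball x e. \<forall>t\<in>{a..b}. norm (f y t) \<le> M"
    unfolding holo_integrand_def by blast
  show thesis
  proof (rule that[of "e/2" "2 * M / e"])
    show "e/2 > 0" "cball x (e/2) \<subseteq> U" using e by auto
    fix y t assume y: "y \<in> cball x (e/2)" and t: "t \<in> {a..b}"
    have hol: "(\<lambda>x. f x t) holomorphic_on U" using assms t unfolding holo_integrand_def by blast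
    have sub: "cball y (e/2) \<subseteq> cball x e" using y 
      by (auto simp: cball_subset_cball_iff dist_commute)
    have "norm ((deriv ^^ 1) (\<lambda>x. f x t) y) \<le> fact 1 * M / (e/2)^1"
    proof (rule Cauchy_inequality)
      show "(\<lambda>x. f x t) holomorphic_on ball y (e/2)"
        by (rule holomorphic_on_subset[OF hol]) (use sub e ball_subset_cball in blast)
      show "continuous_on (cball y (e/2)) (\<lambda>x. f x t)"
        by (rule holomorphic_on_imp_continuous_on, rule holomorphic_on_subset[OF hol]) (use sub e in blast)
      fix w assume "norm (y - w) = e/2"
      then have "w \<in> cball y (e/2)" by (simp add: dist_norm)
      then show "norm (f w t) \<le> M" using sub e t by blast
    qed (use e in auto)
    then show "norm (deriv (\<lambda>y. f y t) y) \<le> 2 * M / e" by (simp add: mult.commute)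
  qed
qed

text \<open>Cauchy's estimate turns the local bound on \<open>f\<close> into a local bound on the derivative, so the difference quotients
  are dominated by a constant and dominated convergence applies.\<close>
lemma holo_integrand_has_derivative:
  assumes "holo_integrand U a b f" "x \<in> U"
  shows "(\<lambda>t. deriv (\<lambda>y. f y t) x) integrable_on {a..b}"
    and "((\<lambda>y. integral {a..b} (f y)) has_field_derivative integral {a..b} (\<lambda>t. deriv (\<lambda>y. f y t) x)) (at x)"
proof -
  obtain r M where r: "r > 0" "cball x r \<subseteq> U" and
    M: "\<And>y t. y \<in> cball x r \<Longrightarrow> t \<in> {a..b} \<Longrightarrow> norm (deriv (\<lambda>y. f y t) y) \<le> M"
    using holo_integrand_deriv_bound[OF assms] by metis
  have hol: "(\<lambda>x. f x t) holomorphic_on U" if "t \<in> {a..b}" for t 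
    using assms that unfolding holo_integrand_def by blast
  have "open U" using assms unfolding holo_integrand_def by blast
  have int: "f y integrable_on {a..b}" if "y \<in> U" for y using assms that unfolding holo_integrand_def by blast
  have dd: "((\<lambda>y. f y t) has_field_derivative deriv (\<lambda>y. f y t) y) (at y)" if "y \<in> U" "t \<in> {a..b}" for y t
    using hol[OF that(2)] that(1) \<open>open U\<close> holomorphic_derivI by blast
  have lip: "norm (f y t - f x t) \<le> M * norm (y - x)" if "y \<in> cball x r" "t \<in> {a..b}" for y t
  proof (rule field_differentiable_bound[where S="cball x r" and f'="\<lambda>y. deriv (\<lambda>y. f y t) y"])
    show "((\<lambda>y. f y t) has_field_derivative deriv (\<lambda>y. f y t) z) (at z within cball x r)" if "z \<in> cball x r" for z
      using dd[of z t] that r \<open>t \<in> {a..b}\<close> has_field_derivative_at_within by blast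
    show "norm (deriv (\<lambda>y. f y t) z) \<le> M" if "z \<in> cball x r" for z using M that \<open>t \<in> {a..b}\<close> by blast
  qed (use that r in auto)
  have main: "(\<lambda>t. deriv (\<lambda>y. f y t) x) integrable_on {a..b} \<and>
     (\<lambda>n. (integral {a..b} (f (X n)) - integral {a..b} (f x)) / (X n - x)) \<longlonglongrightarrow> integral {a..b} (\<lambda>t. deriv (\<lambda>y. f y t) x)"
    if X: "\<forall>n. X n \<noteq> x" "\<forall>n. X n \<in> cball x r" "X \<longlonglongrightarrow> x" for X
  proof -
    define q where "q n t = (f (X n) t - f x t) / (X n - x)" for n t
    have Xi: "X n \<in> U" for n using X r by blast
    have qi: "q n integrable_on {a..b}" for n
      unfolding q_def using int[OF Xi] int[OF assms(2)]
      by (intro integrable_on_divide integrable_diff) auto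
    have qb: "norm (q n t) \<le> M" if "t \<in> {a..b}" for n t
    proof -
      have "norm (X n - x) > 0" using X by simp
      then show ?thesis using lip[of "X n" t] X that unfolding q_def norm_divide by (simp add: divide_le_eq)
    qed
    have ql: "(\<lambda>n. q n t) \<longlonglongrightarrow> deriv (\<lambda>y. f y t) x" if "t \<in> {a..b}" for t
    proof -
      have "((\<lambda>y. (f y t - f x t) / (y - x)) \<longlongrightarrow> deriv (\<lambda>y. f y t) x) (at x)"
        using dd[OF assms(2) that] by (simp add: has_field_derivative_iff)
      moreover have "filterlim X (at x) sequentially"
        using X by (auto simp: filterlim_at)
      ultimately show ?thesis unfolding q_def by (rule filterlim_compose)
    qed
    note dc = dominated_convergence[of q "{a..b}" "\<lambda>_. M", OF qi integrable_const_ivl qb ql]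
    have "integral {a..b} (q n) = (integral {a..b} (f (X n)) - integral {a..b} (f x)) / (X n - x)" for n
      unfolding q_def using int[OF Xi[of n]] int[OF assms(2)]
      by (simp add: integral_diff divide_inverse)
    with dc show ?thesis by simp
  qed
  define X0 where "X0 n = x + of_real (r / (real n + 1))" for n :: nat
  have X0l: "X0 \<longlonglongrightarrow> x + of_real 0" unfolding X0_def
    by (intro tendsto_intros) real_asymp
  have X0n: "norm (X0 n - x) = r / (real n + 1)" for n
    unfolding X0_def using r by (simp only: add_diff_cancel_left' norm_of_real) simp
  have "\<forall>n. X0 n \<noteq> x"
  proof
    fix n
    have "norm (X0 n - x) > 0" unfolding X0n using r by (intro divide_pos_pos) auto
    then show "X0 n \<noteq> x" by auto
  qed
  moreover have "\<forall>n. X0 n \<in> cball x r"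
  proof
    fix n
    have "r / (real n + 1) \<le> r / 1" using r by (intro divide_left_mono) auto
    then show "X0 n \<in> cball x r" using X0n[of n] by (simp add: dist_norm norm_minus_commute)
  qed
  ultimately show "(\<lambda>t. deriv (\<lambda>y. f y t) x) integrable_on {a..b}" using main[of X0] X0l by simp
  show "((\<lambda>y. integral {a..b} (f y)) has_field_derivative integral {a..b} (\<lambda>t. deriv (\<lambda>y. f y t) x)) (at x)"
    unfolding has_field_derivative_iff tendsto_at_iff_sequentially
  proof (intro allI impI)
    fix X assume X: "\<forall>i. X i \<in> UNIV - {x}" "X \<longlonglongrightarrow> x"
    from X(2) r have "eventually (\<lambda>n. X n \<in> cball x r) sequentially"
      by (intro eventually_mono[OF tendstoD[OF X(2) r(1)]]) (auto simp: dist_commute)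
    then obtain N where N: "\<And>n. n \<ge> N \<Longrightarrow> X n \<in> cball x r" by (auto simp: eventually_sequentially)
    have "(\<lambda>n. X (n + N)) \<longlonglongrightarrow> x" using X(2) by (rule LIMSEQ_ignore_initial_segment)
    moreover have "\<forall>n. X (n + N) \<noteq> x" "\<forall>n. X (n + N) \<in> cball x r" using X(1) N by auto
    ultimately have "(\<lambda>n. (integral {a..b} (f (X (n + N))) - integral {a..b} (f x)) / (X (n + N) - x))
       \<longlonglongrightarrow> integral {a..b} (\<lambda>t. deriv (\<lambda>y. f y t) x)"
      using main[of "\<lambda>n. X (n + N)"] by simp
    then have "(\<lambda>n. (integral {a..b} (f (X n)) - integral {a..b} (f x)) / (X n - x))
       \<longlonglongrightarrow> integral {a..b} (\<lambda>t. deriv (\<lambda>y. f y t) x)" by (rule LIMSEQ_offset)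
    then show "((\<lambda>y. (integral {a..b} (f y) - integral {a..b} (f x)) / (y - x)) \<circ> X)
       \<longlonglongrightarrow> integral {a..b} (\<lambda>t. deriv (\<lambda>y. f y t) x)" by (simp only: o_def)
  qed
qed

lemma holo_integrand_holomorphic:
  assumes "holo_integrand U a b f"
  shows "(\<lambda>x. integral {a..b} (f x)) holomorphic_on U"
  using holo_integrand_has_derivative(2)[OF assms] assms
  unfolding holo_integrand_def by (auto simp: holomorphic_on_open)

text \<open>The class is closed under differentiation, so that differentiation under the integral can be iterated.\<close>
lemma holo_integrand_deriv:
  assumes "holo_integrand U a b f"
  shows "holo_integrand U a b (\<lambda>x t. deriv (\<lambda>y. f y t) x)"
  unfolding holo_integrand_def
proof (intro conjI ballI)
  show "open U" using assms unfolding holo_integrand_def by blast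
  show "(\<lambda>x. deriv (\<lambda>y. f y t) x) holomorphic_on U" if "t \<in> {a..b}" for t
    using assms that unfolding holo_integrand_def by (intro holomorphic_deriv) auto
  show "(\<lambda>t. deriv (\<lambda>y. f y t) x) integrable_on {a..b}" if "x \<in> U" for x
    by (rule holo_integrand_has_derivative[OF assms that])
  show "\<exists>e>0. \<exists>M. cball x e \<subseteq> U \<and> (\<forall>y\<in>cball x e. \<forall>t\<in>{a..b}. norm (deriv (\<lambda>y. f y t) y) \<le> M)" if "x \<in> U" for x
    using holo_integrand_deriv_bound[OF assms that] by metis
qed

lemma holo_integrand_second_deriv:
  assumes "holo_integrand U a b f" "x \<in> U"
  shows "(deriv ^^ 2) (\<lambda>y. integral {a..b} (f y)) x = integral {a..b} (\<lambda>t. (deriv ^^ 2) (\<lambda>y. f y t) x)"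
proof -
  have "open U" using assms unfolding holo_integrand_def by blast
  have 1: "deriv (\<lambda>y. integral {a..b} (f y)) y = integral {a..b} (\<lambda>t. deriv (\<lambda>y. f y t) y)" if "y \<in> U" for y
    using holo_integrand_has_derivative(2)[OF assms(1) that] by (rule DERIV_imp_deriv)
  have "deriv (deriv (\<lambda>y. integral {a..b} (f y))) x = deriv (\<lambda>y. integral {a..b} (\<lambda>t. deriv (\<lambda>y. f y t) y)) x"
    using 1 \<open>open U\<close> assms(2) by (intro deriv_cong_ev) (auto intro: eventually_mono[OF eventually_nhds_in_open])
  also have "\<dots> = integral {a..b} (\<lambda>t. deriv (\<lambda>y. deriv (\<lambda>y. f y t) y) x)"
    by (rule DERIV_imp_deriv, rule holo_integrand_has_derivative(2)[OF holo_integrand_deriv[OF assms(1)] assms(2)])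
  finally show ?thesis by (simp add: numeral_2_eq_2)
qed

lemma holo_integrand_compactI:
  assumes "open U" "\<And>t. t \<in> {a..b} \<Longrightarrow> (\<lambda>x. f x t) holomorphic_on U"
    and c: "continuous_on (U \<times> {a..b}) (\<lambda>(x,t). f x t)"
  shows "holo_integrand U a b f"
  unfolding holo_integrand_def
proof (intro conjI ballI)
  show "open U" by fact
  show "(\<lambda>x. f x t) holomorphic_on U" if "t \<in> {a..b}" for t using that assms by blast
  show "f x integrable_on {a..b}" if x: "x \<in> U" for x
  proof (rule integrable_continuous_real)
    have "continuous_on {a..b} (\<lambda>t. (\<lambda>(x,t). f x t) (x, t))"
      by (rule continuous_on_compose2[OF c]) (use x in \<open>auto intro!: continuous_intros\<close>)
    then show "continuous_on {a..b} (f x)" by simp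
  qed
  show "\<exists>e>0. \<exists>M. cball x e \<subseteq> U \<and> (\<forall>y\<in>cball x e. \<forall>t\<in>{a..b}. norm (f y t) \<le> M)" if x: "x \<in> U" for x
  proof -
    obtain e where e: "e > 0" "cball x e \<subseteq> U" using \<open>open U\<close> x open_contains_cball by blast
    have "compact (cball x e \<times> {a..b})" by (intro compact_Times) auto
    then have "compact ((\<lambda>(x,t). f x t) ` (cball x e \<times> {a..b}))"
      using e by (intro compact_continuous_image continuous_on_subset[OF c]) auto
    then obtain M where M: "\<forall>z\<in>(\<lambda>(x,t). f x t) ` (cball x e \<times> {a..b}). norm z \<le> M"
      using compact_imp_bounded bounded_iff by metis
    have "\<forall>y\<in>cball x e. \<forall>t\<in>{a..b}. norm (f y t) \<le> M"
    proof (intro ballI)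
      fix y t assume "y \<in> cball x e" "t \<in> {a..b}"
      then have "(\<lambda>(x,t). f x t) (y,t) \<in> (\<lambda>(x,t). f x t) ` (cball x e \<times> {a..b})" by (intro imageI) auto
      then show "norm (f y t) \<le> M" using M by auto
    qed
    with e show ?thesis by blast
  qed
qed

section \<open>The Gauss function on the slit plane\<close>

unbundle no vec_syntax

text \<open>The conformal map of the slit plane onto the unit disc that fixes \<open>0\<close>, inverse to the (rescaled) Koebe function
  \<open>w \<mapsto> -4w/(1-w)\<^sup>2\<close>.\<close>
definition kw :: "complex \<Rightarrow> complex" where
  "kw z = (csqrt (1 - z) - 1) / (csqrt (1 - z) + 1)"

lemma slit_plane_iff: "z \<in> slit_plane \<longleftrightarrow> 1 - z \<notin> \<real>\<^sub>\<le>\<^sub>0"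
proof -
  have "z \<in> slit_plane \<longleftrightarrow> \<not> (Im z = 0 \<and> Re z \<ge> 1)"
    by (auto simp: slit_plane_def complex_eq_iff intro: exI[of _ "Re z"])
  then show ?thesis by (auto simp: complex_nonpos_Reals_iff)
qed

lemma open_slit_plane: "open slit_plane"
proof -
  have "slit_plane = (\<lambda>z. 1 - z) -` (- \<real>\<^sub>\<le>\<^sub>0)" by (auto simp: slit_plane_iff)
  moreover have "open ((\<lambda>z. 1 - z) -` (- \<real>\<^sub>\<le>\<^sub>0 :: complex set))"
    by (intro continuous_open_vimage) (auto intro!: continuous_intros)
  ultimately show ?thesis by simp
qed

lemma connected_slit_plane: "connected slit_plane"
proof (rule starlike_imp_connected)
  have "closed_segment 0 x \<subseteq> slit_plane" if x: "x \<in> slit_plane" for x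
  proof
    fix y assume "y \<in> closed_segment 0 x"
    then obtain u where u: "0 \<le> u" "u \<le> 1" "y = of_real u * x"
      by (auto simp: closed_segment_def scaleR_conv_of_real)
    show "y \<in> slit_plane"
    proof (rule ccontr)
      assume "y \<notin> slit_plane"
      then have y: "Im y = 0" "Re y \<ge> 1" by (auto simp: slit_plane_iff complex_nonpos_Reals_iff)
      with u have "u \<noteq> 0" by auto
      with y u have "Im x = 0" "u * Re x \<ge> 1" by auto
      moreover have "Re x \<ge> 1"
      proof (rule ccontr)
        assume "\<not> Re x \<ge> 1"
        moreover have "u > 0" using u \<open>u \<noteq> 0\<close> by simp
        ultimately have "u * Re x < u * 1" by (intro mult_strict_left_mono) auto
        then show False using \<open>u * Re x \<ge> 1\<close> u by simp
      qed
      ultimately show False using x by (auto simp: slit_plane_iff complex_nonpos_Reals_iff)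
    qed
  qed
  moreover have "0 \<in> slit_plane" by (auto simp: slit_plane_iff)
  ultimately show "starlike slit_plane" unfolding starlike_def by blast
qed

lemma ball_subset_slit_plane: "ball 0 1 \<subseteq> slit_plane"
proof
  fix z :: complex assume "z \<in> ball 0 1"
  then have "Re z < 1" using complex_Re_le_cmod[of z] by simp
  then show "z \<in> slit_plane" by (auto simp: slit_plane_iff complex_nonpos_Reals_iff)
qed

lemma Re_csqrt_slit: assumes "z \<in> slit_plane" shows "Re (csqrt (1 - z)) > 0"
proof (rule ccontr)
  assume "\<not> ?thesis"
  then have "Re (csqrt (1 - z)) = 0" using csqrt_principal[of "1 - z"] by auto
  then have "csqrt (1 - z) = \<i> * of_real (Im (csqrt (1-z)))" by (simp add: complex_eq_iff)
  then have "1 - z = (\<i> * of_real (Im (csqrt (1-z))))^2" by (metis power2_csqrt)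
  also have "\<dots> = of_real (- ((Im (csqrt (1-z)))^2))" by (simp add: power_mult_distrib)
  finally have "1 - z \<in> \<real>\<^sub>\<le>\<^sub>0" by (metis neg_le_0_iff_le nonpos_Reals_of_real_iff zero_le_power2)
  with assms show False by (simp add: slit_plane_iff)
qed

lemma csqrt_slit_neq: assumes "z \<in> slit_plane" shows "csqrt (1 - z) + 1 \<noteq> 0"
proof -
  define r where "r = csqrt (1 - z)"
  have "Re r > 0" using Re_csqrt_slit[OF assms] by (simp add: r_def)
  then have "r + 1 \<noteq> 0" by (auto simp: complex_eq_iff)
  then show ?thesis by (simp add: r_def)
qed

lemma norm_kw_less: assumes "z \<in> slit_plane" shows "norm (kw z) < 1"
proof -
  define r where "r = csqrt (1 - z)"
  have r: "Re r > 0" using Re_csqrt_slit[OF assms] by (simp add: r_def)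
  then have "(norm (r - 1))^2 < (norm (r + 1))^2"
    unfolding cmod_power2 by (simp add: power2_eq_square algebra_simps)
  then have "norm (r - 1) < norm (r + 1)" by (rule power_less_imp_less_base) auto
  moreover have "r + 1 \<noteq> 0" using r by (auto simp: complex_eq_iff)
  ultimately show ?thesis unfolding kw_def r_def[symmetric] by (simp add: norm_divide divide_less_eq)
qed

lemma kw_holomorphic: "kw holomorphic_on slit_plane"
proof -
  show ?thesis unfolding kw_def[abs_def]
    by (intro holomorphic_intros csqrt_slit_neq) (auto simp: slit_plane_iff)
qed

lemma kw_inverse: assumes "z \<in> slit_plane" shows "-4 * kw z / (1 - kw z)^2 = z"
proof -
  define r where "r = csqrt (1 - z)"
  have r: "r + 1 \<noteq> 0" using csqrt_slit_neq[OF assms] unfolding r_def .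
  have z: "z = 1 - r^2" by (simp add: r_def)
  define q where "q = r + 1"
  have "q \<noteq> 0" using r by (simp add: q_def)
  have k: "kw z = (q - 2) / q" by (simp add: kw_def r_def[symmetric] q_def)
  have "1 - kw z = 2 / q" using \<open>q \<noteq> 0\<close> unfolding k by (simp add: field_simps)
  then have "-4 * kw z / (1 - kw z)^2 = 1 - (q - 1)^2"
    using \<open>q \<noteq> 0\<close> by (simp only: k) (simp add: field_simps power2_eq_square)
  also have "\<dots> = z" by (simp add: z q_def)
  finally show ?thesis .
qed

lemma kw_0: "kw 0 = 0" by (simp add: kw_def)

text \<open>The Taylor coefficients of \<open>-4w/(1-w)\<^sup>2\<close>.\<close>
definition koebe :: "complex fps" where
  "koebe = Abs_fps (\<lambda>n. -4 * of_nat n)"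

lemma koebe_nth: "koebe $ n = -4 * of_nat n" by (simp add: koebe_def)
lemma koebe_0: "koebe $ 0 = 0" by (simp add: koebe_nth)

lemma fps_const_numeral_mult: "((numeral k :: complex fps) * f) $ n = numeral k * f $ n"
  by (metis fps_mult_left_const_nth numeral_fps_const)

lemma koebe_eq: "(1 - fps_X)^2 * koebe = -4 * fps_X"
proof -
  have "(1 - fps_X) * koebe = -4 * (Abs_fps (\<lambda>n. if n = 0 then 0 else 1))"
    by (rule fps_ext) (auto simp: left_diff_distrib koebe_nth fps_const_numeral_mult of_nat_diff algebra_simps)
  moreover have "(1 - fps_X) * Abs_fps (\<lambda>n. if n = 0 then 0 else (1::complex)) = fps_X"
    by (rule fps_ext) (auto simp: left_diff_distrib)
  ultimately show ?thesis by (simp add: power2_eq_square mult.assoc mult.left_commute[of "1 - fps_X"])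
qed

lemma one_minus_X_neq: "1 - fps_X \<noteq> (0 :: complex fps)" "1 + fps_X \<noteq> (0 :: complex fps)"
   "1 - fps_X^2 \<noteq> (0 :: complex fps)"
proof -
  have "(1 - fps_X) $ 0 = (1::complex)" "(1 + fps_X) $ 0 = (1::complex)" "(1 - fps_X^2) $ 0 = (1::complex)" by auto
  then show "1 - fps_X \<noteq> (0 :: complex fps)" "1 + fps_X \<noteq> (0 :: complex fps)" "1 - fps_X^2 \<noteq> (0 :: complex fps)"
    by (metis fps_zero_nth zero_neq_one)+
qed

lemma koebe_deriv: "(1 - fps_X) * (fps_X * fps_deriv koebe) = (1 + fps_X) * koebe"
proof -
  have "fps_deriv ((1 - fps_X)^2 * koebe) = fps_deriv (-4 * fps_X)" by (simp add: koebe_eq)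
  then have "(1 - fps_X)^2 * fps_deriv koebe - 2 * (1 - fps_X) * koebe = -4"
    by (simp add: power2_eq_square algebra_simps)
  then have "fps_X * ((1 - fps_X)^2 * fps_deriv koebe - 2 * (1 - fps_X) * koebe) = (1 - fps_X)^2 * koebe"
    by (simp add: koebe_eq)
  then have "(1 - fps_X) * ((1 - fps_X) * (fps_X * fps_deriv koebe)) = (1 - fps_X) * ((1 + fps_X) * koebe)"
    by (simp add: algebra_simps power2_eq_square)
  then show ?thesis using one_minus_X_neq by (metis mult_cancel_left)
qed

lemma koebe_expansion: "(\<lambda>w. -4 * w / (1 - w)^2) has_fps_expansion koebe"
proof -
  have "((1 - fps_X :: complex fps)^2) $ 0 \<noteq> 0" by simp
  then have "(1 - fps_X)^2 * (-4 * fps_X * inverse ((1 - fps_X)^2)) = (-4 * fps_X :: complex fps)"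
    by (metis (no_types, lifting) inverse_mult_eq_1' mult.left_commute mult.right_neutral)
  then have "koebe = fps_const (-4) * fps_X * inverse ((1 - fps_X)^2)"
    using koebe_eq one_minus_X_neq(1)
    by (metis (no_types, lifting) mult_cancel_left power_not_zero fps_const_neg numeral_fps_const)
  moreover have "(\<lambda>w::complex. -4 * w * inverse ((1 - w)^2)) has_fps_expansion fps_const (-4) * fps_X * inverse ((1 - fps_X)^2)"
    by (intro fps_expansion_intros) auto
  ultimately show ?thesis by (simp add: divide_inverse)
qed

text \<open>The hypergeometric series in the coordinate of the disc. Its coefficients are finite sums, so it depends
  rationally on the parameters; the point is that it converges in the whole disc.\<close>
definition hyE :: "complex \<Rightarrow> complex \<Rightarrow> complex \<Rightarrow> complex fps" where
  "hyE a b c = fps_hypergeo [a, b] [c] 1 oo koebe"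

text \<open>The hypergeometric equation written with the Euler operator \<open>\<theta> = X d/dX\<close>:
  \<open>\<theta>(\<theta> + c - 1) F = X (\<theta> + a)(\<theta> + b) F\<close>.\<close>
lemma hypergeo_ode:
  fixes F :: "complex fps"
  assumes c: "c \<notin> \<int>\<^sub>\<le>\<^sub>0" and F: "F = fps_hypergeo [a, b] [c] 1"
  defines "F1 \<equiv> fps_X * fps_deriv F"
  defines "F2 \<equiv> fps_X * fps_deriv F1"
  shows "F2 + fps_const (c - 1) * F1 = fps_X * (F2 + fps_const (a + b) * F1 + fps_const (a * b) * F)"
proof (rule fps_ext)
  fix n
  have F1: "F1 $ n = of_nat n * F $ n" for n by (cases n) (auto simp: F1_def)
  have F2: "F2 $ n = of_nat n ^ 2 * F $ n" for n by (cases n) (auto simp: F2_def F1 power2_eq_square)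
  show "(F2 + fps_const (c - 1) * F1) $ n = (fps_X * (F2 + fps_const (a + b) * F1 + fps_const (a * b) * F)) $ n"
  proof (cases n)
    case 0 then show ?thesis by (simp add: F1 F2)
  next
    case (Suc m)
    have "c + of_nat m \<noteq> 0" using c by (metis add_eq_0_iff2 minus_of_nat_in_nonpos_Ints)
    moreover have "F $ Suc m = (a + of_nat m) * (b + of_nat m) / ((1 + of_nat m) * (c + of_nat m)) * F $ m"
      unfolding F by (subst fps_hypergeo_rec) simp
    moreover have "1 + of_nat m \<noteq> (0::complex)" using of_nat_neq_0[of m, where 'a=complex] by simp
    moreover have "P \<noteq> 0 \<Longrightarrow> Q \<noteq> 0 \<Longrightarrow> P * Q * (N / (P * Q) * f) = N * f" for P Q N f :: complex by simp
    ultimately have "(1 + of_nat m) * (c + of_nat m) * F $ Suc m = (a + of_nat m) * (b + of_nat m) * F $ m"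
      by metis
    then show ?thesis by (simp add: Suc F1 F2) (simp add: algebra_simps power2_eq_square)
  qed
qed

text \<open>The Euler operator transforms under the Koebe substitution by the factor \<open>(1 + w)/(1 - w)\<close>.\<close>
lemma compose_koebe_theta:
  fixes F :: "complex fps"
  shows "(1 - fps_X) * (fps_X * fps_deriv (F oo koebe)) = (1 + fps_X) * ((fps_X * fps_deriv F) oo koebe)"
proof -
  have "(1 - fps_X) * (fps_X * fps_deriv (F oo koebe)) = ((1 - fps_X) * (fps_X * fps_deriv koebe)) * (fps_deriv F oo koebe)"
    by (simp add: fps_compose_deriv koebe_0 mult_ac)
  also have "\<dots> = (1 + fps_X) * (koebe * (fps_deriv F oo koebe))" unfolding koebe_deriv by (simp only: mult.assoc)
  also have "koebe * (fps_deriv F oo koebe) = (fps_X * fps_deriv F) oo koebe"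
    by (simp add: fps_compose_mult_distrib koebe_0)
  finally show ?thesis .
qed

text \<open>The coefficient of the first order term of the hypergeometric equation after the Koebe substitution, a rational function
  with poles at \<open>\<plusminus>1\<close> only. Its Taylor coefficients are therefore bounded, which is what the
  convergence in the unit disc rests on.\<close>
definition hyP :: "complex \<Rightarrow> complex \<Rightarrow> complex \<Rightarrow> complex fps" where
  "hyP a b c = Abs_fps (\<lambda>j. (c - 1) * (if j = 0 then 1 else 2 * (-1)^j) + (if odd j then 4 * (a + b) - 2 else 0))"

lemma hyP_eq: "(1 - fps_X^2) * hyP a b c =
    fps_const (4 * (a + b) - 2) * fps_X + fps_const (c - 1) * (1 - fps_X)^2"
proof -
  have nth2: "(fps_X^2 * f) $ n = (if n < 2 then 0 else f $ (n - 2))" for f :: "complex fps" and n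
    by (simp add: fps_X_power_mult_nth)
  have "(1 - fps_X :: complex fps)^2 = 1 - 2 * fps_X + fps_X^2" by (simp add: power2_eq_square algebra_simps)
  note * = this
  have *: "((1 - fps_X :: complex fps)^2) $ n = (if n = 0 then 1 else if n = 1 then -2 else if n = 2 then 1 else 0)" for n
    by (subst *) (auto simp: fps_const_numeral_mult fps_X_power_nth fps_numeral_nth)
  show ?thesis
  proof (rule fps_ext)
    fix n :: nat
    consider "n = 0" | "n = 1" | "n = 2" | m where "n = m + 3" 
      by (metis add.commute add_2_eq_Suc' le_add_diff_inverse less_2_cases_iff not_less_eq_eq numeral_2_eq_2 numeral_3_eq_3 One_nat_def not_le le_neq_implies_less)
    then show "((1 - fps_X^2) * hyP a b c) $ n = (fps_const (4 * (a + b) - 2) * fps_X + fps_const (c - 1) * (1 - fps_X)^2) $ n"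
    proof cases
      case (4 m)
      have "(-1) ^ (m + 3) = - ((-1)^m :: complex)" by (simp add: power_add)
      then show ?thesis unfolding 4 by (auto simp: left_diff_distrib nth2 hyP_def * algebra_simps simp del: power_minus1_even)
    qed (auto simp: left_diff_distrib nth2 hyP_def * algebra_simps)
  qed
qed

lemma hyE_ode:
  fixes E :: "complex fps"
  assumes c: "c \<notin> \<int>\<^sub>\<le>\<^sub>0" and E: "E = hyE a b c"
  defines "D \<equiv> fps_X * fps_deriv E"
  defines "DD \<equiv> fps_X * fps_deriv D"
  shows "DD + hyP a b c * D = fps_const (a * b) * koebe * E"
proof -
  define F where "F = fps_hypergeo [a, b] [c] (1::complex)"
  define F1 where "F1 = fps_X * fps_deriv F"
  define F2 where "F2 = fps_X * fps_deriv F1"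
  define e1 where "e1 = F1 oo koebe"
  define e2 where "e2 = F2 oo koebe"
  define X where "X = (fps_X :: complex fps)"
  define g where "g = X * fps_deriv e1"
  define c1 where "c1 = fps_const (c - 1)"
  define ab where "ab = fps_const (a + b)"
  define m where "m = fps_const (a * b)"
  define K where "K = koebe"
  have EF: "E = F oo koebe" by (simp add: E hyE_def F_def)
  have A1: "(1 - X) * D = (1 + X) * e1"
    using compose_koebe_theta[of F] by (simp add: D_def EF e1_def F1_def X_def)
  have A2: "(1 - X) * g = (1 + X) * e2"
    using compose_koebe_theta[of F1] by (simp add: g_def e1_def e2_def F2_def X_def)
  have A3: "e2 + c1 * e1 = K * (e2 + ab * e1 + m * E)"
  proof -
    have "(F2 + fps_const (c - 1) * F1) oo koebe = (fps_X * (F2 + fps_const (a + b) * F1 + fps_const (a * b) * F)) oo koebe"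
      using hypergeo_ode[OF c F_def] by (simp add: F1_def F2_def)
    then show ?thesis
      by (simp add: fps_compose_mult_distrib fps_compose_add_distrib koebe_0 e1_def e2_def EF c1_def ab_def m_def K_def)
  qed
  have A4: "(1 - X)^2 * K = -4 * X" using koebe_eq by (simp add: X_def K_def)
  have "fps_deriv ((1 - X) * D) = fps_deriv ((1 + X) * e1)" by (simp add: A1)
  then have "(1 - X) * fps_deriv D - D = e1 + (1 + X) * fps_deriv e1"
    by (simp add: X_def algebra_simps)
  then have "X * ((1 - X) * fps_deriv D - D) = X * (e1 + (1 + X) * fps_deriv e1)" by simp
  then have A5: "(1 - X) * DD - X * D = X * e1 + (1 + X) * g"
    by (simp add: g_def DD_def X_def[symmetric] algebra_simps)
  have A6: "(1 - X^2) * hyP a b c = (4 * ab - 2) * X + c1 * (1 - X)^2"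
  proof -
    have "fps_const (4 * (a + b) - 2) = 4 * ab - 2"
      by (simp add: ab_def numeral_fps_const)
    then show ?thesis using hyP_eq[of a b c] by (simp add: X_def c1_def)
  qed
  have B1: "(1 + X)^2 * e2 + (c1 * (1 - X)^2 + 4 * ab * X) * e1 + 4 * m * X * E = 0"
    using A3 A4 by algebra
  have B2: "(1 + X)^3 * e2 = (1 - X) * ((1 + X) * ((1 - X) * DD - X * D) - X * ((1 - X) * D))"
    using A1 A2 A5 by algebra
  have B3: "(1 - X) * ((1 - X^2) * DD - 2 * X * D + (c1 * (1 - X)^2 + 4 * ab * X) * D) + 4 * m * X * (1 + X) * E = 0"
    using B1 B2 A1 by algebra
  have B4: "((1 - X) * (1 - X^2)) * (DD + hyP a b c * D) = ((1 - X) * (1 - X^2)) * (m * K * E)"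
    using B3 A6 A4 by algebra
  have "(1 - X) * (1 - X^2) \<noteq> 0" using one_minus_X_neq by (simp add: X_def)
  with B4 show ?thesis by (simp add: m_def K_def)
qed

lemma hyE_recurrence_bound:
  assumes c: "c \<notin> \<int>\<^sub>\<le>\<^sub>0" and n: "n \<ge> 1" and B: "2 * norm (c - 1) + 4 * norm (a + b) + 2 + 4 * norm (a * b) \<le> B"
  shows "norm (of_nat n + c - 1) * norm (hyE a b c $ n) \<le> B * (\<Sum>k<n. norm (hyE a b c $ k))"
proof -
  define E where "E = hyE a b c"
  define D where "D = fps_X * fps_deriv E"
  define DD where "DD = fps_X * fps_deriv D"
  have D: "D $ k = of_nat k * E $ k" for k by (cases k) (auto simp: D_def)
  have DD: "DD $ k = of_nat k ^ 2 * E $ k" for k by (cases k) (auto simp: DD_def D power2_eq_square)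
  have "(DD + hyP a b c * D) $ n = (fps_const (a * b) * (koebe * E)) $ n"
    using hyE_ode[OF c E_def] by (simp add: D_def DD_def mult.assoc)
  then have "DD $ n + (hyP a b c * D) $ n = a * b * (koebe * E) $ n"
    by (simp only: fps_add_nth fps_mult_left_const_nth)
  then have "of_nat n ^ 2 * E $ n + (\<Sum>i=0..n. hyP a b c $ i * D $ (n - i)) = a * b * (\<Sum>i=0..n. koebe $ i * E $ (n - i))"
    by (simp only: DD fps_mult_nth)
  also have "(\<Sum>i=0..n. hyP a b c $ i * D $ (n - i)) = (c - 1) * of_nat n * E $ n + (\<Sum>i=1..n. hyP a b c $ i * D $ (n - i))"
    by (subst sum.atLeast_Suc_atMost) (auto simp: hyP_def D)
  also have "(\<Sum>i=0..n. koebe $ i * E $ (n - i)) = (\<Sum>i=1..n. koebe $ i * E $ (n - i))"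
    by (subst sum.atLeast_Suc_atMost) (auto simp: koebe_nth)
  finally have "of_nat n * ((of_nat n + c - 1) * E $ n) =
     (\<Sum>i=1..n. a * b * (koebe $ i * E $ (n - i)) - hyP a b c $ i * D $ (n - i))"
    by (simp add: sum_subtractf sum_distrib_left algebra_simps power2_eq_square)
  then have "norm (of_nat n * ((of_nat n + c - 1) * E $ n)) =
     norm (\<Sum>i=1..n. a * b * (koebe $ i * E $ (n - i)) - hyP a b c $ i * D $ (n - i))" by simp
  also have "\<dots> \<le> (\<Sum>i=1..n. of_nat n * (B * norm (E $ (n - i))))"
  proof (rule sum_norm_le)
    fix i assume i: "i \<in> {1..n}"
    have P: "norm (hyP a b c $ i) \<le> 2 * norm (c - 1) + 4 * norm (a + b) + 2"
    proof -
      have "norm (hyP a b c $ i) \<le> norm ((c - 1) * (if i = 0 then 1 else 2 * (-1)^i)) + norm (if odd i then 4 * (a + b) - 2 else 0)"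
        unfolding hyP_def fps_nth_Abs_fps by (rule norm_triangle_ineq)
      also have "norm ((c - 1) * (if i = 0 then 1 else 2 * (-1)^i)) \<le> 2 * norm (c - 1)"
        by (auto simp: norm_mult norm_power)
      also have "norm (if odd i then 4 * (a + b) - 2 else 0) \<le> 4 * norm (a + b) + 2"
      proof -
        have "norm (if odd i then 4 * u - 2 else 0) \<le> 4 * norm u + 2" for u :: complex
          using norm_triangle_ineq4[of "4 * u" 2] by (auto simp: norm_mult)
        then show ?thesis .
      qed
      finally show ?thesis by simp
    qed
    have "norm (a * b * (koebe $ i * E $ (n - i)) - hyP a b c $ i * D $ (n - i)) \<le>
      norm (a * b * (koebe $ i * E $ (n - i))) + norm (hyP a b c $ i * D $ (n - i))" by (rule norm_triangle_ineq4)
    also have "norm (a * b * (koebe $ i * E $ (n - i))) = real i * (4 * norm (a * b)) * norm (E $ (n - i))"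
      by (simp add: koebe_nth norm_mult)
    also have "norm (hyP a b c $ i * D $ (n - i)) = real (n - i) * norm (hyP a b c $ i) * norm (E $ (n - i))"
      by (simp add: D norm_mult)
    also have "real i * (4 * norm (a * b)) * norm (E $ (n - i)) + real (n - i) * norm (hyP a b c $ i) * norm (E $ (n - i))
       \<le> real i * B * norm (E $ (n - i)) + real (n - i) * B * norm (E $ (n - i))"
    proof -
      have "4 * norm (a * b) \<le> B" using B norm_ge_zero[of "c - 1"] norm_ge_zero[of "a + b"] by linarith
      moreover have "norm (hyP a b c $ i) \<le> B" using B P norm_ge_zero[of "a*b"] by linarith
      ultimately show ?thesis by (intro add_mono mult_right_mono mult_left_mono) auto
    qed
    also have "\<dots> = of_nat n * (B * norm (E $ (n - i)))"
      using i by (simp add: of_nat_diff algebra_simps)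
    finally show "norm (a * b * (koebe $ i * E $ (n - i)) - hyP a b c $ i * D $ (n - i)) \<le> of_nat n * (B * norm (E $ (n - i)))" .
  qed
  also have "\<dots> = of_nat n * (B * (\<Sum>k<n. norm (E $ k)))"
  proof -
    have "(\<Sum>i=1..n. norm (E $ (n - i))) = (\<Sum>k<n. norm (E $ k))"
      by (rule sum.reindex_bij_witness[of _ "\<lambda>k. n - k" "\<lambda>i. n - i"]) auto
    then show ?thesis by (simp add: sum_distrib_left[symmetric])
  qed
  finally have "real n * (norm (of_nat n + c - 1) * norm (E $ n)) \<le> real n * (B * (\<Sum>k<n. norm (E $ k)))"
    by (simp add: norm_mult)
  then show ?thesis using n by (simp add: E_def)
qed

lemma hyE_0: "hyE a b c $ 0 = 1" by (simp add: hyE_def)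

text \<open>A recurrence in which the new coefficient times \<open>n\<close> is dominated by the sum of the preceding ones has
  solutions of polynomial growth; \<open>pochhammer (1 + B/\<delta>) n / fact n\<close> is a convenient majorant of that kind.\<close>
lemma hyE_bound:
  assumes c: "c \<notin> \<int>\<^sub>\<le>\<^sub>0" and B: "2 * norm (c - 1) + 4 * norm (a + b) + 2 + 4 * norm (a * b) \<le> B"
    and \<delta>: "\<delta> > 0" "\<And>n. n \<ge> 1 \<Longrightarrow> \<delta> * real n \<le> norm (of_nat n + c - 1)"
  shows "norm (hyE a b c $ n) \<le> pochhammer (1 + B / \<delta>) n / fact n"
proof -
  define S where "S n = (\<Sum>k<n. norm (hyE a b c $ k))" for n
  define g where "g n = pochhammer (1 + B / \<delta>) n / fact n" for n
  have B0: "B \<ge> 0" using B by (smt (verit) norm_ge_zero)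
  have g: "g (Suc n) = g n * (1 + B / \<delta> / real (Suc n))" for n
  proof -
    have *: "1 + y / real (Suc n) = (1 + y + real n) / real (Suc n)" for y by (simp add: field_simps)
    show ?thesis unfolding g_def pochhammer_Suc * by simp
  qed
  have S: "S (Suc n) \<le> g n" for n
  proof (induction n)
    case 0 then show ?case by (simp add: S_def g_def hyE_0)
  next
    case (Suc n)
    have S0: "S (Suc n) \<ge> 0" by (simp add: S_def sum_nonneg)
    have "\<delta> * real (Suc n) * norm (hyE a b c $ Suc n) \<le> norm (of_nat (Suc n) + c - 1) * norm (hyE a b c $ Suc n)"
      by (intro mult_right_mono \<delta>) auto
    also have "\<dots> \<le> B * S (Suc n)" unfolding S_def by (rule hyE_recurrence_bound[OF c _ B]) auto
    finally have "norm (hyE a b c $ Suc n) \<le> S (Suc n) * (B / \<delta> / real (Suc n))"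
      using \<delta>(1) by (simp add: pos_le_divide_eq mult.commute mult.left_commute del: of_nat_Suc)
    then have "S (Suc (Suc n)) \<le> S (Suc n) * (1 + B / \<delta> / real (Suc n))"
      by (simp add: S_def algebra_simps)
    also have "\<dots> \<le> g n * (1 + B / \<delta> / real (Suc n))" using Suc B0 \<delta>(1) by (intro mult_right_mono) auto
    finally show ?case by (simp add: g)
  qed
  have "norm (hyE a b c $ n) \<le> S (Suc n)" by (simp add: S_def sum_nonneg)
  with S[of n] show ?thesis by (simp add: g_def)
qed

lemma summable_pochhammer_fact:
  fixes r \<beta> :: real assumes "0 \<le> r" "r < 1"
  shows "summable (\<lambda>n. pochhammer \<beta> n / fact n * r ^ n)"
proof -
  have "summable (\<lambda>n. ((- \<beta>) gchoose n) * (- r)^n)"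
    using gen_binomial_real[of "- r" "- \<beta>"] assms by (auto simp: sums_iff)
  moreover have "((- \<beta>) gchoose n) * (- r)^n = pochhammer \<beta> n / fact n * r ^ n" for n
  proof -
    have "((- \<beta>) gchoose n) * (- r)^n = ((-1)^n * (-1)^n) * (pochhammer \<beta> n / fact n * r ^ n)"
      by (subst power_minus) (simp add: gbinomial_pochhammer)
    also have "(-1)^n * (-1)^n = (1::real)" by (simp flip: power_mult_distrib)
    finally show ?thesis by simp
  qed
  ultimately show ?thesis by simp
qed

text \<open>The constants are uniform near \<open>c0\<close>, as needed for holomorphic dependence on \<open>c\<close>.\<close>
lemma nonpos_Ints_distance:
  fixes c0 :: complex assumes "c0 \<notin> \<int>\<^sub>\<le>\<^sub>0"
  obtains \<delta> r where "\<delta> > 0" "r > 0" "\<And>c n. c \<in> cball c0 r \<Longrightarrow> n \<ge> 1 \<Longrightarrow> \<delta> * real n \<le> norm (of_nat n + c - 1)"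
    "\<And>c. c \<in> cball c0 r \<Longrightarrow> c \<notin> \<int>\<^sub>\<le>\<^sub>0"
proof -
  have "open (- \<int>\<^sub>\<le>\<^sub>0 :: complex set)" by (simp add: open_Compl)
  with assms obtain \<eta> where \<eta>: "\<eta> > 0" "ball c0 \<eta> \<subseteq> - \<int>\<^sub>\<le>\<^sub>0" by (meson ComplI openE)
  define R where "R = norm c0 + \<eta> / 2 + 1"
  define \<delta> where "\<delta> = min (1/2) (\<eta> / (4 * R))"
  have R: "R > 0" using \<eta> by (simp add: R_def add_nonneg_pos)
  show thesis
  proof (rule that[of \<delta> "\<eta>/2"])
    show "\<delta> > 0" "\<eta>/2 > 0" using \<eta> R by (auto simp: \<delta>_def)
    show "c \<notin> \<int>\<^sub>\<le>\<^sub>0" if "c \<in> cball c0 (\<eta>/2)" for c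
    proof -
      have "c \<in> ball c0 \<eta>" using that \<eta> by auto
      then show ?thesis using \<eta> by blast
    qed
    fix c and n :: nat assume c: "c \<in> cball c0 (\<eta>/2)" and n: "n \<ge> 1"
    have "(1 - of_nat n :: complex) \<in> \<int>\<^sub>\<le>\<^sub>0" using n
      by (metis minus_diff_eq of_nat_1 of_nat_diff minus_of_nat_in_nonpos_Ints)
    then have "\<eta> \<le> dist c0 (1 - of_nat n)" using \<eta>(2) by (meson ComplD linorder_not_less mem_ball subsetD)
    also have "\<dots> \<le> dist c0 c + dist c (1 - of_nat n)" by (rule dist_triangle)
    finally have 1: "norm (of_nat n + c - 1) \<ge> \<eta> / 2" using c by (simp add: dist_norm algebra_simps)
    have "norm (of_nat n :: complex) \<le> norm (of_nat n + c - 1) + norm (1 - c)"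
      using norm_triangle_ineq[of "of_nat n + c - 1" "1 - c"] by simp
    moreover have "norm (1 - c) \<le> R"
      using norm_triangle_ineq4[of 1 c] norm_triangle_ineq2[of c c0] c
      by (simp add: R_def dist_norm norm_minus_commute)
    ultimately have 2: "norm (of_nat n + c - 1) \<ge> real n - R" by simp
    show "\<delta> * real n \<le> norm (of_nat n + c - 1)"
    proof (cases "real n \<ge> 2 * R")
      case True
      have "\<delta> * real n \<le> 1/2 * real n" by (intro mult_right_mono) (auto simp: \<delta>_def)
      then show ?thesis using 2 True by simp
    next
      case False
      have "\<delta> * real n \<le> \<eta> / (4 * R) * (2 * R)" using False \<eta> R by (intro mult_mono) (auto simp: \<delta>_def)
      then show ?thesis using 1 R by simp
    qed
  qed
qed

lemma hyE_conv_radius: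
  assumes "c \<notin> \<int>\<^sub>\<le>\<^sub>0" shows "fps_conv_radius (hyE a b c) \<ge> 1"
proof -
  obtain \<delta> r where \<delta>: "\<delta> > 0" "r > 0" "\<And>c' n. c' \<in> cball c r \<Longrightarrow> n \<ge> 1 \<Longrightarrow> \<delta> * real n \<le> norm (of_nat n + c' - 1)"
    using nonpos_Ints_distance[OF assms] by metis
  define B where "B = 2 * norm (c - 1) + 4 * norm (a + b) + 2 + 4 * norm (a * b)"
  have bd: "norm (hyE a b c $ n) \<le> pochhammer (1 + B / \<delta>) n / fact n" for n
    by (rule hyE_bound[OF assms _ \<delta>(1)]) (use \<delta> in \<open>auto simp: B_def\<close>)
  show ?thesis unfolding fps_conv_radius_def
  proof (rule conv_radius_geI_ex')
    fix r :: real assume r: "0 < r" "ereal r < 1"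
    show "summable (\<lambda>n. hyE a b c $ n * of_real r ^ n)"
    proof (rule summable_comparison_test)
      show "summable (\<lambda>n. pochhammer (1 + B / \<delta>) n / fact n * r ^ n)"
        by (rule summable_pochhammer_fact) (use r in auto)
      have "norm (hyE a b c $ n * of_real r ^ n) \<le> pochhammer (1 + B / \<delta>) n / fact n * r ^ n" for n
      proof -
        have "norm (of_real r :: complex) = r" using r by simp
        then show ?thesis unfolding norm_mult norm_power using r by (simp only:) (intro mult_right_mono bd, auto)
      qed
      then show "\<exists>N. \<forall>n\<ge>N. norm (hyE a b c $ n * of_real r ^ n) \<le> pochhammer (1 + B / \<delta>) n / fact n * r ^ n"
        by blast
    qed
  qed
qed

lemma hypergeo_conv_radius_pos:
  fixes a b c :: complex
  assumes "c \<notin> \<int>\<^sub>\<le>\<^sub>0" shows "fps_conv_radius (fps_hypergeo [a, b] [c] 1) > 0"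
proof -
  obtain \<delta> r where \<delta>: "\<delta> > 0" "r > 0" "\<And>c' n. c' \<in> cball c r \<Longrightarrow> n \<ge> 1 \<Longrightarrow> \<delta> * real n \<le> norm (of_nat n + c' - 1)"
    using nonpos_Ints_distance[OF assms] by metis
  define F where "F = fps_hypergeo [a, b] [c] (1::complex)"
  define C where "C = (norm a + 1) * (norm b + 1) / \<delta>"
  have C: "C > 0" using \<delta> by (simp add: C_def add_nonneg_pos)
  have st: "norm (F $ Suc n) \<le> C * norm (F $ n)" for n
  proof -
    have F: "F $ Suc n = (a + of_nat n) * (b + of_nat n) / ((1 + of_nat n) * (c + of_nat n)) * F $ n"
      unfolding F_def by (subst fps_hypergeo_rec) simp
    have 1: "norm (x + of_nat n) \<le> (norm x + 1) * (real n + 1)" for x :: complex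
    proof -
      have "norm (x + of_nat n) \<le> norm x + real n" using norm_triangle_ineq[of x "of_nat n"] by simp
      also have "\<dots> \<le> (norm x + 1) * (real n + 1)" by (simp add: algebra_simps)
      finally show ?thesis .
    qed
    have 2: "\<delta> * (real n + 1) \<le> norm (c + of_nat n)" using \<delta>(3)[of c "Suc n"] \<delta>(2) by (simp add: algebra_simps)
    have 3: "norm (1 + of_nat n :: complex) = real n + 1" by (metis add.commute norm_of_nat of_nat_Suc)
    have "norm ((a + of_nat n) * (b + of_nat n)) \<le> ((norm a + 1) * (real n + 1)) * ((norm b + 1) * (real n + 1))"
      unfolding norm_mult by (intro mult_mono 1) auto
    moreover have "norm ((1 + of_nat n) * (c + of_nat n)) \<ge> (real n + 1) * (\<delta> * (real n + 1))"
      unfolding norm_mult 3 by (intro mult_left_mono 2) auto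
    ultimately have "norm ((a + of_nat n) * (b + of_nat n)) / norm ((1 + of_nat n) * (c + of_nat n))
       \<le> ((norm a + 1) * (real n + 1)) * ((norm b + 1) * (real n + 1)) / ((real n + 1) * (\<delta> * (real n + 1)))"
      by (intro frac_le) (auto intro!: mult_pos_pos \<delta>)
    also have "\<dots> = C"
    proof -
      have "N \<noteq> 0 \<Longrightarrow> (P * N) * (Q * N) / (N * (d * N)) = P * Q / d" for N P Q d :: real by simp
      then show ?thesis unfolding C_def by (metis add_nonneg_pos less_irrefl of_nat_0_le_iff zero_less_one)
    qed
    finally show ?thesis unfolding F norm_mult[of _ "F $ n"] norm_divide by (intro mult_right_mono) auto
  qed
  have bd: "norm (F $ n) \<le> C ^ n" for n
  proof (induction n)
    case 0 then show ?case by (simp add: F_def)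
  next
    case (Suc n)
    have "norm (F $ Suc n) \<le> C * norm (F $ n)" by (rule st)
    also have "\<dots> \<le> C * C ^ n" using Suc C by (intro mult_left_mono) auto
    finally show ?case by simp
  qed
  have "summable (\<lambda>n. F $ n * of_real (1 / (2 * C)) ^ n)"
  proof (rule summable_comparison_test)
    show "summable (\<lambda>n. (1/2 :: real) ^ n)" by (intro summable_geometric) auto
    have "norm (F $ n * of_real (1 / (2 * C)) ^ n) \<le> (1/2)^n" for n
    proof -
      have "norm (F $ n * of_real (1 / (2 * C)) ^ n) = norm (F $ n) * (1 / (2 * C)) ^ n" using C
        by (simp add: norm_mult norm_power norm_divide)
      also have "\<dots> \<le> C ^ n * (1 / (2 * C)) ^ n" using C by (intro mult_right_mono bd) auto
      also have "\<dots> = (1/2)^n" using C by (simp add: power_divide power_mult_distrib)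
      finally show ?thesis .
    qed
    then show "\<exists>N. \<forall>n\<ge>N. norm (F $ n * of_real (1 / (2 * C)) ^ n) \<le> (1/2)^n" by blast
  qed
  then have "conv_radius (fps_nth F) \<ge> norm (of_real (1 / (2 * C)) :: complex)" by (rule conv_radius_geI)
  moreover have "norm (of_real (1 / (2 * C)) :: complex) > 0" using C by simp
  ultimately show ?thesis unfolding F_def[symmetric] fps_conv_radius_def
    by (metis ereal_less(2) less_le_trans)
qed


text \<open>The disc coordinate continues the hypergeometric series to the slit plane.\<close>
lemma hypergeo_continuation:
  assumes c: "c \<notin> \<int>\<^sub>\<le>\<^sub>0"
  shows "(\<lambda>z. eval_fps (hyE a b c) (kw z)) holomorphic_on slit_plane"
    and "\<forall>u\<in>ball 0 1. eval_fps (hyE a b c) (kw u) = eval_fps (fps_hypergeo [a, b] [c] 1) u"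
proof -
  define f where "f z = eval_fps (hyE a b c) (kw z)" for z
  define F where "F = fps_hypergeo [a, b] [c] (1::complex)"
  have "eval_fps (hyE a b c) holomorphic_on ball 0 1"
  proof (rule holomorphic_on_eval_fps)
    show "ball (0::complex) 1 \<subseteq> eball 0 (fps_conv_radius (hyE a b c))"
    proof
      fix x :: complex assume "x \<in> ball 0 1"
      then have "ereal (norm x) < 1" by (simp add: one_ereal_def)
      then show "x \<in> eball 0 (fps_conv_radius (hyE a b c))"
        using less_le_trans[OF _ hyE_conv_radius[OF c, of a b]] by (simp add: in_eball_iff)
    qed
  qed
  then have "(eval_fps (hyE a b c) \<circ> kw) holomorphic_on slit_plane"
    by (intro holomorphic_on_compose_gen[OF kw_holomorphic]) (auto simp: norm_kw_less)
  then have fh: "f holomorphic_on slit_plane" by (simp add: f_def[abs_def] o_def)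
  have F: "eval_fps F has_fps_expansion F"
    by (rule eval_fps_has_fps_expansion) (use hypergeo_conv_radius_pos[OF c] in \<open>simp add: F_def\<close>)
  have "(eval_fps F \<circ> (\<lambda>w. -4 * w / (1 - w)^2)) has_fps_expansion (F oo koebe)"
    by (rule has_fps_expansion_compose[OF F koebe_expansion koebe_0])
  then have "eventually (\<lambda>w. eval_fps (F oo koebe) w = eval_fps F (-4 * w / (1 - w)^2)) (nhds 0)"
    by (simp add: has_fps_expansion_def o_def)
  moreover have "filterlim kw (nhds 0) (nhds 0)"
  proof -
    have "isCont kw 0" using kw_holomorphic open_slit_plane ball_subset_slit_plane
      by (meson centre_in_ball continuous_on_eq_continuous_at holomorphic_on_imp_continuous_on subsetD zero_less_one)
    then show ?thesis by (metis isCont_def kw_0 tendsto_at_iff_tendsto_nhds)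
  qed
  ultimately have "eventually (\<lambda>u. eval_fps (F oo koebe) (kw u) = eval_fps F (-4 * kw u / (1 - kw u)^2)) (nhds 0)"
    by (rule eventually_compose_filterlim)
  moreover have "eventually (\<lambda>u. u \<in> slit_plane) (nhds 0)"
    using open_slit_plane ball_subset_slit_plane by (intro eventually_nhds_in_open) auto
  ultimately have "eventually (\<lambda>u. f u = eval_fps F u) (nhds 0)"
  proof eventually_elim
    case (elim u)
    then show ?case unfolding kw_inverse[OF elim(2)] by (simp add: f_def hyE_def F_def)
  qed
  with F have "f has_fps_expansion F" by (subst has_fps_expansion_cong) auto
  then have ex: "fps_expansion f 0 = F" by (rule fps_expansion_eqI)
  have ball: "f u = eval_fps F u" if "u \<in> ball 0 1" for u
    using eval_fps_expansion[of f 0 1 u] holomorphic_on_subset[OF fh ball_subset_slit_plane] that ex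
    by (simp add: one_ereal_def)
  show "(\<lambda>z. eval_fps (hyE a b c) (kw z)) holomorphic_on slit_plane" using fh by (simp add: f_def[abs_def])
  show "\<forall>u\<in>ball 0 1. eval_fps (hyE a b c) (kw u) = eval_fps (fps_hypergeo [a, b] [c] 1) u"
    using ball by (simp add: f_def F_def)
qed

lemma hyp2F1_eq:
  assumes c: "c \<notin> \<int>\<^sub>\<le>\<^sub>0" and z: "z \<in> slit_plane"
  shows "hyp2F1 a b c z = eval_fps (hyE a b c) (kw z)"
  unfolding hyp2F1_def
proof (rule the_equality)
    show "\<exists>f. f holomorphic_on slit_plane \<and> (\<forall>u\<in>ball 0 1. f u = eval_fps (fps_hypergeo [a, b] [c] 1) u) \<and> eval_fps (hyE a b c) (kw z) = f z"
      using hypergeo_continuation[OF c, of a b] by blast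
    fix w assume "\<exists>f. f holomorphic_on slit_plane \<and> (\<forall>u\<in>ball 0 1. f u = eval_fps (fps_hypergeo [a, b] [c] 1) u) \<and> w = f z"
    then obtain g where g: "g holomorphic_on slit_plane" "\<forall>u\<in>ball 0 1. g u = eval_fps (fps_hypergeo [a, b] [c] 1) u" "w = g z"
      by blast
    have "g z = eval_fps (hyE a b c) (kw z)"
      by (rule analytic_continuation_open[of "ball 0 1" slit_plane])
         (use g hypergeo_continuation[OF c, of a b] z open_slit_plane connected_slit_plane ball_subset_slit_plane in auto)
    then show "w = eval_fps (hyE a b c) (kw z)" using g by simp
qed

lemma hyp2F1_holomorphic:
  assumes "c \<notin> \<int>\<^sub>\<le>\<^sub>0" shows "hyp2F1 a b c holomorphic_on slit_plane"
  using hypergeo_continuation(1)[OF assms] by (rule holomorphic_transform) (use assms in \<open>auto simp: hyp2F1_eq\<close>)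

lemma hyp2F1_ball:
  assumes "c \<notin> \<int>\<^sub>\<le>\<^sub>0" "u \<in> ball 0 1"
  shows "hyp2F1 a b c u = eval_fps (fps_hypergeo [a, b] [c] 1) u"
proof -
  have "u \<in> slit_plane" using assms ball_subset_slit_plane by blast
  with hyp2F1_eq[OF assms(1) this, of a b] hypergeo_continuation(2)[OF assms(1), of a b] assms(2) show ?thesis by simp
qed

lemma hyp2F1_eqI:
  assumes c: "c \<notin> \<int>\<^sub>\<le>\<^sub>0" and f: "f holomorphic_on slit_plane" "\<And>u. u \<in> ball 0 1 \<Longrightarrow> f u = eval_fps (fps_hypergeo [a, b] [c] 1) u"
    and z: "z \<in> slit_plane"
  shows "f z = hyp2F1 a b c z"
  by (rule analytic_continuation_open[of "ball 0 1" slit_plane])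
     (use f z open_slit_plane connected_slit_plane ball_subset_slit_plane hyp2F1_holomorphic[OF c] hyp2F1_ball[OF c] in auto)

lemma hyE_local_bound:
  assumes "c0 \<notin> \<int>\<^sub>\<le>\<^sub>0"
  obtains r g where "r > 0" "\<And>c. c \<in> cball c0 r \<Longrightarrow> c \<notin> \<int>\<^sub>\<le>\<^sub>0"
    "\<And>a b c n. norm a \<le> R \<Longrightarrow> norm b \<le> R \<Longrightarrow> c \<in> cball c0 r \<Longrightarrow> norm (hyE a b c $ n) \<le> g n"
    "\<And>x. 0 \<le> x \<Longrightarrow> x < 1 \<Longrightarrow> summable (\<lambda>n. g n * x ^ n)"
proof -
  obtain \<delta> r where \<delta>: "\<delta> > 0" "r > 0" "\<And>c n. c \<in> cball c0 r \<Longrightarrow> n \<ge> 1 \<Longrightarrow> \<delta> * real n \<le> norm (of_nat n + c - 1)"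
    "\<And>c. c \<in> cball c0 r \<Longrightarrow> c \<notin> \<int>\<^sub>\<le>\<^sub>0" by (rule nonpos_Ints_distance[OF assms]) (rule that)
  define B where "B = 2 * (norm c0 + r + 1) + 4 * (R + R) + 2 + 4 * (R * R)"
  show thesis
  proof (rule that[of r "\<lambda>n. pochhammer (1 + B / \<delta>) n / fact n"])
    fix a b c :: complex and n :: nat
    assume a: "norm a \<le> R" and b: "norm b \<le> R" and c: "c \<in> cball c0 r"
    have R0: "0 \<le> R" using a norm_ge_zero[of a] by linarith
    have "norm (c - 1) \<le> norm c0 + r + 1"
      using norm_triangle_ineq4[of c 1] norm_triangle_ineq2[of c c0] c by (simp add: dist_norm norm_minus_commute)
    moreover have "norm (a + b) \<le> R + R" using norm_triangle_ineq[of a b] a b by linarith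
    moreover have "norm (a * b) \<le> R * R" unfolding norm_mult using a b R0 by (intro mult_mono) auto
    ultimately have "2 * norm (c - 1) + 4 * norm (a + b) + 2 + 4 * norm (a * b) \<le> B"
      unfolding B_def by (intro add_mono mult_left_mono) auto
    then show "norm (hyE a b c $ n) \<le> pochhammer (1 + B / \<delta>) n / fact n"
      by (rule hyE_bound[OF \<delta>(4)[OF c] _ \<delta>(1) \<delta>(3)[OF c]])
  next
    show "summable (\<lambda>n. pochhammer (1 + B / \<delta>) n / fact n * x ^ n)" if "0 \<le> x" "x < 1" for x
      by (rule summable_pochhammer_fact[OF that])
  qed (use \<delta> in auto)
qed

lemma hyp2F1_local_bound:
  assumes "c0 \<notin> \<int>\<^sub>\<le>\<^sub>0" "z \<in> slit_plane"
  obtains M where "\<And>a b. norm a \<le> R \<Longrightarrow> norm b \<le> R \<Longrightarrow> norm (hyp2F1 a b c0 z) \<le> M"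
proof -
  obtain r g where g: "r > 0" "\<And>c. c \<in> cball c0 r \<Longrightarrow> c \<notin> \<int>\<^sub>\<le>\<^sub>0"
    "\<And>a b c n. norm a \<le> R \<Longrightarrow> norm b \<le> R \<Longrightarrow> c \<in> cball c0 r \<Longrightarrow> norm (hyE a b c $ n) \<le> g n"
    "\<And>x. 0 \<le> x \<Longrightarrow> x < 1 \<Longrightarrow> summable (\<lambda>n. g n * x ^ n)" by (rule hyE_local_bound[OF assms(1), where R = R]) (rule that)
  have sg: "summable (\<lambda>n. g n * norm (kw z) ^ n)" using g(4) norm_kw_less[OF assms(2)] by simp
  show thesis
  proof (rule that)
    fix a b :: complex assume ab: "norm a \<le> R" "norm b \<le> R"
    have "norm (hyE a b c0 $ n * kw z ^ n) \<le> g n * norm (kw z) ^ n" for n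
      unfolding norm_mult norm_power using g(1) g(3)[OF ab] by (intro mult_right_mono) auto
    then have "norm (\<Sum>n. hyE a b c0 $ n * kw z ^ n) \<le> (\<Sum>n. g n * norm (kw z) ^ n)"
      by (rule norm_suminf_le[OF _ sg])
    then show "norm (hyp2F1 a b c0 z) \<le> (\<Sum>n. g n * norm (kw z) ^ n)"
      by (simp add: hyp2F1_eq[OF assms] eval_fps_def)
  qed
qed

lemma hyE_nth: "hyE a b c $ n = (\<Sum>i=0..n. pochhammer a i * pochhammer b i / (pochhammer c i * fact i) * (koebe ^ i $ n))"
  by (simp add: hyE_def fps_compose_nth)

text \<open>Near each parameter value the disc series is dominated by one convergent numerical series, so it is a locally uniform limit of
  its partial sums, which are rational in the parameters.\<close>
lemma hyp2F1_param_holomorphic: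
  assumes U: "open U" and p: "p holomorphic_on U" and q: "q holomorphic_on U" and c: "c holomorphic_on U"
    and c0: "\<And>x. x \<in> U \<Longrightarrow> c x \<notin> \<int>\<^sub>\<le>\<^sub>0" and z: "z \<in> slit_plane"
  shows "(\<lambda>x. hyp2F1 (p x) (q x) (c x) z) holomorphic_on U"
proof -
  define f where "f n x = (\<Sum>i<n. hyE (p x) (q x) (c x) $ i * kw z ^ i)" for n :: nat and x
  have "(\<lambda>x. \<Sum>i. hyE (p x) (q x) (c x) $ i * kw z ^ i) holomorphic_on U"
  proof (rule holomorphic_uniform_sequence[OF U])
    fix n
    have nz: "pochhammer (c x) i \<noteq> 0" if "x \<in> U" for x i
      using c0[OF that] by (metis pochhammer_eq_0_iff minus_of_nat_in_nonpos_Ints)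
    have poch: "(\<lambda>x. pochhammer (h x) i) holomorphic_on U" if "h holomorphic_on U" for h :: "complex \<Rightarrow> complex" and i
      unfolding pochhammer_prod using that by (intro holomorphic_intros)
    show "f n holomorphic_on U" unfolding f_def hyE_nth
      by (intro holomorphic_intros poch p q c) (use nz in auto)
  next
    fix x assume x: "x \<in> U"
    obtain e0 where e0: "e0 > 0" "cball x e0 \<subseteq> U" using U x open_contains_cball by blast
    have "compact (p ` cball x e0)" "compact (q ` cball x e0)"
      using e0 p q by (auto intro!: compact_continuous_image holomorphic_on_imp_continuous_on intro: holomorphic_on_subset)
    then obtain R1 R2 where R: "\<forall>y\<in>p ` cball x e0. norm y \<le> R1" "\<forall>y\<in>q ` cball x e0. norm y \<le> R2"
      by (meson bounded_iff compact_imp_bounded)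
    define R where "R = max R1 R2"
    obtain r g where g: "r > 0" "\<And>c'. c' \<in> cball (c x) r \<Longrightarrow> c' \<notin> \<int>\<^sub>\<le>\<^sub>0"
      "\<And>a b c' n. norm a \<le> R \<Longrightarrow> norm b \<le> R \<Longrightarrow> c' \<in> cball (c x) r \<Longrightarrow> norm (hyE a b c' $ n) \<le> g n"
      "\<And>x. 0 \<le> x \<Longrightarrow> x < 1 \<Longrightarrow> summable (\<lambda>n. g n * x ^ n)" by (rule hyE_local_bound[OF c0[OF x], where R = R]) (rule that)
    have "isCont c x" using c U x by (meson continuous_on_eq_continuous_at holomorphic_on_imp_continuous_on)
    then obtain e1 where e1: "e1 > 0" "\<And>y. dist y x < e1 \<Longrightarrow> dist (c y) (c x) < r"
      unfolding continuous_at_eps_delta using g(1) by metis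
    define e where "e = min e0 (e1/2)"
    have e: "e > 0" "cball x e \<subseteq> cball x e0" using e0 e1 by (auto simp: e_def)
    have "uniform_limit (cball x e) f (\<lambda>x. \<Sum>i. hyE (p x) (q x) (c x) $ i * kw z ^ i) sequentially"
      unfolding f_def
    proof (rule Weierstrass_m_test)
      show "summable (\<lambda>n. g n * norm (kw z) ^ n)" using g(4) norm_kw_less[OF z] by simp
      fix n y assume y: "y \<in> cball x e"
      have "dist y x < e1" using y e1(1) unfolding e_def by (simp add: dist_commute)
      then have "c y \<in> cball (c x) r" using e1(2)[of y] by (simp add: dist_commute)
      moreover have "norm (p y) \<le> R" "norm (q y) \<le> R" using R y e(2) unfolding R_def by fastforce+
      ultimately show "norm (hyE (p y) (q y) (c y) $ n * kw z ^ n) \<le> g n * norm (kw z) ^ n"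
        unfolding norm_mult norm_power by (intro mult_right_mono g) auto
    qed
    then show "\<exists>d>0. cball x d \<subseteq> U \<and> uniform_limit (cball x d) f (\<lambda>x. \<Sum>i. hyE (p x) (q x) (c x) $ i * kw z ^ i) sequentially"
      using e e0 by blast
  qed
  then show ?thesis
    by (rule holomorphic_transform) (simp add: hyp2F1_eq[OF c0 z] eval_fps_def)
qed

section \<open>Weighted means of the logarithm and the phase\<close>

text \<open>The logarithm of the modulus of \<open>(1 - e^(i\<theta>))/(1 + e^(i\<theta>))\<close>; \<open>ph\<close> below is the
  linear phase that accompanies it, centred at \<open>\<pi>/2\<close>.\<close>
definition lam :: "real \<Rightarrow> real" where "lam \<theta> = ln (tan (\<theta> / 2))"
definition ph :: "real \<Rightarrow> real" where "ph \<theta> = \<theta> - pi / 2"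

lemma tan_half_pos: assumes "0 < \<theta>" "\<theta> < pi" shows "tan (\<theta>/2) > 0"
  using assms by (intro tan_gt_zero) auto

lemma lam_deriv: assumes "0 < \<theta>" "\<theta> < pi" shows "(lam has_real_derivative 1 / sin \<theta>) (at \<theta>)"
proof -
  have c: "cos (\<theta>/2) > 0" "sin (\<theta>/2) > 0" using assms by (auto intro!: cos_gt_zero sin_gt_zero)
  have s: "sin \<theta> = 2 * sin (\<theta>/2) * cos (\<theta>/2)" using sin_double[of "\<theta>/2"] by simp
  have "(lam has_real_derivative (inverse ((cos (\<theta>/2))^2) * (1/2)) / tan (\<theta>/2)) (at \<theta>)"
    unfolding lam_def[abs_def] using c tan_half_pos[OF assms] by (auto intro!: derivative_eq_intros)
  moreover have "(inverse ((cos (\<theta>/2))^2) * (1/2)) / tan (\<theta>/2) = 1 / sin \<theta>"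
    unfolding s tan_def using c by (simp add: field_simps power2_eq_square)
  ultimately show ?thesis by simp
qed

lemma ph_deriv: "(ph has_real_derivative 1) (at \<theta>)"
  unfolding ph_def[abs_def] by (auto intro!: derivative_eq_intros)

lemma ln_abs_le: fixes x :: real assumes "x > 0" shows "\<bar>ln x\<bar> \<le> \<bar>x - 1/x\<bar> / 2"
proof -
  have 1: "ln x \<le> (x - 1/x) / 2" if x: "x \<ge> 1" for x :: real
  proof -
    have "(x - 1/x)/2 - ln x \<ge> (1 - 1/1)/2 - ln 1"
    proof (rule DERIV_nonneg_imp_nondecreasing[OF x])
      fix y :: real assume y: "1 \<le> y" "y \<le> x"
      have "((\<lambda>x. (x - 1/x)/2 - ln x) has_real_derivative (1 + 1/y^2)/2 - 1/y) (at y)"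
        using y by (auto intro!: derivative_eq_intros simp: power2_eq_square)
      moreover have "(1 + 1/y^2)/2 - 1/y = (1 - 1/y)^2 / 2"
        using y by (simp add: power2_eq_square divide_simps) (simp add: algebra_simps)
      ultimately show "\<exists>D. ((\<lambda>x. (x - 1/x)/2 - ln x) has_real_derivative D) (at y) \<and> 0 \<le> D"
        by (metis zero_le_divide_iff zero_le_numeral zero_le_power2)
    qed
    then show ?thesis by simp
  qed
  show ?thesis
  proof (cases "x \<ge> 1")
    case True
    then have "1/x \<le> 1" by simp
    then show ?thesis using 1[OF True] True by simp
  next
    case False
    then have "1/x > 1" using assms by simp
    then have "1/x \<ge> 1" "1/x > x" using False by linarith+
    then show ?thesis using 1[of "1/x"] False assms by (simp add: ln_div)
  qed
qed

text \<open>With \<open>x = tan (\<theta>/2)\<close> one has \<open>|x - 1/x|/2 = |cot \<theta>|\<close>. This bound and the next make the weighted means decay as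
  the exponent of the weight grows.\<close>
lemma lam_le_cot: assumes "0 < \<theta>" "\<theta> < pi" shows "\<bar>lam \<theta>\<bar> \<le> \<bar>cot \<theta>\<bar>"
proof -
  have c: "cos (\<theta>/2) > 0" "sin (\<theta>/2) > 0" using assms by (auto intro!: cos_gt_zero sin_gt_zero)
  have "cot \<theta> = cos (2 * (\<theta>/2)) / sin (2 * (\<theta>/2))" by (simp add: cot_def)
  also have "\<dots> = - ((tan (\<theta>/2) - 1 / tan (\<theta>/2)) / 2)"
    unfolding sin_double cos_double tan_def using c by (simp add: field_simps power2_eq_square)
  finally have "\<bar>cot \<theta>\<bar> = \<bar>tan (\<theta>/2) - 1 / tan (\<theta>/2)\<bar> / 2" by simp
  then show ?thesis using ln_abs_le[OF tan_half_pos[OF assms]] by (simp add: lam_def)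
qed

lemma ph_le_cot: assumes "0 < \<theta>" "\<theta> < pi" shows "\<bar>ph \<theta>\<bar> \<le> \<bar>cot \<theta>\<bar>"
proof -
  have "\<bar>ph \<theta>\<bar> \<le> \<bar>tan (ph \<theta>)\<bar>" using assms by (intro abs_tan_ge) (auto simp: ph_def abs_if)
  also have "tan (ph \<theta>) = - cot \<theta>"
    using assms sin_gt_zero[of \<theta>] by (simp add: ph_def tan_def cot_def sin_diff cos_diff)
  finally show ?thesis by simp
qed

lemma lam_reflect: assumes "0 < \<theta>" "\<theta> < pi" shows "lam (pi - \<theta>) = - lam \<theta>"
proof -
  have "tan ((pi - \<theta>) / 2) = inverse (tan (\<theta>/2))"
    by (simp add: diff_divide_distrib tan_def sin_diff cos_diff)
  then show ?thesis using tan_half_pos[OF assms] by (simp add: lam_def ln_inverse)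
qed

lemma sin_powr_lam_tendsto:
  assumes "p > 0" shows "((\<lambda>\<theta>. sin \<theta> powr p * lam \<theta> ^ j) \<longlongrightarrow> 0) (at_right 0)"
proof -
  define q where "q = p / (2 * (real j + 1))"
  have q: "q > 0" using assms by (simp add: q_def)
  have "p / (2 * y) * y = p / 2" if "y > 0" for y :: real using that by simp
  then have "q * (real j + 1) = p / 2" unfolding q_def by (simp only: add_nonneg_pos of_nat_0_le_iff zero_less_one)
  then have pq: "p = p / 2 + q * real j + q" by (simp add: algebra_simps)
  have l: "((\<lambda>\<theta>::real. sin \<theta> powr q * ln (tan (\<theta>/2))) \<longlongrightarrow> 0) (at_right 0)" using q by real_asymp
  have s: "((\<lambda>\<theta>::real. sin \<theta> powr (p/2 + q)) \<longlongrightarrow> 0) (at_right 0)" using q assms by real_asymp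
  have "((\<lambda>\<theta>. sin \<theta> powr (p/2 + q) * (sin \<theta> powr q * ln (tan (\<theta>/2))) ^ j) \<longlongrightarrow> 0 * 0 ^ j) (at_right 0)"
    by (intro tendsto_intros l s)
  moreover have "eventually (\<lambda>\<theta>. sin \<theta> powr (p/2 + q) * (sin \<theta> powr q * ln (tan (\<theta>/2))) ^ j = sin \<theta> powr p * lam \<theta> ^ j) (at_right 0)"
  proof -
    have "eventually (\<lambda>\<theta>. \<theta> \<in> {0<..<pi}) (at_right (0::real))" by (rule eventually_at_right_real) simp
    then show ?thesis
    proof eventually_elim
      case (elim \<theta>)
      then have "sin \<theta> > 0" by (auto intro: sin_gt_zero)
      then have "sin \<theta> powr p = sin \<theta> powr (p/2 + q) * (sin \<theta> powr q) ^ j"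
        by (subst pq) (simp add: powr_add powr_powr[symmetric] powr_realpow)
      then show ?case by (simp add: power_mult_distrib lam_def)
    qed
  qed
  ultimately have "((\<lambda>\<theta>. sin \<theta> powr p * lam \<theta> ^ j) \<longlongrightarrow> 0 * 0 ^ j) (at_right 0)"
    by (rule Lim_transform_eventually)
  then show ?thesis by (simp only: mult_zero_left)
qed

lemma continuous_sin_powr_lam:
  assumes "p > 0" shows "continuous_on {0..pi} (\<lambda>\<theta>. sin \<theta> powr p * lam \<theta> ^ j)"
  unfolding continuous_on_eq_continuous_within
proof
  fix x assume x: "x \<in> {0..pi}"
  consider "x = 0" | "x = pi" | "0 < x" "x < pi" using x by fastforce
  then show "continuous (at x within {0..pi}) (\<lambda>\<theta>. sin \<theta> powr p * lam \<theta> ^ j)"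
  proof cases
    case 1
    then show ?thesis using sin_powr_lam_tendsto[OF assms, of j]
      by (simp add: continuous_within at_within_Icc_at_right)
  next
    case 2
    have "((\<lambda>\<theta>. sin (pi - \<theta>) powr p * lam (pi - \<theta>) ^ j) \<longlongrightarrow> 0) (at_left pi)"
    proof -
      have "filterlim (\<lambda>\<theta>. pi - \<theta>) (at_right 0) (at_left pi)"
        by (auto simp: filterlim_at eventually_at_left_field intro!: tendsto_eq_intros exI[of _ 0])
      then show ?thesis by (rule filterlim_compose[OF sin_powr_lam_tendsto[OF assms, of j]])
    qed
    then have "((\<lambda>\<theta>. (-1)^j * (sin (pi - \<theta>) powr p * lam (pi - \<theta>) ^ j)) \<longlongrightarrow> (-1)^j * 0) (at_left pi)"
      by (intro tendsto_intros)
    moreover have "eventually (\<lambda>\<theta>. (-1)^j * (sin (pi - \<theta>) powr p * lam (pi - \<theta>) ^ j) = sin \<theta> powr p * lam \<theta> ^ j) (at_left pi)"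
    proof -
      have "eventually (\<lambda>\<theta>. \<theta> \<in> {0<..<pi}) (at_left pi)" by (rule eventually_at_left_real) simp
      then show ?thesis
      proof eventually_elim
        case (elim \<theta>)
        then have "(-1)^j * (sin (pi - \<theta>) powr p * lam (pi - \<theta>) ^ j) = sin \<theta> powr p * ((-1) * (- lam \<theta>)) ^ j"
          unfolding power_mult_distrib by (simp add: lam_reflect)
        then show ?case by simp
      qed
    qed
    ultimately have "((\<lambda>\<theta>. sin \<theta> powr p * lam \<theta> ^ j) \<longlongrightarrow> (-1)^j * 0) (at_left pi)"
      by (rule Lim_transform_eventually)
    then have "((\<lambda>\<theta>. sin \<theta> powr p * lam \<theta> ^ j) \<longlongrightarrow> 0) (at_left pi)" by (simp only: mult_zero_right)
    then show ?thesis using 2 by (simp add: continuous_within at_within_Icc_at_left)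
  next
    case 3
    then have "cos (x/2) \<noteq> 0" "tan (x/2) > 0" "sin x > 0" 
      using cos_gt_zero[of "x/2"] tan_half_pos sin_gt_zero by auto
    then have "isCont (\<lambda>\<theta>. sin \<theta> powr p * lam \<theta> ^ j) x" unfolding lam_def
      by (intro continuous_intros) auto
    then show ?thesis by (rule continuous_at_imp_continuous_at_within)
  qed
qed

lemma continuous_sin_powr: "p > 0 \<Longrightarrow> continuous_on {0..pi} (\<lambda>\<theta>. sin \<theta> powr p)"
  using continuous_sin_powr_lam[of p 0] by simp

lemma sin_powr_Suc: assumes "\<theta> \<in> {0..pi}" shows "sin \<theta> powr (p + 1) = sin \<theta> powr p * sin \<theta>"
  using assms sin_ge_zero[of \<theta>] by (simp add: powr_add)

lemma sin_powr_2: assumes "\<theta> \<in> {0..pi}" shows "sin \<theta> powr (p + 2) = sin \<theta> powr p * (sin \<theta>)^2"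
  using assms sin_powr_Suc[of \<theta> "p+1"] sin_powr_Suc[of \<theta> p] by (simp add: power2_eq_square algebra_simps)

lemma sin_powr_deriv: assumes "0 < \<theta>" "\<theta> < pi"
  shows "((\<lambda>\<theta>. sin \<theta> powr (p + 1)) has_real_derivative (p + 1) * sin \<theta> powr p * cos \<theta>) (at \<theta>)"
proof -
  have "sin \<theta> > 0" using assms by (auto intro: sin_gt_zero)
  from DERIV_chain2[OF has_real_derivative_powr[OF this, of "p + 1"] DERIV_sin] show ?thesis by simp
qed

text \<open>Integration by parts against \<open>sin^(\<nu>+1)\<close>, whose boundary terms vanish although \<open>f\<close> may have a logarithmic singularity.\<close>
lemma sin_power_parts:
  assumes \<nu>: "\<nu> > 0" and f: "\<And>\<theta>. 0 < \<theta> \<Longrightarrow> \<theta> < pi \<Longrightarrow> (f has_real_derivative f' \<theta>) (at \<theta>)"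
    and C0: "continuous_on {0..pi} (\<lambda>\<theta>. sin \<theta> powr \<nu> * f \<theta>)"
    and C1: "(\<lambda>\<theta>. sin \<theta> powr (\<nu> + 1) * f' \<theta>) integrable_on {0..pi}"
  shows "(\<nu> + 1) * integral {0..pi} (\<lambda>\<theta>. cos \<theta> * sin \<theta> powr \<nu> * f \<theta>) =
      - integral {0..pi} (\<lambda>\<theta>. sin \<theta> powr (\<nu> + 1) * f' \<theta>)"
proof -
  have cont: "continuous_on {0..pi} (\<lambda>\<theta>. sin \<theta> powr (\<nu> + 1) * f \<theta>)"
  proof -
    have "continuous_on {0..pi} (\<lambda>\<theta>. sin \<theta> * (sin \<theta> powr \<nu> * f \<theta>))" by (intro continuous_intros C0)
    then show ?thesis by (rule continuous_on_eq) (simp add: sin_powr_Suc mult_ac)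
  qed
  have "((\<lambda>\<theta>. (\<nu> + 1) * (cos \<theta> * sin \<theta> powr \<nu> * f \<theta>) + sin \<theta> powr (\<nu> + 1) * f' \<theta>) has_integral
      (sin pi powr (\<nu> + 1) * f pi - sin 0 powr (\<nu> + 1) * f 0)) {0..pi}"
  proof (rule fundamental_theorem_of_calculus_interior[OF _ cont])
    fix \<theta> assume "\<theta> \<in> {0<..<pi}"
    then show "((\<lambda>\<theta>. sin \<theta> powr (\<nu> + 1) * f \<theta>) has_vector_derivative
       (\<nu> + 1) * (cos \<theta> * sin \<theta> powr \<nu> * f \<theta>) + sin \<theta> powr (\<nu> + 1) * f' \<theta>) (at \<theta>)"
      unfolding has_real_derivative_iff_has_vector_derivative[symmetric]
      using DERIV_mult[OF sin_powr_deriv[of \<theta> \<nu>] f[of \<theta>]] by (simp add: algebra_simps)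
  qed simp
  then have "integral {0..pi} (\<lambda>\<theta>. (\<nu> + 1) * (cos \<theta> * sin \<theta> powr \<nu> * f \<theta>) + sin \<theta> powr (\<nu> + 1) * f' \<theta>) = 0"
    by (simp add: has_integral_iff)
  moreover have i: "(\<lambda>\<theta>. cos \<theta> * sin \<theta> powr \<nu> * f \<theta>) integrable_on {0..pi}"
  proof -
    have "continuous_on {0..pi} (\<lambda>\<theta>. cos \<theta> * (sin \<theta> powr \<nu> * f \<theta>))" by (intro continuous_intros C0)
    then show ?thesis by (intro integrable_continuous_real) (simp add: mult.assoc)
  qed
  moreover have "integral {0..pi} (\<lambda>\<theta>. (\<nu> + 1) * (cos \<theta> * sin \<theta> powr \<nu> * f \<theta>) + sin \<theta> powr (\<nu> + 1) * f' \<theta>)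
    = (\<nu> + 1) * integral {0..pi} (\<lambda>\<theta>. cos \<theta> * sin \<theta> powr \<nu> * f \<theta>) + integral {0..pi} (\<lambda>\<theta>. sin \<theta> powr (\<nu> + 1) * f' \<theta>)"
    by (rule integral_unique, intro has_integral_add has_integral_mult_right integrable_integral i C1)
  ultimately show ?thesis by linarith
qed

text \<open>The common source of the four recurrences below, with \<open>f = 1, L\<Phi>, L\<^sup>2, \<Phi>\<^sup>2\<close>.\<close>
lemma sin_power_reduction:
  assumes \<nu>: "\<nu> > 0" and f: "\<And>\<theta>. 0 < \<theta> \<Longrightarrow> \<theta> < pi \<Longrightarrow> (f has_real_derivative f' \<theta>) (at \<theta>)"
    and C0: "continuous_on {0..pi} (\<lambda>\<theta>. sin \<theta> powr \<nu> * f \<theta>)"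
    and C1: "(\<lambda>\<theta>. cos \<theta> * sin \<theta> powr (\<nu> + 1) * f' \<theta>) integrable_on {0..pi}"
  shows "(\<nu> + 2) * integral {0..pi} (\<lambda>\<theta>. sin \<theta> powr (\<nu> + 2) * f \<theta>) =
     (\<nu> + 1) * integral {0..pi} (\<lambda>\<theta>. sin \<theta> powr \<nu> * f \<theta>) + integral {0..pi} (\<lambda>\<theta>. cos \<theta> * sin \<theta> powr (\<nu> + 1) * f' \<theta>)"
proof -
  have cont: "continuous_on {0..pi} (\<lambda>\<theta>. - cos \<theta> * (sin \<theta> powr (\<nu> + 1) * f \<theta>))"
  proof -
    have "continuous_on {0..pi} (\<lambda>\<theta>. - cos \<theta> * (sin \<theta> * (sin \<theta> powr \<nu> * f \<theta>)))" by (intro continuous_intros C0)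
    then show ?thesis by (rule continuous_on_eq) (simp add: sin_powr_Suc mult_ac)
  qed
  have cont2: "continuous_on {0..pi} (\<lambda>\<theta>. sin \<theta> powr (\<nu> + 2) * f \<theta>)"
  proof -
    have "continuous_on {0..pi} (\<lambda>\<theta>. (sin \<theta>)^2 * (sin \<theta> powr \<nu> * f \<theta>))" by (intro continuous_intros C0)
    then show ?thesis by (rule continuous_on_eq) (simp add: sin_powr_2 mult_ac)
  qed
  have "((\<lambda>\<theta>. ((\<nu> + 2) * (sin \<theta> powr (\<nu> + 2) * f \<theta>) - (\<nu> + 1) * (sin \<theta> powr \<nu> * f \<theta>)) - cos \<theta> * sin \<theta> powr (\<nu> + 1) * f' \<theta>) has_integral
      (- cos pi * (sin pi powr (\<nu> + 1) * f pi) - (- cos 0 * (sin 0 powr (\<nu> + 1) * f 0)))) {0..pi}"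
  proof (rule fundamental_theorem_of_calculus_interior[OF _ cont])
    fix \<theta> assume t: "\<theta> \<in> {0<..<pi}"
    define S where "S = sin \<theta> powr \<nu>"
    have e: "sin \<theta> powr (\<nu> + 1) = S * sin \<theta>" "sin \<theta> powr (\<nu> + 2) = S * (sin \<theta>)^2"
      unfolding S_def using t by (intro sin_powr_Suc sin_powr_2; auto)+
    have c: "cos \<theta> * cos \<theta> = 1 - (sin \<theta>)^2" using sin_cos_squared_add[of \<theta>] by (simp add: power2_eq_square)
    have "((\<lambda>\<theta>. - cos \<theta> * (sin \<theta> powr (\<nu> + 1) * f \<theta>)) has_real_derivative
       sin \<theta> * (sin \<theta> powr (\<nu> + 1) * f \<theta>) + (((\<nu> + 1) * sin \<theta> powr \<nu> * cos \<theta>) * f \<theta> + f' \<theta> * sin \<theta> powr (\<nu> + 1)) * (- cos \<theta>)) (at \<theta>)"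
      using t by (intro DERIV_mult sin_powr_deriv f) (auto intro!: derivative_eq_intros)
    also have "sin \<theta> * (sin \<theta> powr (\<nu> + 1) * f \<theta>) + (((\<nu> + 1) * sin \<theta> powr \<nu> * cos \<theta>) * f \<theta> + f' \<theta> * sin \<theta> powr (\<nu> + 1)) * (- cos \<theta>)
      = S * (sin \<theta>)^2 * f \<theta> - (\<nu> + 1) * S * (cos \<theta> * cos \<theta>) * f \<theta> - cos \<theta> * (S * sin \<theta>) * f' \<theta>"
      unfolding e S_def[symmetric] by (simp add: algebra_simps power2_eq_square)
    also have "\<dots> = ((\<nu> + 2) * (sin \<theta> powr (\<nu> + 2) * f \<theta>) - (\<nu> + 1) * (sin \<theta> powr \<nu> * f \<theta>)) - cos \<theta> * sin \<theta> powr (\<nu> + 1) * f' \<theta>"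
      unfolding c e S_def[symmetric] by (simp add: algebra_simps)
    finally show "((\<lambda>\<theta>. - cos \<theta> * (sin \<theta> powr (\<nu> + 1) * f \<theta>)) has_vector_derivative
       ((\<nu> + 2) * (sin \<theta> powr (\<nu> + 2) * f \<theta>) - (\<nu> + 1) * (sin \<theta> powr \<nu> * f \<theta>)) - cos \<theta> * sin \<theta> powr (\<nu> + 1) * f' \<theta>) (at \<theta>)"
      unfolding has_real_derivative_iff_has_vector_derivative[symmetric] .
  qed simp
  then have "integral {0..pi} (\<lambda>\<theta>. ((\<nu> + 2) * (sin \<theta> powr (\<nu> + 2) * f \<theta>) - (\<nu> + 1) * (sin \<theta> powr \<nu> * f \<theta>)) - cos \<theta> * sin \<theta> powr (\<nu> + 1) * f' \<theta>) = 0"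
    by (simp add: has_integral_iff)
  moreover have "(\<lambda>\<theta>. sin \<theta> powr (\<nu> + 2) * f \<theta>) integrable_on {0..pi}" "(\<lambda>\<theta>. sin \<theta> powr \<nu> * f \<theta>) integrable_on {0..pi}"
    using cont2 C0 integrable_continuous_real by blast+
  moreover have "integral {0..pi} (\<lambda>\<theta>. ((\<nu> + 2) * (sin \<theta> powr (\<nu> + 2) * f \<theta>) - (\<nu> + 1) * (sin \<theta> powr \<nu> * f \<theta>)) - cos \<theta> * sin \<theta> powr (\<nu> + 1) * f' \<theta>)
     = ((\<nu> + 2) * integral {0..pi} (\<lambda>\<theta>. sin \<theta> powr (\<nu> + 2) * f \<theta>) - (\<nu> + 1) * integral {0..pi} (\<lambda>\<theta>. sin \<theta> powr \<nu> * f \<theta>))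
        - integral {0..pi} (\<lambda>\<theta>. cos \<theta> * sin \<theta> powr (\<nu> + 1) * f' \<theta>)"
    if "(\<lambda>\<theta>. sin \<theta> powr (\<nu> + 2) * f \<theta>) integrable_on {0..pi}" "(\<lambda>\<theta>. sin \<theta> powr \<nu> * f \<theta>) integrable_on {0..pi}"
    by (rule integral_unique, intro has_integral_diff has_integral_mult_right integrable_integral that C1)
  ultimately show ?thesis by linarith
qed


definition sinint :: "real \<Rightarrow> real" where "sinint n = integral {0..pi} (\<lambda>\<theta>. sin \<theta> powr n)"
definition lamphint :: "real \<Rightarrow> real" where "lamphint n = integral {0..pi} (\<lambda>\<theta>. sin \<theta> powr n * (lam \<theta> * ph \<theta>))"
definition lam2int :: "real \<Rightarrow> real" where "lam2int n = integral {0..pi} (\<lambda>\<theta>. sin \<theta> powr n * (lam \<theta>)^2)"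
definition ph2int :: "real \<Rightarrow> real" where "ph2int n = integral {0..pi} (\<lambda>\<theta>. sin \<theta> powr n * (ph \<theta>)^2)"

lemma continuous_ph: "continuous_on A ph" unfolding ph_def[abs_def] by (intro continuous_intros)

lemma continuous_sin_powr_lamph:
  assumes "n > 0"
  shows "continuous_on {0..pi} (\<lambda>\<theta>. sin \<theta> powr n * (lam \<theta> * ph \<theta>))"
    "continuous_on {0..pi} (\<lambda>\<theta>. sin \<theta> powr n * lam \<theta>)"
    "continuous_on {0..pi} (\<lambda>\<theta>. sin \<theta> powr n * ph \<theta>)"
    "continuous_on {0..pi} (\<lambda>\<theta>. sin \<theta> powr n * (lam \<theta>)^2)"
    "continuous_on {0..pi} (\<lambda>\<theta>. sin \<theta> powr n * (ph \<theta>)^2)"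
proof -
  show "continuous_on {0..pi} (\<lambda>\<theta>. sin \<theta> powr n * lam \<theta>)"
    using continuous_sin_powr_lam[OF assms, of 1] by simp
  then have "continuous_on {0..pi} (\<lambda>\<theta>. (sin \<theta> powr n * lam \<theta>) * ph \<theta>)" by (rule continuous_on_mult[OF _ continuous_ph])
  then show "continuous_on {0..pi} (\<lambda>\<theta>. sin \<theta> powr n * (lam \<theta> * ph \<theta>))" by (simp only: mult.assoc)
  show "continuous_on {0..pi} (\<lambda>\<theta>. sin \<theta> powr n * ph \<theta>)" "continuous_on {0..pi} (\<lambda>\<theta>. sin \<theta> powr n * (ph \<theta>)^2)"
    by (intro continuous_on_mult continuous_on_power continuous_ph continuous_sin_powr[OF assms])+
  show "continuous_on {0..pi} (\<lambda>\<theta>. sin \<theta> powr n * (lam \<theta>)^2)"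
    by (rule continuous_sin_powr_lam[OF assms])
qed

lemma sinint_rec: assumes "\<nu> > 0" shows "(\<nu> + 2) * sinint (\<nu> + 2) = (\<nu> + 1) * sinint \<nu>"
  using sin_power_reduction[OF assms, of "\<lambda>_. 1" "\<lambda>_. 0"] continuous_sin_powr[OF assms]
  by (simp add: sinint_def integrable_0)

lemma sinint_pos: assumes "n > 0" shows "sinint n > 0"
proof -
  have "integral {0..pi} (\<lambda>\<theta>. sin \<theta> powr n) \<noteq> 0"
  proof
    have pi0: "\<not> pi \<le> 0" using pi_gt_zero by linarith
    assume "integral {0..pi} (\<lambda>\<theta>. sin \<theta> powr n) = 0"
    then have "((\<lambda>\<theta>. sin \<theta> powr n) has_integral 0) (cbox 0 pi)"
      using integrable_continuous_real[OF continuous_sin_powr[OF assms]] by (simp add: has_integral_iff)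
    then have "sin (pi/2) powr n = 0"
      by (rule has_integral_0_cbox_imp_0[rotated 2]) (use continuous_sin_powr[OF assms] pi0 in auto)
    then show False by simp
  qed
  moreover have "integral {0..pi} (\<lambda>\<theta>. sin \<theta> powr n) \<ge> 0"
    by (intro integral_nonneg integrable_continuous_real continuous_sin_powr assms) auto
  ultimately show ?thesis unfolding sinint_def by linarith
qed

lemma integral_sin_parts:
  assumes "\<nu> > 0"
  shows "integral {0..pi} (\<lambda>\<theta>. cos \<theta> * sin \<theta> powr \<nu> * lam \<theta>) = - (1 / (\<nu> + 1)) * sinint \<nu>"
    and "integral {0..pi} (\<lambda>\<theta>. cos \<theta> * sin \<theta> powr \<nu> * ph \<theta>) = - (1 / (\<nu> + 1)) * sinint (\<nu> + 1)"
proof -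
  have eq: "sin \<theta> powr (\<nu> + 1) * (1 / sin \<theta>) = sin \<theta> powr \<nu>" if "\<theta> \<in> {0..pi}" for \<theta>
    using that by (cases "sin \<theta> = 0") (auto simp: sin_powr_Suc[of \<theta> \<nu>])
  have "(\<lambda>\<theta>. sin \<theta> powr (\<nu> + 1) * (1 / sin \<theta>)) integrable_on {0..pi}"
    by (rule integrable_eq[OF integrable_continuous_real[OF continuous_sin_powr[OF assms]]]) (simp only: eq)
  from sin_power_parts[OF assms lam_deriv _ this] continuous_sin_powr_lamph[OF assms]
  have "(\<nu> + 1) * integral {0..pi} (\<lambda>\<theta>. cos \<theta> * sin \<theta> powr \<nu> * lam \<theta>) = - integral {0..pi} (\<lambda>\<theta>. sin \<theta> powr (\<nu> + 1) * (1 / sin \<theta>))"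
    by blast
  also have "integral {0..pi} (\<lambda>\<theta>. sin \<theta> powr (\<nu> + 1) * (1 / sin \<theta>)) = sinint \<nu>"
    unfolding sinint_def by (rule integral_cong) (simp only: eq)
  finally show "integral {0..pi} (\<lambda>\<theta>. cos \<theta> * sin \<theta> powr \<nu> * lam \<theta>) = - (1 / (\<nu> + 1)) * sinint \<nu>"
    using assms by (simp add: field_simps)
  have "(\<lambda>\<theta>. sin \<theta> powr (\<nu> + 1) * 1) integrable_on {0..pi}"
    using integrable_continuous_real[OF continuous_sin_powr[of "\<nu> + 1"]] assms by simp
  from sin_power_parts[OF assms ph_deriv _ this] continuous_sin_powr_lamph[OF assms]
  show "integral {0..pi} (\<lambda>\<theta>. cos \<theta> * sin \<theta> powr \<nu> * ph \<theta>) = - (1 / (\<nu> + 1)) * sinint (\<nu> + 1)"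
    using assms by (simp add: field_simps sinint_def)
qed

lemma sin_cos_integrable:
  assumes "continuous_on {0..pi} (\<lambda>\<theta>. sin \<theta> powr \<nu> * f \<theta>)"
  shows "(\<lambda>\<theta>. cos \<theta> * sin \<theta> powr \<nu> * f \<theta>) integrable_on {0..pi}"
proof -
  have "continuous_on {0..pi} (\<lambda>\<theta>. cos \<theta> * (sin \<theta> powr \<nu> * f \<theta>))" by (intro continuous_intros assms)
  then show ?thesis by (intro integrable_continuous_real) (simp only: mult.assoc)
qed

lemma lamphint_rec:
  assumes "\<nu> > 0"
  shows "(\<nu> + 2) * lamphint (\<nu> + 2) = (\<nu> + 1) * lamphint \<nu> - (1 / (\<nu> + 1) + 1 / (\<nu> + 2)) * sinint (\<nu> + 1)"
proof -
  have d: "((\<lambda>\<theta>. lam \<theta> * ph \<theta>) has_real_derivative (1 / sin \<theta> * ph \<theta> + 1 * lam \<theta>)) (at \<theta>)" if "0 < \<theta>" "\<theta> < pi" for \<theta>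
    by (intro DERIV_mult lam_deriv ph_deriv that)
  have eq: "cos \<theta> * sin \<theta> powr (\<nu> + 1) * (1 / sin \<theta> * ph \<theta> + 1 * lam \<theta>) =
     cos \<theta> * sin \<theta> powr \<nu> * ph \<theta> + cos \<theta> * sin \<theta> powr (\<nu> + 1) * lam \<theta>" if "\<theta> \<in> {0..pi}" for \<theta>
    unfolding sin_powr_Suc[OF that] by (cases "sin \<theta> = 0") (auto simp: algebra_simps)
  have \<nu>1: "\<nu> + 1 > 0" using assms by simp
  have hi: "((\<lambda>\<theta>. cos \<theta> * sin \<theta> powr \<nu> * ph \<theta> + cos \<theta> * sin \<theta> powr (\<nu> + 1) * lam \<theta>) has_integral
     (- (1 / (\<nu> + 1)) * sinint (\<nu> + 1) + - (1 / (\<nu> + 1 + 1)) * sinint (\<nu> + 1))) {0..pi}"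
    unfolding integral_sin_parts(2)[OF assms, symmetric] integral_sin_parts(1)[OF \<nu>1, symmetric]
    by (intro has_integral_add integrable_integral sin_cos_integrable continuous_sin_powr_lamph assms \<nu>1)
  have hi2: "((\<lambda>\<theta>. cos \<theta> * sin \<theta> powr (\<nu> + 1) * (1 / sin \<theta> * ph \<theta> + 1 * lam \<theta>)) has_integral
     (- (1 / (\<nu> + 1)) * sinint (\<nu> + 1) + - (1 / (\<nu> + 1 + 1)) * sinint (\<nu> + 1))) {0..pi}"
    by (rule has_integral_eq[OF _ hi]) (simp only: eq)
  have "(\<nu> + 2) * lamphint (\<nu> + 2) = (\<nu> + 1) * lamphint \<nu> + (- (1 / (\<nu> + 1)) * sinint (\<nu> + 1) + - (1 / (\<nu> + 1 + 1)) * sinint (\<nu> + 1))"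
    unfolding lamphint_def
    by (subst sin_power_reduction[OF assms d continuous_sin_powr_lamph(1)[OF assms] has_integral_integrable[OF hi2]])
       (simp_all only: integral_unique[OF hi2])
  also have "\<nu> + 1 + 1 = \<nu> + 2" by simp
  finally show ?thesis by (simp add: left_diff_distrib distrib_right)
qed

lemma lam2int_rec:
  assumes "\<nu> > 0"
  shows "(\<nu> + 2) * lam2int (\<nu> + 2) = (\<nu> + 1) * lam2int \<nu> - 2 / (\<nu> + 1) * sinint \<nu>"
proof -
  have d: "((\<lambda>\<theta>. (lam \<theta>)^2) has_real_derivative (2 * lam \<theta> * (1 / sin \<theta>))) (at \<theta>)" if "0 < \<theta>" "\<theta> < pi" for \<theta>
    using DERIV_power[OF lam_deriv[OF that], of 2] by (simp add: mult_ac)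
  have eq: "cos \<theta> * sin \<theta> powr (\<nu> + 1) * (2 * lam \<theta> * (1 / sin \<theta>)) =
     2 * (cos \<theta> * sin \<theta> powr \<nu> * lam \<theta>)" if "\<theta> \<in> {0..pi}" for \<theta>
    using that by (cases "sin \<theta> = 0") (auto simp: sin_powr_Suc[of \<theta> \<nu>])
  have hi: "((\<lambda>\<theta>. 2 * (cos \<theta> * sin \<theta> powr \<nu> * lam \<theta>)) has_integral (2 * (- (1 / (\<nu> + 1)) * sinint \<nu>))) {0..pi}"
    unfolding integral_sin_parts(1)[OF assms, symmetric]
    by (intro has_integral_mult_right integrable_integral sin_cos_integrable continuous_sin_powr_lamph assms)
  have hi2: "((\<lambda>\<theta>. cos \<theta> * sin \<theta> powr (\<nu> + 1) * (2 * lam \<theta> * (1 / sin \<theta>))) has_integral (2 * (- (1 / (\<nu> + 1)) * sinint \<nu>))) {0..pi}"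
    by (rule has_integral_eq[OF _ hi]) (simp only: eq)
  have "(\<nu> + 2) * lam2int (\<nu> + 2) = (\<nu> + 1) * lam2int \<nu> + (2 * (- (1 / (\<nu> + 1)) * sinint \<nu>))"
    unfolding lam2int_def
    by (subst sin_power_reduction[OF assms d continuous_sin_powr_lamph(4)[OF assms] has_integral_integrable[OF hi2]])
       (simp_all only: integral_unique[OF hi2])
  then show ?thesis by simp
qed

lemma ph2int_rec:
  assumes "\<nu> > 0"
  shows "(\<nu> + 2) * ph2int (\<nu> + 2) = (\<nu> + 1) * ph2int \<nu> - 2 / (\<nu> + 2) * sinint (\<nu> + 2)"
proof -
  have d: "((\<lambda>\<theta>. (ph \<theta>)^2) has_real_derivative (2 * ph \<theta>)) (at \<theta>)" for \<theta>
    using DERIV_power[OF ph_deriv, of 2] by (simp add: mult_ac)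
  have \<nu>1: "\<nu> + 1 > 0" using assms by simp
  have hi: "((\<lambda>\<theta>. 2 * (cos \<theta> * sin \<theta> powr (\<nu> + 1) * ph \<theta>)) has_integral (2 * (- (1 / (\<nu> + 1 + 1)) * sinint (\<nu> + 1 + 1)))) {0..pi}"
    unfolding integral_sin_parts(2)[OF \<nu>1, symmetric]
    by (intro has_integral_mult_right integrable_integral sin_cos_integrable continuous_sin_powr_lamph \<nu>1)
  have hi2: "((\<lambda>\<theta>. cos \<theta> * sin \<theta> powr (\<nu> + 1) * (2 * ph \<theta>)) has_integral (2 * (- (1 / (\<nu> + 1 + 1)) * sinint (\<nu> + 1 + 1)))) {0..pi}"
    by (rule has_integral_eq[OF _ hi]) simp
  have "(\<nu> + 2) * ph2int (\<nu> + 2) = (\<nu> + 1) * ph2int \<nu> + (2 * (- (1 / (\<nu> + 1 + 1)) * sinint (\<nu> + 1 + 1)))"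
    unfolding ph2int_def
    by (subst sin_power_reduction[OF assms d continuous_sin_powr_lamph(5)[OF assms] has_integral_integrable[OF hi2]])
       (simp_all only: integral_unique[OF hi2])
  also have "\<nu> + 1 + 1 = \<nu> + 2" by simp
  finally show ?thesis by simp
qed

text \<open>The weight cancels the double pole: \<open>sin^(\<nu>+2) cot\<^sup>2 = sin^\<nu> cos\<^sup>2 = sin^\<nu> - sin^(\<nu>+2)\<close>, and the mean of this is
  \<open>1/(\<nu>+1)\<close> by the recurrence of the weights.\<close>
lemma cot_weight_bound:
  assumes \<nu>: "\<nu> > 0" and f: "\<And>\<theta>. 0 < \<theta> \<Longrightarrow> \<theta> < pi \<Longrightarrow> \<bar>f \<theta>\<bar> \<le> (cot \<theta>)^2"
    and C: "continuous_on {0..pi} (\<lambda>\<theta>. sin \<theta> powr (\<nu> + 2) * f \<theta>)"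
  shows "\<bar>integral {0..pi} (\<lambda>\<theta>. sin \<theta> powr (\<nu> + 2) * f \<theta>) / sinint (\<nu> + 2)\<bar> \<le> 1 / (\<nu> + 1)"
proof -
  have pos: "sinint (\<nu> + 2) > 0" using \<nu> by (intro sinint_pos) auto
  have c: "continuous_on {0..pi} (\<lambda>\<theta>. sin \<theta> powr \<nu>)" "continuous_on {0..pi} (\<lambda>\<theta>. sin \<theta> powr (\<nu> + 2))"
    using \<nu> by (auto intro: continuous_sin_powr)
  have "norm (integral {0..pi} (\<lambda>\<theta>. sin \<theta> powr (\<nu> + 2) * f \<theta>)) \<le> integral {0..pi} (\<lambda>\<theta>. sin \<theta> powr \<nu> - sin \<theta> powr (\<nu> + 2))"
  proof (rule integral_norm_bound_integral)
    show "(\<lambda>\<theta>. sin \<theta> powr (\<nu> + 2) * f \<theta>) integrable_on {0..pi}" by (rule integrable_continuous_real[OF C])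
    show "(\<lambda>\<theta>. sin \<theta> powr \<nu> - sin \<theta> powr (\<nu> + 2)) integrable_on {0..pi}" by (intro integrable_continuous_real continuous_intros c)
    fix \<theta> assume t: "\<theta> \<in> {0..pi}"
    show "norm (sin \<theta> powr (\<nu> + 2) * f \<theta>) \<le> sin \<theta> powr \<nu> - sin \<theta> powr (\<nu> + 2)"
    proof (cases "\<theta> = 0 \<or> \<theta> = pi")
      case False
      then have t': "0 < \<theta>" "\<theta> < pi" using t by auto
      then have s: "sin \<theta> > 0" by (auto intro: sin_gt_zero)
      have "norm (sin \<theta> powr (\<nu> + 2) * f \<theta>) \<le> sin \<theta> powr (\<nu> + 2) * (cot \<theta>)^2"
        using f[OF t'] by (simp add: abs_mult mult_left_mono)
      also have "\<dots> = sin \<theta> powr \<nu> * (cos \<theta>)^2"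
        using s by (simp add: sin_powr_2[OF t] cot_def power_divide)
      also have "\<dots> = sin \<theta> powr \<nu> - sin \<theta> powr (\<nu> + 2)"
        by (simp add: sin_powr_2[OF t] cos_squared_eq algebra_simps)
      finally show ?thesis .
    qed auto
  qed
  also have "\<dots> = sinint \<nu> - sinint (\<nu> + 2)"
    unfolding sinint_def by (intro integral_diff integrable_continuous_real c)
  also have "\<dots> = sinint (\<nu> + 2) / (\<nu> + 1)"
    using sinint_rec[OF \<nu>] \<nu> by (simp add: field_simps)
  finally show ?thesis using pos \<nu> by (simp add: divide_le_eq)
qed

text \<open>The decay of the remainder is what excludes an additive constant in the sum.\<close>
lemma telescope_sums:
  fixes R t :: "real \<Rightarrow> real"
  assumes \<nu>: "\<nu> > 0" and st: "\<And>x. x > 0 \<Longrightarrow> R x = R (x + 2) + t x" and lim: "\<And>x. x > 0 \<Longrightarrow> \<bar>R (x + 2)\<bar> \<le> 1 / (x + 1)"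
  shows "(\<lambda>k. t (\<nu> + 2 * real k)) sums R \<nu>"
proof -
  have "(\<lambda>k. R (\<nu> + 2 * real k)) \<longlonglongrightarrow> 0"
  proof (rule LIMSEQ_offset[where k = 1], rule Lim_null_comparison)
    show "eventually (\<lambda>k. norm (R (\<nu> + 2 * real (k + 1))) \<le> 1 / (\<nu> + 2 * real k + 1)) sequentially"
    proof (rule always_eventually, rule allI)
      fix k have "\<nu> + 2 * real k > 0" using \<nu> by (intro add_pos_nonneg) auto
      from lim[OF this] show "norm (R (\<nu> + 2 * real (k + 1))) \<le> 1 / (\<nu> + 2 * real k + 1)" by (simp add: algebra_simps)
    qed
    show "(\<lambda>k. 1 / (\<nu> + 2 * real k + 1)) \<longlonglongrightarrow> 0" by real_asymp
  qed
  then have "(\<lambda>k. R (\<nu> + 2 * real k) - R (\<nu> + 2 * real (Suc k))) sums (R (\<nu> + 2 * real 0) - 0)"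
    by (rule telescope_sums')
  moreover have "R (\<nu> + 2 * real k) - R (\<nu> + 2 * real (Suc k)) = t (\<nu> + 2 * real k)" for k
  proof -
    have "\<nu> + 2 * real k > 0" using \<nu> by (intro add_pos_nonneg) auto
    from st[OF this] show ?thesis by (simp add: algebra_simps)
  qed
  ultimately show ?thesis by simp
qed

lemma solve_linear: fixes r :: real assumes "X = r * A - D" "r \<noteq> 0" shows "A = (X + D) / r"
  using assms by (simp add: nonzero_eq_divide_eq)

lemma lamph_mean_sums:
  assumes "\<nu> > 0"
  shows "(\<lambda>k. (2 * (\<nu> + 2 * real k) + 3) / ((\<nu> + 2 * real k + 1) * (\<nu> + 2 * real k + 2)^2) *
       (sinint (\<nu> + 2 * real k + 1) / sinint (\<nu> + 2 * real k + 2))) sums (lamphint \<nu> / sinint \<nu>)"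
proof (rule telescope_sums[OF assms, where t = "\<lambda>x. (2 * x + 3) / ((x + 1) * (x + 2)^2) * (sinint (x + 1) / sinint (x + 2))"])
  fix x :: real assume x: "x > 0"
  have p: "sinint x > 0" "sinint (x + 2) > 0" using x by (auto intro: sinint_pos)
  have s: "sinint x = (x + 2) * sinint (x + 2) / (x + 1)" using sinint_rec[OF x] x by (simp add: field_simps)
  have l: "lamphint x = ((x + 2) * lamphint (x + 2) + (1 / (x + 1) + 1 / (x + 2)) * sinint (x + 1)) / (x + 1)"
    by (rule solve_linear[OF lamphint_rec[OF x]]) (use x in simp)
  have n: "x + 1 \<noteq> 0" "x + 2 \<noteq> 0" "sinint (x + 2) \<noteq> 0" using x p by auto
  have gen: "((q * L + (1 / r + 1 / q) * M) / r) / (q * S / r) = L / S + (r + q) / (r * q^2) * (M / S)"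
    if "r \<noteq> 0" "q \<noteq> 0" "S \<noteq> 0" for q r L M S :: real
    using that by (simp add: divide_simps power2_eq_square)
  show "lamphint x / sinint x = lamphint (x + 2) / sinint (x + 2) + (2 * x + 3) / ((x + 1) * (x + 2)^2) * (sinint (x + 1) / sinint (x + 2))"
    unfolding s l gen[OF n] by simp
  have "\<bar>lam \<theta> * ph \<theta>\<bar> \<le> (cot \<theta>)^2" if "0 < \<theta>" "\<theta> < pi" for \<theta>
  proof -
    have "\<bar>lam \<theta>\<bar> * \<bar>ph \<theta>\<bar> \<le> \<bar>cot \<theta>\<bar> * \<bar>cot \<theta>\<bar>" by (intro mult_mono lam_le_cot ph_le_cot that) auto
    then show ?thesis by (simp add: abs_mult power2_eq_square)
  qed
  then show "\<bar>lamphint (x + 2) / sinint (x + 2)\<bar> \<le> 1 / (x + 1)"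
    unfolding lamphint_def using x by (intro cot_weight_bound continuous_sin_powr_lamph) auto
qed

lemma lam2_mean_sums:
  assumes "\<nu> > 0"
  shows "(\<lambda>k. 2 / (\<nu> + 2 * real k + 1)^2) sums (lam2int \<nu> / sinint \<nu>)"
proof (rule telescope_sums[OF assms, where t = "\<lambda>x. 2 / (x + 1)^2"])
  fix x :: real assume x: "x > 0"
  have p: "sinint x > 0" "sinint (x + 2) > 0" using x by (auto intro: sinint_pos)
  have s: "sinint x = (x + 2) * sinint (x + 2) / (x + 1)" using sinint_rec[OF x] x by (simp add: field_simps)
  have l: "lam2int x = ((x + 2) * lam2int (x + 2) + 2 / (x + 1) * ((x + 2) * sinint (x + 2) / (x + 1))) / (x + 1)"
    unfolding s[symmetric] by (rule solve_linear[OF lam2int_rec[OF x]]) (use x in simp)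
  have n: "x + 1 \<noteq> 0" "x + 2 \<noteq> 0" "sinint (x + 2) \<noteq> 0" using x p by auto
  have gen: "((q * L + 2 / r * (q * S / r)) / r) / (q * S / r) = L / S + 2 / r^2"
    if "r \<noteq> 0" "q \<noteq> 0" "S \<noteq> 0" for q r L S :: real
  proof -
    have "q * L + 2 / r * (q * S / r) = q * (L + 2 * S / r^2)" by (simp add: power2_eq_square distrib_left)
    moreover have "(q * Y / r) / (q * S / r) = Y / S" for Y using that by simp
    moreover have "(L + 2 * S / r^2) / S = L / S + 2 / r^2" using that by (simp add: add_divide_distrib)
    ultimately show ?thesis by metis
  qed
  show "lam2int x / sinint x = lam2int (x + 2) / sinint (x + 2) + 2 / (x + 1)^2"
    unfolding s l gen[OF n] by simp
  have "\<bar>(lam \<theta>)^2\<bar> \<le> (cot \<theta>)^2" if "0 < \<theta>" "\<theta> < pi" for \<theta>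
    using lam_le_cot[OF that] by (simp add: abs_le_square_iff)
  then show "\<bar>lam2int (x + 2) / sinint (x + 2)\<bar> \<le> 1 / (x + 1)"
    unfolding lam2int_def using x by (intro cot_weight_bound continuous_sin_powr_lamph) auto
qed

lemma ph2_mean_sums:
  assumes "\<nu> > 0"
  shows "(\<lambda>k. 2 / (\<nu> + 2 * real k + 2)^2) sums (ph2int \<nu> / sinint \<nu>)"
proof (rule telescope_sums[OF assms, where t = "\<lambda>x. 2 / (x + 2)^2"])
  fix x :: real assume x: "x > 0"
  have p: "sinint x > 0" "sinint (x + 2) > 0" using x by (auto intro: sinint_pos)
  have s: "sinint x = (x + 2) * sinint (x + 2) / (x + 1)" using sinint_rec[OF x] x by (simp add: field_simps)
  have l: "ph2int x = ((x + 2) * ph2int (x + 2) + 2 / (x + 2) * sinint (x + 2)) / (x + 1)"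
    by (rule solve_linear[OF ph2int_rec[OF x]]) (use x in simp)
  have n: "x + 1 \<noteq> 0" "x + 2 \<noteq> 0" "sinint (x + 2) \<noteq> 0" using x p by auto
  have gen: "((q * L + 2 / q * S) / r) / (q * S / r) = L / S + 2 / q^2"
    if "r \<noteq> 0" "q \<noteq> 0" "S \<noteq> 0" for q r L S :: real
  proof -
    have "q * L + 2 / q * S = q * (L + 2 * S / q^2)" using that by (simp add: power2_eq_square distrib_left)
    moreover have "(q * Y / r) / (q * S / r) = Y / S" for Y using that by simp
    moreover have "(L + 2 * S / q^2) / S = L / S + 2 / q^2" using that by (simp add: add_divide_distrib)
    ultimately show ?thesis by metis
  qed
  show "ph2int x / sinint x = ph2int (x + 2) / sinint (x + 2) + 2 / (x + 2)^2"
    unfolding s l gen[OF n] by simp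
  have "\<bar>(ph \<theta>)^2\<bar> \<le> (cot \<theta>)^2" if "0 < \<theta>" "\<theta> < pi" for \<theta>
    using ph_le_cot[OF that] by (simp add: abs_le_square_iff)
  then show "\<bar>ph2int (x + 2) / sinint (x + 2)\<bar> \<le> 1 / (x + 1)"
    unfolding ph2int_def using x by (intro cot_weight_bound continuous_sin_powr_lamph) auto
qed

text \<open>From the Beta integral.\<close>
lemma sinint_Gamma:
  assumes "n > 1"
  shows "sinint n = sqrt pi * Gamma ((n + 1) / 2) / Gamma (n / 2 + 1)"
proof -
  define a where "a = (n + 1) / 2"
  have a: "a > 1" using assms by (simp add: a_def)
  have "((\<lambda>\<theta>. (sin \<theta> / 2) *\<^sub>R (((1 - cos \<theta>) / 2) powr (a - 1) * (1 - (1 - cos \<theta>) / 2) powr (a - 1))) has_integral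
      integral {(1 - cos 0) / 2..(1 - cos pi) / 2} (\<lambda>x. x powr (a - 1) * (1 - x) powr (a - 1))) {0..pi}"
  proof (rule has_integral_substitution[where c = 0 and d = 1])
    show "continuous_on {0..1} (\<lambda>x. x powr (a - 1) * (1 - x) powr (a - 1))"
      using a by (intro continuous_intros continuous_on_powr') auto
    show "(\<lambda>x. (1 - cos x) / 2) ` {0..pi} \<subseteq> {0..1}"
      using cos_ge_minus_one cos_le_one by (auto simp: field_simps) (smt (verit) cos_ge_minus_one)
  qed (auto intro!: derivative_eq_intros)
  also have "integral {(1 - cos 0) / 2..(1 - cos pi) / 2} (\<lambda>x. x powr (a - 1) * (1 - x) powr (a - 1)) = Beta a a"
    using has_integral_Beta_real[of a a] a by (simp add: has_integral_iff)
  finally have h: "((\<lambda>\<theta>. (sin \<theta> / 2) *\<^sub>R (((1 - cos \<theta>) / 2) powr (a - 1) * (1 - (1 - cos \<theta>) / 2) powr (a - 1))) has_integral Beta a a) {0..pi}" .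
  have eq: "(sin \<theta> / 2) *\<^sub>R (((1 - cos \<theta>) / 2) powr (a - 1) * (1 - (1 - cos \<theta>) / 2) powr (a - 1)) = 2 powr (- n) * sin \<theta> powr n"
    if t: "\<theta> \<in> {0..pi}" for \<theta>
  proof -
    have c: "cos \<theta> \<le> 1" "cos \<theta> \<ge> -1" by auto
    have "(1 - cos \<theta>) / 2 * (1 - (1 - cos \<theta>) / 2) = (sin \<theta> / 2)^2"
      by (simp add: sin_squared_eq power_divide) (simp add: power2_eq_square field_simps)
    then have "((1 - cos \<theta>) / 2) powr (a - 1) * (1 - (1 - cos \<theta>) / 2) powr (a - 1) = ((sin \<theta> / 2)^2) powr (a - 1)"
      using c by (subst powr_mult[symmetric]) auto
    also have "\<dots> = (sin \<theta> / 2) powr (n - 1)"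
      using sin_ge_zero[of \<theta>] t assms by (cases "sin \<theta> = 0") (auto simp: a_def powr_powr diff_divide_distrib simp flip: powr_numeral)
    finally have "(sin \<theta> / 2) *\<^sub>R (((1 - cos \<theta>) / 2) powr (a - 1) * (1 - (1 - cos \<theta>) / 2) powr (a - 1)) = (sin \<theta> / 2) powr (n - 1) * (sin \<theta> / 2)" by simp
    also have "\<dots> = (sin \<theta> / 2) powr n"
      using sin_ge_zero[of \<theta>] t by (cases "sin \<theta> = 0") (auto simp: powr_diff)
    finally show ?thesis using sin_ge_zero[of \<theta>] t by (simp add: powr_divide powr_minus_divide)
  qed
  have "((\<lambda>\<theta>. 2 powr (- n) * sin \<theta> powr n) has_integral Beta a a) {0..pi}"
    by (rule has_integral_eq[OF _ h]) (simp only: eq)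
  moreover have "((\<lambda>\<theta>. 2 powr (- n) * sin \<theta> powr n) has_integral (2 powr (- n) * sinint n)) {0..pi}"
    unfolding sinint_def using assms
    by (intro has_integral_mult_right integrable_integral integrable_continuous_real continuous_sin_powr) auto
  ultimately have "2 powr (- n) * sinint n = Beta a a" by (rule has_integral_unique[rotated])
  then have s: "sinint n = 2 powr n * (Gamma a * Gamma a / Gamma (2 * a))"
    by (simp add: powr_minus Beta_def field_simps)
  have g: "Gamma a > 0" "Gamma (a + 1/2) > 0" "Gamma (2 * a) > 0" using a by (auto intro: Gamma_real_pos)
  have e: "1 - 2 * a = - n" by (simp add: a_def field_simps)
  have d: "Gamma a * Gamma (a + 1/2) = 2 powr (- n) * sqrt pi * Gamma (2 * a)"
  proof -
    have "complex_of_real a \<notin> \<int>\<^sub>\<le>\<^sub>0" "complex_of_real a + 1/2 \<notin> \<int>\<^sub>\<le>\<^sub>0"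
      using a by (auto elim!: nonpos_Ints_cases simp: complex_eq_iff)
    from Gamma_legendre_duplication[OF this]
    have "Gamma (of_real a) * Gamma (of_real (a + 1/2)) = exp (of_real ((1 - 2 * a) * ln 2)) * of_real (sqrt pi) * Gamma (complex_of_real (2 * a))" by simp
    then have "complex_of_real (Gamma a * Gamma (a + 1/2)) = of_real (exp ((1 - 2 * a) * ln 2) * sqrt pi * Gamma (2 * a))"
      unfolding Gamma_complex_of_real exp_of_real by (simp only: of_real_mult)
    then have "Gamma a * Gamma (a + 1/2) = exp ((1 - 2 * a) * ln 2) * sqrt pi * Gamma (2 * a)"
      by (simp only: of_real_eq_iff)
    then show ?thesis unfolding e by (simp add: powr_def)
  qed
  have gen: "P * (A * A / C) = q * A / B" if "A * B = inverse P * q * C" "P > 0" "A > 0" "B > 0" "C > 0" for P A B C q :: real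
    using that by (simp add: field_simps)
  have "sinint n = sqrt pi * Gamma a / Gamma (a + 1/2)"
    unfolding s by (rule gen) (use g d in \<open>auto simp: powr_minus\<close>)
  also have "a + 1/2 = n / 2 + 1" by (simp add: a_def field_simps)
  finally show ?thesis by (simp add: a_def)
qed

lemma sinint_ratio:
  assumes "m > 2"
  shows "sinint (m - 1) / sinint m = m / 2 * (Gamma (m / 2) / Gamma ((m + 1) / 2))^2"
proof -
  have "Gamma (m/2 + 1) = m/2 * Gamma (m/2)" using assms by (intro Gamma_plus1) (auto simp: nonpos_Ints_def)
  moreover have "Gamma (m/2) > 0" "Gamma ((m+1)/2) > 0" using assms by (auto intro: Gamma_real_pos)
  moreover have "(m - 1) / 2 + 1 = (m + 1) / 2" by (simp add: field_simps)
  moreover have "(q * A / B) / (q * B / (m / 2 * A)) = m / 2 * (A / B)^2" if "A > 0" "B > 0" "q > 0" for A B q :: real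
    using that assms by (simp add: field_simps power2_eq_square)
  moreover have "sqrt pi > 0" by simp
  ultimately show ?thesis using assms sinint_Gamma[of m] sinint_Gamma[of "m - 1"]
    by (metis (no_types, lifting) add.commute add_diff_cancel_right' diff_add_cancel less_diff_eq one_add_one order_less_trans less_add_one)
qed

section \<open>The value at -1 as a circle integral\<close>

lemma norm_powr_le: fixes x y :: complex
  shows "norm (x powr y) \<le> norm x powr Re y * exp (pi * \<bar>Im y\<bar>)"
proof -
  have "\<bar>Arg x\<bar> \<le> pi" using mpi_less_Arg[of x] Arg_le_pi[of x] by linarith
  then have "\<bar>Im y * Arg x\<bar> \<le> pi * \<bar>Im y\<bar>" by (simp add: abs_mult mult.commute mult_right_mono)
  then have "- Im y * Arg x \<le> pi * \<bar>Im y\<bar>" by linarith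
  then show ?thesis unfolding norm_powr_complex by (intro mult_left_mono) auto
qed

lemma powr_polar: fixes x t :: real
  assumes "x \<ge> 0" "- pi < t" "t \<le> pi"
  shows "(of_real x * cis t) powr p = of_real x powr p * exp (\<i> * of_real t * p)"
proof (cases "x = 0")
  case False
  then have "(of_real x * cis t) powr p = of_real x powr p * cis t powr p"
    using assms by (intro powr_times_real_left) auto
  also have "cis t powr p = exp (\<i> * of_real t * p)"
  proof -
    have "ln (cis t) = \<i> * of_real t" using assms by (simp add: cis_conv_exp Ln_exp)
    then show ?thesis by (simp add: powr_def mult_ac)
  qed
  finally show ?thesis .
qed simp

lemma continuous_on_powr_right_half:
  assumes "Re p > 0" shows "continuous_on {z::complex. Re z \<ge> 0} (\<lambda>z. z powr p)"
  by (rule continuous_on_powr_complex) (use assms in \<open>auto intro!: continuous_intros\<close>)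

lemma integral_suminf:
  fixes f :: "nat \<Rightarrow> real \<Rightarrow> complex"
  assumes c: "\<And>n. f n integrable_on {a..b}" and M: "\<And>n t. t \<in> {a..b} \<Longrightarrow> norm (f n t) \<le> M n" and s: "summable M"
  shows "(\<lambda>n. integral {a..b} (f n)) sums integral {a..b} (\<lambda>t. \<Sum>n. f n t)"
    and "(\<lambda>t. \<Sum>n. f n t) integrable_on {a..b}"
proof -
  note dc = dominated_convergence[of "\<lambda>k t. \<Sum>n<k. f n t" "{a..b}" "\<lambda>_. suminf M" "\<lambda>t. \<Sum>n. f n t"]
  have 1: "(\<lambda>t. \<Sum>n<k. f n t) integrable_on {a..b}" for k by (intro integrable_sum c) auto
  have 2: "norm (\<Sum>n<k. f n t) \<le> suminf M" if "t \<in> {a..b}" for k t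
  proof -
    have "norm (\<Sum>n<k. f n t) \<le> (\<Sum>n<k. M n)" by (rule sum_norm_le) (use M that in auto)
    also have "\<dots> \<le> suminf M" using M[OF that] norm_ge_zero order_trans
      by (intro sum_le_suminf s) blast+
    finally show ?thesis .
  qed
  have 3: "(\<lambda>k. \<Sum>n<k. f n t) \<longlonglongrightarrow> (\<Sum>n. f n t)" if "t \<in> {a..b}" for t
    using summable_comparison_test'[OF s, of 0 "\<lambda>n. f n t"] M[OF that] by (intro summable_LIMSEQ) auto
  note dc' = dc[OF 1 integrable_const_ivl 2 3]
  show "(\<lambda>t. \<Sum>n. f n t) integrable_on {a..b}" by (rule dc'(1))
  have "integral {a..b} (\<lambda>t. \<Sum>n<k. f n t) = (\<Sum>n<k. integral {a..b} (f n))" for k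
    by (rule integral_sum) (use c in auto)
  with dc'(2) show "(\<lambda>n. integral {a..b} (f n)) sums integral {a..b} (\<lambda>t. \<Sum>n. f n t)"
    by (simp add: sums_def)
qed

lemma integral_cis_int:
  "integral {0..2 * pi} (\<lambda>\<theta>. cis (of_int k * \<theta>)) = (if k = 0 then of_real (2 * pi) else 0)"
proof (cases "k = 0")
  case False
  define F where "F = (\<lambda>\<theta>. cis (of_int k * \<theta>) / (\<i> * of_int k))"
  have "((\<lambda>\<theta>. cis (of_int k * \<theta>)) has_integral (F (2 * pi) - F 0)) {0..2 * pi}"
  proof (rule fundamental_theorem_of_calculus)
    fix x :: real
    have "((\<lambda>z. exp (\<i> * (of_int k * z))) has_field_derivative exp (\<i> * (of_int k * of_real x)) * (\<i> * of_int k)) (at (of_real x))"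
      by (auto intro!: derivative_eq_intros)
    from DERIV_cdivide[OF this, of "\<i> * of_int k"]
    have "((\<lambda>z. exp (\<i> * (of_int k * z)) / (\<i> * of_int k)) has_field_derivative exp (\<i> * (of_int k * of_real x))) (at (of_real x))"
      using False by simp
    then have "((\<lambda>x. exp (\<i> * (of_int k * of_real x)) / (\<i> * of_int k)) has_vector_derivative exp (\<i> * (of_int k * of_real x))) (at x)"
      by (rule has_vector_derivative_real_field)
    then show "(F has_vector_derivative cis (of_int k * x)) (at x within {0..2 * pi})"
      using has_vector_derivative_at_within by (fastforce simp: F_def cis_conv_exp)
  qed simp
  moreover have "cis (of_int k * (2 * pi)) = 1"
    using cis_multiple_2pi[of "of_int k"] by (simp add: mult_ac)
  ultimately show ?thesis using False by (simp add: F_def has_integral_iff)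
qed (simp add: scaleR_conv_of_real)

lemma norm_one_plus_powr_sums:
  fixes x p :: complex assumes "norm x < 1"
  shows "(\<lambda>n. (p gchoose n) * x ^ n) sums (1 + x) powr p" "summable (\<lambda>n. norm (p gchoose n) * norm x ^ n)"
proof -
  show "(\<lambda>n. (p gchoose n) * x ^ n) sums (1 + x) powr p" by (rule gen_binomial_complex[OF assms])
  obtain y where y: "norm x < y" "y < 1" using assms dense by blast
  then have y0: "y > 0" using norm_ge_zero[of x] by linarith
  have "summable (\<lambda>n. (p gchoose n) * (of_real y :: complex) ^ n)"
    by (rule sums_summable, rule gen_binomial_complex) (use y y0 in simp)
  then have "summable (\<lambda>n. norm ((p gchoose n) * x ^ n))" by (rule powser_insidea) (use y y0 in simp)
  then show "summable (\<lambda>n. norm (p gchoose n) * norm x ^ n)" by (simp add: norm_mult norm_power)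
qed

text \<open>Parseval: only the products of equal powers of \<open>e^(i\<theta>)\<close> and \<open>e^(-i\<theta>)\<close> survive the
  integration, and they form the hypergeometric series at \<open>-r\<^sup>2\<close>.\<close>
lemma circle_mean_product:
  fixes p q :: complex and r :: real
  assumes r: "0 \<le> r" "r < 1"
  shows "integral {0..2 * pi} (\<lambda>\<theta>. (1 - of_real r * cis \<theta>) powr p * (1 + of_real r * cis (- \<theta>)) powr q) =
     of_real (2 * pi) * eval_fps (fps_hypergeo [- p, - q] [1] 1) (- ((of_real r)^2))"
proof -
  define g where "g \<theta> = (1 - of_real r * cis \<theta>) powr p" for \<theta>
  have nr: "norm (- (of_real r * cis \<theta>)) < 1" "norm (of_real r * cis (- \<theta>)) < 1" for \<theta> using r by (auto simp: norm_mult)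
  have gs: "(\<lambda>n. (p gchoose n) * (- (of_real r * cis \<theta>)) ^ n) sums g \<theta>" for \<theta>
    using norm_one_plus_powr_sums(1)[OF nr(1)] by (simp add: g_def)
  have pos: "Re (1 - of_real r * cis \<theta>) > 0" for \<theta>
    using complex_Re_le_cmod[of "of_real r * cis \<theta>"] nr(1)[of \<theta>] by (simp add: norm_mult)
  have gc: "continuous_on {0..2*pi} g" unfolding g_def
  proof (rule continuous_on_powr_complex)
    show "{0..2*pi} \<subseteq> {\<theta>. 0 \<le> Re (1 - of_real r * cis \<theta>) \<or> Im (1 - of_real r * cis \<theta>) \<noteq> 0}"
      using pos less_imp_le by blast
    show "0 < Re p" if "1 - of_real r * cis \<theta> = 0" for \<theta>
      using pos[of \<theta>] unfolding that by simp
  qed (intro continuous_intros)+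
  define M1 where "M1 = (\<Sum>n. norm (p gchoose n) * r ^ n)"
  have gM: "norm (g \<theta>) \<le> M1" for \<theta>
  proof -
    have s: "summable (\<lambda>n. norm (p gchoose n) * r ^ n)" using norm_one_plus_powr_sums(2)[of "of_real r"] r by simp
    have "norm (\<Sum>n. (p gchoose n) * (- (of_real r * cis \<theta>)) ^ n) \<le> M1"
      unfolding M1_def by (rule norm_suminf_le[OF _ s]) (use r in \<open>simp add: norm_mult norm_power\<close>)
    then show ?thesis using gs[of \<theta>] by (simp add: sums_iff)
  qed
  have coef: "integral {0..2*pi} (\<lambda>\<theta>. g \<theta> * cis (- real m * \<theta>)) = of_real (2 * pi) * ((p gchoose m) * (-1)^m * of_real r ^ m)" for m
  proof -
    define f where "f n \<theta> = (p gchoose n) * (-1)^n * of_real r ^ n * cis (of_int (int n - int m) * \<theta>)" for n \<theta>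
    have f: "(p gchoose n) * (- (of_real r * cis \<theta>)) ^ n * cis (- real m * \<theta>) = f n \<theta>" for n \<theta>
    proof -
      have "(- (of_real r * cis \<theta>)) ^ n = (-1)^n * of_real r ^ n * cis (real n * \<theta>)"
        unfolding power_minus[of "of_real r * cis \<theta>"] power_mult_distrib Complex.DeMoivre by (simp only: mult.assoc)
      moreover have "cis (real n * \<theta>) * cis (- real m * \<theta>) = cis (of_int (int n - int m) * \<theta>)"
        unfolding cis_mult by (rule arg_cong[where f = cis]) (simp add: left_diff_distrib)
      ultimately show ?thesis unfolding f_def by (simp only: mult.assoc)
    qed
    have s: "summable (\<lambda>n. norm (p gchoose n) * r ^ n)" using norm_one_plus_powr_sums(2)[of "of_real r"] r by simp
    have "(\<lambda>n. integral {0..2*pi} (f n)) sums integral {0..2*pi} (\<lambda>\<theta>. \<Sum>n. f n \<theta>)"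
    proof (rule integral_suminf(1)[OF _ _ s])
      show "f n integrable_on {0..2*pi}" for n unfolding f_def
        by (intro integrable_continuous_real continuous_intros)
      show "norm (f n t) \<le> norm (p gchoose n) * r ^ n" for n t
        using r by (simp add: f_def norm_mult norm_power)
    qed
    moreover have "(\<Sum>n. f n \<theta>) = g \<theta> * cis (- real m * \<theta>)" for \<theta>
      using sums_mult2[OF gs[of \<theta>], of "cis (- real m * \<theta>)"] unfolding f by (simp add: sums_iff)
    moreover have "integral {0..2*pi} (f n) = (if n = m then of_real (2 * pi) * ((p gchoose m) * (-1)^m * of_real r ^ m) else 0)" for n
      unfolding f_def by (simp only: integral_mult_right integral_cis_int) auto
    ultimately have "(\<lambda>n. if n = m then of_real (2 * pi) * ((p gchoose m) * (-1)^m * of_real r ^ m) else 0) sums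
       integral {0..2*pi} (\<lambda>\<theta>. g \<theta> * cis (- real m * \<theta>))" by simp
    moreover have "(\<lambda>n. if n = m then of_real (2 * pi) * ((p gchoose m) * (-1)^m * of_real r ^ m) else 0) sums
       (of_real (2 * pi) * ((p gchoose m) * (-1)^m * of_real r ^ m))" using sums_single[of m "\<lambda>_. of_real (2 * pi) * ((p gchoose m) * (-1)^m * of_real r ^ m)"] by simp
    ultimately show ?thesis by (rule sums_unique2)
  qed
  define f where "f m \<theta> = (q gchoose m) * of_real r ^ m * (g \<theta> * cis (- real m * \<theta>))" for m \<theta>
  have f: "g \<theta> * ((q gchoose m) * (of_real r * cis (- \<theta>)) ^ m) = f m \<theta>" for m \<theta>
    unfolding f_def power_mult_distrib Complex.DeMoivre by (simp add: mult_ac)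
  have s: "summable (\<lambda>n. norm (q gchoose n) * r ^ n * M1)"
    using norm_one_plus_powr_sums(2)[of "of_real r" q] r by (intro summable_mult2) simp
  have "(\<lambda>n. integral {0..2*pi} (f n)) sums integral {0..2*pi} (\<lambda>\<theta>. \<Sum>n. f n \<theta>)"
  proof (rule integral_suminf(1)[OF _ _ s])
    show "f n integrable_on {0..2*pi}" for n unfolding f_def
      by (intro integrable_continuous_real continuous_intros gc)
    show "norm (f n t) \<le> norm (q gchoose n) * r ^ n * M1" for n t
      using r gM[of t] by (simp add: f_def norm_mult norm_power mult_left_mono)
  qed
  moreover have "(\<Sum>n. f n \<theta>) = (1 - of_real r * cis \<theta>) powr p * (1 + of_real r * cis (- \<theta>)) powr q" for \<theta>
    using sums_mult[OF norm_one_plus_powr_sums(1)[OF nr(2)[of \<theta>], of q], of "g \<theta>"] unfolding f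
    by (simp add: sums_iff g_def)
  moreover have "integral {0..2*pi} (f m) = of_real (2 * pi) * (fps_hypergeo [- p, - q] [1] 1 $ m * (- ((of_real r)^2)) ^ m)" for m
  proof -
    have "integral {0..2*pi} (f m) = (q gchoose m) * of_real r ^ m * (of_real (2 * pi) * ((p gchoose m) * (-1)^m * of_real r ^ m))"
      unfolding f_def by (simp only: integral_mult_right coef)
    also have "(p gchoose m) * (-1)^m = pochhammer (- p) m / fact m"
      by (simp add: gbinomial_pochhammer)
    also have "(q gchoose m) = (-1)^m * pochhammer (- q) m / fact m" by (simp add: gbinomial_pochhammer)
    also have "(-1)^m * pochhammer (- q) m / fact m * of_real r ^ m * (of_real (2 * pi) * (pochhammer (- p) m / fact m * of_real r ^ m))
       = of_real (2 * pi) * (pochhammer (- p) m * pochhammer (- q) m / (fact m * fact m) * ((-1)^m * (of_real r ^ m * of_real r ^ m)))"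
      by (simp add: mult_ac)
    also have "(-1)^m * (of_real r ^ m * of_real r ^ m) = (- ((of_real r)^2) :: complex) ^ m"
      by (subst power_minus) (simp add: power2_eq_square power_mult_distrib)
    finally show ?thesis by (simp flip: pochhammer_fact)
  qed
  ultimately have sm: "(\<lambda>m. of_real (2 * pi) * (fps_hypergeo [- p, - q] [1] 1 $ m * (- ((of_real r)^2)) ^ m)) sums
     integral {0..2 * pi} (\<lambda>\<theta>. (1 - of_real r * cis \<theta>) powr p * (1 + of_real r * cis (- \<theta>)) powr q)" by simp
  from sm have "integral {0..2 * pi} (\<lambda>\<theta>. (1 - of_real r * cis \<theta>) powr p * (1 + of_real r * cis (- \<theta>)) powr q) =
     (\<Sum>m. of_real (2 * pi) * (fps_hypergeo [- p, - q] [1] 1 $ m * (- ((of_real r)^2)) ^ m))" by (simp only: sums_iff)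
  also have "\<dots> = of_real (2 * pi) * eval_fps (fps_hypergeo [- p, - q] [1] 1) (- ((of_real r)^2))"
    unfolding eval_fps_def
  proof (rule suminf_mult)
    show "summable (\<lambda>m. fps_hypergeo [- p, - q] [1] 1 $ m * (- ((of_real r)^2) :: complex) ^ m)"
      using sums_summable[OF sm] by (simp only: summable_cmult_iff) simp
  qed
  finally show ?thesis .
qed

lemma one_nonpos: "(1::complex) \<notin> \<int>\<^sub>\<le>\<^sub>0" by simp
lemma minus_one_slit: "-1 \<in> slit_plane" by (auto simp: slit_plane_iff complex_nonpos_Reals_iff)

lemma norm_powr_le_2:
  assumes "norm x \<le> 2" "Re p > 0" shows "norm ((x::complex) powr p) \<le> 2 powr Re p * exp (pi * \<bar>Im p\<bar>)"
proof -
  have "norm (x powr p) \<le> norm x powr Re p * exp (pi * \<bar>Im p\<bar>)" by (rule norm_powr_le)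
  also have "\<dots> \<le> 2 powr Re p * exp (pi * \<bar>Im p\<bar>)" using assms by (intro mult_right_mono powr_mono2) auto
  finally show ?thesis .
qed

lemma norm_one_cis_le: assumes "0 \<le> r" "r \<le> 1"
  shows "norm (1 - of_real r * cis \<theta>) \<le> 2" "norm (1 + of_real r * cis \<theta>) \<le> 2"
    "Re (1 - of_real r * cis \<theta>) \<ge> 0" "Re (1 + of_real r * cis \<theta>) \<ge> 0"
proof -
  have n: "norm (of_real r * cis \<theta>) \<le> 1" using assms by (simp add: norm_mult)
  show "norm (1 - of_real r * cis \<theta>) \<le> 2" "norm (1 + of_real r * cis \<theta>) \<le> 2"
    using norm_triangle_ineq4[of 1 "of_real r * cis \<theta>"] norm_triangle_ineq[of 1 "of_real r * cis \<theta>"] n by simp_all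
  show "Re (1 - of_real r * cis \<theta>) \<ge> 0" "Re (1 + of_real r * cis \<theta>) \<ge> 0"
    using abs_Re_le_cmod[of "of_real r * cis \<theta>"] n by simp_all
qed

text \<open>Limit \<open>r \<rightarrow> 1\<close> of the previous identity; positivity of the real parts keeps the integrand bounded.\<close>
lemma hyp2F1_minus_one_circle:
  assumes "Re p > 0" "Re q > 0"
  shows "of_real (2 * pi) * hyp2F1 (- p) (- q) 1 (-1) =
     integral {0..2 * pi} (\<lambda>\<theta>. (1 - cis \<theta>) powr p * (1 + cis (- \<theta>)) powr q)"
proof -
  define r where "r k = 1 - 1 / (real k + 2)" for k :: nat
  have r: "0 \<le> r k" "r k < 1" for k by (auto simp: r_def field_simps)
  have rl: "r \<longlonglongrightarrow> 1" unfolding r_def by real_asymp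
  define f where "f k \<theta> = (1 - of_real (r k) * cis \<theta>) powr p * (1 + of_real (r k) * cis (- \<theta>)) powr q" for k \<theta>
  define M where "M = (2 powr Re p * exp (pi * \<bar>Im p\<bar>)) * (2 powr Re q * exp (pi * \<bar>Im q\<bar>))"
  have rle: "r k \<le> 1" for k using r(2)[of k] by simp
  have H: "1 - of_real (r k) * cis \<theta> \<in> {z. Re z \<ge> 0}" "1 + of_real (r k) * cis \<theta> \<in> {z. Re z \<ge> 0}" for k \<theta>
    using norm_one_cis_le(3,4)[OF r(1) rle, of k \<theta>] by simp_all
  have H1: "1 - cis \<theta> \<in> {z. Re z \<ge> 0}" "1 + cis \<theta> \<in> {z. Re z \<ge> 0}" for \<theta>
    using norm_one_cis_le(3,4)[of 1 \<theta>] by simp_all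
  have c: "continuous_on {0..2*pi} (f k)" for k unfolding f_def
  proof (rule continuous_on_mult)
    show "continuous_on {0..2*pi} (\<lambda>\<theta>. (1 - of_real (r k) * cis \<theta>) powr p)"
    proof (rule continuous_on_compose2[OF continuous_on_powr_right_half[OF assms(1)]])
      show "continuous_on {0..2*pi} (\<lambda>\<theta>. 1 - of_real (r k) * cis \<theta>)" by (intro continuous_intros)
      show "(\<lambda>\<theta>. 1 - of_real (r k) * cis \<theta>) ` {0..2*pi} \<subseteq> {z. Re z \<ge> 0}" using H by blast
    qed
    show "continuous_on {0..2*pi} (\<lambda>\<theta>. (1 + of_real (r k) * cis (- \<theta>)) powr q)"
    proof (rule continuous_on_compose2[OF continuous_on_powr_right_half[OF assms(2)]])
      show "continuous_on {0..2*pi} (\<lambda>\<theta>. 1 + of_real (r k) * cis (- \<theta>))" by (intro continuous_intros)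
      show "(\<lambda>\<theta>. 1 + of_real (r k) * cis (- \<theta>)) ` {0..2*pi} \<subseteq> {z. Re z \<ge> 0}" using H by blast
    qed
  qed
  have lim: "(\<lambda>k. f k \<theta>) \<longlonglongrightarrow> (1 - cis \<theta>) powr p * (1 + cis (- \<theta>)) powr q" for \<theta>
  proof -
    have 1: "(\<lambda>k. (1 - of_real (r k) * cis \<theta>) powr p) \<longlonglongrightarrow> (1 - cis \<theta>) powr p"
    proof (rule continuous_on_tendsto_compose[OF continuous_on_powr_right_half[OF assms(1)]])
      have "(\<lambda>k. 1 - of_real (r k) * cis \<theta>) \<longlonglongrightarrow> 1 - of_real 1 * cis \<theta>" by (intro tendsto_intros rl)
      then show "(\<lambda>k. 1 - of_real (r k) * cis \<theta>) \<longlonglongrightarrow> 1 - cis \<theta>" by simp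
      show "1 - cis \<theta> \<in> {z. 0 \<le> Re z}" by (rule H1)
      show "\<forall>\<^sub>F k in sequentially. 1 - of_real (r k) * cis \<theta> \<in> {z. 0 \<le> Re z}" by (intro always_eventually allI H)
    qed
    have 2: "(\<lambda>k. (1 + of_real (r k) * cis (- \<theta>)) powr q) \<longlonglongrightarrow> (1 + cis (- \<theta>)) powr q"
    proof (rule continuous_on_tendsto_compose[OF continuous_on_powr_right_half[OF assms(2)]])
      have "(\<lambda>k. 1 + of_real (r k) * cis (- \<theta>)) \<longlonglongrightarrow> 1 + of_real 1 * cis (- \<theta>)" by (intro tendsto_intros rl)
      then show "(\<lambda>k. 1 + of_real (r k) * cis (- \<theta>)) \<longlonglongrightarrow> 1 + cis (- \<theta>)" by simp
      show "1 + cis (- \<theta>) \<in> {z. 0 \<le> Re z}" by (rule H1)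
      show "\<forall>\<^sub>F k in sequentially. 1 + of_real (r k) * cis (- \<theta>) \<in> {z. 0 \<le> Re z}" by (intro always_eventually allI H)
    qed
    show ?thesis unfolding f_def by (intro tendsto_mult 1 2)
  qed
  have "(\<lambda>k. integral {0..2*pi} (f k)) \<longlonglongrightarrow> integral {0..2*pi} (\<lambda>\<theta>. (1 - cis \<theta>) powr p * (1 + cis (- \<theta>)) powr q)"
  proof (rule dominated_convergence(2)[where h = "\<lambda>_. M"])
    show "f k integrable_on {0..2*pi}" for k by (rule integrable_continuous_real[OF c])
    show "norm (f k t) \<le> M" for k t
    proof -
      have 1: "norm ((1 - of_real (r k) * cis t) powr p) \<le> 2 powr Re p * exp (pi * \<bar>Im p\<bar>)"
        by (rule norm_powr_le_2[OF norm_one_cis_le(1)[OF r(1) rle] assms(1)])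
      have 2: "norm ((1 + of_real (r k) * cis (- t)) powr q) \<le> 2 powr Re q * exp (pi * \<bar>Im q\<bar>)"
        by (rule norm_powr_le_2[OF norm_one_cis_le(2)[OF r(1) rle] assms(2)])
      show ?thesis unfolding f_def M_def norm_mult[of "_ powr p"]
        by (rule mult_mono[OF 1 2]) (simp_all del: norm_powr_real_powr)
    qed
  qed (rule integrable_const_ivl, rule lim)
  moreover have eq: "integral {0..2*pi} (f k) = of_real (2 * pi) * hyp2F1 (- p) (- q) 1 (- ((of_real (r k))^2))" for k
  proof -
    have "(r k)^2 < 1" using r[of k] power_strict_mono[of "r k" 1 2] by simp
    then have "- ((of_real (r k))^2) \<in> ball (0::complex) 1" by (simp add: norm_power)
    from hyp2F1_ball[OF one_nonpos this, of "- p" "- q"] show ?thesis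
      unfolding f_def circle_mean_product[OF r] by (simp only:)
  qed
  moreover have L2: "(\<lambda>k. of_real (2 * pi) * hyp2F1 (- p) (- q) 1 (- ((of_real (r k))^2))) \<longlonglongrightarrow> of_real (2 * pi) * hyp2F1 (- p) (- q) 1 (-1)"
  proof (intro tendsto_intros)
    have "isCont (hyp2F1 (- p) (- q) 1) (-1)"
      using hyp2F1_holomorphic[OF one_nonpos] open_slit_plane minus_one_slit
      by (meson continuous_on_eq_continuous_at holomorphic_on_imp_continuous_on)
    moreover have "(\<lambda>k. - ((of_real (r k))^2) :: complex) \<longlonglongrightarrow> - ((of_real 1)^2)" by (intro tendsto_intros rl)
    ultimately show "(\<lambda>k. hyp2F1 (- p) (- q) 1 (- ((of_real (r k))^2))) \<longlonglongrightarrow> hyp2F1 (- p) (- q) 1 (-1)"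
      by (intro isCont_tendsto_compose[where g = "hyp2F1 (- p) (- q) 1"]) auto
  qed
  ultimately show ?thesis unfolding eq using LIMSEQ_unique[OF L2] by blast
qed

section \<open>Folding the circle\<close>

text \<open>Both arcs of the circle contribute integrals of this shape, since \<open>1 + e^(i\<theta>)\<close> and \<open>1 - e^(i\<theta>)\<close> have moduli
  \<open>2 cos (\<theta>/2)\<close>, \<open>2 sin (\<theta>/2)\<close> and arguments linear in \<open>\<theta>\<close>.\<close>
definition Vint :: "complex \<Rightarrow> complex \<Rightarrow> complex \<Rightarrow> complex" where
  "Vint \<tau> p q = integral {0..pi} (\<lambda>\<theta>. of_real (2 * cos (\<theta>/2)) powr q * of_real (2 * sin (\<theta>/2)) powr p * exp (\<tau> * of_real \<theta>))"

lemma continuous_Vint_integrand: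
  assumes "Re p > 0" "Re q > 0"
  shows "continuous_on {0..pi} (\<lambda>\<theta>. of_real (2 * cos (\<theta>/2)) powr q * of_real (2 * sin (\<theta>/2)) powr p * exp (\<tau> * of_real \<theta>))"
proof -
  have c: "cos (\<theta>/2) \<ge> 0" "sin (\<theta>/2) \<ge> 0" if "\<theta> \<in> {0..pi}" for \<theta>
    using that by (auto intro!: cos_ge_zero sin_ge_zero)
  have 1: "continuous_on {0..pi} (\<lambda>\<theta>. of_real (2 * cos (\<theta>/2)) powr q)"
  proof (rule continuous_on_compose2[OF continuous_on_powr_right_half[OF assms(2)]])
    show "continuous_on {0..pi} (\<lambda>\<theta>. complex_of_real (2 * cos (\<theta>/2)))" by (intro continuous_intros) auto
    show "(\<lambda>\<theta>. complex_of_real (2 * cos (\<theta>/2))) ` {0..pi} \<subseteq> {z. 0 \<le> Re z}" using c by fastforce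
  qed
  have 2: "continuous_on {0..pi} (\<lambda>\<theta>. of_real (2 * sin (\<theta>/2)) powr p)"
  proof (rule continuous_on_compose2[OF continuous_on_powr_right_half[OF assms(1)]])
    show "continuous_on {0..pi} (\<lambda>\<theta>. complex_of_real (2 * sin (\<theta>/2)))" by (intro continuous_intros) auto
    show "(\<lambda>\<theta>. complex_of_real (2 * sin (\<theta>/2))) ` {0..pi} \<subseteq> {z. 0 \<le> Re z}" using c by fastforce
  qed
  show ?thesis by (intro continuous_on_mult 1 2 continuous_intros)
qed

lemma integral_fold:
  fixes f :: "real \<Rightarrow> complex"
  assumes "f integrable_on {0..pi}" "(\<lambda>\<theta>. f (2 * pi - \<theta>)) integrable_on {0..pi}"
  shows "integral {0..2 * pi} f = integral {0..pi} f + integral {0..pi} (\<lambda>\<theta>. f (2 * pi - \<theta>))"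
proof -
  have "((\<lambda>\<theta>. f (2 * pi - \<theta>)) has_integral integral {0..pi} (\<lambda>\<theta>. f (2 * pi - \<theta>))) (cbox 0 pi)"
    using assms(2) by (simp add: integrable_integral)
  from has_integral_affinity[OF this, of "-1" "2 * pi"]
  have "((\<lambda>x. f (2 * pi - (- x + 2 * pi))) has_integral integral {0..pi} (\<lambda>\<theta>. f (2 * pi - \<theta>))) ((\<lambda>x. - x + 2 * pi) ` {0..pi})"
    by simp
  moreover have "(\<lambda>x. - x + 2 * pi) ` {0..pi} = {pi..2 * pi}"
  proof -
    have "(\<lambda>x. - x + 2 * pi) = (\<lambda>x. 2 * pi - x)" by (rule ext) simp
    then show ?thesis by simp
  qed
  moreover have "f (2 * pi - (- x + 2 * pi)) = f x" for x by simp
  ultimately have 2: "(f has_integral integral {0..pi} (\<lambda>\<theta>. f (2 * pi - \<theta>))) {pi..2 * pi}" by (simp only:)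
  have "(f has_integral integral {0..pi} f + integral {0..pi} (\<lambda>\<theta>. f (2 * pi - \<theta>))) {0..2 * pi}"
    by (rule has_integral_combine[OF _ _ integrable_integral[OF assms(1)] 2]) auto
  then show ?thesis by (rule integral_unique)
qed

lemma one_plus_cis_polar: "1 + cis \<theta> = of_real (2 * cos (\<theta>/2)) * cis (\<theta>/2)"
proof -
  have "1 + cos \<theta> = 2 * cos (\<theta>/2) * cos (\<theta>/2)" "sin \<theta> = 2 * cos (\<theta>/2) * sin (\<theta>/2)"
    using cos_double_cos[of "\<theta>/2"] sin_double[of "\<theta>/2"] by (simp_all add: power2_eq_square)
  then show ?thesis by (simp add: complex_eq_iff)
qed

lemma one_minus_cis_polar: "1 - cis \<theta> = of_real (2 * sin (\<theta>/2)) * cis ((\<theta> - pi)/2)"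
proof -
  have "1 - cos \<theta> = 2 * sin (\<theta>/2) * sin (\<theta>/2)" "sin \<theta> = 2 * sin (\<theta>/2) * cos (\<theta>/2)"
    using cos_double_sin[of "\<theta>/2"] sin_double[of "\<theta>/2"] by (simp_all add: power2_eq_square)
  then show ?thesis by (simp add: complex_eq_iff diff_divide_distrib cos_diff sin_diff)
qed

lemma one_plus_cis_powr:
  assumes "\<theta> \<in> {0..pi}"
  shows "(1 + cis \<theta>) powr q = of_real (2 * cos (\<theta>/2)) powr q * exp (\<i> * q * of_real \<theta> / 2)"
    "(1 + cis (- \<theta>)) powr q = of_real (2 * cos (\<theta>/2)) powr q * exp (- (\<i> * q * of_real \<theta> / 2))"
proof -
  have c: "2 * cos (\<theta>/2) \<ge> 0" using assms by (auto intro!: cos_ge_zero)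
  have "(1 + cis \<theta>) powr q = of_real (2 * cos (\<theta>/2)) powr q * exp (\<i> * of_real (\<theta>/2) * q)"
    unfolding one_plus_cis_polar by (rule powr_polar[OF c]) (use assms pi_gt_zero in \<open>auto simp del: pi_gt_zero\<close>)
  then show "(1 + cis \<theta>) powr q = of_real (2 * cos (\<theta>/2)) powr q * exp (\<i> * q * of_real \<theta> / 2)" by (simp add: mult_ac)
  have "1 + cis (- \<theta>) = of_real (2 * cos (\<theta>/2)) * cis (- (\<theta>/2))" using one_plus_cis_polar[of "- \<theta>"] by simp
  then have "(1 + cis (- \<theta>)) powr q = of_real (2 * cos (\<theta>/2)) powr q * exp (\<i> * of_real (- (\<theta>/2)) * q)"
    by (simp only:) (rule powr_polar[OF c], use assms pi_gt_zero in \<open>auto simp del: pi_gt_zero\<close>)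
  then show "(1 + cis (- \<theta>)) powr q = of_real (2 * cos (\<theta>/2)) powr q * exp (- (\<i> * q * of_real \<theta> / 2))" by (simp add: mult_ac)
qed

lemma one_minus_cis_powr:
  assumes "\<theta> \<in> {0..pi}"
  shows "(1 - cis \<theta>) powr p = of_real (2 * sin (\<theta>/2)) powr p * exp (\<i> * p * of_real (\<theta> - pi) / 2)"
    "(1 - cis (- \<theta>)) powr p = of_real (2 * sin (\<theta>/2)) powr p * exp (- (\<i> * p * of_real (\<theta> - pi) / 2))"
proof -
  have c: "2 * sin (\<theta>/2) \<ge> 0" using assms by (auto intro!: sin_ge_zero)
  have b: "- pi < (\<theta> - pi)/2" "(\<theta> - pi)/2 \<le> pi" "- pi < (pi - \<theta>)/2" "(pi - \<theta>)/2 \<le> pi"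
    using assms pi_gt_zero by (auto simp del: pi_gt_zero)
  have "(1 - cis \<theta>) powr p = of_real (2 * sin (\<theta>/2)) powr p * exp (\<i> * of_real ((\<theta> - pi)/2) * p)"
    unfolding one_minus_cis_polar by (rule powr_polar[OF c b(1,2)])
  then show "(1 - cis \<theta>) powr p = of_real (2 * sin (\<theta>/2)) powr p * exp (\<i> * p * of_real (\<theta> - pi) / 2)" by (simp add: mult_ac)
  have "1 - cis (- \<theta>) = cnj (1 - cis \<theta>)" by (simp add: cis_cnj)
  also have "\<dots> = of_real (2 * sin (\<theta>/2)) * cis ((pi - \<theta>)/2)"
    unfolding one_minus_cis_polar by (simp add: cis_cnj diff_divide_distrib)
  finally have "(1 - cis (- \<theta>)) powr p = of_real (2 * sin (\<theta>/2)) powr p * exp (\<i> * of_real ((pi - \<theta>)/2) * p)"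
    by (simp only:) (rule powr_polar[OF c b(3,4)])
  also have "\<i> * of_real ((pi - \<theta>)/2) * p = - (\<i> * p * of_real (\<theta> - pi) / 2)" by (simp add: field_simps)
  finally show "(1 - cis (- \<theta>)) powr p = of_real (2 * sin (\<theta>/2)) powr p * exp (- (\<i> * p * of_real (\<theta> - pi) / 2))" .
qed

lemma cis_2pi_minus: "cis (2 * pi - \<theta>) = cis (- \<theta>)" "cis (- (2 * pi - \<theta>)) = cis \<theta>"
  by (simp_all add: complex_eq_iff cos_diff sin_diff)

lemma integral_circle_fold:
  assumes pq: "Re p > 0" "Re q > 0"
    and f1: "\<And>\<theta>. \<theta> \<in> {0..pi} \<Longrightarrow> f \<theta> = C1 * (of_real (2 * cos (\<theta>/2)) powr q * of_real (2 * sin (\<theta>/2)) powr p * exp (\<tau>1 * of_real \<theta>))"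
    and f2: "\<And>\<theta>. \<theta> \<in> {0..pi} \<Longrightarrow> f (2 * pi - \<theta>) = C2 * (of_real (2 * cos (\<theta>/2)) powr q * of_real (2 * sin (\<theta>/2)) powr p * exp (\<tau>2 * of_real \<theta>))"
  shows "integral {0..2 * pi} f = C1 * Vint \<tau>1 p q + C2 * Vint \<tau>2 p q"
proof -
  have b1: "((\<lambda>\<theta>. C1 * (of_real (2 * cos (\<theta>/2)) powr q * of_real (2 * sin (\<theta>/2)) powr p * exp (\<tau>1 * of_real \<theta>))) has_integral C1 * Vint \<tau>1 p q) {0..pi}"
    unfolding Vint_def by (intro has_integral_mult_right integrable_integral integrable_continuous_real continuous_Vint_integrand pq)
  have h1: "(f has_integral C1 * Vint \<tau>1 p q) {0..pi}"
    by (rule has_integral_eq[OF _ b1]) (simp only: f1)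
  have b2: "((\<lambda>\<theta>. C2 * (of_real (2 * cos (\<theta>/2)) powr q * of_real (2 * sin (\<theta>/2)) powr p * exp (\<tau>2 * of_real \<theta>))) has_integral C2 * Vint \<tau>2 p q) {0..pi}"
    unfolding Vint_def by (intro has_integral_mult_right integrable_integral integrable_continuous_real continuous_Vint_integrand pq)
  have h2: "((\<lambda>\<theta>. f (2 * pi - \<theta>)) has_integral C2 * Vint \<tau>2 p q) {0..pi}"
    by (rule has_integral_eq[OF _ b2]) (simp only: f2)
  show ?thesis
    using integral_fold[OF has_integral_integrable[OF h1] has_integral_integrable[OF h2]] h1 h2
    by (simp only: integral_unique)
qed

lemma mult_regroup:
  fixes a b :: complex
  assumes "a * b = c * e" shows "(x * a) * (y * b) = c * (y * x * e)"
proof -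
  have "(x * a) * (y * b) = (a * b) * (x * y)" by (simp only: mult_ac)
  also have "\<dots> = c * (y * x * e)" unfolding assms by (simp only: mult_ac)
  finally show ?thesis .
qed

lemma hyp2F1_minus_one_Vint:
  assumes pq: "Re p > 0" "Re q > 0"
  shows "of_real (2 * pi) * hyp2F1 (- p) (- q) 1 (-1) =
    exp (- (\<i> * p * of_real pi / 2)) * Vint (\<i> * (p - q) / 2) p q + exp (\<i> * p * of_real pi / 2) * Vint (- (\<i> * (p - q) / 2)) p q"
  unfolding hyp2F1_minus_one_circle[OF pq]
proof (rule integral_circle_fold[OF pq])
  fix \<theta> assume t: "\<theta> \<in> {0..pi}"
  have e1: "exp (\<i> * p * of_real (\<theta> - pi) / 2) * exp (- (\<i> * q * of_real \<theta> / 2)) = exp (- (\<i> * p * of_real pi / 2)) * exp (\<i> * (p - q) / 2 * of_real \<theta>)"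
    unfolding exp_add[symmetric] by (rule arg_cong[where f = exp]) (simp add: field_simps)
  show "(1 - cis \<theta>) powr p * (1 + cis (- \<theta>)) powr q = exp (- (\<i> * p * of_real pi / 2)) *
     (of_real (2 * cos (\<theta>/2)) powr q * of_real (2 * sin (\<theta>/2)) powr p * exp (\<i> * (p - q) / 2 * of_real \<theta>))"
    unfolding one_minus_cis_powr(1)[OF t] one_plus_cis_powr(2)[OF t] by (rule mult_regroup[OF e1])
  have e2: "exp (- (\<i> * p * of_real (\<theta> - pi) / 2)) * exp (\<i> * q * of_real \<theta> / 2) = exp (\<i> * p * of_real pi / 2) * exp (- (\<i> * (p - q) / 2) * of_real \<theta>)"
    unfolding exp_add[symmetric] by (rule arg_cong[where f = exp]) (simp add: field_simps)
  show "(1 - cis (2 * pi - \<theta>)) powr p * (1 + cis (- (2 * pi - \<theta>))) powr q = exp (\<i> * p * of_real pi / 2) *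
     (of_real (2 * cos (\<theta>/2)) powr q * of_real (2 * sin (\<theta>/2)) powr p * exp (- (\<i> * (p - q) / 2) * of_real \<theta>))"
    unfolding cis_2pi_minus one_minus_cis_powr(2)[OF t] one_plus_cis_powr(1)[OF t] by (rule mult_regroup[OF e2])
qed

text \<open>The folded integral with the phase centred at \<open>\<pi>/2\<close>; \<open>\<sigma> = \<plusminus>1\<close> distinguishes the two arcs. For \<open>0 < \<theta> < \<pi>\<close> the integrand
  equals \<open>(2 sin \<theta>)^\<nu> exp (\<alpha> (lam \<theta> + i \<sigma> ph \<theta>)/2)\<close>.\<close>
definition Wint :: "real \<Rightarrow> real \<Rightarrow> complex \<Rightarrow> complex" where
  "Wint \<sigma> \<nu> \<alpha> = integral {0..pi} (\<lambda>\<theta>. of_real (2 * cos (\<theta>/2)) powr (of_real \<nu> - \<alpha>/2) * of_real (2 * sin (\<theta>/2)) powr (of_real \<nu> + \<alpha>/2)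
     * exp (\<i> * of_real (\<sigma> * ph \<theta>) * \<alpha> / 2))"

lemma Vint_Wint:
  assumes "norm \<alpha> < 2 * \<nu>"
  shows "Vint (\<i> * of_real \<sigma> * \<alpha> / 2) (of_real \<nu> + \<alpha>/2) (of_real \<nu> - \<alpha>/2) = exp (\<i> * of_real (\<sigma> * pi) * \<alpha> / 4) * Wint \<sigma> \<nu> \<alpha>"
proof -
  have "of_real (2 * cos (\<theta>/2)) powr (of_real \<nu> - \<alpha>/2) * of_real (2 * sin (\<theta>/2)) powr (of_real \<nu> + \<alpha>/2) * exp (\<i> * of_real \<sigma> * \<alpha> / 2 * of_real \<theta>)
    = exp (\<i> * of_real (\<sigma> * pi) * \<alpha> / 4) * (of_real (2 * cos (\<theta>/2)) powr (of_real \<nu> - \<alpha>/2) * of_real (2 * sin (\<theta>/2)) powr (of_real \<nu> + \<alpha>/2)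
     * exp (\<i> * of_real (\<sigma> * ph \<theta>) * \<alpha> / 2))" for \<theta>
  proof -
    have "exp (\<i> * of_real \<sigma> * \<alpha> / 2 * of_real \<theta>) = exp (\<i> * of_real (\<sigma> * pi) * \<alpha> / 4) * exp (\<i> * of_real (\<sigma> * ph \<theta>) * \<alpha> / 2)"
      unfolding exp_add[symmetric] by (rule arg_cong[where f = exp]) (simp add: ph_def field_simps)
    then show ?thesis by (simp only: mult_ac)
  qed
  then show ?thesis unfolding Vint_def Wint_def by (simp only: integral_mult_right)
qed

text \<open>Centring the phase removes \<open>\<alpha>\<close> from the prefactors, which makes the \<open>\<alpha>\<close>-derivatives transparent.\<close>
lemma Kfun_Wint:
  assumes "norm \<alpha> < 2 * \<nu>"
  shows "of_real (2 * pi) * Kfun \<alpha> (- of_real \<nu>) =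
    exp (- (\<i> * of_real (pi * \<nu>) / 2)) * Wint 1 \<nu> \<alpha> + exp (\<i> * of_real (pi * \<nu>) / 2) * Wint (-1) \<nu> \<alpha>"
proof -
  define p where "p = of_real \<nu> + \<alpha>/2"
  define q where "q = of_real \<nu> - \<alpha>/2"
  have "\<bar>Re \<alpha>\<bar> < 2 * \<nu>" using assms abs_Re_le_cmod[of \<alpha>] by linarith
  then have pq: "Re p > 0" "Re q > 0" by (auto simp: p_def q_def abs_if split: if_splits)
  have d: "p - q = \<alpha>" by (simp add: p_def q_def)
  have "Kfun \<alpha> (- of_real \<nu>) = hyp2F1 (- p) (- q) 1 (-1)"
    unfolding Kfun_def p_def q_def by (simp add: algebra_simps)
  then have "of_real (2 * pi) * Kfun \<alpha> (- of_real \<nu>) =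
     exp (- (\<i> * p * of_real pi / 2)) * Vint (\<i> * \<alpha> / 2) p q + exp (\<i> * p * of_real pi / 2) * Vint (- (\<i> * \<alpha> / 2)) p q"
    using hyp2F1_minus_one_Vint[OF pq] by (simp only: d)
  also have "Vint (\<i> * \<alpha> / 2) p q = exp (\<i> * of_real pi * \<alpha> / 4) * Wint 1 \<nu> \<alpha>"
    using Vint_Wint[OF assms, of 1] by (simp add: p_def q_def)
  also have "Vint (- (\<i> * \<alpha> / 2)) p q = exp (- (\<i> * of_real pi * \<alpha> / 4)) * Wint (-1) \<nu> \<alpha>"
    using Vint_Wint[OF assms, of "-1"] by (simp add: p_def q_def)
  also have "exp (- (\<i> * p * of_real pi / 2)) * (exp (\<i> * of_real pi * \<alpha> / 4) * Wint 1 \<nu> \<alpha>) = exp (- (\<i> * of_real (pi * \<nu>) / 2)) * Wint 1 \<nu> \<alpha>"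
    unfolding mult.assoc[symmetric] exp_add[symmetric] by (simp add: p_def field_simps)
  also have "exp (\<i> * p * of_real pi / 2) * (exp (- (\<i> * of_real pi * \<alpha> / 4)) * Wint (-1) \<nu> \<alpha>) = exp (\<i> * of_real (pi * \<nu>) / 2) * Wint (-1) \<nu> \<alpha>"
    unfolding mult.assoc[symmetric] exp_add[symmetric] by (simp add: p_def field_simps)
  finally show ?thesis .
qed

lemma holo_integrand_Wint:
  assumes \<nu>: "\<nu> > 0"
  shows "holo_integrand (ball 0 (2 * \<nu>)) 0 pi (\<lambda>\<alpha> \<theta>. of_real (2 * cos (\<theta>/2)) powr (of_real \<nu> - \<alpha>/2) * of_real (2 * sin (\<theta>/2)) powr (of_real \<nu> + \<alpha>/2)
     * exp (\<i> * of_real (\<sigma> * ph \<theta>) * \<alpha> / 2))"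
  unfolding holo_integrand_def
proof (intro conjI ballI)
  show "open (ball (0::complex) (2 * \<nu>))" by simp
  fix \<theta> assume "\<theta> \<in> {0..pi}"
  have h: "(\<lambda>\<alpha>. of_real x powr g \<alpha>) holomorphic_on S" if "g holomorphic_on S" for x :: real and g :: "complex \<Rightarrow> complex" and S
    using that by (cases "x = 0") (auto simp: powr_def intro!: holomorphic_intros)
  show "(\<lambda>\<alpha>. of_real (2 * cos (\<theta>/2)) powr (of_real \<nu> - \<alpha>/2) * of_real (2 * sin (\<theta>/2)) powr (of_real \<nu> + \<alpha>/2)
     * exp (\<i> * of_real (\<sigma> * ph \<theta>) * \<alpha> / 2)) holomorphic_on ball 0 (2 * \<nu>)"
    by (intro holomorphic_on_mult h holomorphic_intros) auto
next
  fix \<alpha> :: complex assume a: "\<alpha> \<in> ball 0 (2 * \<nu>)"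
  have "\<bar>Re \<alpha>\<bar> < 2 * \<nu>" using a abs_Re_le_cmod[of \<alpha>] by simp
  then have pq: "Re (of_real \<nu> + \<alpha>/2) > 0" "Re (of_real \<nu> - \<alpha>/2) > 0" by (auto simp: abs_if split: if_splits)
  have c0: "continuous_on {0..pi} (\<lambda>\<theta>. of_real (2 * cos (\<theta>/2)) powr (of_real \<nu> - \<alpha>/2) * of_real (2 * sin (\<theta>/2)) powr (of_real \<nu> + \<alpha>/2))"
    using continuous_Vint_integrand[OF pq, of 0] by simp
  show "(\<lambda>\<theta>. of_real (2 * cos (\<theta>/2)) powr (of_real \<nu> - \<alpha>/2) * of_real (2 * sin (\<theta>/2)) powr (of_real \<nu> + \<alpha>/2)
     * exp (\<i> * of_real (\<sigma> * ph \<theta>) * \<alpha> / 2)) integrable_on {0..pi}"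
    by (rule integrable_continuous_real, rule continuous_on_mult[OF c0]) (auto intro!: continuous_intros continuous_ph)
  obtain e where e: "e > 0" "cball \<alpha> e \<subseteq> ball 0 (2 * \<nu>)" using a open_ball open_contains_cball by blast
  define M where "M = 2 powr (2 * \<nu>) * 2 powr (2 * \<nu>) * exp (\<bar>\<sigma>\<bar> * pi * \<nu>)"
  have bd: "norm (of_real (2 * cos (\<theta>/2)) powr (of_real \<nu> - \<beta>/2) * of_real (2 * sin (\<theta>/2)) powr (of_real \<nu> + \<beta>/2) * exp (\<i> * of_real (\<sigma> * ph \<theta>) * \<beta> / 2)) \<le> M"
    if b: "\<beta> \<in> cball \<alpha> e" and t: "\<theta> \<in> {0..pi}" for \<beta> \<theta>
  proof -
    have nb: "norm \<beta> < 2 * \<nu>" using b e by auto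
    have rb: "\<bar>Re \<beta>\<bar> < 2 * \<nu>" using nb abs_Re_le_cmod[of \<beta>] by linarith
    have pw: "norm (of_real x powr z) \<le> 2 powr (2 * \<nu>)" if "0 \<le> x" "x \<le> 2" "0 < Re z" "Re z \<le> 2 * \<nu>" for x :: real and z :: complex
    proof -
      have "norm (of_real x powr z) = x powr Re z" using that by (simp add: norm_powr_real_powr)
      also have "\<dots> \<le> 2 powr Re z" using that by (intro powr_mono2) auto
      also have "\<dots> \<le> 2 powr (2 * \<nu>)" using that by (intro powr_mono) auto
      finally show ?thesis .
    qed
    have c: "0 \<le> cos (\<theta>/2)" "0 \<le> sin (\<theta>/2)" using t by (auto intro!: cos_ge_zero sin_ge_zero)
    have 1: "norm (of_real (2 * cos (\<theta>/2)) powr (of_real \<nu> - \<beta>/2)) \<le> 2 powr (2 * \<nu>)"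
      using c rb by (intro pw) (auto simp: abs_if split: if_splits)
    have 2: "norm (of_real (2 * sin (\<theta>/2)) powr (of_real \<nu> + \<beta>/2)) \<le> 2 powr (2 * \<nu>)"
      using c rb by (intro pw) (auto simp: abs_if split: if_splits)
    have 3: "norm (exp (\<i> * of_real (\<sigma> * ph \<theta>) * \<beta> / 2)) \<le> exp (\<bar>\<sigma>\<bar> * pi * \<nu>)"
    proof -
      have "norm (exp (\<i> * of_real (\<sigma> * ph \<theta>) * \<beta> / 2)) \<le> exp (norm (\<i> * of_real (\<sigma> * ph \<theta>) * \<beta> / 2))" by (rule norm_exp)
      also have "norm (\<i> * of_real (\<sigma> * ph \<theta>) * \<beta> / 2) = \<bar>\<sigma>\<bar> * \<bar>ph \<theta>\<bar> * (norm \<beta> / 2)" by (simp add: norm_mult abs_mult)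
      also have "\<dots> \<le> \<bar>\<sigma>\<bar> * pi * \<nu>"
        using t nb \<nu> by (intro mult_mono) (auto simp: ph_def abs_if)
      finally show ?thesis by simp
    qed
    show ?thesis unfolding norm_mult M_def by (intro mult_mono 1 2 3) auto
  qed
  show "\<exists>e>0. \<exists>M. cball \<alpha> e \<subseteq> ball 0 (2 * \<nu>) \<and> (\<forall>y\<in>cball \<alpha> e. \<forall>t\<in>{0..pi}.
     norm (of_real (2 * cos (t/2)) powr (of_real \<nu> - y/2) * of_real (2 * sin (t/2)) powr (of_real \<nu> + y/2) * exp (\<i> * of_real (\<sigma> * ph t) * y / 2)) \<le> M)"
    by (rule exI[of _ e], rule conjI[OF e(1)], rule exI[of _ M], rule conjI[OF e(2)], intro ballI, rule bd)
qed

lemma Wint_holomorphic: "\<nu> > 0 \<Longrightarrow> Wint \<sigma> \<nu> holomorphic_on ball 0 (2 * \<nu>)"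
  using holo_integrand_holomorphic[OF holo_integrand_Wint] unfolding Wint_def[abs_def] .

lemma Wint_integrand_exp:
  assumes t: "0 < \<theta>" "\<theta> < pi" and \<nu>: "\<nu> > 0"
  shows "of_real (2 * cos (\<theta>/2)) powr (of_real \<nu> - \<alpha>/2) * of_real (2 * sin (\<theta>/2)) powr (of_real \<nu> + \<alpha>/2) * exp (\<i> * of_real (\<sigma> * ph \<theta>) * \<alpha> / 2)
    = of_real ((2 * sin \<theta>) powr \<nu>) * exp (\<alpha> * ((of_real (lam \<theta>) + \<i> * of_real (\<sigma> * ph \<theta>)) / 2))"
proof -
  define c where "c = cos (\<theta>/2)"
  define s where "s = sin (\<theta>/2)"
  have cs: "c > 0" "s > 0" using t by (auto intro!: cos_gt_zero sin_gt_zero simp: c_def s_def)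
  have l: "lam \<theta> = ln (2 * s) - ln (2 * c)" unfolding lam_def tan_def c_def[symmetric] s_def[symmetric]
    using cs by (simp add: ln_div ln_mult)
  have l2: "ln (2 * sin \<theta>) = ln (2 * s) + ln (2 * c)"
  proof -
    have eq: "2 * sin \<theta> = (2 * s) * (2 * c)" using sin_double[of "\<theta>/2"] by (simp add: c_def s_def)
    show ?thesis unfolding eq by (rule ln_mult_pos) (use cs in auto)
  qed
  have sp: "sin \<theta> > 0" using t by (auto intro: sin_gt_zero)
  have p: "of_real x powr z = exp (z * of_real (ln x))" if "x > 0" for x :: real and z :: complex
    using that by (simp add: powr_def Ln_of_real)
  have "of_real ((2 * sin \<theta>) powr \<nu>) = exp (of_real (\<nu> * (ln (2 * s) + ln (2 * c))) :: complex)"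
  proof -
    have "(2 * sin \<theta>) powr \<nu> = exp (\<nu> * (ln (2 * s) + ln (2 * c)))" using sp l2 by (simp add: powr_def)
    then show ?thesis by (simp only: exp_of_real)
  qed
  moreover have "of_real (2 * c) powr (of_real \<nu> - \<alpha>/2) * of_real (2 * s) powr (of_real \<nu> + \<alpha>/2) * exp (\<i> * of_real (\<sigma> * ph \<theta>) * \<alpha> / 2)
     = exp (of_real (\<nu> * (ln (2 * s) + ln (2 * c))) + \<alpha> * ((of_real (ln (2 * s) - ln (2 * c)) + \<i> * of_real (\<sigma> * ph \<theta>)) / 2))"
  proof -
    have c2: "2 * c > 0" "2 * s > 0" using cs by auto
    show ?thesis unfolding p[OF c2(1)] p[OF c2(2)] exp_add[symmetric]
      by (rule arg_cong[where f = exp]) (simp add: algebra_simps add_divide_distrib diff_divide_distrib)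
  qed
  ultimately show ?thesis unfolding l c_def[symmetric] s_def[symmetric] by (simp only: exp_add)
qed

lemma second_deriv_exp: "(deriv ^^ 2) (\<lambda>x::complex. c * exp (x * k)) 0 = c * k^2"
proof -
  have "deriv (\<lambda>x. c * exp (x * k)) = (\<lambda>x. (c * k) * exp (x * k))"
    by (rule ext, rule DERIV_imp_deriv) (auto intro!: derivative_eq_intros)
  moreover have "deriv (\<lambda>x. (c * k) * exp (x * k)) 0 = c * k^2"
    by (rule DERIV_imp_deriv) (auto intro!: derivative_eq_intros simp: power2_eq_square)
  ultimately show ?thesis by (simp add: numeral_2_eq_2)
qed

lemma Wint_0:
  assumes \<nu>: "\<nu> > 0" shows "Wint \<sigma> \<nu> 0 = of_real (2 powr \<nu> * sinint \<nu>)"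
proof -
  have eq: "of_real (2 * cos (\<theta>/2)) powr (of_real \<nu> - 0/2) * of_real (2 * sin (\<theta>/2)) powr (of_real \<nu> + 0/2) * exp (\<i> * of_real (\<sigma> * ph \<theta>) * 0 / 2)
     = complex_of_real (2 powr \<nu> * sin \<theta> powr \<nu>)" if "\<theta> \<in> {0..pi}" for \<theta>
  proof (cases "\<theta> = 0 \<or> \<theta> = pi")
    case False
    then have t: "0 < \<theta>" "\<theta> < pi" using that by auto
    then have "sin \<theta> > 0" by (auto intro: sin_gt_zero)
    then show ?thesis unfolding Wint_integrand_exp[OF t \<nu>] by (simp add: powr_mult)
  qed auto
  have "Wint \<sigma> \<nu> 0 = integral {0..pi} (\<lambda>\<theta>. complex_of_real (2 powr \<nu> * sin \<theta> powr \<nu>))"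
    unfolding Wint_def by (rule integral_cong) (simp only: eq)
  also have "\<dots> = of_real (2 powr \<nu> * sinint \<nu>)"
    unfolding sinint_def using integrable_continuous_real[OF continuous_sin_powr[OF \<nu>]]
    by (rule integral_unique[OF has_integral_of_real[OF has_integral_mult_right[OF integrable_integral]]])
  finally show ?thesis .
qed

text \<open>The square of \<open>(lam + i \<sigma> ph)/2\<close> is integrated against the weight.\<close>
lemma Wint_second_deriv:
  assumes \<nu>: "\<nu> > 0" and \<sigma>: "\<sigma>^2 = 1"
  shows "(deriv ^^ 2) (Wint \<sigma> \<nu>) 0 = of_real (2 powr \<nu> / 4) * (of_real (lam2int \<nu> - ph2int \<nu>) + \<i> * of_real (2 * \<sigma> * lamphint \<nu>))"
proof -
  have "(deriv ^^ 2) (Wint \<sigma> \<nu>) 0 = integral {0..pi} (\<lambda>\<theta>. (deriv ^^ 2) (\<lambda>\<alpha>. of_real (2 * cos (\<theta>/2)) powr (of_real \<nu> - \<alpha>/2) * of_real (2 * sin (\<theta>/2)) powr (of_real \<nu> + \<alpha>/2)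
     * exp (\<i> * of_real (\<sigma> * ph \<theta>) * \<alpha> / 2)) 0)"
    unfolding Wint_def[abs_def] using \<nu> by (intro holo_integrand_second_deriv[OF holo_integrand_Wint]) auto
  also have "\<dots> = integral {0..pi} (\<lambda>\<theta>. of_real (2 powr \<nu> / 4) * (of_real (sin \<theta> powr \<nu> * (lam \<theta>)^2 - sin \<theta> powr \<nu> * (ph \<theta>)^2)
       + \<i> * of_real (2 * \<sigma> * (sin \<theta> powr \<nu> * (lam \<theta> * ph \<theta>)))))"
  proof (rule integral_cong)
    fix \<theta> assume t: "\<theta> \<in> {0..pi}"
    show "(deriv ^^ 2) (\<lambda>\<alpha>. of_real (2 * cos (\<theta>/2)) powr (of_real \<nu> - \<alpha>/2) * of_real (2 * sin (\<theta>/2)) powr (of_real \<nu> + \<alpha>/2)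
     * exp (\<i> * of_real (\<sigma> * ph \<theta>) * \<alpha> / 2)) 0 = of_real (2 powr \<nu> / 4) * (of_real (sin \<theta> powr \<nu> * (lam \<theta>)^2 - sin \<theta> powr \<nu> * (ph \<theta>)^2)
       + \<i> * of_real (2 * \<sigma> * (sin \<theta> powr \<nu> * (lam \<theta> * ph \<theta>))))"
    proof (cases "\<theta> = 0 \<or> \<theta> = pi")
      case True
      then show ?thesis by (auto simp: numeral_2_eq_2)
    next
      case False
      then have t: "0 < \<theta>" "\<theta> < pi" using t by auto
      then have sp: "sin \<theta> > 0" by (auto intro: sin_gt_zero)
      have "(of_real \<sigma>)^2 = (1::complex)" by (metis \<sigma> of_real_1 of_real_power)
      then have sq: "(of_real (lam \<theta>) + \<i> * of_real (\<sigma> * ph \<theta>))^2 = of_real ((lam \<theta>)^2 - (ph \<theta>)^2) + \<i> * of_real (2 * \<sigma> * (lam \<theta> * ph \<theta>))"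
        by (simp add: power2_sum power_mult_distrib)
      show ?thesis unfolding Wint_integrand_exp[OF t \<nu>] second_deriv_exp power_divide sq
        using sp by (simp add: powr_mult field_simps)
    qed
  qed
  also have "\<dots> = of_real (2 powr \<nu> / 4) * (of_real (lam2int \<nu> - ph2int \<nu>) + \<i> * of_real (2 * \<sigma> * lamphint \<nu>))"
  proof (rule integral_unique, rule has_integral_mult_right, rule has_integral_add)
    have "((\<lambda>\<theta>. sin \<theta> powr \<nu> * (lam \<theta>)^2 - sin \<theta> powr \<nu> * (ph \<theta>)^2) has_integral (lam2int \<nu> - ph2int \<nu>)) {0..pi}"
      unfolding lam2int_def ph2int_def
      by (intro has_integral_diff integrable_integral integrable_continuous_real continuous_sin_powr_lamph \<nu>)
    then show "((\<lambda>\<theta>. complex_of_real (sin \<theta> powr \<nu> * (lam \<theta>)^2 - sin \<theta> powr \<nu> * (ph \<theta>)^2)) has_integral of_real (lam2int \<nu> - ph2int \<nu>)) {0..pi}"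
      by (rule has_integral_of_real)
    have "((\<lambda>\<theta>. 2 * \<sigma> * (sin \<theta> powr \<nu> * (lam \<theta> * ph \<theta>))) has_integral (2 * \<sigma> * lamphint \<nu>)) {0..pi}"
      unfolding lamphint_def
      by (rule has_integral_mult_right) (intro integrable_integral integrable_continuous_real continuous_sin_powr_lamph \<nu>)
    then show "((\<lambda>\<theta>. \<i> * complex_of_real (2 * \<sigma> * (sin \<theta> powr \<nu> * (lam \<theta> * ph \<theta>)))) has_integral \<i> * of_real (2 * \<sigma> * lamphint \<nu>)) {0..pi}"
      by (intro has_integral_mult_right) (rule has_integral_of_real)
  qed
  finally show ?thesis .
qed

section \<open>The identity on the negative real axis\<close>

lemma open_compl_Ints: "open (- \<int> :: complex set)" by (simp add: open_Compl closed_Ints)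

lemma countable_Ints: "countable (\<int> :: complex set)" unfolding Ints_def by simp

lemma connected_compl_Ints: "connected (- \<int> :: complex set)"
  using connected_open_diff_countable[OF _ open_UNIV connected_UNIV countable_Ints] by (simp add: Compl_eq_Diff_UNIV)

lemma Kfun_holomorphic:
  assumes "open U" "p holomorphic_on U" "q holomorphic_on U"
  shows "(\<lambda>x. Kfun (p x) (q x)) holomorphic_on U"
  unfolding Kfun_def using assms minus_one_slit
  by (intro hyp2F1_param_holomorphic holomorphic_intros) auto

lemma Kfun0_holomorphic: "Kfun0 holomorphic_on UNIV"
  unfolding Kfun0_def[abs_def] by (intro Kfun_holomorphic) auto

lemma Kfun2_circle:
  "Kfun2 s = 2 / (2 * of_real pi * \<i>) * integral {0..2 * pi} (\<lambda>t. Kfun (cis t) s / cis t ^ 3 * \<i> * cis t)"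
proof -
  have h: "(\<lambda>\<alpha>. Kfun \<alpha> s) holomorphic_on UNIV" by (rule Kfun_holomorphic) auto
  have "((\<lambda>u. Kfun u s / (u - 0) ^ (Suc 2)) has_contour_integral ((2 * pi * \<i>) / (fact 2) * (deriv ^^ 2) (\<lambda>\<alpha>. Kfun \<alpha> s) 0)) (circlepath 0 1)"
    by (rule Cauchy_has_contour_integral_higher_derivative_circlepath)
       (auto intro: holomorphic_on_subset[OF h] holomorphic_on_imp_continuous_on)
  then have "contour_integral (circlepath 0 1) (\<lambda>u. Kfun u s / u ^ 3) = (2 * pi * \<i>) / (fact 2) * Kfun2 s"
    by (simp add: contour_integral_unique Kfun2_def numeral_3_eq_3 numeral_2_eq_2)
  moreover have "contour_integral (circlepath 0 1) (\<lambda>u. Kfun u s / u ^ 3) = integral {0..2 * pi} (\<lambda>t. Kfun (cis t) s / cis t ^ 3 * \<i> * cis t)"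
    unfolding circlepath_def by (subst contour_integral_part_circlepath_eq) auto
  ultimately show ?thesis by (simp add: fact_numeral)
qed

text \<open>The second derivative is a Cauchy integral over a circle in \<open>\<alpha>\<close>, hence holomorphic in \<open>s\<close>.\<close>
lemma Kfun2_holomorphic: "Kfun2 holomorphic_on UNIV"
proof -
  have "holo_integrand UNIV 0 (2 * pi) (\<lambda>s t. Kfun (cis t) s / cis t ^ 3 * \<i> * cis t)"
    unfolding holo_integrand_def
  proof (intro conjI ballI)
    show "open (UNIV :: complex set)" by simp
    show "(\<lambda>s. Kfun (cis t) s / cis t ^ 3 * \<i> * cis t) holomorphic_on UNIV" for t
      by (intro holomorphic_intros Kfun_holomorphic) auto
    show "(\<lambda>t. Kfun (cis t) s / cis t ^ 3 * \<i> * cis t) integrable_on {0..2 * pi}" for s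
    proof -
      have "continuous_on UNIV (\<lambda>\<alpha>. Kfun \<alpha> s)"
        by (rule holomorphic_on_imp_continuous_on, rule Kfun_holomorphic) auto
      then have "continuous_on {0..2 * pi} (\<lambda>t. Kfun (cis t) s)"
        by (rule continuous_on_compose2) (auto intro!: continuous_intros)
      then show ?thesis by (intro integrable_continuous_real continuous_intros) auto
    qed
    fix s :: complex
    obtain M where M: "\<And>a b. norm a \<le> norm s + 2 \<Longrightarrow> norm b \<le> norm s + 2 \<Longrightarrow> norm (hyp2F1 a b 1 (-1)) \<le> M"
      by (rule hyp2F1_local_bound[OF one_nonpos minus_one_slit, where R = "norm s + 2"]) (rule that)
    have "norm (Kfun (cis t) y / cis t ^ 3 * \<i> * cis t) \<le> M" if "y \<in> cball s 1" for y t
    proof -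
      have "norm y \<le> norm s + 1" using that norm_triangle_ineq2[of y s] by (simp add: dist_norm norm_minus_commute)
      then have "norm (y - cis t / 2) \<le> norm s + 2" "norm (y + cis t / 2) \<le> norm s + 2"
        using norm_triangle_ineq4[of y "cis t / 2"] norm_triangle_ineq[of y "cis t / 2"] by (simp_all add: norm_divide)
      from M[OF this] show ?thesis by (simp add: Kfun_def norm_mult norm_divide norm_power)
    qed
    then show "\<exists>e>0. \<exists>M. cball s e \<subseteq> UNIV \<and> (\<forall>y\<in>cball s e. \<forall>t\<in>{0..2 * pi}. norm (Kfun (cis t) y / cis t ^ 3 * \<i> * cis t) \<le> M)"
      by (intro exI[of _ 1] conjI exI[of _ M]) auto
  qed
  then have "(\<lambda>s. integral {0..2 * pi} (\<lambda>t. Kfun (cis t) s / cis t ^ 3 * \<i> * cis t)) holomorphic_on UNIV"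
    by (rule holo_integrand_holomorphic)
  then show ?thesis unfolding Kfun2_circle[abs_def] by (intro holomorphic_intros)
qed

lemma Kfun0_neg:
  assumes \<nu>: "\<nu> > 0"
  shows "Kfun0 (- of_real \<nu>) = of_real (cos (pi * \<nu> / 2) * 2 powr \<nu> * sinint \<nu> / pi)"
proof -
  have "of_real (2 * pi) * Kfun0 (- of_real \<nu>) = (exp (- (\<i> * of_real (pi * \<nu> / 2))) + exp (\<i> * of_real (pi * \<nu> / 2))) * of_real (2 powr \<nu> * sinint \<nu>)"
    using Kfun_Wint[of 0 \<nu>] \<nu> by (simp add: Wint_0 Kfun0_def algebra_simps)
  also have "exp (- (\<i> * of_real (pi * \<nu> / 2))) + exp (\<i> * of_real (pi * \<nu> / 2)) = 2 * of_real (cos (pi * \<nu> / 2))"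
    unfolding cos_of_real[symmetric] by (simp add: cos_exp_eq)
  finally have "Kfun0 (- of_real \<nu>) = (2 * of_real (cos (pi * \<nu> / 2)) * of_real (2 powr \<nu> * sinint \<nu>)) / of_real (2 * pi)"
    by (simp add: field_simps)
  then show ?thesis by simp
qed

lemma Kfun_second_deriv_neg:
  assumes \<nu>: "\<nu> > 0"
  shows "Kfun2 (- of_real \<nu>) = of_real (2 powr \<nu> / (4 * pi) * (cos (pi * \<nu> / 2) * (lam2int \<nu> - ph2int \<nu>) + 2 * sin (pi * \<nu> / 2) * lamphint \<nu>))"
proof -
  define E where "E = exp (\<i> * of_real (pi * \<nu>) / 2)"
  define E' where "E' = exp (- (\<i> * of_real (pi * \<nu>) / 2))"
  let ?B = "ball (0::complex) (2 * \<nu>)"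
  have W: "Wint \<sigma> \<nu> holomorphic_on ?B" for \<sigma> by (rule Wint_holomorphic[OF \<nu>])
  have z: "0 \<in> ?B" using \<nu> by simp
  have "of_real (2 * pi) * Kfun2 (- of_real \<nu>) = (deriv ^^ 2) (\<lambda>\<alpha>. of_real (2 * pi) * Kfun \<alpha> (- of_real \<nu>)) 0"
    unfolding Kfun2_def by (rule higher_deriv_cmult[symmetric, of _ UNIV]) (auto intro: Kfun_holomorphic)
  also have "\<dots> = (deriv ^^ 2) (\<lambda>\<alpha>. E' * Wint 1 \<nu> \<alpha> + E * Wint (-1) \<nu> \<alpha>) 0"
  proof (rule higher_deriv_transform_within_open[of _ ?B])
    show "(\<lambda>\<alpha>. of_real (2 * pi) * Kfun \<alpha> (- of_real \<nu>)) holomorphic_on ?B"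
      by (intro holomorphic_intros Kfun_holomorphic) auto
    show "(\<lambda>\<alpha>. E' * Wint 1 \<nu> \<alpha> + E * Wint (-1) \<nu> \<alpha>) holomorphic_on ?B" by (intro holomorphic_intros W)
    show "of_real (2 * pi) * Kfun w (- of_real \<nu>) = E' * Wint 1 \<nu> w + E * Wint (-1) \<nu> w" if "w \<in> ?B" for w
      using Kfun_Wint[of w \<nu>] that by (simp add: E_def E'_def)
  qed (use z in auto)
  also have "\<dots> = (deriv ^^ 2) (\<lambda>\<alpha>. E' * Wint 1 \<nu> \<alpha>) 0 + (deriv ^^ 2) (\<lambda>\<alpha>. E * Wint (-1) \<nu> \<alpha>) 0"
    by (rule higher_deriv_add[of _ ?B]) (use z in \<open>auto intro!: holomorphic_intros W\<close>)
  also have "(deriv ^^ 2) (\<lambda>\<alpha>. E' * Wint 1 \<nu> \<alpha>) 0 = E' * (deriv ^^ 2) (Wint 1 \<nu>) 0"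
    by (rule higher_deriv_cmult[OF W z]) simp
  also have "(deriv ^^ 2) (\<lambda>\<alpha>. E * Wint (-1) \<nu> \<alpha>) 0 = E * (deriv ^^ 2) (Wint (-1) \<nu>) 0"
    by (rule higher_deriv_cmult[OF W z]) simp
  also have "E' * (deriv ^^ 2) (Wint 1 \<nu>) 0 + E * (deriv ^^ 2) (Wint (-1) \<nu>) 0 =
      of_real (2 powr \<nu> / 4) * ((E' + E) * of_real (lam2int \<nu> - ph2int \<nu>) + (E' - E) * \<i> * of_real (2 * lamphint \<nu>))"
    by (subst Wint_second_deriv[OF \<nu>], simp, subst Wint_second_deriv[OF \<nu>], simp) (simp add: algebra_simps)
  also have "E' + E = 2 * of_real (cos (pi * \<nu> / 2))"
    unfolding cos_of_real[symmetric] E_def E'_def by (simp add: cos_exp_eq)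
  also have "(E' - E) * \<i> = 2 * of_real (sin (pi * \<nu> / 2))"
    unfolding sin_of_real[symmetric] E_def E'_def by (simp add: sin_exp_eq field_simps)
  also have "of_real (2 powr \<nu> / 4) * (2 * of_real (cos (pi * \<nu> / 2)) * of_real (lam2int \<nu> - ph2int \<nu>) + 2 * of_real (sin (pi * \<nu> / 2)) * of_real (2 * lamphint \<nu>))
     = complex_of_real (2 powr \<nu> / 4 * (2 * cos (pi * \<nu> / 2) * (lam2int \<nu> - ph2int \<nu>) + 2 * sin (pi * \<nu> / 2) * (2 * lamphint \<nu>)))"
    by simp
  finally have "Kfun2 (- of_real \<nu>) = complex_of_real (2 powr \<nu> / 4 * (2 * cos (pi * \<nu> / 2) * (lam2int \<nu> - ph2int \<nu>) + 2 * sin (pi * \<nu> / 2) * (2 * lamphint \<nu>))) / of_real (2 * pi)"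
    by (simp add: field_simps)
  also have "\<dots> = of_real (2 powr \<nu> / 4 * (2 * cos (pi * \<nu> / 2) * (lam2int \<nu> - ph2int \<nu>) + 2 * sin (pi * \<nu> / 2) * (2 * lamphint \<nu>)) / (2 * pi))"
    by (simp only: of_real_divide)
  also have "2 powr \<nu> / 4 * (2 * cos (pi * \<nu> / 2) * (lam2int \<nu> - ph2int \<nu>) + 2 * sin (pi * \<nu> / 2) * (2 * lamphint \<nu>)) / (2 * pi)
     = 2 powr \<nu> / (4 * pi) * (cos (pi * \<nu> / 2) * (lam2int \<nu> - ph2int \<nu>) + 2 * sin (pi * \<nu> / 2) * lamphint \<nu>)"
    by (simp add: field_simps)
  finally show ?thesis .
qed

lemma cos_half_neq_0: assumes "\<nu> \<notin> \<int>" shows "cos (pi * \<nu> / 2) \<noteq> 0" "sin (pi * \<nu> / 2) \<noteq> 0"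
proof -
  have "sin (pi * \<nu>) \<noteq> 0" using assms sin_zero_iff_int2[of "pi * \<nu>"] by (auto simp: Ints_def)
  moreover have "sin (pi * \<nu>) = 2 * sin (pi * \<nu> / 2) * cos (pi * \<nu> / 2)" using sin_double[of "pi * \<nu> / 2"] by simp
  ultimately show "cos (pi * \<nu> / 2) \<noteq> 0" "sin (pi * \<nu> / 2) \<noteq> 0" by auto
qed

lemma Qfun_neg:
  assumes \<nu>: "\<nu> > 0" and c: "cos (pi * \<nu> / 2) \<noteq> 0"
  shows "Qfun (- of_real \<nu>) = of_real ((lam2int \<nu> / sinint \<nu> - ph2int \<nu> / sinint \<nu>) / 4 + tan (pi * \<nu> / 2) * (lamphint \<nu> / sinint \<nu>) / 2)"
proof -
  have I: "sinint \<nu> \<noteq> 0" using sinint_pos[OF \<nu>] by simp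
  have gen: "(P / (4 * p) * (C * D + 2 * S * J)) / (C * P * I / p) = D / I / 4 + S / C * (J / I) / 2"
    if "P \<noteq> 0" "p \<noteq> 0" "C \<noteq> 0" "I \<noteq> 0" for P p C D S J I :: real
    using that by (simp add: field_simps)
  have "Qfun (- of_real \<nu>) = of_real ((2 powr \<nu> / (4 * pi) * (cos (pi * \<nu> / 2) * (lam2int \<nu> - ph2int \<nu>) + 2 * sin (pi * \<nu> / 2) * lamphint \<nu>)) /
      (cos (pi * \<nu> / 2) * 2 powr \<nu> * sinint \<nu> / pi))"
    unfolding Qfun_def Kfun0_neg[OF \<nu>] Kfun_second_deriv_neg[OF \<nu>] by (simp only: of_real_divide)
  also have "(2 powr \<nu> / (4 * pi) * (cos (pi * \<nu> / 2) * (lam2int \<nu> - ph2int \<nu>) + 2 * sin (pi * \<nu> / 2) * lamphint \<nu>)) /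
      (cos (pi * \<nu> / 2) * 2 powr \<nu> * sinint \<nu> / pi) = (lam2int \<nu> - ph2int \<nu>) / sinint \<nu> / 4 + tan (pi * \<nu> / 2) * (lamphint \<nu> / sinint \<nu>) / 2"
    unfolding tan_def by (rule gen) (use I c in auto)
  finally show ?thesis by (simp add: diff_divide_distrib)
qed

text \<open>The two telescoped series are exactly the two trigamma series.\<close>
lemma Qrat_neg:
  assumes \<nu>: "\<nu> > 0"
  shows "Qrat (- of_real \<nu>) = of_real ((lam2int \<nu> / sinint \<nu> - ph2int \<nu> / sinint \<nu>) / 4)"
proof -
  have pg: "(\<lambda>k. inverse ((x + real k)^2)) sums Polygamma 1 x" if "x > 0" for x :: real
    using Polygamma_LIMSEQ[of x 1] that by (simp add: numeral_2_eq_2)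
  have P: "Polygamma 1 (c/2) = 2 * y" if "c > 0" "(\<lambda>k. 2 / (c + 2 * real k)^2) sums y" for c y :: real
  proof -
    have "2 / (c + 2 * real k)^2 = 1/2 * inverse ((c/2 + real k)^2)" for k
    proof -
      have "(c + 2 * real k)^2 = 4 * (c/2 + real k)^2" by (simp add: power2_eq_square field_simps)
      show ?thesis unfolding \<open>(c + 2 * real k)^2 = 4 * (c/2 + real k)^2\<close> by (simp add: inverse_eq_divide)
    qed
    then have "(\<lambda>k. 1/2 * inverse ((c/2 + real k)^2)) sums y" using that(2) by (simp only:)
    moreover have "(\<lambda>k. 1/2 * inverse ((c/2 + real k)^2)) sums (1/2 * Polygamma 1 (c/2))" using that by (intro sums_mult pg) simp
    ultimately have "y = 1/2 * Polygamma 1 (c/2)" by (rule sums_unique2)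
    then show ?thesis by simp
  qed
  have 1: "Polygamma 1 ((1 + \<nu>)/2) = 2 * (lam2int \<nu> / sinint \<nu>)"
  proof (rule P)
    have "\<nu> + 2 * real k + 1 = 1 + \<nu> + 2 * real k" for k by simp
    then show "(\<lambda>k. 2 / (1 + \<nu> + 2 * real k)^2) sums (lam2int \<nu> / sinint \<nu>)"
      using lam2_mean_sums[OF \<nu>] by (simp only:)
  qed (use \<nu> in simp)
  have "Polygamma 1 ((2 + \<nu>)/2) = 2 * (ph2int \<nu> / sinint \<nu>)"
  proof (rule P)
    have "\<nu> + 2 * real k + 2 = 2 + \<nu> + 2 * real k" for k by simp
    then show "(\<lambda>k. 2 / (2 + \<nu> + 2 * real k)^2) sums (ph2int \<nu> / sinint \<nu>)"
      using ph2_mean_sums[OF \<nu>] by (simp only:)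
  qed (use \<nu> in simp)
  moreover have "(2 + \<nu>)/2 = 1 + \<nu>/2" by simp
  ultimately have 2: "Polygamma 1 (1 + \<nu>/2) = 2 * (ph2int \<nu> / sinint \<nu>)" by simp
  have e: "(1 - (- of_real \<nu>))/2 = complex_of_real ((1 + \<nu>)/2)" "1 - (- of_real \<nu>)/2 = complex_of_real (1 + \<nu>/2)" by simp_all
  have p: "(1 + \<nu>)/2 \<noteq> 0" "1 + \<nu>/2 \<noteq> 0" using \<nu> by auto
  have gen: "1/8 * (of_real (2 * A) - of_real (2 * B)) = complex_of_real ((A - B)/4)" for A B :: real
  proof -
    have "(A - B)/4 = 1/8 * (2 * A - 2 * B)" by simp
    then show ?thesis by (simp only: of_real_mult of_real_diff of_real_divide of_real_1 of_real_numeral)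
  qed
  show ?thesis unfolding Qrat_def e Polygamma_of_real[OF p(1)] Polygamma_of_real[OF p(2)] 1 2 by (rule gen)
qed

text \<open>The term \<open>fhat\<close> after reflection \<open>m \<mapsto> 1 - m\<close>, without its trigonometric factor: the Gamma quotient is regular to the right, where it can be estimated.\<close>
definition phi :: "complex \<Rightarrow> complex" where "phi m = (2 * m - 1) * rhat m / (4 * m\<^sup>2 * (m - 1))"

lemma half_Ints: assumes "m \<notin> \<int>" shows "m/2 \<notin> (\<int> :: complex set)" "(1 + m)/2 \<notin> (\<int> :: complex set)"
proof -
  have "m \<in> \<int>" if "m/2 \<in> \<int>" using Ints_mult[of 2 "m/2"] that by simp
  moreover have "m \<in> \<int>" if "(1 + m)/2 \<in> \<int>" 
  proof -
    define x where "x = (1 + m)/2"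
    have "2 * x - 1 \<in> \<int>" using that unfolding x_def[symmetric] by (intro Ints_diff Ints_mult) auto
    moreover have "2 * x - 1 = m" unfolding x_def by (simp add: field_simps)
    ultimately show ?thesis by simp
  qed
  ultimately show "m/2 \<notin> \<int>" "(1 + m)/2 \<notin> \<int>" using assms by blast+
qed

lemma sin_pi_neq_0: assumes "m \<notin> (\<int> :: complex set)" shows "sin (of_real pi * m) \<noteq> 0"
  using assms sin_eq_0[of "of_real pi * m"] by (auto simp: Ints_def mult.commute)

lemma sin_cos_half_complex: assumes "m \<notin> (\<int> :: complex set)"
  shows "sin (of_real pi * m / 2) \<noteq> 0" "cos (of_real pi * m / 2) \<noteq> 0"
proof -
  have "sin (of_real pi * m) = 2 * sin (of_real pi * m / 2) * cos (of_real pi * m / 2)" using sin_double[of "of_real pi * m / 2"] by simp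
  then show "sin (of_real pi * m / 2) \<noteq> 0" "cos (of_real pi * m / 2) \<noteq> 0" using sin_pi_neq_0[OF assms] by auto
qed

text \<open>The reflection formula for the Gamma function, applied to numerator and denominator of \<open>rhat\<close>, produces the square of
  a tangent, which is the same for all terms of \<open>T\<close> because their arguments differ by even integers.\<close>
lemma fhat_reflect:
  assumes "m \<notin> \<int>" shows "fhat (1 - m) = (tan (of_real pi * m / 2))\<^sup>2 * phi m"
proof -
  define S where "S = sin (of_real pi * m / 2)"
  define C where "C = cos (of_real pi * m / 2)"
  have SC: "S \<noteq> 0" "C \<noteq> 0" using sin_cos_half_complex[OF assms] by (simp_all add: S_def C_def)
  define A where "A = Gamma (m/2)"
  define B where "B = Gamma ((1 + m)/2)"
  have AB: "A \<noteq> 0" "B \<noteq> 0" using half_Ints[OF assms] nonpos_Ints_subset_Ints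
    by (auto simp: A_def B_def Gamma_eq_zero_iff)
  have 1: "Gamma (1 - m/2) = of_real pi / (S * A)"
    using Gamma_reflection_complex[of "m/2"] AB SC by (simp add: S_def A_def field_simps)
  have 2: "Gamma ((1 - m)/2) = of_real pi / (C * B)"
  proof -
    have "1 - (1 + m)/2 = (1 - m)/2" by (simp add: field_simps)
    moreover have "sin (of_real pi * ((1 + m)/2)) = C"
    proof -
      have *: "of_real pi * ((1 + m)/2) = of_real (pi/2) + of_real pi * m / 2" by (simp add: field_simps)
      show ?thesis unfolding * sin_add sin_of_real cos_of_real sin_pi_half cos_pi_half C_def by simp
    qed
    ultimately show ?thesis using Gamma_reflection_complex[of "(1+m)/2"] AB SC by (simp add: B_def field_simps)
  qed
  have h: "(1 + (1 - m))/2 = 1 - m/2" by (simp add: field_simps)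
  have m: "m \<noteq> 0" "m \<noteq> 1" using assms by auto
  have r: "rhat (1 - m) = (1 - m) * (S / C * (A / B))\<^sup>2"
    unfolding rhat_def h 1 2 using AB SC by (simp add: field_simps)
  have gen: "- ((2 * (1 - m) - 1) * ((1 - m) * X)) / (4 * (1 - m)\<^sup>2 * (1 - m - 1)) = (2 * m - 1) * (m * X) / (4 * m\<^sup>2 * (m - 1))" for X
  proof -
    define u where "u = m - 1"
    define v where "v = 2 * m - 1"
    have e: "1 - m = - u" "2 * (- u) - 1 = - v" "- u - 1 = - m" by (simp_all add: u_def v_def)
    have "u \<noteq> 0" using m by (simp add: u_def)
    then show ?thesis unfolding e u_def[symmetric] v_def[symmetric] using m by (simp add: field_simps power2_eq_square)
  qed
  have regroup: "K * (m * (x * y)) / D = x * (K * (m * y) / D)" for K x y D :: complex by (simp add: mult_ac)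
  show ?thesis unfolding fhat_def r gen unfolding phi_def rhat_def tan_def S_def[symmetric] C_def[symmetric] A_def[symmetric] B_def[symmetric]
      power_mult_distrib[of "S / C"] by (rule regroup)
qed

lemma tan_shift: "(tan (of_real pi * (2 - s + 2 * of_nat k) / 2))\<^sup>2 = (tan (of_real pi * s / 2 :: complex))\<^sup>2"
proof -
  have e: "of_real pi * (2 - s + 2 * of_nat k) / 2 = - (of_real pi * s / 2) + of_nat (Suc k) * (of_real pi :: complex)"
    by (simp add: field_simps)
  have sc: "sin (x + of_nat n * (of_real pi :: complex)) = (-1)^n * sin x \<and> cos (x + of_nat n * (of_real pi :: complex)) = (-1)^n * cos x" for x n
  proof (induction n)
    case (Suc n)
    have "x + of_nat (Suc n) * (of_real pi :: complex) = (x + of_nat n * of_real pi) + of_real pi" by (simp add: algebra_simps)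
    then show ?case using Suc by (simp add: sin_add cos_add sin_of_real cos_of_real)
  qed simp
  show ?thesis unfolding e tan_def sc[THEN conjunct1] sc[THEN conjunct2] by (simp add: power_divide power_mult_distrib)
qed

lemma Tfun_phi:
  assumes "s \<notin> \<int>" shows "Tfun s = (\<Sum>k. (tan (of_real pi * s / 2))\<^sup>2 * phi (2 - s + 2 * of_nat k))"
proof -
  have "fhat (s - 1 - 2 * of_nat k) = (tan (of_real pi * s / 2))\<^sup>2 * phi (2 - s + 2 * of_nat k)" for k
  proof -
    have "2 - s + 2 * of_nat k \<notin> (\<int> :: complex set)"
    proof
      assume "2 - s + 2 * of_nat k \<in> \<int>"
      then have "(2 + 2 * of_nat k) - (2 - s + 2 * of_nat k) \<in> \<int>" by (intro Ints_diff Ints_add Ints_mult) auto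
      with assms show False by simp
    qed
    from fhat_reflect[OF this] show ?thesis unfolding tan_shift by (simp add: algebra_simps)
  qed
  then show ?thesis unfolding Tfun_def by simp
qed

lemma phi_real:
  assumes "m > 2"
  shows "phi (of_real m) = of_real ((2 * m - 1) / (2 * m\<^sup>2 * (m - 1)) * (sinint (m - 1) / sinint m))"
proof -
  have "rhat (of_real m) = of_real (2 * (sinint (m - 1) / sinint m))"
  proof -
    have e: "of_real m / 2 = complex_of_real (m/2)" "(1 + of_real m)/2 = complex_of_real ((m+1)/2)" by simp_all
    have "rhat (of_real m) = of_real (m * (Gamma (m/2) / Gamma ((m+1)/2))\<^sup>2)"
      unfolding rhat_def e Gamma_complex_of_real by simp
    also have "m * (Gamma (m/2) / Gamma ((m+1)/2))\<^sup>2 = 2 * (sinint (m - 1) / sinint m)"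
      unfolding sinint_ratio[OF assms] by simp
    finally show ?thesis .
  qed
  then have "phi (of_real m) = of_real ((2 * m - 1) * (2 * (sinint (m - 1) / sinint m)) / (4 * m\<^sup>2 * (m - 1)))"
    unfolding phi_def by simp
  also have "(2 * m - 1) * (2 * (sinint (m - 1) / sinint m)) / (4 * m\<^sup>2 * (m - 1)) = (2 * m - 1) / (2 * m\<^sup>2 * (m - 1)) * (sinint (m - 1) / sinint m)"
    by (simp add: mult_ac)
  finally show ?thesis .
qed

text \<open>By the ratio formula for the weights the terms \<open>phi\<close> are those of the telescoped series for \<open>lam * ph\<close>.\<close>
lemma Tfun_neg:
  assumes \<nu>: "\<nu> > 0" "\<nu> \<notin> \<int>"
  shows "Tfun (- of_real \<nu>) = of_real ((tan (pi * \<nu> / 2))\<^sup>2 * (lamphint \<nu> / sinint \<nu>) / 2)"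
proof -
  have "- complex_of_real \<nu> \<notin> \<int>" using \<nu>(2) by (simp add: minus_in_Ints_iff)
  note T = Tfun_phi[OF this]
  have "(\<lambda>k. 1/2 * ((2 * (\<nu> + 2 * real k) + 3) / ((\<nu> + 2 * real k + 1) * (\<nu> + 2 * real k + 2)^2) *
       (sinint (\<nu> + 2 * real k + 1) / sinint (\<nu> + 2 * real k + 2)))) sums (1/2 * (lamphint \<nu> / sinint \<nu>))"
    by (rule sums_mult[OF lamph_mean_sums[OF \<nu>(1)]])
  then have "(\<lambda>k. (tan (pi * \<nu> / 2))\<^sup>2 * (1/2 * ((2 * (\<nu> + 2 * real k) + 3) / ((\<nu> + 2 * real k + 1) * (\<nu> + 2 * real k + 2)^2) *
       (sinint (\<nu> + 2 * real k + 1) / sinint (\<nu> + 2 * real k + 2))))) sums ((tan (pi * \<nu> / 2))\<^sup>2 * (1/2 * (lamphint \<nu> / sinint \<nu>)))"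
    by (rule sums_mult)
  then have L: "(\<lambda>k. complex_of_real ((tan (pi * \<nu> / 2))\<^sup>2 * (1/2 * ((2 * (\<nu> + 2 * real k) + 3) / ((\<nu> + 2 * real k + 1) * (\<nu> + 2 * real k + 2)^2) *
       (sinint (\<nu> + 2 * real k + 1) / sinint (\<nu> + 2 * real k + 2)))))) sums of_real ((tan (pi * \<nu> / 2))\<^sup>2 * (1/2 * (lamphint \<nu> / sinint \<nu>)))"
    by (rule sums_of_real)
  have eq: "complex_of_real ((tan (pi * \<nu> / 2))\<^sup>2 * (1/2 * ((2 * (\<nu> + 2 * real k) + 3) / ((\<nu> + 2 * real k + 1) * (\<nu> + 2 * real k + 2)^2) *
       (sinint (\<nu> + 2 * real k + 1) / sinint (\<nu> + 2 * real k + 2))))) = (tan (of_real pi * (- of_real \<nu>) / 2))\<^sup>2 * phi (2 - (- of_real \<nu>) + 2 * of_nat k)" for k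
  proof -
    define m where "m = \<nu> + 2 * real k + 2"
    have m2: "m > 2" using \<nu> unfolding m_def by (simp add: add_pos_nonneg)
    have e: "2 * (\<nu> + 2 * real k) + 3 = 2 * m - 1" "\<nu> + 2 * real k + 1 = m - 1" "\<nu> + 2 * real k + 2 = m" by (simp_all add: m_def)
    have a: "2 - (- of_real \<nu>) + 2 * of_nat k = complex_of_real m" by (simp add: m_def)
    have b: "tan (of_real pi * (- of_real \<nu>) / 2) = complex_of_real (- tan (pi * \<nu> / 2))"
    proof -
      have "of_real pi * (- of_real \<nu>) / 2 = complex_of_real (- (pi * \<nu> / 2))" by simp
      then show ?thesis by (simp only: tan_of_real[symmetric] tan_minus)
    qed
    have c: "1/2 * ((2 * m - 1) / ((m - 1) * m^2) * (sinint (m - 1) / sinint m)) = (2 * m - 1) / (2 * m\<^sup>2 * (m - 1)) * (sinint (m - 1) / sinint m)"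
      by (simp add: mult_ac)
    show ?thesis unfolding e a b c phi_real[OF m2] by simp
  qed
  show ?thesis unfolding T using sums_unique[OF L, symmetric] unfolding eq by (simp add: mult_ac)
qed

lemma Cfun_neg: assumes \<nu>: "\<nu> > 0" "\<nu> \<notin> \<int>" shows "Cfun (- of_real \<nu>) = 0"
proof -
  have sc: "cos (pi * \<nu> / 2) \<noteq> 0" "sin (pi * \<nu> / 2) \<noteq> 0" using cos_half_neq_0[OF \<nu>(2)] by auto
  have "cot (of_real pi * (- of_real \<nu>) / 2) = complex_of_real (- cot (pi * \<nu> / 2))"
  proof -
    have "of_real pi * (- of_real \<nu>) / 2 = complex_of_real (- (pi * \<nu> / 2))" by simp
    then show ?thesis by (simp only: cot_of_real[symmetric] cot_minus)
  qed
  note ct = this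
  define A where "A = (lam2int \<nu> / sinint \<nu> - ph2int \<nu> / sinint \<nu>) / 4"
  define R where "R = lamphint \<nu> / sinint \<nu>"
  have "Cfun (- of_real \<nu>) = of_real (((A + tan (pi * \<nu> / 2) * R / 2) - A) + (- cot (pi * \<nu> / 2)) * ((tan (pi * \<nu> / 2))\<^sup>2 * R / 2))"
    unfolding Cfun_def cotT_def Qfun_neg[OF \<nu>(1) sc(1)] Qrat_neg[OF \<nu>(1)] Tfun_neg[OF \<nu>] ct A_def[symmetric] R_def[symmetric]
    by (simp only: of_real_add of_real_diff of_real_mult)
  also have "((A + tan (pi * \<nu> / 2) * R / 2) - A) + (- cot (pi * \<nu> / 2)) * ((tan (pi * \<nu> / 2))\<^sup>2 * R / 2) = 0"
    using sc by (simp add: cot_def tan_def power2_eq_square)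
  finally show ?thesis by simp
qed

section \<open>Continuation to the complex plane\<close>

text \<open>The weights decrease in the exponent, and their successive ratios are the Gamma quotient.\<close>
lemma Gamma_ratio_real_le:
  assumes "m > 2" shows "(Gamma (m/2) / Gamma ((m+1)/2))\<^sup>2 \<le> 2 / (m - 1 :: real)"
proof -
  have pos: "sinint m > 0" using assms by (intro sinint_pos) auto
  have "sinint (m - 1) \<le> sinint (m - 2)"
    unfolding sinint_def
  proof (rule integral_le)
    show "(\<lambda>\<theta>. sin \<theta> powr (m - 1)) integrable_on {0..pi}" "(\<lambda>\<theta>. sin \<theta> powr (m - 2)) integrable_on {0..pi}"
      using assms by (auto intro!: integrable_continuous_real continuous_sin_powr)
    show "sin \<theta> powr (m - 1) \<le> sin \<theta> powr (m - 2)" if "\<theta> \<in> {0..pi}" for \<theta>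
      using sin_powr_Suc[OF that, of "m - 2"] by (simp add: mult_left_le)
  qed
  also have "sinint (m - 2) = m / (m - 1) * sinint m"
    using sinint_rec[of "m - 2"] assms by (simp add: field_simps)
  finally have "sinint (m - 1) / sinint m \<le> m / (m - 1)" using pos by (simp add: divide_le_eq)
  then have "m / 2 * (Gamma (m/2) / Gamma ((m+1)/2))\<^sup>2 \<le> m / (m - 1)" unfolding sinint_ratio[OF assms] .
  then have "m * (Gamma (m/2) / Gamma ((m+1)/2))\<^sup>2 \<le> m * (2 / (m - 1))" by simp
  then show ?thesis by (rule mult_left_le_imp_le) (use assms in simp)
qed

text \<open>Factor by factor in Gauss's product the complex ratio is dominated by the one at the real part.\<close>
lemma Gamma_ratio_complex_le:
  assumes x: "Re z > 0"
  shows "norm (Gamma z / Gamma (z + 1/2)) \<le> Gamma (Re z) / Gamma (Re z + 1/2)"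
proof -
  have step: "norm ((z + 1/2 + of_nat k) / (z + of_nat k)) \<le> (Re z + 1/2 + real k) / (Re z + real k)" for k
  proof -
    have p: "Re z + real k > 0" using x by (intro add_pos_nonneg) auto
    have n: "norm (z + of_nat k) \<ge> Re z + real k" using complex_Re_le_cmod[of "z + of_nat k"] by simp
    have "z + of_nat k \<noteq> 0" using n p by auto
    moreover have "(w + 1/2) / w = 1 + (1/2) / w" if "w \<noteq> 0" for w :: complex using that by (simp add: add_divide_distrib)
    moreover have "z + 1/2 + of_nat k = (z + of_nat k) + 1/2" by simp
    ultimately have "(z + 1/2 + of_nat k) / (z + of_nat k) = 1 + (1/2) / (z + of_nat k)" by metis
    then have "norm ((z + 1/2 + of_nat k) / (z + of_nat k)) \<le> 1 + norm ((1/2) / (z + of_nat k))"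
      using norm_triangle_ineq[of 1 "(1/2) / (z + of_nat k)"] by simp
    also have "norm ((1/2) / (z + of_nat k)) \<le> (1/2) / (Re z + real k)"
      unfolding norm_divide using n p by (intro frac_le) auto
    also have "1 + (1/2) / (Re z + real k) = (Re z + 1/2 + real k) / (Re z + real k)" using p by (simp add: field_simps)
    finally show ?thesis by simp
  qed
  have alg: "(f * a / p) / (f * b / q) = (a / b) * (q / p)" if "f \<noteq> 0" for f a b p q :: "'z :: field"
    using that by simp
  have eqc: "Gamma_series z n / Gamma_series (z + 1/2) n = exp (- (of_real (ln (real n)) / 2)) * (\<Prod>k=0..n. (z + 1/2 + of_nat k) / (z + of_nat k))" for n
  proof -
    have "exp (z * of_real (ln (real n))) / exp ((z + 1/2) * of_real (ln (real n))) = exp (- (of_real (ln (real n)) / 2))"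
      unfolding exp_diff[symmetric] by (rule arg_cong[where f = exp]) (simp add: algebra_simps)
    then show ?thesis unfolding Gamma_series_def pochhammer_prod alg[OF fact_nonzero] prod_dividef
      by (simp only: Suc_eq_plus1[symmetric] atLeastLessThanSuc_atLeastAtMost)
  qed
  have eqr: "Gamma_series (Re z) n / Gamma_series (Re z + 1/2) n = exp (- (ln (real n) / 2)) * (\<Prod>k=0..n. (Re z + 1/2 + real k) / (Re z + real k))" for n
  proof -
    have "exp (Re z * ln (real n)) / exp ((Re z + 1/2) * ln (real n)) = exp (- (ln (real n) / 2))"
      unfolding exp_diff[symmetric] by (rule arg_cong[where f = exp]) (simp add: algebra_simps)
    then show ?thesis unfolding Gamma_series_def pochhammer_prod alg[OF fact_nonzero] prod_dividef
      by (simp only: Suc_eq_plus1[symmetric] atLeastLessThanSuc_atLeastAtMost of_real_def real_scaleR_def mult_1_right)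
  qed
  have nz: "Gamma (z + 1/2) \<noteq> 0" "Gamma (Re z + 1/2) \<noteq> 0"
  proof -
    have "z + 1/2 \<notin> \<int>\<^sub>\<le>\<^sub>0" "Re z + 1/2 \<notin> \<int>\<^sub>\<le>\<^sub>0" using x by (auto elim!: nonpos_Ints_cases simp: complex_eq_iff)
    then show "Gamma (z + 1/2) \<noteq> 0" "Gamma (Re z + 1/2) \<noteq> 0" by (simp_all only: Gamma_eq_zero_iff not_False_eq_True)
  qed
  have 1: "(\<lambda>n. norm (Gamma_series z n / Gamma_series (z + 1/2) n)) \<longlonglongrightarrow> norm (Gamma z / Gamma (z + 1/2))"
    by (intro tendsto_norm tendsto_divide Gamma_series_LIMSEQ nz)
  have 2: "(\<lambda>n. Gamma_series (Re z) n / Gamma_series (Re z + 1/2) n) \<longlonglongrightarrow> Gamma (Re z) / Gamma (Re z + 1/2)"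
    by (intro tendsto_divide Gamma_series_LIMSEQ nz)
  show ?thesis
  proof (rule LIMSEQ_le[OF 1 2], rule exI[of _ 0], intro allI impI)
    fix n :: nat
    have "norm (exp (- (complex_of_real (ln (real n)) / 2))) = exp (- (ln (real n) / 2))" by simp
    moreover have "norm (\<Prod>k=0..n. (z + 1/2 + of_nat k) / (z + of_nat k)) \<le> (\<Prod>k=0..n. (Re z + 1/2 + real k) / (Re z + real k))"
      unfolding prod_norm[symmetric] by (intro prod_mono conjI norm_ge_zero step)
    ultimately show "norm (Gamma_series z n / Gamma_series (z + 1/2) n) \<le> Gamma_series (Re z) n / Gamma_series (Re z + 1/2) n"
      unfolding eqc eqr norm_mult by (intro mult_mono) auto
  qed
qed

text \<open>Quadratic decay to the right gives locally uniform convergence of the series for \<open>T\<close>.\<close>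
lemma phi_bound:
  assumes m: "Re m > 2" shows "norm (phi m) \<le> (3/2) / (Re m - 1)\<^sup>2"
proof -
  have n: "norm m \<ge> Re m" "norm (m - 1) \<ge> Re m - 1"
    using complex_Re_le_cmod[of m] complex_Re_le_cmod[of "m - 1"] by auto
  have G: "(norm (Gamma (m/2) / Gamma ((1+m)/2)))\<^sup>2 \<le> 2 / (Re m - 1)"
  proof -
    have "norm (Gamma (m/2) / Gamma (m/2 + 1/2)) \<le> Gamma (Re (m/2)) / Gamma (Re (m/2) + 1/2)"
      using m by (intro Gamma_ratio_complex_le) auto
    moreover have "m/2 + 1/2 = (1+m)/2" "Re (m/2) = Re m / 2" "Re m / 2 + 1/2 = (Re m + 1)/2" by (simp_all add: field_simps)
    ultimately have "norm (Gamma (m/2) / Gamma ((1+m)/2)) \<le> Gamma (Re m / 2) / Gamma ((Re m + 1)/2)" by simp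
    then have "(norm (Gamma (m/2) / Gamma ((1+m)/2)))\<^sup>2 \<le> (Gamma (Re m / 2) / Gamma ((Re m + 1)/2))\<^sup>2" by (intro power_mono) auto
    also have "\<dots> \<le> 2 / (Re m - 1)" by (rule Gamma_ratio_real_le[OF m])
    finally show ?thesis .
  qed
  have a: "norm (2 * m - 1) \<le> 3 * norm m" using norm_triangle_ineq4[of "2 * m" 1] n m by (simp add: norm_mult)
  have "norm (phi m) = norm (2 * m - 1) * (norm m * (norm (Gamma (m/2) / Gamma ((1+m)/2)))\<^sup>2) / (4 * (norm m)\<^sup>2 * norm (m - 1))"
    unfolding phi_def rhat_def by (simp add: norm_mult norm_divide norm_power)
  also have "\<dots> \<le> (3 * norm m) * (norm m * (2 / (Re m - 1))) / (4 * (norm m)\<^sup>2 * (Re m - 1))"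
  proof -
    have p: "norm m > 0" "Re m - 1 > 0" using n m by linarith+
    then have "0 < 4 * (norm m)\<^sup>2 * (Re m - 1)" by (intro mult_pos_pos) auto
    then show ?thesis using p n by (intro frac_le mult_mono a G) auto
  qed
  also have "\<dots> = (3/2) / (Re m - 1)\<^sup>2"
  proof -
    have "norm m > 0" "Re m - 1 > 0" using n m by linarith+
    moreover have "(3 * N) * (N * (2 / R)) / (4 * N\<^sup>2 * R) = (3/2) / R\<^sup>2" if "N > 0" "R > 0" for N R :: real
      using that by (simp add: field_simps power2_eq_square)
    ultimately show ?thesis by blast
  qed
  finally show ?thesis .
qed

lemma phi_summable_bound: "summable (\<lambda>k. (3/2) / (1 + 2 * real k)\<^sup>2)"
proof (rule summable_comparison_test')
  show "summable (\<lambda>k. (3/2) * inverse ((1 + real k)^2))"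
    using Polygamma_converges'[of "1::real" 2] by (intro summable_mult) auto
  show "norm ((3/2) / (1 + 2 * real k)\<^sup>2) \<le> (3/2) * inverse ((1 + real k)^2)" for k
    unfolding divide_inverse by (auto intro!: mult_left_mono le_imp_inverse_le power_mono)
qed

lemma phi_holomorphic:
  assumes "\<And>m. m \<in> A \<Longrightarrow> m/2 \<notin> \<int>\<^sub>\<le>\<^sub>0" "\<And>m. m \<in> A \<Longrightarrow> m \<noteq> 1"
  shows "phi holomorphic_on A"
proof -
  have eq: "phi = (\<lambda>m. (2 * m - 1) * (m * (Gamma (m/2) * rGamma ((1+m)/2))\<^sup>2) / (4 * m\<^sup>2 * (m - 1)))"
    by (rule ext) (simp only: phi_def rhat_def rGamma_inverse_Gamma divide_inverse[of "Gamma _"])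
  have g: "(\<lambda>m. Gamma (m/2)) holomorphic_on A"
    by (rule holomorphic_Gamma') (use assms(1) in \<open>auto intro!: holomorphic_intros\<close>)
  have "m \<noteq> 0" if "m \<in> A" for m using assms(1)[OF that] by auto
  then have "4 * m\<^sup>2 * (m - 1) \<noteq> 0" if "m \<in> A" for m using assms(2)[OF that] that by simp
  then show ?thesis unfolding eq
    by (intro holomorphic_on_divide holomorphic_on_mult holomorphic_on_power holomorphic_on_diff
          holomorphic_on_const holomorphic_on_ident g holomorphic_rGamma' holomorphic_on_add) auto
qed

definition phisum :: "complex \<Rightarrow> complex" where "phisum m = (\<Sum>k. phi (m + 2 * of_nat k))"

lemma phi_shift_bound: assumes "Re m > 2" shows "norm (phi (m + 2 * of_nat k)) \<le> (3/2) / (1 + 2 * real k)\<^sup>2"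
proof -
  have "norm (phi (m + 2 * of_nat k)) \<le> (3/2) / (Re (m + 2 * of_nat k) - 1)\<^sup>2"
    using assms by (intro phi_bound) (simp add: add_pos_nonneg)
  also have "\<dots> \<le> (3/2) / (1 + 2 * real k)\<^sup>2"
    using assms by (intro divide_left_mono power_mono mult_pos_pos zero_less_power) (auto simp: add_pos_nonneg)
  finally show ?thesis .
qed

lemma phi_shift_summable: assumes "Re m > 2" shows "summable (\<lambda>k. phi (m + 2 * of_nat k))"
  by (rule summable_comparison_test'[OF phi_summable_bound]) (rule phi_shift_bound[OF assms])

lemma phisum_holomorphic: "phisum holomorphic_on {m. Re m > 2}"
  unfolding phisum_def[abs_def]
proof (rule holomorphic_uniform_sequence)
  show "open {m. Re m > 2}" by (rule open_halfspace_Re_gt)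
  show "(\<lambda>m. \<Sum>k<n. phi (m + 2 * of_nat k)) holomorphic_on {m. Re m > 2}" for n
  proof (intro holomorphic_on_sum)
    fix k
    have "phi holomorphic_on {m. Re m > 2}"
      by (rule phi_holomorphic) (auto elim!: nonpos_Ints_cases simp: complex_eq_iff)
    then have "(phi \<circ> (\<lambda>m. m + 2 * of_nat k)) holomorphic_on {m. Re m > 2}"
      by (intro holomorphic_on_compose_gen[of _ _ phi "{m. Re m > 2}"] holomorphic_intros) (auto simp: add_pos_nonneg)
    then show "(\<lambda>m. phi (m + 2 * of_nat k)) holomorphic_on {m. Re m > 2}" by (simp add: o_def)
  qed
  fix x assume "x \<in> {m. Re m > 2}"
  then obtain d where d: "d > 0" "cball x d \<subseteq> {m. Re m > 2}" using open_halfspace_Re_gt open_contains_cball by blast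
  have "uniform_limit (cball x d) (\<lambda>n m. \<Sum>k<n. phi (m + 2 * of_nat k)) (\<lambda>m. \<Sum>k. phi (m + 2 * of_nat k)) sequentially"
    by (rule Weierstrass_m_test[OF _ phi_summable_bound]) (use d phi_shift_bound in blast)
  with d show "\<exists>d>0. cball x d \<subseteq> {m. Re m > 2} \<and> uniform_limit (cball x d) (\<lambda>n m. \<Sum>k<n. phi (m + 2 * of_nat k)) (\<lambda>m. \<Sum>k. phi (m + 2 * of_nat k)) sequentially"
    by blast
qed

text \<open>Any given point is reached by a finite head of the series plus a tail holomorphic near it.\<close>
lemma Tfun_split:
  assumes "s \<notin> \<int>" "Re s < 2 * real N"
  shows "Tfun s = (tan (of_real pi * s / 2))\<^sup>2 * ((\<Sum>k<N. phi (2 - s + 2 * of_nat k)) + phisum (2 - s + 2 * of_nat N))"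
proof -
  have R: "Re (2 - s + 2 * of_nat N) > 2" using assms by simp
  have sh: "2 - s + 2 * of_nat N + 2 * of_nat k = 2 - s + 2 * of_nat (k + N)" for k by (simp add: algebra_simps)
  have s1: "summable (\<lambda>k. phi (2 - s + 2 * of_nat (k + N)))" using phi_shift_summable[OF R] unfolding sh .
  then have s: "summable (\<lambda>k. phi (2 - s + 2 * of_nat k))"
    using summable_iff_shift[of "\<lambda>k. phi (2 - s + 2 * of_nat k)" N] by blast
  have "Tfun s = (tan (of_real pi * s / 2))\<^sup>2 * (\<Sum>k. phi (2 - s + 2 * of_nat k))"
    unfolding Tfun_phi[OF assms(1)] by (rule suminf_mult[OF s])
  also have "(\<Sum>k. phi (2 - s + 2 * of_nat k)) = phisum (2 - s + 2 * of_nat N) + (\<Sum>k<N. phi (2 - s + 2 * of_nat k))"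
    unfolding phisum_def sh by (rule suminf_split_initial_segment[OF s])
  finally show ?thesis by (simp add: add.commute)
qed

lemma not_Ints_shift: assumes "s \<notin> (\<int>::complex set)" shows "2 - s + 2 * of_nat k \<notin> \<int>"
proof
  assume "2 - s + 2 * of_nat k \<in> \<int>"
  then have "(2 + 2 * of_nat k) - (2 - s + 2 * of_nat k) \<in> \<int>" by (intro Ints_diff Ints_add Ints_mult) auto
  with assms show False by simp
qed

lemma Tfun_holomorphic: "Tfun holomorphic_on (- \<int>)"
proof (subst holomorphic_on_open[OF open_compl_Ints], intro ballI)
  fix s :: complex assume s: "s \<in> - \<int>"
  \<comment> \<open>Enough terms of the series are split off for the tail to be evaluated to the right of 2.\<close>
  obtain N where N: "Re s < 2 * real N" 
  proof -
    obtain n :: nat where "Re s < real n" using reals_Archimedean2 by blast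
    then have "Re s < 2 * real n" by linarith
    then show ?thesis by (rule that)
  qed
  define U where "U = - \<int> \<inter> {s. Re s < 2 * real N}"
  have U: "open U" "s \<in> U" unfolding U_def using s N by (auto intro: open_Int open_compl_Ints open_halfspace_Re_lt)
  have ph: "phi holomorphic_on (- \<int>)"
  proof (rule phi_holomorphic)
    show "m / 2 \<notin> \<int>\<^sub>\<le>\<^sub>0" if "m \<in> - \<int>" for m :: complex using half_Ints(1)[of m] that nonpos_Ints_subset_Ints by auto
  qed auto
  have hp: "(\<lambda>s. phi (2 - s + 2 * of_nat k)) holomorphic_on U" for k
  proof -
    have "(phi \<circ> (\<lambda>s. 2 - s + 2 * of_nat k)) holomorphic_on U"
      by (intro holomorphic_on_compose_gen[OF _ ph] holomorphic_intros) (use not_Ints_shift in \<open>auto simp: U_def\<close>)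
    then show ?thesis by (simp add: o_def)
  qed
  have hs: "(\<lambda>s. phisum (2 - s + 2 * of_nat N)) holomorphic_on U"
  proof -
    have "(phisum \<circ> (\<lambda>s. 2 - s + 2 * of_nat N)) holomorphic_on U"
      by (intro holomorphic_on_compose_gen[OF _ phisum_holomorphic] holomorphic_intros) (auto simp: U_def)
    then show ?thesis by (simp add: o_def)
  qed
  have "(\<lambda>s. (sin (of_real pi * s / 2) / cos (of_real pi * s / 2))\<^sup>2 * ((\<Sum>k<N. phi (2 - s + 2 * of_nat k)) + phisum (2 - s + 2 * of_nat N))) holomorphic_on U"
    by (intro holomorphic_intros hp hs) (use sin_cos_half_complex in \<open>auto simp: U_def\<close>)
  then have "Tfun holomorphic_on U"
    by (rule holomorphic_transform) (use Tfun_split[of _ N] in \<open>auto simp: U_def tan_def\<close>)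
  then show "\<exists>f'. (Tfun has_field_derivative f') (at s)" using U holomorphic_on_open by blast
qed

lemma cotT_holomorphic: "cotT holomorphic_on (- \<int>)"
  unfolding cotT_def[abs_def] cot_def
  by (intro holomorphic_intros Tfun_holomorphic) (use sin_cos_half_complex in auto)

lemma half_shift_not_Ints:
  assumes "s \<notin> (\<int> :: complex set)" shows "(1 - s)/2 \<notin> \<int>" "1 - s/2 \<notin> \<int>"
proof -
  have e: "1 - 2 * ((1 - s)/2) = s" "2 - 2 * (1 - s/2) = s" by (simp_all add: field_simps)
  show "(1 - s)/2 \<notin> \<int>"
  proof
    assume "(1 - s)/2 \<in> \<int>"
    then have "1 - 2 * ((1 - s)/2) \<in> \<int>" by (intro Ints_diff Ints_mult) auto
    with assms e show False by metis
  qed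
  show "1 - s/2 \<notin> \<int>"
  proof
    assume "1 - s/2 \<in> \<int>"
    then have "2 - 2 * (1 - s/2) \<in> \<int>" by (intro Ints_diff Ints_mult) auto
    with assms e show False by metis
  qed
qed

lemma Qrat_holomorphic: "Qrat holomorphic_on (- \<int>)"
proof -
  have "(1 - s)/2 \<notin> \<int>\<^sub>\<le>\<^sub>0" "1 - s/2 \<notin> \<int>\<^sub>\<le>\<^sub>0" if "s \<notin> \<int>" for s :: complex
    using half_shift_not_Ints[OF that] nonpos_Ints_subset_Ints by auto
  note n = this
  have P: "Polygamma 1 holomorphic_on (- \<int>\<^sub>\<le>\<^sub>0)" by (rule holomorphic_on_Polygamma) auto
  have "(Polygamma 1 \<circ> (\<lambda>s. (1 - s)/2)) holomorphic_on (- \<int>)" "(Polygamma 1 \<circ> (\<lambda>s. 1 - s/2)) holomorphic_on (- \<int>)"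
    by (intro holomorphic_on_compose_gen[OF _ P] holomorphic_intros; use n in auto)+
  then show ?thesis unfolding Qrat_def[abs_def] o_def by (intro holomorphic_intros)
qed

lemma islimpt_neg_reals: "(- 3/2 :: complex) islimpt ((\<lambda>\<nu>. - of_real \<nu>) ` {1<..<2})"
  unfolding islimpt_approachable
proof (intro allI impI)
  fix e :: real assume e: "e > 0"
  define \<nu> where "\<nu> = 3/2 + min (e/2) (1/4)"
  have "\<nu> \<in> {1<..<2}" "\<nu> \<noteq> 3/2" using e by (auto simp: \<nu>_def min_def)
  moreover have "dist (- of_real \<nu>) (- 3/2 :: complex) < e"
  proof -
    have "(- of_real \<nu>) - (- 3/2 :: complex) = of_real (3/2 - \<nu>)" by simp
    then have "dist (- of_real \<nu>) (- 3/2 :: complex) = \<bar>3/2 - \<nu>\<bar>" by (simp only: dist_norm norm_of_real)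
    then show ?thesis using e by (simp add: \<nu>_def)
  qed
  moreover have "- of_real \<nu> \<noteq> (- 3/2 :: complex)"
  proof
    assume "- of_real \<nu> = (- 3/2 :: complex)"
    then have "Re (- of_real \<nu>) = Re (- 3/2)" by (rule arg_cong)
    with \<open>\<nu> \<noteq> 3/2\<close> show False by simp
  qed
  ultimately show "\<exists>x'\<in>(\<lambda>\<nu>. - of_real \<nu>) ` {1<..<2}. x' \<noteq> - 3/2 \<and> dist x' (- 3/2 :: complex) < e" by blast
qed

lemma between_not_Ints: assumes "1 < \<nu>" "\<nu> < (2::real)" shows "\<nu> \<notin> \<int>"
  using assms by (auto elim!: Ints_cases)

text \<open>The complement of the integers is connected, and \<open>-3/2\<close> is an accumulation point of the interval where the functions agree.\<close>
lemma identity_compl_Ints: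
  assumes f: "f holomorphic_on (- \<int>)" and g: "g holomorphic_on (- \<int>)"
    and eq: "\<And>\<nu>. 1 < \<nu> \<Longrightarrow> \<nu> < 2 \<Longrightarrow> f (- of_real \<nu>) = g (- of_real \<nu>)" and s: "s \<notin> \<int>"
  shows "f s = g s"
proof -
  have h: "(\<lambda>s. f s - g s) holomorphic_on (- \<int>)" by (intro holomorphic_intros f g)
  have "- 3/2 \<notin> (\<int> :: complex set)"
    using between_not_Ints[of "3/2"] of_real_in_Ints_iff[of "3/2", where 'a = complex] by (simp add: minus_in_Ints_iff)
  then have x: "- 3/2 \<in> - (\<int> :: complex set)" by simp
  have n: "- of_real \<nu> \<notin> (\<int> :: complex set)" if "\<nu> \<in> {1<..<2}" for \<nu> :: real
    unfolding minus_in_Ints_iff of_real_in_Ints_iff using between_not_Ints that by auto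
  have sub: "(\<lambda>\<nu>. - of_real \<nu>) ` {1<..<2} \<subseteq> - (\<int> :: complex set)" using n by blast
  have z: "f w - g w = 0" if "w \<in> (\<lambda>\<nu>. - of_real \<nu>) ` {1<..<2}" for w using that eq by auto
  have "s \<in> - \<int>" using s by simp
  from analytic_continuation[OF h open_compl_Ints connected_compl_Ints sub x islimpt_neg_reals z this]
  have "f s - g s = 0" .
  then show ?thesis by simp
qed

lemma Kfun0_formula_neg:
  assumes \<nu>: "\<nu> > 1"
  shows "Kfun0 (- of_real \<nu>) = cos (of_real pi * (- of_real \<nu>) / 2) * exp (- (- of_real \<nu>) * of_real (ln 2)) / of_real (sqrt pi)
           * Gamma ((1 - (- of_real \<nu>))/2) * rGamma (1 - (- of_real \<nu>)/2)" (is "_ = ?c * ?e / _ * ?g * ?h")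
proof -
  have "sqrt pi * G / R / pi = G * inverse R / sqrt pi" for G R :: real
    using sqrt_divide_self_eq[of pi] by (simp add: divide_inverse mult_ac)
  then have si: "sinint \<nu> / pi = Gamma ((\<nu> + 1)/2) * rGamma (\<nu>/2 + 1) / sqrt pi"
    unfolding sinint_Gamma[OF \<nu>(1)] rGamma_inverse_Gamma by blast
  have "2 powr \<nu> = exp (\<nu> * ln 2)" by (simp add: powr_def)
  moreover have "c * p * (si / pi) = c * p / q * G * R" if "si / pi = G * R / q" for c p q G R si :: real
    unfolding that by simp
  ultimately have e: "cos (pi * \<nu> / 2) * 2 powr \<nu> * sinint \<nu> / pi = cos (pi * \<nu> / 2) * exp (\<nu> * ln 2) / sqrt pi * Gamma ((\<nu> + 1)/2) * rGamma (\<nu>/2 + 1)"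
    using si by (metis times_divide_eq_right)
  have K: "Kfun0 (- of_real \<nu>) = of_real (cos (pi * \<nu> / 2) * exp (\<nu> * ln 2) / sqrt pi * Gamma ((\<nu> + 1)/2) * rGamma (\<nu>/2 + 1))"
    unfolding e[symmetric] by (rule Kfun0_neg) (use \<nu> in simp)
  have "of_real pi * (- of_real \<nu>) / 2 = complex_of_real (- (pi * \<nu> / 2))" by simp
  then have "?c = complex_of_real (cos (- (pi * \<nu> / 2)))" by (simp only: cos_of_real)
  then have c: "?c = complex_of_real (cos (pi * \<nu> / 2))" by (simp only: cos_minus)
  have "- (- complex_of_real \<nu>) * of_real (ln 2) = of_real (\<nu> * ln 2)" by simp
  then have e: "?e = complex_of_real (exp (\<nu> * ln 2))" by (simp only: exp_of_real)
  have "(1 - (- complex_of_real \<nu>))/2 = of_real ((\<nu> + 1)/2)" "1 - (- complex_of_real \<nu>)/2 = of_real (\<nu>/2 + 1)" by simp_all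
  then have g: "?g = complex_of_real (Gamma ((\<nu> + 1)/2))" "?h = complex_of_real (rGamma (\<nu>/2 + 1))"
    by (simp_all only: Gamma_complex_of_real rGamma_complex_of_real)
  show ?thesis unfolding K c e g by (simp only: of_real_mult of_real_divide)
qed

text \<open>The evaluation of \<open>K\<^sub>0\<close> by Gamma functions, of interest here because it exhibits that there are no zeros off the integers.\<close>
lemma Kfun0_formula:
  assumes "s \<notin> \<int>"
  shows "Kfun0 s = cos (of_real pi * s / 2) * exp (- s * of_real (ln 2)) / of_real (sqrt pi) * Gamma ((1 - s)/2) * rGamma (1 - s/2)"
proof -
  define g where "g = (\<lambda>s::complex. cos (of_real pi * s / 2) * exp (- s * of_real (ln 2)) / of_real (sqrt pi) * Gamma ((1 - s)/2) * rGamma (1 - s/2))"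
  have 1: "Kfun0 holomorphic_on - \<int>" using Kfun0_holomorphic by (rule holomorphic_on_subset) auto
  have "(1 - s)/2 \<notin> \<int>\<^sub>\<le>\<^sub>0" if "s \<notin> \<int>" for s :: complex
    using half_shift_not_Ints[OF that] nonpos_Ints_subset_Ints by auto
  then have 2: "g holomorphic_on - \<int>"
    unfolding g_def by (intro holomorphic_intros) auto
  have 3: "Kfun0 (- of_real \<nu>) = g (- of_real \<nu>)" if "1 < \<nu>" "\<nu> < 2" for \<nu>
    unfolding g_def by (rule Kfun0_formula_neg[OF that(1)])
  have "Kfun0 s = g s" by (rule identity_compl_Ints[OF 1 2 3 assms])
  then show ?thesis unfolding g_def .
qed

lemma Kfun0_nonzero: assumes "s \<notin> \<int>" shows "Kfun0 s \<noteq> 0"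
proof -
  have "Gamma ((1 - s)/2) \<noteq> 0" "rGamma (1 - s/2) \<noteq> 0"
    using half_shift_not_Ints[OF assms] nonpos_Ints_subset_Ints by (auto simp: Gamma_eq_zero_iff rGamma_eq_zero_iff)
  then show ?thesis unfolding Kfun0_formula[OF assms] using sin_cos_half_complex[OF assms] by simp
qed

lemma Qfun_holomorphic: "Qfun holomorphic_on (- \<int>)"
  unfolding Qfun_def[abs_def]
  by (intro holomorphic_intros holomorphic_on_subset[OF Kfun2_holomorphic] holomorphic_on_subset[OF Kfun0_holomorphic]) (use Kfun0_nonzero in auto)

theorem Cfun_eq_0: assumes "s \<notin> \<int>" shows "Cfun s = 0"
proof (rule identity_compl_Ints[where f = Cfun and g = "\<lambda>_. 0", OF _ _ _ assms])
  show "Cfun holomorphic_on - \<int>" unfolding Cfun_def[abs_def]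
    by (intro holomorphic_intros Qfun_holomorphic Qrat_holomorphic cotT_holomorphic)
  show "(\<lambda>_. 0) holomorphic_on - \<int>" by (intro holomorphic_intros)
  show "Cfun (- of_real \<nu>) = 0" if "1 < \<nu>" "\<nu> < 2" for \<nu>
    using Cfun_neg[of \<nu>] between_not_Ints[OF that] that by simp
qed

section \<open>Euler integrals\<close>

lemma holomorphic_powr_exponent:
  fixes x :: complex shows "p holomorphic_on S \<Longrightarrow> (\<lambda>s. x powr p s) holomorphic_on S"
  by (cases "x = 0") (auto simp: powr_def intro!: holomorphic_intros)

definition betaint :: "complex \<Rightarrow> complex \<Rightarrow> real \<Rightarrow> complex" where
  "betaint b d t = of_real t powr (b - 1) * of_real (1 - t) powr (d - 1)"

lemma continuous_betaint:
  assumes "Re b > 1" "Re d > 1" shows "continuous_on {0..1} (betaint b d)"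
proof -
  have 1: "continuous_on {0..1} (\<lambda>t. of_real t powr (b - 1) :: complex)"
    by (rule continuous_on_compose2[OF continuous_on_powr_right_half[of "b - 1"]]) (use assms in \<open>auto intro!: continuous_intros\<close>)
  have 2: "continuous_on {0..1} (\<lambda>t. of_real (1 - t) powr (d - 1) :: complex)"
    by (rule continuous_on_compose2[OF continuous_on_powr_right_half[of "d - 1"]]) (use assms in \<open>auto intro!: continuous_intros\<close>)
  show ?thesis unfolding betaint_def[abs_def] by (rule continuous_on_mult[OF 1 2])
qed

lemma norm_betaint_le:
  assumes "Re b > 1" "Re d > 1" "t \<in> {0..1}" shows "norm (betaint b d t) \<le> 1"
proof -
  have p: "norm (of_real x powr z :: complex) \<le> 1" if "0 \<le> x" "x \<le> 1" "Re z > 0" for x :: real and z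
  proof -
    have "norm (of_real x powr z :: complex) = x powr Re z" using that by (simp add: norm_powr_real_powr)
    also have "\<dots> \<le> 1 powr Re z" using that by (intro powr_mono2) auto
    finally show ?thesis by simp
  qed
  have "norm (of_real t powr (b - 1) :: complex) * norm (of_real (1 - t) powr (d - 1) :: complex) \<le> 1 * 1"
    using assms by (intro mult_mono p) auto
  then show ?thesis unfolding betaint_def norm_mult by simp
qed

lemma betaint_holo:
  assumes U: "open U" and b: "b holomorphic_on U" and d: "d holomorphic_on U"
    and R: "\<And>x. x \<in> U \<Longrightarrow> Re (b x) > 1" "\<And>x. x \<in> U \<Longrightarrow> Re (d x) > 1"
  shows "(\<lambda>x. integral {0..1} (betaint (b x) (d x))) holomorphic_on U"
proof (rule holo_integrand_holomorphic[of U 0 1 "\<lambda>x. betaint (b x) (d x)"])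
  show "holo_integrand U 0 1 (\<lambda>x. betaint (b x) (d x))"
    unfolding holo_integrand_def
  proof (intro conjI ballI)
    show "open U" by fact
    show "(\<lambda>x. betaint (b x) (d x) t) holomorphic_on U" for t
      unfolding betaint_def by (intro holomorphic_on_mult holomorphic_powr_exponent holomorphic_intros b d)
    show "betaint (b x) (d x) integrable_on {0..1}" if "x \<in> U" for x
      by (intro integrable_continuous_real continuous_betaint R that)
    fix x assume "x \<in> U"
    then obtain e where e: "e > 0" "cball x e \<subseteq> U" using U open_contains_cball by blast
    have "norm (betaint (b y) (d y) t) \<le> 1" if "y \<in> cball x e" "t \<in> {0..1}" for y t
      by (rule norm_betaint_le) (use R that e in auto)
    then show "\<exists>e>0. \<exists>M. cball x e \<subseteq> U \<and> (\<forall>y\<in>cball x e. \<forall>t\<in>{0..1}. norm (betaint (b y) (d y) t) \<le> M)"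
      using e by blast
  qed
qed

lemma islimpt_two_reals: "(2 :: complex) islimpt (of_real ` {1<..})"
  unfolding islimpt_approachable
proof (intro allI impI)
  fix e :: real assume e: "e > 0"
  have "dist (complex_of_real (2 + e/2)) 2 < e"
  proof -
    have "complex_of_real (2 + e/2) - 2 = of_real (e/2)" by simp
    then have "dist (complex_of_real (2 + e/2)) 2 = \<bar>e/2\<bar>" by (simp only: dist_norm norm_of_real)
    then show ?thesis using e by simp
  qed
  moreover have "complex_of_real (2 + e/2) \<noteq> 2" using e by (simp add: complex_eq_iff)
  moreover have "complex_of_real (2 + e/2) \<in> of_real ` {1<..}" using e by (intro imageI) simp
  ultimately show "\<exists>x'\<in>of_real ` {1<..}. x' \<noteq> 2 \<and> dist x' (2::complex) < e" by blast
qed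

lemma identity_right_half:
  assumes f: "f holomorphic_on {b. Re b > 1}" and g: "g holomorphic_on {b. Re b > 1}"
    and eq: "\<And>x::real. x > 1 \<Longrightarrow> f (of_real x) = g (of_real x)" and b: "Re b > 1"
  shows "f b = g b"
proof -
  have h: "(\<lambda>b. f b - g b) holomorphic_on {b. Re b > 1}" by (intro holomorphic_intros f g)
  have c: "connected {b::complex. Re b > 1}" by (intro convex_connected convex_halfspace_Re_gt)
  have sub: "of_real ` {1<..} \<subseteq> {b::complex. Re b > 1}" and x: "2 \<in> {b::complex. Re b > 1}" and w: "b \<in> {b. Re b > 1}"
    using b by auto
  have z: "f w - g w = 0" if "w \<in> of_real ` {1<..}" for w using that eq by auto
  from analytic_continuation[OF h open_halfspace_Re_gt c sub x islimpt_two_reals z w]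
  have "f b - g b = 0" .
  then show ?thesis by simp
qed

lemma Re_pos_nonpos_Ints: "Re z > 0 \<Longrightarrow> z \<notin> \<int>\<^sub>\<le>\<^sub>0"
  by (auto elim!: nonpos_Ints_cases)

text \<open>Continued from real exponents, one variable at a time.\<close>
lemma complex_Beta_integral:
  assumes b: "Re b > 1" and d: "Re d > 1"
  shows "integral {0..1} (betaint b d) = Gamma b * Gamma d / Gamma (b + d)"
proof -
  have r: "integral {0..1} (betaint (of_real x) (of_real y)) = Gamma (of_real x) * Gamma (of_real y) / Gamma (of_real x + of_real y)" if "x > 1" "y > 1" for x y :: real
  proof -
    have "betaint (of_real x) (of_real y) t = of_real (t powr (x - 1) * (1 - t) powr (y - 1))" if "t \<in> {0..1}" for t
      using powr_of_real[of t "x - 1"] powr_of_real[of "1 - t" "y - 1"] that by (simp add: betaint_def)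
    then have "integral {0..1} (betaint (of_real x) (of_real y)) = integral {0..1} (\<lambda>t. complex_of_real (t powr (x - 1) * (1 - t) powr (y - 1)))"
      by (intro integral_cong) simp
    also have "\<dots> = of_real (Beta x y)"
      by (rule integral_unique, rule has_integral_of_real, rule has_integral_Beta_real) (use that in auto)
    finally show ?thesis by (simp add: Beta_def flip: Gamma_complex_of_real)
  qed
  have hg: "(\<lambda>b. Gamma b * Gamma d / Gamma (b + d)) holomorphic_on {b. Re b > 1}" if "Re d > 1" for d
    using that by (intro holomorphic_intros) (auto simp: Gamma_eq_zero_iff intro!: Re_pos_nonpos_Ints)
  have hg2: "(\<lambda>d. Gamma b * Gamma d / Gamma (b + d)) holomorphic_on {b. Re b > 1}" if "Re b > 1" for b
    using that by (intro holomorphic_intros) (auto simp: Gamma_eq_zero_iff intro!: Re_pos_nonpos_Ints)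
  have s1: "integral {0..1} (betaint b (of_real y)) = Gamma b * Gamma (of_real y) / Gamma (b + of_real y)" if "Re b > 1" "y > 1" for b and y :: real
    by (rule identity_right_half[OF _ hg]) (use that r in \<open>auto intro!: betaint_holo open_halfspace_Re_gt holomorphic_intros\<close>)
  show ?thesis
    by (rule identity_right_half[OF _ hg2[OF b] _ d]) (use b s1 in \<open>auto intro!: betaint_holo open_halfspace_Re_gt holomorphic_intros\<close>)
qed

lemma slit_segment:
  assumes "z \<in> slit_plane" "t \<in> {0..1}" shows "1 - z * of_real t \<notin> \<real>\<^sub>\<le>\<^sub>0"
proof
  assume "1 - z * of_real t \<in> \<real>\<^sub>\<le>\<^sub>0"
  then have i: "Im z * t = 0" "Re z * t \<ge> 1" by (auto simp: complex_nonpos_Reals_iff)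
  have t: "0 < t" "t \<le> 1" using assms(2) i(2) by (auto simp: less_eq_real_def)
  then have "Im z = 0" using i by auto
  moreover have "Re z \<ge> 1"
  proof (rule ccontr)
    assume "\<not> Re z \<ge> 1"
    then have "Re z * t < 1 * t" using t by (intro mult_strict_right_mono) auto
    with i t show False by linarith
  qed
  ultimately show False using assms(1) by (simp add: slit_plane_iff complex_nonpos_Reals_iff)
qed

lemma continuous_powr_const:
  fixes f :: "'a :: topological_space \<Rightarrow> complex"
  assumes "continuous_on S f" "\<And>x. x \<in> S \<Longrightarrow> f x \<notin> \<real>\<^sub>\<le>\<^sub>0"
  shows "continuous_on S (\<lambda>x. f x powr p)"
proof -
  have "(\<lambda>w. w powr p) holomorphic_on - \<real>\<^sub>\<le>\<^sub>0" by (intro holomorphic_intros) auto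
  then show ?thesis
    by (rule continuous_on_compose2[OF holomorphic_on_imp_continuous_on assms(1)]) (use assms(2) in auto)
qed

definition eulint :: "complex \<Rightarrow> complex \<Rightarrow> complex \<Rightarrow> complex \<Rightarrow> real \<Rightarrow> complex" where
  "eulint a b d z t = betaint b d t * (1 - z * of_real t) powr (- a)"

lemma continuous_eulint:
  assumes "Re b > 1" "Re d > 1" "z \<in> slit_plane" shows "continuous_on {0..1} (eulint a b d z)"
proof -
  have "continuous_on {0..1} (\<lambda>t. (1 - z * of_real t) powr (- a))"
    by (intro continuous_powr_const continuous_intros slit_segment assms)
  then show ?thesis unfolding eulint_def[abs_def] by (intro continuous_on_mult continuous_betaint assms)
qed

text \<open>Real parts above 1, rather than merely positive, make the integrand continuous on the closed interval; the later continuation in the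
  parameters starts from there. The series is integrated termwise in the unit disc; uniqueness of the continuation does the rest.\<close>
lemma Euler_integral:
  assumes b: "Re b > 1" and d: "Re d > 1" and z: "z \<in> slit_plane"
  shows "integral {0..1} (eulint a b d z) = Gamma b * Gamma d / Gamma (b + d) * hyp2F1 a b (b + d) z"
proof -
  define B where "B = Gamma b * Gamma d / Gamma (b + d)"
  have np: "b \<notin> \<int>\<^sub>\<le>\<^sub>0" "d \<notin> \<int>\<^sub>\<le>\<^sub>0" "b + d \<notin> \<int>\<^sub>\<le>\<^sub>0" using b d by (auto intro!: Re_pos_nonpos_Ints)
  then have Bnz: "B \<noteq> 0" by (simp add: B_def Gamma_eq_zero_iff)
  have hi: "holo_integrand slit_plane 0 1 (\<lambda>z. eulint a b d z)"
  proof (rule holo_integrand_compactI[OF open_slit_plane])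
    show "(\<lambda>z. eulint a b d z t) holomorphic_on slit_plane" if "t \<in> {0..1}" for t
      unfolding eulint_def by (intro holomorphic_intros) (use slit_segment that in auto)
    have c1: "continuous_on (slit_plane \<times> {0..1}) (\<lambda>x. betaint b d (snd x))"
      by (rule continuous_on_compose2[OF continuous_betaint[OF b d]]) (auto intro!: continuous_intros)
    have c2: "continuous_on (slit_plane \<times> {0..1}) (\<lambda>x. (1 - fst x * of_real (snd x)) powr (- a))"
      by (intro continuous_powr_const continuous_intros slit_segment) auto
    have "continuous_on (slit_plane \<times> {0..1}) (\<lambda>x. eulint a b d (fst x) (snd x))"
      unfolding eulint_def by (rule continuous_on_mult[OF c1 c2])
    then show "continuous_on (slit_plane \<times> {0..1}) (\<lambda>(z, t). eulint a b d z t)" by (simp add: case_prod_unfold)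
  qed
  have "integral {0..1} (eulint a b d z) / B = hyp2F1 a b (b + d) z"
  proof (rule hyp2F1_eqI[OF np(3) _ _ z])
    show "(\<lambda>z. integral {0..1} (eulint a b d z) / B) holomorphic_on slit_plane"
      by (intro holomorphic_intros holo_integrand_holomorphic[OF hi]) (use Bnz in auto)
    fix u :: complex assume u: "u \<in> ball 0 1"
    define f where "f n t = ((- a) gchoose n) * (- u) ^ n * betaint (b + of_nat n) d t" for n t
    have s: "summable (\<lambda>n. norm ((- a) gchoose n) * norm u ^ n)" using norm_one_plus_powr_sums(2)[of u "- a"] u by simp
    have "(\<lambda>n. integral {0..1} (f n)) sums integral {0..1} (\<lambda>t. \<Sum>n. f n t)"
    proof (rule integral_suminf(1)[OF _ _ s])
      show "f n integrable_on {0..1}" for n unfolding f_def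
        using b d by (intro integrable_on_mult_right integrable_continuous_real continuous_betaint) auto
      show "norm (f n t) \<le> norm ((- a) gchoose n) * norm u ^ n" if "t \<in> {0..1}" for n t
      proof -
        have "norm (betaint (b + of_nat n) d t) \<le> 1" using that b d by (intro norm_betaint_le) auto
        then show ?thesis unfolding f_def norm_mult norm_power norm_minus_cancel by (intro mult_left_le) auto
      qed
    qed
    moreover have "(\<Sum>n. f n t) = eulint a b d u t" if t: "t \<in> {0..1}" for t
    proof -
      have nt: "norm (- (u * of_real t)) < 1" using u t by (auto simp: norm_mult intro: le_less_trans[OF mult_left_le])
      have pw: "of_real t powr (b - 1) * of_real t ^ n = (of_real t powr (b + of_nat n - 1) :: complex)" for n
      proof (cases "t = 0")
        case False
        then have "complex_of_real t \<noteq> 0" by simp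
        then have "of_real t ^ n = (of_real t powr of_nat n :: complex)" by simp
        then show ?thesis by (simp add: powr_add[symmetric] algebra_simps)
      qed simp
      have "f n t = betaint b d t * (((- a) gchoose n) * (- (u * of_real t)) ^ n)" for n
      proof -
        have "(- (u * of_real t)) ^ n = (- u) ^ n * of_real t ^ n" by (simp flip: power_mult_distrib)
        then show ?thesis unfolding f_def betaint_def pw[of n, symmetric] by (simp only: mult_ac)
      qed
      then show ?thesis
        using sums_mult[OF norm_one_plus_powr_sums(1)[OF nt, of "- a"], of "betaint b d t"]
        by (simp add: sums_iff eulint_def)
    qed
    ultimately have S: "(\<lambda>n. integral {0..1} (f n)) sums integral {0..1} (eulint a b d u)"
      using integral_cong[of "{0..1}" "\<lambda>t. \<Sum>n. f n t" "eulint a b d u"] by simp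
    have fi: "integral {0..1} (f n) = B * (fps_hypergeo [a, b] [b + d] 1 $ n * u ^ n)" for n
    proof -
      have "integral {0..1} (f n) = ((- a) gchoose n) * (- u) ^ n * (Gamma (b + of_nat n) * Gamma d / Gamma (b + of_nat n + d))"
        unfolding f_def using complex_Beta_integral[of "b + of_nat n" d] b d by (simp add: integral_mult_right)
      also have "Gamma (b + of_nat n) = pochhammer b n * Gamma b"
        using pochhammer_Gamma[OF np(1), of n] np(1) by (simp add: Gamma_eq_zero_iff)
      also have "Gamma (b + of_nat n + d) = pochhammer (b + d) n * Gamma (b + d)"
        using pochhammer_Gamma[OF np(3), of n] np(3) by (simp add: Gamma_eq_zero_iff add_ac)
      also have "((- a) gchoose n) * (- u) ^ n = pochhammer a n / fact n * u ^ n"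
      proof -
        have "((- a) gchoose n) * (- u) ^ n = ((-1)^n * (-1)^n) * (pochhammer a n / fact n * u ^ n)"
          by (subst power_minus) (simp add: gbinomial_pochhammer)
        also have "(-1)^n * (-1)^n = (1::complex)" by (simp flip: power_mult_distrib)
        finally show ?thesis by simp
      qed
      finally show ?thesis by (simp add: B_def mult_ac)
    qed
    from S have "integral {0..1} (eulint a b d u) = (\<Sum>n. B * (fps_hypergeo [a, b] [b + d] 1 $ n * u ^ n))"
      unfolding fi by (simp only: sums_iff)
    also have "\<dots> = B * eval_fps (fps_hypergeo [a, b] [b + d] 1) u"
    proof -
      have "summable (\<lambda>n. B * (fps_hypergeo [a, b] [b + d] 1 $ n * u ^ n))" using S unfolding fi by (simp only: sums_iff)
      then have "summable (\<lambda>n. fps_hypergeo [a, b] [b + d] 1 $ n * u ^ n)" using Bnz by (simp only: summable_cmult_iff) simp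
      then show ?thesis unfolding eval_fps_def by (rule suminf_mult)
    qed
    finally show "integral {0..1} (eulint a b d u) / B = eval_fps (fps_hypergeo [a, b] [b + d] 1) u" using Bnz by simp
  qed
  then show ?thesis using Bnz unfolding B_def by (simp add: field_simps)
qed

text \<open>The integrand of half of Euler's integral after \<open>t = 2\<rho>v/(1+v)\<close>, without the factor \<open>v^(b-1)\<close>. With \<open>\<rho> = Re (1/z)\<close> the
  parameter \<open>\<omega> = 2\<rho>z - 1\<close> has modulus 1, so that all three singularities lie on or outside the unit circle.\<close>
definition hh :: "complex \<Rightarrow> complex \<Rightarrow> complex \<Rightarrow> real \<Rightarrow> complex \<Rightarrow> complex \<Rightarrow> complex" where
  "hh a b d \<rho> \<omega> v = (1 + v) powr (a - b - d) * (1 + of_real (1 - 2 * \<rho>) * v) powr (d - 1) * (1 - \<omega> * v) powr (- a)"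

lemma powr_divide_real:
  fixes x :: complex and y :: real assumes "y > 0"
  shows "(x / of_real y) powr p = x powr p * of_real y powr (- p)"
proof -
  have "x / of_real y = of_real (1/y) * x" using assms by simp
  moreover have "(of_real (1/y) * x) powr p = of_real (1/y) powr p * x powr p" using assms by (intro powr_times_real_left) auto
  moreover have "of_real (1/y) powr p = (of_real y powr (- p) :: complex)"
    using assms by (simp add: powr_def Ln_of_real ln_div flip: of_real_divide)
  ultimately show ?thesis by (simp only: mult.commute)
qed

text \<open>The substitution \<open>t = 2\<rho>v/(1+v)\<close> sends \<open>v = 1\<close> to \<open>t = \<rho>\<close>.\<close>
lemma half_Euler:
  assumes b: "Re b > 1" and d: "Re d > 1" and z: "z \<in> slit_plane" and \<rho>: "0 < \<rho>" "\<rho> < 1" and \<omega>: "\<omega> = 2 * of_real \<rho> * z - 1"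
  shows "integral {0..\<rho>} (eulint a b d z) = of_real (2 * \<rho>) powr b * integral {0..1} (\<lambda>v. of_real v powr (b - 1) * hh a b d \<rho> \<omega> (of_real v))"
proof -
  define g where "g v = 2 * \<rho> * v / (1 + v)" for v :: real
  have g: "g v \<in> {0..\<rho>}" if "v \<in> {0..1}" for v
  proof -
    have "2 * \<rho> * v \<le> \<rho> * (1 + v)" using that \<rho> by (simp add: algebra_simps mult_left_le)
    then show ?thesis using that \<rho> by (simp add: g_def divide_le_eq)
  qed
  have "((\<lambda>v. (2 * \<rho> / (1 + v)^2) *\<^sub>R eulint a b d z (g v)) has_integral integral {g 0..g 1} (eulint a b d z)) {0..1}"
  proof (rule has_integral_substitution[where c = 0 and d = 1])
    show "g 0 \<le> g 1" using \<rho> by (simp add: g_def)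
    show "g ` {0..1} \<subseteq> {0..1}" using g \<rho> by fastforce
    show "continuous_on {0..1} (eulint a b d z)" by (rule continuous_eulint[OF b d z])
    show "(g has_real_derivative 2 * \<rho> / (1 + x)^2) (at x within {0..1})" if "x \<in> {0..1}" for x
    proof -
      have "(g has_real_derivative (2 * \<rho> * (1 + x) - 2 * \<rho> * x * 1) / ((1 + x) * (1 + x))) (at x within {0..1})"
        unfolding g_def using that by (intro DERIV_divide) (auto intro!: derivative_eq_intros)
      then show ?thesis by (simp add: power2_eq_square algebra_simps)
    qed
  qed simp
  also have "g 0 = 0" by (simp add: g_def)
  also have "g 1 = \<rho>" by (simp add: g_def)
  finally have 1: "((\<lambda>v. (2 * \<rho> / (1 + v)^2) *\<^sub>R eulint a b d z (g v)) has_integral integral {0..\<rho>} (eulint a b d z)) {0..1}" .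
  have eq: "(2 * \<rho> / (1 + v)^2) *\<^sub>R eulint a b d z (g v) = of_real (2 * \<rho>) powr b * (of_real v powr (b - 1) * hh a b d \<rho> \<omega> (of_real v))"
    if v: "v \<in> {0..1}" for v
  proof -
    define Y where "Y = complex_of_real (1 + v)"
    have y: "1 + v > 0" using v by simp
    have Y0: "Y \<noteq> 0" using y unfolding Y_def of_real_eq_0_iff by simp
    have t1: "of_real (g v) powr (b - 1) = of_real (2 * \<rho>) powr (b - 1) * of_real v powr (b - 1) * Y powr (- (b - 1))"
    proof -
      have "complex_of_real (g v) = (of_real (2 * \<rho>) * of_real v) / of_real (1 + v)" by (simp add: g_def)
      then have "of_real (g v) powr (b - 1) = (of_real (2 * \<rho>) * of_real v) powr (b - 1) * Y powr (- (b - 1))"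
        unfolding Y_def by (simp only: powr_divide_real[OF y])
      also have "(of_real (2 * \<rho>) * of_real v) powr (b - 1) = of_real (2 * \<rho>) powr (b - 1) * (of_real v powr (b - 1) :: complex)"
        using \<rho> by (intro powr_times_real_left) auto
      finally show ?thesis .
    qed
    have t2: "of_real (1 - g v) powr (d - 1) = (1 + of_real (1 - 2 * \<rho>) * of_real v) powr (d - 1) * Y powr (- (d - 1))"
    proof -
      have "1 - g v = (1 + (1 - 2 * \<rho>) * v) / (1 + v)" using y by (simp add: g_def field_simps)
      then have "complex_of_real (1 - g v) = (1 + of_real (1 - 2 * \<rho>) * of_real v) / of_real (1 + v)" by simp
      then show ?thesis unfolding Y_def by (simp only: powr_divide_real[OF y])
    qed
    have t3: "(1 - z * of_real (g v)) powr (- a) = (1 - \<omega> * of_real v) powr (- a) * Y powr a"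
    proof -
      have "1 - z * of_real (g v) = (Y - z * (2 * of_real \<rho> * of_real v)) / Y" using Y0 by (simp add: g_def Y_def diff_divide_distrib)
      also have "Y - z * (2 * of_real \<rho> * of_real v) = 1 - \<omega> * of_real v" by (simp add: \<omega> Y_def algebra_simps)
      finally have "1 - z * of_real (g v) = (1 - \<omega> * of_real v) / of_real (1 + v)" by (simp only: Y_def)
      then show ?thesis unfolding Y_def by (simp only: powr_divide_real[OF y] minus_minus)
    qed
    have t4: "(2 * \<rho> / (1 + v)^2) *\<^sub>R w = of_real (2 * \<rho>) * Y powr (- 2) * w" for w :: complex
    proof -
      have "Y powr (- 2) = inverse (Y ^ 2)" using Y0 by (simp add: powr_minus)
      then show ?thesis by (simp add: scaleR_conv_of_real Y_def divide_inverse)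
    qed
    have pw: "Y powr (- 2) * (Y powr (- (b - 1)) * (Y powr (- (d - 1)) * Y powr a)) = Y powr (a - b - d)"
      unfolding powr_add[symmetric] by (rule arg_cong[where f = "\<lambda>p. Y powr p"]) simp
    have r: "of_real (2 * \<rho>) * of_real (2 * \<rho>) powr (b - 1) = (of_real (2 * \<rho>) powr b :: complex)"
    proof -
      have "complex_of_real (2 * \<rho>) \<noteq> 0" using \<rho> by simp
      then show ?thesis by (simp add: powr_diff)
    qed
    have "(2 * \<rho> / (1 + v)^2) *\<^sub>R eulint a b d z (g v) = (of_real (2 * \<rho>) * of_real (2 * \<rho>) powr (b - 1)) * (of_real v powr (b - 1) *
       ((Y powr (- 2) * (Y powr (- (b - 1)) * (Y powr (- (d - 1)) * Y powr a))) * (1 + of_real (1 - 2 * \<rho>) * of_real v) powr (d - 1) * (1 - \<omega> * of_real v) powr (- a)))"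
      unfolding t4 eulint_def betaint_def t1 t2 t3 by (simp only: mult_ac)
    also have "\<dots> = of_real (2 * \<rho>) powr b * (of_real v powr (b - 1) * hh a b d \<rho> \<omega> (of_real v))"
      unfolding pw r unfolding hh_def Y_def by simp
    finally show ?thesis .
  qed
  have "((\<lambda>v. of_real (2 * \<rho>) powr b * (of_real v powr (b - 1) * hh a b d \<rho> \<omega> (of_real v))) has_integral integral {0..\<rho>} (eulint a b d z)) {0..1}"
    by (rule has_integral_eq[OF eq 1])
  then have "integral {0..\<rho>} (eulint a b d z) = integral {0..1} (\<lambda>v. of_real (2 * \<rho>) powr b * (of_real v powr (b - 1) * hh a b d \<rho> \<omega> (of_real v)))"
    by (simp only: integral_unique)
  then show ?thesis by (simp only: integral_mult_right)
qed

text \<open>Pfaff's transformation exchanges the two ends of Euler's integral. The condition on \<open>z\<close> guarantees that the arguments of the two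
  factors of \<open>1 - z(1-t)\<close> have opposite signs, so that the principal powers multiply.\<close>
lemma Pfaff_half_Euler:
  assumes z: "Im z > 0" and t: "t \<in> {0..1}"
  shows "eulint a b d z (1 - t) = (1 - z) powr (- a) * eulint a d b (z / (z - 1)) t"
proof -
  have z1: "z - 1 \<noteq> 0" "1 - z \<noteq> 0" using z by auto
  define w where "w = z / (z - 1)"
  define y where "y = 1 - w * of_real t"
  have wz: "(1 - z) * w = - z" using z1 by (simp add: w_def field_simps)
  have "(1 - z) * y = (1 - z) - ((1 - z) * w) * of_real t" by (simp add: y_def algebra_simps)
  then have eq: "1 - z * of_real (1 - t) = (1 - z) * y" unfolding wz by (simp add: algebra_simps)
  moreover have "((1 - z) * y) powr (- a) = (1 - z) powr (- a) * y powr (- a)"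
  proof -
    have "Im w = - Im z / (norm (z - 1))\<^sup>2"
      unfolding w_def Im_divide by (simp add: cmod_power2 algebra_simps)
    then have iw: "Im w < 0" using z z1 by (simp add: divide_neg_pos)
    have Iy: "Im y = - Im w * t" by (simp add: y_def)
    then have iy: "Im y \<ge> 0" using iw t by (simp add: mult_nonpos_nonneg)
    have ny2: "y \<notin> \<real>\<^sub>\<le>\<^sub>0"
    proof
      assume "y \<in> \<real>\<^sub>\<le>\<^sub>0"
      then have "Im y = 0" "Re y \<le> 0" by (auto simp: complex_nonpos_Reals_iff)
      then have "t = 0" using Iy iw by simp
      then show False using \<open>Re y \<le> 0\<close> by (simp add: y_def)
    qed
    then have ny: "y \<noteq> 0" by auto
    have "Im (Ln (1 - z)) < 0"
      using z Im_Ln_pos_le[of "1 - z"] Im_Ln_le_pi[of "1 - z"] z1 by auto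
    moreover have "Im (Ln (1 - z)) > - pi" using mpi_less_Im_Ln[of "1 - z"] z1 by auto
    moreover have "Im (Ln y) \<ge> 0" "Im (Ln y) < pi"
      using iy ny ny2 Im_Ln_pos_le[of y] Im_Ln_le_pi[of y] Im_Ln_less_pi[of y] by auto
    ultimately have "Ln ((1 - z) * y) = Ln (1 - z) + Ln y" using z1 ny by (subst Ln_times) auto
    then show ?thesis using z1 ny by (simp add: powr_def exp_add[symmetric] algebra_simps)
  qed
  ultimately show ?thesis unfolding eulint_def betaint_def y_def w_def by (simp add: mult_ac)
qed

section \<open>Keyhole contours\<close>

lemma has_integral_powr_complex:
  assumes c: "Re c > 0" and r: "0 \<le> r"
  shows "((\<lambda>v. of_real v powr (c - 1)) has_integral (of_real r powr c / c)) {0..r}"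
proof -
  have c0: "c \<noteq> 0" using c by auto
  have "continuous_on {0..r} (\<lambda>v. complex_of_real v powr c / c)"
  proof -
    have "continuous_on {0..r} (\<lambda>v. complex_of_real v powr c)"
      by (rule continuous_on_compose2[OF continuous_on_powr_right_half[OF c]]) (auto intro!: continuous_intros)
    then show ?thesis using c0 by (intro continuous_on_divide continuous_on_const) auto
  qed
  moreover have "((\<lambda>v. of_real v powr c / c) has_vector_derivative of_real v powr (c - 1)) (at v)" if "v \<in> {0<..<r}" for v :: real
  proof (rule has_vector_derivative_real_field)
    have "complex_of_real v \<notin> \<real>\<^sub>\<le>\<^sub>0" using that by (simp add: complex_nonpos_Reals_iff)
    then have "((\<lambda>z. z powr c / c) has_field_derivative (c * of_real v powr (c - 1)) / c) (at (of_real v))"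
      by (intro DERIV_cdivide has_field_derivative_powr)
    then show "((\<lambda>z. z powr c / c) has_field_derivative of_real v powr (c - 1)) (at (of_real v))" using c0 by simp
  qed
  ultimately have "((\<lambda>v. of_real v powr (c - 1)) has_integral (of_real r powr c / c - of_real 0 powr c / c)) {0..r}"
    by (intro fundamental_theorem_of_calculus_interior[OF r]) auto
  then show ?thesis by simp
qed

lemma has_integral_exp_circle:
  assumes "c \<noteq> 0"
  shows "((\<lambda>\<theta>. exp (\<i> * c * of_real \<theta>)) has_integral (exp (2 * of_real pi * \<i> * c) - 1) / (\<i> * c)) {0..2 * pi}"
proof -
  have "((\<lambda>\<theta>. exp (\<i> * c * of_real \<theta>) / (\<i> * c)) has_vector_derivative exp (\<i> * c * of_real \<theta>)) (at \<theta> within {0..2 * pi})" for \<theta>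
  proof (rule has_vector_derivative_real_field)
    have "((\<lambda>z. exp (\<i> * c * z) / (\<i> * c)) has_field_derivative (exp (\<i> * c * of_real \<theta>) * (\<i> * c)) / (\<i> * c)) (at (of_real \<theta>))"
      by (intro DERIV_cdivide) (auto intro!: derivative_eq_intros)
    then show "((\<lambda>z. exp (\<i> * c * z) / (\<i> * c)) has_field_derivative exp (\<i> * c * of_real \<theta>)) (at (of_real \<theta>))" using assms by simp
  qed
  then have "((\<lambda>\<theta>. exp (\<i> * c * of_real \<theta>)) has_integral (exp (\<i> * c * of_real (2 * pi)) / (\<i> * c) - exp (\<i> * c * of_real 0) / (\<i> * c))) {0..2 * pi}"
    by (intro fundamental_theorem_of_calculus) auto
  moreover have "exp (\<i> * c * of_real (2 * pi)) = exp (2 * of_real pi * \<i> * c)" by (rule arg_cong[where f = exp]) simp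
  ultimately show ?thesis by (simp add: diff_divide_distrib)
qed

text \<open>For a power \<open>h = v^n\<close> both sides equal \<open>(e^(2\<pi>ib) - 1) r^(b+n)/(b+n)\<close>; the general case is a sum over the power series.\<close>
lemma keyhole_disc:
  assumes h: "h holomorphic_on ball 0 1" and b: "Re b > 1" and r: "0 < r" "r < 1"
  shows "(exp (2 * of_real pi * \<i> * b) - 1) * integral {0..r} (\<lambda>v. of_real v powr (b - 1) * h (of_real v))
     = \<i> * of_real r powr b * integral {0..2 * pi} (\<lambda>\<theta>. exp (\<i> * b * of_real \<theta>) * h (of_real r * cis \<theta>))" (is "(?e - 1) * ?L = _ * ?R")
proof -
  define H where "H n = (deriv ^^ n) h 0 / fact n" for n
  have ps: "(\<lambda>n. H n * v ^ n) sums h v" if "norm v < 1" for v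
    using holomorphic_power_series[OF h, of v] that by (simp add: H_def)
  have sm: "summable (\<lambda>n. norm (H n * of_real r ^ n))"
  proof (rule powser_insidea)
    show "summable (\<lambda>n. H n * of_real ((1 + r)/2) ^ n)"
      using ps[of "of_real ((1 + r)/2)"] r by (simp add: sums_iff norm_of_real del: of_real_add of_real_divide)
    show "norm (of_real r :: complex) < norm (of_real ((1 + r)/2) :: complex)" using r by (simp only: norm_of_real) auto
  qed
  have M: "norm (H n * v ^ n) \<le> norm (H n * of_real r ^ n)" if "norm v \<le> r" for n v
    using that r by (auto simp: norm_mult norm_power intro!: mult_left_mono power_mono)
  have bn: "Re (b + of_nat n) > 0" "b + of_nat n \<noteq> 0" for n
  proof -
    show "Re (b + of_nat n) > 0" using b by (simp add: add_pos_nonneg)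
    then show "b + of_nat n \<noteq> 0" by (metis less_irrefl zero_complex.sel(1))
  qed
  define f1 where "f1 n v = of_real v powr (b - 1) * (H n * of_real v ^ n)" for n and v :: real
  define f2 where "f2 n \<theta> = exp (\<i> * b * of_real \<theta>) * (H n * (of_real r * cis \<theta>) ^ n)" for n and \<theta> :: real
  have i1: "(f1 n has_integral H n * (of_real r powr (b + of_nat n) / (b + of_nat n))) {0..r}" for n
  proof -
    have "f1 n v = H n * of_real v powr (b + of_nat n - 1)" for v
    proof (cases "v = 0")
      case False
      then have "complex_of_real v \<noteq> 0" by simp
      then have "of_real v ^ n = (of_real v powr of_nat n :: complex)" by simp
      moreover have "of_real v powr (b - 1) * of_real v powr of_nat n = (of_real v powr (b + of_nat n - 1) :: complex)"
        unfolding powr_add[symmetric] by (rule arg_cong[where f = "\<lambda>p. of_real v powr p"]) simp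
      ultimately show ?thesis unfolding f1_def by (metis mult.left_commute)
    qed (simp add: f1_def)
    moreover have "((\<lambda>v. H n * of_real v powr (b + of_nat n - 1)) has_integral H n * (of_real r powr (b + of_nat n) / (b + of_nat n))) {0..r}"
      by (rule has_integral_mult_right[OF has_integral_powr_complex[OF bn(1)]]) (use r in simp)
    moreover have "f1 n = (\<lambda>v. H n * of_real v powr (b + of_nat n - 1))" by (rule ext) (rule calculation(1))
    ultimately show ?thesis by (simp only:)
  qed
  have i2: "(f2 n has_integral H n * of_real r ^ n * ((?e - 1) / (\<i> * (b + of_nat n)))) {0..2 * pi}" for n
  proof -
    have "f2 n \<theta> = H n * of_real r ^ n * exp (\<i> * (b + of_nat n) * of_real \<theta>)" for \<theta>
    proof -
      have "cis \<theta> ^ n = exp (\<i> * of_nat n * of_real \<theta>)" unfolding cis_conv_exp exp_of_nat_mult[symmetric] by (rule arg_cong[where f = exp]) (simp only: mult_ac)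
      moreover have "exp (\<i> * (b + of_nat n) * of_real \<theta>) = exp (\<i> * b * of_real \<theta>) * exp (\<i> * of_nat n * of_real \<theta>)"
        unfolding exp_add[symmetric] by (rule arg_cong[where f = exp]) (simp add: algebra_simps)
      ultimately show ?thesis by (simp add: f2_def power_mult_distrib)
    qed
    then have "f2 n = (\<lambda>\<theta>. H n * of_real r ^ n * exp (\<i> * (b + of_nat n) * of_real \<theta>))" by (rule ext)
    moreover have "((\<lambda>\<theta>. H n * of_real r ^ n * exp (\<i> * (b + of_nat n) * of_real \<theta>)) has_integral
        H n * of_real r ^ n * ((exp (2 * of_real pi * \<i> * (b + of_nat n)) - 1) / (\<i> * (b + of_nat n)))) {0..2 * pi}"
      by (rule has_integral_mult_right[OF has_integral_exp_circle[OF bn(2)]])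
    moreover have "exp (2 * of_real pi * \<i> * (b + of_nat n)) = ?e"
    proof -
      have "exp (2 * of_real pi * \<i> * (b + of_nat n)) = ?e * exp (2 * of_nat n * of_real pi * \<i>)"
        unfolding exp_add[symmetric] by (rule arg_cong[where f = exp]) (simp add: algebra_simps)
      moreover have "exp (2 * of_nat n * of_real pi * \<i>) = 1" 
      proof -
        have "2 * of_nat n * of_real pi * \<i> = of_nat n * (2 * of_real pi * \<i>)" by (simp only: mult_ac)
        then show ?thesis by (simp only: exp_of_nat_mult exp_two_pi_i power_one)
      qed
      ultimately show ?thesis by simp
    qed
    ultimately show ?thesis by (simp only:)
  qed
  have c1: "(\<Sum>n. f1 n v) = of_real v powr (b - 1) * h (of_real v)" if "v \<in> {0..r}" for v
    using sums_mult[OF ps[of "of_real v"], of "of_real v powr (b - 1)"] that r by (simp add: f1_def sums_iff)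
  have c2: "(\<Sum>n. f2 n \<theta>) = exp (\<i> * b * of_real \<theta>) * h (of_real r * cis \<theta>)" for \<theta>
    using sums_mult[OF ps[of "of_real r * cis \<theta>"], of "exp (\<i> * b * of_real \<theta>)"] r by (simp add: f2_def sums_iff norm_mult)
  have s1: "(\<lambda>n. integral {0..r} (f1 n)) sums integral {0..r} (\<lambda>v. \<Sum>n. f1 n v)"
  proof (rule integral_suminf(1)[OF _ _ sm])
    show "f1 n integrable_on {0..r}" for n using i1 by blast
    show "norm (f1 n v) \<le> norm (H n * of_real r ^ n)" if "v \<in> {0..r}" for n v
    proof -
      have "norm (of_real v powr (b - 1) :: complex) = v powr (Re b - 1)" using that by (simp add: norm_powr_real_powr)
      also have "\<dots> \<le> 1 powr (Re b - 1)" using that r b by (intro powr_mono2) auto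
      finally have "norm (of_real v powr (b - 1) :: complex) \<le> 1" by simp
      then have "norm (of_real v powr (b - 1) :: complex) * norm (H n * of_real v ^ n) \<le> 1 * norm (H n * of_real r ^ n)"
        using M[of "of_real v" n] that by (intro mult_mono) auto
      then show ?thesis unfolding f1_def norm_mult[of "of_real v powr (b - 1)"] by simp
    qed
  qed
  have s2: "(\<lambda>n. integral {0..2 * pi} (f2 n)) sums integral {0..2 * pi} (\<lambda>\<theta>. \<Sum>n. f2 n \<theta>)"
  proof (rule integral_suminf(1)[where M = "\<lambda>n. exp (2 * pi * \<bar>Im b\<bar>) * norm (H n * of_real r ^ n)"])
    show "f2 n integrable_on {0..2 * pi}" for n using i2 by blast
    show "summable (\<lambda>n. exp (2 * pi * \<bar>Im b\<bar>) * norm (H n * of_real r ^ n))" by (rule summable_mult[OF sm])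
    show "norm (f2 n \<theta>) \<le> exp (2 * pi * \<bar>Im b\<bar>) * norm (H n * of_real r ^ n)" if "\<theta> \<in> {0..2 * pi}" for n \<theta>
    proof -
      have "- Im b * \<theta> \<le> \<bar>Im b\<bar> * (2 * pi)" using that by (intro mult_mono) auto
      then have "norm (exp (\<i> * b * of_real \<theta>)) \<le> exp (2 * pi * \<bar>Im b\<bar>)" by (simp add: norm_exp_eq_Re mult_ac)
      moreover have "norm (H n * (of_real r * cis \<theta>) ^ n) \<le> norm (H n * of_real r ^ n)" by (rule M) (use r in \<open>simp add: norm_mult\<close>)
      ultimately show ?thesis unfolding f2_def norm_mult[of "exp _"] by (intro mult_mono) auto
    qed
  qed
  have eL: "integral {0..r} (\<lambda>v. \<Sum>n. f1 n v) = ?L" by (rule integral_cong) (rule c1)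
  have eR: "integral {0..2 * pi} (\<lambda>\<theta>. \<Sum>n. f2 n \<theta>) = ?R" by (rule integral_cong) (rule c2)
  have t: "(?e - 1) * integral {0..r} (f1 n) = \<i> * of_real r powr b * integral {0..2 * pi} (f2 n)" for n
  proof -
    have "of_real r powr (b + of_nat n) = of_real r powr b * (of_real r ^ n :: complex)" using r by (simp add: powr_add)
    moreover have "(E - 1) * (h * (P * R / B)) = \<i> * P * (h * R * ((E - 1) / (\<i> * B)))" if "B \<noteq> 0" for E h P R B :: complex
      using that by (simp add: field_simps)
    ultimately show ?thesis using bn(2)[of n] unfolding integral_unique[OF i1] integral_unique[OF i2] by (simp only:)
  qed
  have "(\<lambda>n. (?e - 1) * integral {0..r} (f1 n)) sums ((?e - 1) * ?L)" using sums_mult[OF s1, of "?e - 1"] unfolding eL .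
  moreover have "(\<lambda>n. (?e - 1) * integral {0..r} (f1 n)) sums (\<i> * of_real r powr b * ?R)"
    unfolding t using sums_mult[OF s2, of "\<i> * of_real r powr b"] unfolding eR .
  ultimately show ?thesis by (rule sums_unique2)
qed

text \<open>The loop that starts at 1, runs along the radius to \<open>r\<close>, around the circle and back. Unlike the radial integral from 0 it makes sense for
  every exponent \<open>b\<close>.\<close>
definition keyhole :: "complex \<Rightarrow> complex \<Rightarrow> complex \<Rightarrow> real \<Rightarrow> complex \<Rightarrow> real \<Rightarrow> complex" where
  "keyhole a b d \<rho> \<omega> r = \<i> * of_real r powr b * integral {0..2 * pi} (\<lambda>\<theta>. exp (\<i> * b * of_real \<theta>) * hh a b d \<rho> \<omega> (of_real r * cis \<theta>))
     + (exp (2 * of_real pi * \<i> * b) - 1) * integral {r..1} (\<lambda>v. of_real v powr (b - 1) * hh a b d \<rho> \<omega> (of_real v))"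

lemma one_minus_small: assumes "norm (w::complex) < 1" shows "1 + w \<notin> \<real>\<^sub>\<le>\<^sub>0" "1 - w \<notin> \<real>\<^sub>\<le>\<^sub>0"
  using assms abs_Re_le_cmod[of w] by (auto simp: complex_nonpos_Reals_iff)

lemma one_minus_unit:
  fixes \<omega> :: complex and v :: real
  assumes "norm \<omega> = 1" "\<omega> \<noteq> 1" "v \<in> {0..1}" shows "1 - \<omega> * of_real v \<notin> \<real>\<^sub>\<le>\<^sub>0"
proof (cases "v = 1")
  case True
  have "1 - \<omega> \<notin> \<real>\<^sub>\<le>\<^sub>0"
  proof
    assume "1 - \<omega> \<in> \<real>\<^sub>\<le>\<^sub>0"
    then have "Im \<omega> = 0" "Re \<omega> \<ge> 1" by (auto simp: complex_nonpos_Reals_iff)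
    moreover have "Re \<omega> \<le> 1" using abs_Re_le_cmod[of \<omega>] assms(1) by simp
    ultimately have "\<omega> = 1" by (simp add: complex_eq_iff)
    with assms(2) show False ..
  qed
  with True show ?thesis by simp
next
  case False
  then have "norm (\<omega> * of_real v) < 1" using assms by (simp add: norm_mult)
  then show ?thesis by (rule one_minus_small(2))
qed

text \<open>None of the three bases in \<open>hh\<close> lies on the cut of the principal power.\<close>
definition hh_ok :: "real \<Rightarrow> complex \<Rightarrow> complex \<Rightarrow> bool" where
  "hh_ok \<rho> \<omega> v \<longleftrightarrow> 1 + v \<notin> \<real>\<^sub>\<le>\<^sub>0 \<and> 1 + of_real (1 - 2 * \<rho>) * v \<notin> \<real>\<^sub>\<le>\<^sub>0 \<and> 1 - \<omega> * v \<notin> \<real>\<^sub>\<le>\<^sub>0"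

lemma hh_ok_ball:
  assumes "0 < \<rho>" "\<rho> < 1" "norm \<omega> = 1" "norm v < 1" shows "hh_ok \<rho> \<omega> v"
proof -
  have "norm (of_real (1 - 2 * \<rho>) * v) < 1"
  proof -
    have "\<bar>1 - 2 * \<rho>\<bar> * norm v \<le> 1 * norm v" using assms by (intro mult_right_mono) auto
    then show ?thesis using assms unfolding norm_mult norm_of_real by linarith
  qed
  moreover have "norm (\<omega> * v) < 1" using assms by (simp add: norm_mult)
  ultimately show ?thesis unfolding hh_ok_def using assms one_minus_small by blast
qed

lemma hh_ok_segment:
  assumes "0 < \<rho>" "\<rho> < 1" "norm \<omega> = 1" "\<omega> \<noteq> 1" "v \<in> {0..1}" shows "hh_ok \<rho> \<omega> (of_real v)"
proof -
  have "(2 * \<rho> - 1) * v < 1"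
  proof (cases "v = 1")
    case False
    have "(2 * \<rho> - 1) * v \<le> 1 * v" using assms by (intro mult_right_mono) auto
    then show ?thesis using False assms by auto
  qed (use assms in auto)
  then have "1 + (1 - 2 * \<rho>) * v > 0" by (simp add: algebra_simps)
  then have "1 + of_real (1 - 2 * \<rho>) * complex_of_real v \<notin> \<real>\<^sub>\<le>\<^sub>0" by (simp add: complex_nonpos_Reals_iff)
  moreover have "1 + complex_of_real v \<notin> \<real>\<^sub>\<le>\<^sub>0" using assms by (simp add: complex_nonpos_Reals_iff)
  ultimately show ?thesis unfolding hh_ok_def using one_minus_unit[OF assms(3,4,5)] by blast
qed

lemma hh_holomorphic_v: assumes "\<And>v. v \<in> S \<Longrightarrow> hh_ok \<rho> \<omega> v" shows "hh a b d \<rho> \<omega> holomorphic_on S"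
  unfolding hh_def[abs_def] by (intro holomorphic_intros) (use assms in \<open>auto simp: hh_ok_def\<close>)

lemma hh_continuous:
  fixes g :: "real \<Rightarrow> complex"
  assumes "continuous_on S g" "\<And>t. t \<in> S \<Longrightarrow> hh_ok \<rho> \<omega> (g t)" shows "continuous_on S (\<lambda>t. hh a b d \<rho> \<omega> (g t))"
proof -
  have "hh a b d \<rho> \<omega> holomorphic_on {v. hh_ok \<rho> \<omega> v}" by (rule hh_holomorphic_v) auto
  then show ?thesis by (rule continuous_on_compose2[OF holomorphic_on_imp_continuous_on assms(1)]) (use assms(2) in auto)
qed

lemma hh_holomorphic_param:
  assumes "b holomorphic_on U" "d holomorphic_on U"
  shows "(\<lambda>x. hh a (b x) (d x) \<rho> \<omega> v) holomorphic_on U"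
  unfolding hh_def by (intro holomorphic_on_mult holomorphic_powr_exponent holomorphic_intros assms)

lemma continuous_powr_joint:
  fixes f :: "real \<Rightarrow> complex" and p :: "complex \<Rightarrow> complex"
  assumes "continuous_on T f" "\<And>t. t \<in> T \<Longrightarrow> f t \<notin> \<real>\<^sub>\<le>\<^sub>0" "continuous_on U p"
  shows "continuous_on (U \<times> T) (\<lambda>x. f (snd x) powr p (fst x))"
proof -
  have L: "continuous_on T (\<lambda>t. Ln (f t))" by (rule continuous_on_Ln'[OF assms(1)]) (use assms(2) in auto)
  have 1: "continuous_on (U \<times> T) (\<lambda>x. Ln (f (snd x)))" by (rule continuous_on_compose2[OF L continuous_on_snd]) (auto intro: continuous_on_id)
  have 2: "continuous_on (U \<times> T) (\<lambda>x. p (fst x))" by (rule continuous_on_compose2[OF assms(3) continuous_on_fst]) (auto intro: continuous_on_id)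
  have c: "continuous_on (U \<times> T) (\<lambda>x. exp (p (fst x) * Ln (f (snd x))))" by (intro continuous_on_exp continuous_on_mult 1 2)
  have e: "exp (p (fst x) * Ln (f (snd x))) = f (snd x) powr p (fst x)" if "x \<in> U \<times> T" for x
  proof -
    have "f (snd x) \<noteq> 0" using assms(2)[of "snd x"] that by auto
    then show ?thesis by (simp add: powr_def)
  qed
  show ?thesis by (rule continuous_on_eq[OF c e])
qed

lemma holomorphic_exp_mult:
  assumes "b holomorphic_on U"
  shows "(\<lambda>x. exp (c * b x)) holomorphic_on U" "(\<lambda>x. exp (c * b x * e)) holomorphic_on U"
  by (intro holomorphic_intros assms)+

lemma hh_continuous_joint:
  fixes g :: "real \<Rightarrow> complex" and b d :: "complex \<Rightarrow> complex"
  assumes "continuous_on U b" "continuous_on U d" "continuous_on S g" "\<And>t. t \<in> S \<Longrightarrow> hh_ok \<rho> \<omega> (g t)"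
  shows "continuous_on (U \<times> S) (\<lambda>x. hh a (b (fst x)) (d (fst x)) \<rho> \<omega> (g (snd x)))"
  unfolding hh_def
  by (intro continuous_on_mult continuous_powr_joint[where f = "\<lambda>t. 1 + g t" and p = "\<lambda>x. a - b x - d x"]
        continuous_powr_joint[where f = "\<lambda>t. 1 + of_real (1 - 2 * \<rho>) * g t" and p = "\<lambda>x. d x - 1"]
        continuous_powr_joint[where f = "\<lambda>t. 1 - \<omega> * g t" and p = "\<lambda>x. - a"] continuous_intros assms)
     (use assms(4) in \<open>auto simp: hh_ok_def\<close>)

lemma keyhole_holomorphic:
  assumes U: "open U" "b holomorphic_on U" "d holomorphic_on U"
    and \<rho>: "0 < \<rho>" "\<rho> < 1" "norm \<omega> = 1" "\<omega> \<noteq> 1" and r: "0 < r" "r < 1"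
  shows "(\<lambda>x. keyhole a (b x) (d x) \<rho> \<omega> r) holomorphic_on U"
proof -
  note c = holomorphic_on_imp_continuous_on[OF U(2)] holomorphic_on_imp_continuous_on[OF U(3)]
  have h1: "holo_integrand U 0 (2 * pi) (\<lambda>x \<theta>. exp (\<i> * b x * of_real \<theta>) * hh a (b x) (d x) \<rho> \<omega> (of_real r * cis \<theta>))"
  proof (rule holo_integrand_compactI[OF U(1)])
    show "(\<lambda>x. exp (\<i> * b x * of_real t) * hh a (b x) (d x) \<rho> \<omega> (of_real r * cis t)) holomorphic_on U" for t
      by (intro holomorphic_on_mult hh_holomorphic_param holomorphic_exp_mult U holomorphic_on_const)
    have 1: "continuous_on (U \<times> {0..2 * pi}) (\<lambda>x. hh a (b (fst x)) (d (fst x)) \<rho> \<omega> (of_real r * cis (snd x)))"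
      by (rule hh_continuous_joint[where g = "\<lambda>\<theta>. of_real r * cis \<theta>", OF c])
         (use \<rho> r in \<open>auto intro!: continuous_intros hh_ok_ball simp: norm_mult\<close>)
    have b: "continuous_on (U \<times> {0..2 * pi}) (\<lambda>x. b (fst x))" by (rule continuous_on_compose2[OF c(1) continuous_on_fst]) (auto intro: continuous_on_id)
    have 2: "continuous_on (U \<times> {0..2 * pi}) (\<lambda>x. exp (\<i> * b (fst x) * of_real (snd x)))"
      by (intro continuous_on_exp continuous_on_mult b continuous_on_of_real continuous_on_snd continuous_on_id continuous_on_const)
    show "continuous_on (U \<times> {0..2 * pi}) (\<lambda>(x, \<theta>). exp (\<i> * b x * of_real \<theta>) * hh a (b x) (d x) \<rho> \<omega> (of_real r * cis \<theta>))"
      using continuous_on_mult[OF 2 1] by (simp add: case_prod_unfold)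
  qed
  have h2: "holo_integrand U r 1 (\<lambda>x v. of_real v powr (b x - 1) * hh a (b x) (d x) \<rho> \<omega> (of_real v))"
  proof (rule holo_integrand_compactI[OF U(1)])
    show "(\<lambda>x. of_real v powr (b x - 1) * hh a (b x) (d x) \<rho> \<omega> (of_real v)) holomorphic_on U" for v
      by (intro holomorphic_on_mult hh_holomorphic_param holomorphic_powr_exponent holomorphic_on_diff U holomorphic_on_const)
    have 1: "continuous_on (U \<times> {r..1}) (\<lambda>x. hh a (b (fst x)) (d (fst x)) \<rho> \<omega> (of_real (snd x)))"
      by (rule hh_continuous_joint[where g = of_real, OF c])
         (use \<rho> r in \<open>auto intro!: continuous_intros hh_ok_segment\<close>)
    have 2: "continuous_on (U \<times> {r..1}) (\<lambda>x. of_real (snd x) powr (b (fst x) - 1))"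
      by (rule continuous_powr_joint[where f = of_real and p = "\<lambda>x. b x - 1"])
         (use r c in \<open>auto intro!: continuous_intros simp: complex_nonpos_Reals_iff\<close>)
    show "continuous_on (U \<times> {r..1}) (\<lambda>(x, v). of_real v powr (b x - 1) * hh a (b x) (d x) \<rho> \<omega> (of_real v))"
      using continuous_on_mult[OF 2 1] by (simp add: case_prod_unfold)
  qed
  show ?thesis unfolding keyhole_def
    by (intro holomorphic_on_add holomorphic_on_mult holomorphic_powr_exponent holomorphic_on_diff holomorphic_exp_mult
          holo_integrand_holomorphic[OF h1] holo_integrand_holomorphic[OF h2] U holomorphic_on_const)
qed

lemma keyhole_half_Euler:
  assumes b: "Re b > 1" and d: "Re d > 1" and z: "z \<in> slit_plane" and \<rho>: "0 < \<rho>" "\<rho> < 1"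
    and \<omega>: "\<omega> = 2 * of_real \<rho> * z - 1" "norm \<omega> = 1" "\<omega> \<noteq> 1" and r: "0 < r" "r < 1"
  shows "(exp (2 * of_real pi * \<i> * b) - 1) * integral {0..\<rho>} (eulint a b d z) = of_real (2 * \<rho>) powr b * keyhole a b d \<rho> \<omega> r"
proof -
  define e where "e = exp (2 * of_real pi * \<i> * b)"
  define f where "f v = of_real v powr (b - 1) * hh a b d \<rho> \<omega> (of_real v)" for v :: real
  have c: "continuous_on {0..1} f"
  proof -
    have 1: "continuous_on {0..1} (\<lambda>v. of_real v powr (b - 1) :: complex)"
      by (rule continuous_on_compose2[OF continuous_on_powr_right_half[of "b - 1"]]) (use b in \<open>auto intro!: continuous_intros\<close>)
    have 2: "continuous_on {0..1} (\<lambda>v. hh a b d \<rho> \<omega> (of_real v))"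
      by (rule hh_continuous) (use \<rho> \<omega> in \<open>auto intro!: continuous_intros hh_ok_segment\<close>)
    show ?thesis unfolding f_def[abs_def] by (rule continuous_on_mult[OF 1 2])
  qed
  have "hh a b d \<rho> \<omega> holomorphic_on ball 0 1" by (rule hh_holomorphic_v) (use \<rho> \<omega> in \<open>auto intro!: hh_ok_ball\<close>)
  from keyhole_disc[OF this b r]
  have k: "(e - 1) * integral {0..r} f = \<i> * of_real r powr b * integral {0..2 * pi} (\<lambda>\<theta>. exp (\<i> * b * of_real \<theta>) * hh a b d \<rho> \<omega> (of_real r * cis \<theta>))"
    unfolding e_def f_def[abs_def] .
  have s: "integral {0..1} f = integral {0..r} f + integral {r..1} f"
    by (rule Henstock_Kurzweil_Integration.integral_combine[symmetric]) (use r in \<open>auto intro: integrable_continuous_real[OF c]\<close>)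
  have "(e - 1) * integral {0..1} f = (e - 1) * integral {0..r} f + (e - 1) * integral {r..1} f"
    unfolding s by (rule distrib_left)
  also have "\<dots> = keyhole a b d \<rho> \<omega> r"
    unfolding k unfolding keyhole_def e_def f_def[abs_def] ..
  finally have K: "(e - 1) * integral {0..1} f = keyhole a b d \<rho> \<omega> r" .
  have h: "integral {0..\<rho>} (eulint a b d z) = of_real (2 * \<rho>) powr b * integral {0..1} f"
    unfolding f_def[abs_def] by (rule half_Euler[OF b d z \<rho> \<omega>(1)])
  show ?thesis unfolding h e_def[symmetric] K[symmetric] by (rule mult.left_commute)
qed

text \<open>Indeed \<open>2\<rho>z - 1 = z/cnj z\<close>.\<close>
lemma omega_unit:
  assumes "Im z \<noteq> 0" "Re (1/z) = \<rho>" "\<rho> > 0"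
  shows "norm (2 * of_real \<rho> * z - 1) = 1" "2 * of_real \<rho> * z - 1 \<noteq> 1"
proof -
  have z0: "z \<noteq> 0" using assms by auto
  have rz: "\<rho> * (norm z)\<^sup>2 = Re z" using z0 unfolding assms(2)[symmetric] by (simp add: Re_divide cmod_power2)
  have "(norm (2 * of_real \<rho> * z - 1))\<^sup>2 = 4 * \<rho> * (\<rho> * (norm z)\<^sup>2) - 4 * \<rho> * Re z + 1"
    unfolding cmod_power2 by (simp add: power2_eq_square algebra_simps)
  then have "(norm (2 * of_real \<rho> * z - 1))\<^sup>2 = 1\<^sup>2" unfolding rz by simp
  then show "norm (2 * of_real \<rho> * z - 1) = 1" by (rule power2_eq_imp_eq) auto
  have "Im (2 * of_real \<rho> * z - 1) \<noteq> 0" using assms by simp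
  then show "2 * of_real \<rho> * z - 1 \<noteq> 1" by (metis one_complex.sel(2))
qed

lemma exp_2pi_i_neq_1: assumes "b \<notin> \<int>" shows "exp (2 * of_real pi * \<i> * b) - 1 \<noteq> 0"
proof
  assume "exp (2 * of_real pi * \<i> * b) - 1 = 0"
  then have "exp (2 * of_real pi * \<i> * b) = 1" by simp
  then obtain n :: int where n: "Im (2 * of_real pi * \<i> * b) = of_int (2 * n) * pi" "Re (2 * of_real pi * \<i> * b) = 0"
    unfolding exp_eq_1 by blast
  from n have "Re b = of_int n" "Im b = 0" by auto
  then have "b = of_int n" by (simp add: complex_eq_iff)
  with assms show False by simp
qed

text \<open>The sum of the two halves of Euler's integral, each over its keyhole contour; the second one after Pfaff's transformation.\<close>
definition keyrep :: "complex \<Rightarrow> complex \<Rightarrow> complex \<Rightarrow> complex \<Rightarrow> real \<Rightarrow> complex" where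
  "keyrep a b d z r = (let \<rho> = Re (1/z); z' = z / (z - 1) in
     of_real (2 * \<rho>) powr b * keyhole a b d \<rho> (2 * of_real \<rho> * z - 1) r / (exp (2 * of_real pi * \<i> * b) - 1)
   + (1 - z) powr (- a) * (of_real (2 * (1 - \<rho>)) powr d * keyhole a d b (1 - \<rho>) (2 * of_real (1 - \<rho>) * z' - 1) r / (exp (2 * of_real pi * \<i> * d) - 1)))"

lemma Im_pfaff_neg: assumes "Im z > 0" shows "Im (z / (z - 1)) < 0"
proof -
  have "Im (z / (z - 1)) = - Im z / (norm (z - 1))\<^sup>2" unfolding Im_divide by (simp add: cmod_power2 algebra_simps)
  moreover have "z - 1 \<noteq> 0" using assms by auto
  ultimately show ?thesis using assms by (simp add: divide_neg_pos)
qed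

lemma Im_nonzero_slit: "Im z \<noteq> 0 \<Longrightarrow> z \<in> slit_plane"
  by (auto simp: slit_plane_def)

lemma keyrep_right:
  assumes b: "Re b > 1" "b \<notin> \<int>" and d: "Re d > 1" "d \<notin> \<int>" and z: "Im z > 0" and \<rho>: "0 < Re (1/z)" "Re (1/z) < 1" and r: "0 < r" "r < 1"
  shows "Gamma b * Gamma d / Gamma (b + d) * hyp2F1 a b (b + d) z = keyrep a b d z r"
proof -
  define \<rho> where "\<rho> = Re (1/z)"
  define z' where "z' = z / (z - 1)"
  have zz: "z \<noteq> 0" "z - 1 \<noteq> 0" using z by auto
  have iz: "Im z' < 0" unfolding z'_def by (rule Im_pfaff_neg[OF z])
  have slit: "z \<in> slit_plane" "z' \<in> slit_plane" using z iz by (auto intro: Im_nonzero_slit)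
  have "1 / z' = 1 - 1/z" using zz by (simp add: z'_def diff_divide_distrib)
  then have rz': "Re (1/z') = 1 - \<rho>" by (simp add: \<rho>_def)
  have R: "0 < \<rho>" "\<rho> < 1" "0 < 1 - \<rho>" "1 - \<rho> < 1" using \<rho> by (auto simp: \<rho>_def)
  have o1: "norm (2 * of_real \<rho> * z - 1) = 1" "2 * of_real \<rho> * z - 1 \<noteq> 1"
    using omega_unit[OF _ \<rho>_def[symmetric] R(1)] z by auto
  have o2: "norm (2 * of_real (1 - \<rho>) * z' - 1) = 1" "2 * of_real (1 - \<rho>) * z' - 1 \<noteq> 1"
    using omega_unit[OF _ rz' R(3)] iz by auto
  have c: "continuous_on {0..1} (eulint a b d z)" by (rule continuous_eulint[OF b(1) d(1) slit(1)])
  have div: "I = P / E" if "E * I = P" "E \<noteq> 0" for E I P :: complex using that by (metis nonzero_mult_div_cancel_left)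
  have A: "integral {0..\<rho>} (eulint a b d z) = of_real (2 * \<rho>) powr b * keyhole a b d \<rho> (2 * of_real \<rho> * z - 1) r / (exp (2 * of_real pi * \<i> * b) - 1)"
    by (rule div[OF keyhole_half_Euler[OF b(1) d(1) slit(1) R(1,2) refl o1 r] exp_2pi_i_neq_1[OF b(2)]])
  have B: "integral {0..1 - \<rho>} (eulint a d b z') = of_real (2 * (1 - \<rho>)) powr d * keyhole a d b (1 - \<rho>) (2 * of_real (1 - \<rho>) * z' - 1) r / (exp (2 * of_real pi * \<i> * d) - 1)"
    by (rule div[OF keyhole_half_Euler[OF d(1) b(1) slit(2) R(3,4) refl o2 r] exp_2pi_i_neq_1[OF d(2)]])
  have C: "integral {\<rho>..1} (eulint a b d z) = (1 - z) powr (- a) * integral {0..1 - \<rho>} (eulint a d b z')"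
  proof -
    have i: "eulint a d b z' integrable_on {0..1 - \<rho>}"
      by (rule integrable_continuous_real, rule continuous_on_subset[OF continuous_eulint[OF d(1) b(1) slit(2)]]) (use R in auto)
    have "((\<lambda>t. (1 - z) powr (- a) * eulint a d b z' t) has_integral (1 - z) powr (- a) * integral {0..1 - \<rho>} (eulint a d b z')) {0..1 - \<rho>}"
      by (rule has_integral_mult_right[OF integrable_integral[OF i]])
    then have "((\<lambda>t. eulint a b d z (1 - t)) has_integral (1 - z) powr (- a) * integral {0..1 - \<rho>} (eulint a d b z')) {0..1 - \<rho>}"
      by (rule has_integral_eq[rotated]) (use R in \<open>auto simp: z'_def intro!: Pfaff_half_Euler[OF z, symmetric]\<close>)
    then have "((\<lambda>t. eulint a b d z (1 - t)) has_integral (1 - z) powr (- a) * integral {0..1 - \<rho>} (eulint a d b z')) (cbox 0 (1 - \<rho>))" by simp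
    from has_integral_affinity[OF this, of "-1" 1]
    have "((\<lambda>x. eulint a b d z (1 - (- x + 1))) has_integral (1 - z) powr (- a) * integral {0..1 - \<rho>} (eulint a d b z')) ((\<lambda>x. - x + 1) ` {0..1 - \<rho>})"
      by simp
    moreover have "(\<lambda>x. - x + 1) ` {0..1 - \<rho>} = {\<rho>..1}"
    proof -
      have "(\<lambda>x. - x + 1) = (\<lambda>x::real. 1 - x)" by (rule ext) simp
      then show ?thesis by simp
    qed
    moreover have "1 - (- x + 1) = x" for x :: real by simp
    ultimately show ?thesis by (simp only: integral_unique)
  qed
  have s: "integral {0..1} (eulint a b d z) = integral {0..\<rho>} (eulint a b d z) + integral {\<rho>..1} (eulint a b d z)"
    by (rule Henstock_Kurzweil_Integration.integral_combine[symmetric]) (use R in \<open>auto intro: integrable_continuous_real[OF c]\<close>)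
  note T = s[unfolded C B A]
  show ?thesis
    unfolding Euler_integral[OF b(1) d(1) slit(1), symmetric] T keyrep_def Let_def \<rho>_def z'_def ..
qed

text \<open>Both sides are holomorphic in a common shift \<open>\<sigma>\<close> of \<open>b\<close> and \<open>d\<close> off a countable set, whose complement is connected, and they agree for
  large real part of \<open>\<sigma>\<close>.\<close>
theorem keyrep_eq:
  assumes b: "b \<notin> \<int>" and d: "d \<notin> \<int>" and bd: "b + d \<notin> \<int>"
    and z: "Im z > 0" and \<rho>: "0 < Re (1/z)" "Re (1/z) < 1" and r: "0 < r" "r < 1"
  shows "Gamma b * Gamma d / Gamma (b + d) * hyp2F1 a b (b + d) z = keyrep a b d z r"
proof -
  define N where "N = {\<sigma>. b + \<sigma> \<in> \<int>} \<union> {\<sigma>. d + \<sigma> \<in> \<int>} \<union> {\<sigma>. b + d + 2 * \<sigma> \<in> \<int>}"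
  define W where "W = UNIV - N"
  have cN: "countable N"
  proof -
    have "{\<sigma>. b + \<sigma> \<in> \<int>} \<subseteq> (\<lambda>k. k - b) ` \<int>" "{\<sigma>. d + \<sigma> \<in> \<int>} \<subseteq> (\<lambda>k. k - d) ` \<int>" "{\<sigma>. b + d + 2 * \<sigma> \<in> \<int>} \<subseteq> (\<lambda>k. (k - b - d) / 2) ` \<int>"
      by (auto intro!: image_eqI simp: field_simps)
    then show ?thesis unfolding N_def using countable_Ints by (meson countable_Un countable_image countable_subset)
  qed
  have oW: "open W"
  proof -
    have "W = ((\<lambda>\<sigma>. b + \<sigma>) -` (- \<int>)) \<inter> ((\<lambda>\<sigma>. d + \<sigma>) -` (- \<int>)) \<inter> ((\<lambda>\<sigma>. b + d + 2 * \<sigma>) -` (- \<int>))"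
      by (auto simp: W_def N_def)
    then show ?thesis by (auto intro!: open_Int open_vimage open_compl_Ints continuous_intros)
  qed
  have kW: "connected W" unfolding W_def by (rule connected_open_diff_countable[OF _ open_UNIV connected_UNIV cN]) simp
  define V where "V = W \<inter> {\<sigma>. Re \<sigma> > 1 + \<bar>Re b\<bar> + \<bar>Re d\<bar>}"
  have oV: "open V" unfolding V_def by (intro open_Int oW open_halfspace_Re_gt)
  have neV: "V \<noteq> {}"
  proof
    assume "V = {}"
    then have "{\<sigma>. Re \<sigma> > 1 + \<bar>Re b\<bar> + \<bar>Re d\<bar>} \<subseteq> N" unfolding V_def W_def by blast
    then have "countable {\<sigma>. Re \<sigma> > 1 + \<bar>Re b\<bar> + \<bar>Re d\<bar>}" using cN countable_subset by blast
    moreover have "ball (of_real (2 + \<bar>Re b\<bar> + \<bar>Re d\<bar>)) 1 \<subseteq> {\<sigma>. Re \<sigma> > 1 + \<bar>Re b\<bar> + \<bar>Re d\<bar>}"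
    proof
      fix w :: complex assume "w \<in> ball (of_real (2 + \<bar>Re b\<bar> + \<bar>Re d\<bar>)) 1"
      then have "norm (of_real (2 + \<bar>Re b\<bar> + \<bar>Re d\<bar>) - w) < 1" by (simp only: mem_ball dist_norm)
      then have "\<bar>Re (of_real (2 + \<bar>Re b\<bar> + \<bar>Re d\<bar>) - w)\<bar> < 1" using abs_Re_le_cmod le_less_trans by blast
      then show "w \<in> {\<sigma>. Re \<sigma> > 1 + \<bar>Re b\<bar> + \<bar>Re d\<bar>}" by simp
    qed
    ultimately show False using uncountable_ball[of 1 "complex_of_real (2 + \<bar>Re b\<bar> + \<bar>Re d\<bar>)"] countable_subset by auto
  qed
  have z2: "z - 1 \<noteq> 0" "z \<noteq> 0" using z by auto
  have slit: "z \<in> slit_plane" using z by (auto intro: Im_nonzero_slit)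
  define f where "f \<sigma> = Gamma (b + \<sigma>) * Gamma (d + \<sigma>) * rGamma (b + d + 2 * \<sigma>) * hyp2F1 a (b + \<sigma>) (b + d + 2 * \<sigma>) z" for \<sigma>
  define g where "g \<sigma> = keyrep a (b + \<sigma>) (d + \<sigma>) z r" for \<sigma>
  have ni: "b + \<sigma> \<notin> \<int>" "d + \<sigma> \<notin> \<int>" "b + d + 2 * \<sigma> \<notin> \<int>" if "\<sigma> \<in> W" for \<sigma> using that by (auto simp: W_def N_def)
  then have np: "b + \<sigma> \<notin> \<int>\<^sub>\<le>\<^sub>0" "d + \<sigma> \<notin> \<int>\<^sub>\<le>\<^sub>0" "b + d + 2 * \<sigma> \<notin> \<int>\<^sub>\<le>\<^sub>0" if "\<sigma> \<in> W" for \<sigma> using that nonpos_Ints_subset_Ints by auto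
  have hb: "(\<lambda>\<sigma>. b + \<sigma>) holomorphic_on W" "(\<lambda>\<sigma>. d + \<sigma>) holomorphic_on W" by (intro holomorphic_intros)+
  have f: "f holomorphic_on W"
    unfolding f_def[abs_def]
    by (intro holomorphic_on_mult holomorphic_Gamma' holomorphic_rGamma' hyp2F1_param_holomorphic oW holomorphic_intros np slit)
  have g: "g holomorphic_on W"
  proof -
    define \<rho> where "\<rho> = Re (1/z)"
    define z' where "z' = z / (z - 1)"
    have iz: "Im z' < 0" unfolding z'_def by (rule Im_pfaff_neg[OF z])
    have "1 / z' = 1 - 1/z" using z2 by (simp add: z'_def diff_divide_distrib)
    then have rz': "Re (1/z') = 1 - \<rho>" by (simp add: \<rho>_def)
    have R: "0 < \<rho>" "\<rho> < 1" "0 < 1 - \<rho>" "1 - \<rho> < 1" using \<rho> by (auto simp: \<rho>_def)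
    have o1: "norm (2 * of_real \<rho> * z - 1) = 1" "2 * of_real \<rho> * z - 1 \<noteq> 1"
      using omega_unit[OF _ \<rho>_def[symmetric] R(1)] z by auto
    have o2: "norm (2 * of_real (1 - \<rho>) * z' - 1) = 1" "2 * of_real (1 - \<rho>) * z' - 1 \<noteq> 1"
      using omega_unit[OF _ rz' R(3)] iz by auto
    have k1: "(\<lambda>\<sigma>. keyhole a (b + \<sigma>) (d + \<sigma>) \<rho> (2 * of_real \<rho> * z - 1) r) holomorphic_on W"
      by (rule keyhole_holomorphic[OF oW hb R(1,2) o1 r])
    have k2: "(\<lambda>\<sigma>. keyhole a (d + \<sigma>) (b + \<sigma>) (1 - \<rho>) (2 * of_real (1 - \<rho>) * z' - 1) r) holomorphic_on W"
      by (rule keyhole_holomorphic[OF oW hb(2,1) R(3,4) o2 r])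
    show ?thesis unfolding g_def[abs_def] keyrep_def Let_def \<rho>_def[symmetric] z'_def[symmetric]
      by (intro holomorphic_on_add holomorphic_on_mult holomorphic_on_divide holomorphic_powr_exponent holomorphic_on_diff
            holomorphic_exp_mult hb k1 k2 holomorphic_on_const exp_2pi_i_neq_1 ni)
  qed
  have eq: "f \<sigma> = g \<sigma>" if "\<sigma> \<in> V" for \<sigma>
  proof -
    have W: "\<sigma> \<in> W" and R: "Re (b + \<sigma>) > 1" "Re (d + \<sigma>) > 1" using that by (auto simp: V_def abs_if split: if_splits)
    have e: "(b + \<sigma>) + (d + \<sigma>) = b + d + 2 * \<sigma>" by simp
    show ?thesis using keyrep_right[OF R(1) ni(1)[OF W] R(2) ni(2)[OF W] z \<rho> r, of a]
      unfolding e f_def g_def rGamma_inverse_Gamma divide_inverse .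
  qed
  have "0 \<in> W" using b d bd by (simp add: W_def N_def)
  then have "f 0 = g 0"
    by (intro analytic_continuation_open[OF oV oW neV kW _ f g eq]) (auto simp: V_def)
  then show ?thesis by (simp add: f_def g_def rGamma_inverse_Gamma divide_inverse)
qed

section \<open>The boundary value at 2\<close>

lemma tendsto_powr_slit:
  fixes f :: "'a \<Rightarrow> complex"
  assumes "(f \<longlongrightarrow> w) F" "w \<notin> \<real>\<^sub>\<le>\<^sub>0" shows "((\<lambda>x. f x powr p) \<longlongrightarrow> w powr p) F"
proof -
  have "isCont (\<lambda>w. w powr p) w" by (rule DERIV_isCont[OF has_field_derivative_powr[OF assms(2)]])
  then show ?thesis by (rule isCont_tendsto_compose[OF _ assms(1)])
qed

lemma tendsto_powr_right_half:
  fixes f :: "'a \<Rightarrow> complex"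
  assumes "(f \<longlongrightarrow> w) F" "Re p > 0" "\<And>x. Re (f x) \<ge> 0" "Re w \<ge> 0" shows "((\<lambda>x. f x powr p) \<longlongrightarrow> w powr p) F"
  by (rule continuous_on_tendsto_compose[OF continuous_on_powr_right_half[OF assms(2)] assms(1)])
     (use assms in auto)

lemma norm_powr_between:
  assumes "1/2 \<le> norm w" "norm w \<le> 2" shows "norm ((w::complex) powr m) \<le> 2 powr \<bar>Re m\<bar> * exp (pi * \<bar>Im m\<bar>)"
proof -
  have "norm w powr Re m \<le> 2 powr \<bar>Re m\<bar>"
  proof (cases "Re m \<ge> 0")
    case True
    then show ?thesis using assms by (auto intro: powr_mono2)
  next
    case False
    have "norm w powr Re m \<le> (1/2) powr Re m" using False assms by (intro powr_mono2') auto
    also have "\<dots> = 2 powr \<bar>Re m\<bar>" using False by (simp add: powr_divide powr_minus_divide)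
    finally show ?thesis .
  qed
  then have "norm w powr Re m * exp (pi * \<bar>Im m\<bar>) \<le> 2 powr \<bar>Re m\<bar> * exp (pi * \<bar>Im m\<bar>)" by (rule mult_right_mono) simp
  then show ?thesis using norm_powr_le[of w m] by linarith
qed

lemma norm_exp_circle_le:
  assumes "\<theta> \<in> {0..2 * pi}" shows "norm (exp (\<i> * b * of_real \<theta>)) \<le> exp (2 * pi * \<bar>Im b\<bar>)"
proof -
  have "- Im b * \<theta> \<le> \<bar>Im b\<bar> * (2 * pi)" using assms by (intro mult_mono) auto
  then show ?thesis by (simp add: norm_exp_eq_Re mult_ac)
qed

text \<open>Exponents with positive real part at the two singular points, and a middle factor whose base stays in the annulus
  \<open>1/2 \<le> |w| \<le> 2\<close>, give a bound independent of \<open>\<rho>\<close>, \<open>\<omega>\<close> and \<open>v\<close>.\<close>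
lemma hh_bound:
  fixes v :: complex
  assumes e: "a - b - d = q" "Re q > 0" "Re (- a) > 0"
    and \<rho>: "\<bar>1 - 2 * \<rho>\<bar> \<le> 1/2" "norm \<omega> = 1" "norm v \<le> 1"
  shows "norm (hh a b d \<rho> \<omega> v) \<le> (2 powr Re q * exp (pi * \<bar>Im q\<bar>)) * (2 powr \<bar>Re (d - 1)\<bar> * exp (pi * \<bar>Im (d - 1)\<bar>))
     * (2 powr Re (- a) * exp (pi * \<bar>Im (- a)\<bar>))"
proof -
  have 1: "norm (1 + v) \<le> 2" using norm_triangle_ineq[of 1 v] \<rho> by simp
  have w: "norm (\<omega> * v) \<le> 1" using \<rho> by (simp add: norm_mult)
  have 2: "norm (1 - \<omega> * v) \<le> 2" using norm_triangle_ineq4[of 1 "\<omega> * v"] w by simp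
  define u where "u = of_real (1 - 2 * \<rho>) * v"
  have "norm u \<le> 1/2"
  proof -
    have "\<bar>1 - 2 * \<rho>\<bar> * norm v \<le> (1/2) * 1" using \<rho> by (intro mult_mono) auto
    then show ?thesis unfolding u_def norm_mult norm_of_real by simp
  qed
  then have 3: "1/2 \<le> norm (1 + u)" "norm (1 + u) \<le> 2"
    using norm_triangle_ineq[of 1 u] norm_diff_ineq[of 1 u] by simp_all
  show ?thesis unfolding hh_def e(1) norm_mult u_def[symmetric]
    by (intro mult_mono norm_powr_le_2 norm_powr_between 1 2 3 e) auto
qed

text \<open>The two straight parts shrink to a point as \<open>r \<rightarrow> 1\<close>, and the middle factor of \<open>hh\<close> tends to 1 as \<open>\<rho> \<rightarrow> 1/2\<close>.\<close>
lemma keyhole_tendsto: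
  fixes \<rho> r :: "nat \<Rightarrow> real" and \<omega> :: "nat \<Rightarrow> complex"
  assumes e: "a - b - d = q" "Re q > 0" "Re (- a) > 0"
    and R: "\<And>n. 0 < \<rho> n" "\<And>n. \<rho> n < 1" "\<And>n. \<bar>1 - 2 * \<rho> n\<bar> \<le> 1/2" "\<rho> \<longlonglongrightarrow> 1/2"
    and O: "\<And>n. norm (\<omega> n) = 1" "\<And>n. \<omega> n \<noteq> 1" "\<omega> \<longlonglongrightarrow> 1"
    and r: "\<And>n. 1/2 \<le> r n" "\<And>n. r n < 1" "r \<longlonglongrightarrow> 1"
  shows "(\<lambda>n. keyhole a b d (\<rho> n) (\<omega> n) (r n)) \<longlonglongrightarrow>
     \<i> * integral {0..2 * pi} (\<lambda>\<theta>. exp (\<i> * b * of_real \<theta>) * ((1 + cis \<theta>) powr q * (1 - cis \<theta>) powr (- a)))"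
proof -
  have r0: "0 < r n" for n using r(1)[of n] by linarith
  define B where "B = (2 powr Re q * exp (pi * \<bar>Im q\<bar>)) * (2 powr \<bar>Re (d - 1)\<bar> * exp (pi * \<bar>Im (d - 1)\<bar>))
     * (2 powr Re (- a) * exp (pi * \<bar>Im (- a)\<bar>))"
  have rc: "(\<lambda>n. complex_of_real (r n)) \<longlonglongrightarrow> 1" using tendsto_of_real[OF r(3), where 'a = complex] by simp
  have \<rho>c: "(\<lambda>n. complex_of_real (1 - 2 * \<rho> n)) \<longlonglongrightarrow> 0"
  proof -
    have "(\<lambda>n. 1 - 2 * \<rho> n) \<longlonglongrightarrow> 1 - 2 * (1/2)" by (intro tendsto_intros R(4))
    then show ?thesis using tendsto_of_real[of "\<lambda>n. 1 - 2 * \<rho> n" 0, where 'a = complex] by simp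
  qed
  define F where "F n \<theta> = exp (\<i> * b * of_real \<theta>) * hh a b d (\<rho> n) (\<omega> n) (of_real (r n) * cis \<theta>)" for n \<theta>
  define G where "G \<theta> = exp (\<i> * b * of_real \<theta>) * ((1 + cis \<theta>) powr q * (1 - cis \<theta>) powr (- a))" for \<theta>
  have 1: "(\<lambda>n. integral {0..2 * pi} (F n)) \<longlonglongrightarrow> integral {0..2 * pi} G"
  proof (rule dominated_convergence(2)[where h = "\<lambda>_. exp (2 * pi * \<bar>Im b\<bar>) * B"])
    show "F n integrable_on {0..2 * pi}" for n
    proof (rule integrable_continuous_real)
      have "continuous_on {0..2 * pi} (\<lambda>\<theta>. hh a b d (\<rho> n) (\<omega> n) (of_real (r n) * cis \<theta>))"
        by (rule hh_continuous, intro continuous_intros)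
           (rule hh_ok_ball, use R O r r0[of n] r(2)[of n] in \<open>auto simp: norm_mult\<close>)
      then show "continuous_on {0..2 * pi} (F n)" unfolding F_def[abs_def] by (rule continuous_on_mult[rotated]) (intro continuous_intros)
    qed
    show "(\<lambda>_. exp (2 * pi * \<bar>Im b\<bar>) * B) integrable_on {0..2 * pi}" by (rule integrable_const_ivl)
    show "norm (F n \<theta>) \<le> exp (2 * pi * \<bar>Im b\<bar>) * B" if "\<theta> \<in> {0..2 * pi}" for n \<theta>
    proof -
      have "norm (hh a b d (\<rho> n) (\<omega> n) (of_real (r n) * cis \<theta>)) \<le> B"
        unfolding B_def by (rule hh_bound[OF e R(3) O(1)]) (use r0[of n] r(2)[of n] in \<open>simp add: norm_mult\<close>)
      then show ?thesis unfolding F_def norm_mult using norm_exp_circle_le[OF that] by (intro mult_mono) auto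
    qed
    show "(\<lambda>n. F n \<theta>) \<longlonglongrightarrow> G \<theta>" for \<theta>
    proof -
      have v: "(\<lambda>n. of_real (r n) * cis \<theta>) \<longlonglongrightarrow> 1 * cis \<theta>" by (intro tendsto_mult rc tendsto_const)
      have rs: "\<bar>Re (cis \<theta>)\<bar> \<le> 1" "\<bar>Re (of_real (r n) * cis \<theta>)\<bar> \<le> 1" "\<bar>Re (\<omega> n * (of_real (r n) * cis \<theta>))\<bar> \<le> 1" for n
      proof -
        have "norm (of_real (r n) * cis \<theta>) \<le> 1" using r0[of n] r(2)[of n] by (simp add: norm_mult)
        moreover have "norm (\<omega> n * (of_real (r n) * cis \<theta>)) \<le> 1" using r0[of n] r(2)[of n] by (simp add: norm_mult O)
        ultimately show "\<bar>Re (of_real (r n) * cis \<theta>)\<bar> \<le> 1" "\<bar>Re (\<omega> n * (of_real (r n) * cis \<theta>))\<bar> \<le> 1"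
          using abs_Re_le_cmod order_trans by blast+
      qed simp
      have 1: "(\<lambda>n. (1 + of_real (r n) * cis \<theta>) powr q) \<longlonglongrightarrow> (1 + 1 * cis \<theta>) powr q"
      proof (rule tendsto_powr_right_half[OF tendsto_add[OF tendsto_const v] e(2)])
        show "Re (1 + of_real (r n) * cis \<theta>) \<ge> 0" for n using rs(2)[of n] unfolding plus_complex.sel one_complex.sel by linarith
        show "Re (1 + 1 * cis \<theta>) \<ge> 0" using rs(1) unfolding plus_complex.sel one_complex.sel mult_1_left by linarith
      qed
      have 2: "(\<lambda>n. (1 + of_real (1 - 2 * \<rho> n) * (of_real (r n) * cis \<theta>)) powr (d - 1)) \<longlonglongrightarrow> (1 + 0 * (1 * cis \<theta>)) powr (d - 1)"
        by (rule tendsto_powr_slit[OF tendsto_add[OF tendsto_const tendsto_mult[OF \<rho>c v]]]) simp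
      have 3: "(\<lambda>n. (1 - \<omega> n * (of_real (r n) * cis \<theta>)) powr (- a)) \<longlonglongrightarrow> (1 - 1 * (1 * cis \<theta>)) powr (- a)"
        by (rule tendsto_powr_right_half[OF tendsto_diff[OF tendsto_const tendsto_mult[OF O(3) v]] e(3)])
           (use rs in \<open>auto simp: abs_le_iff\<close>)
      from tendsto_mult[OF tendsto_const[of "exp (\<i> * b * of_real \<theta>)"] tendsto_mult[OF tendsto_mult[OF 1 2] 3]]
      show ?thesis unfolding F_def G_def hh_def e(1) by simp
    qed
  qed
  define J where "J n = integral {r n..1} (\<lambda>v. of_real v powr (b - 1) * hh a b d (\<rho> n) (\<omega> n) (of_real v))" for n
  have 2: "J \<longlonglongrightarrow> 0"
  proof (rule Lim_null_comparison)
    define C where "C = 2 powr \<bar>Re (b - 1)\<bar> * exp (pi * \<bar>Im (b - 1)\<bar>) * B"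
    show "\<forall>\<^sub>F n in sequentially. norm (J n) \<le> C * (1 - r n)"
    proof (rule always_eventually, rule allI)
      fix n
      show "norm (J n) \<le> C * (1 - r n)" unfolding J_def
      proof (rule integral_bound)
        show "r n \<le> 1" using r(2)[of n] by simp
        have 1: "continuous_on {r n..1} (\<lambda>v. hh a b d (\<rho> n) (\<omega> n) (of_real v))"
          by (rule hh_continuous) (use R O r0[of n] in \<open>auto intro!: continuous_intros hh_ok_segment\<close>)
        have 2: "continuous_on {r n..1} (\<lambda>v. complex_of_real v powr (b - 1))"
          by (rule continuous_powr_const) (use r0[of n] in \<open>auto intro!: continuous_intros simp: complex_nonpos_Reals_iff\<close>)
        show "continuous_on {r n..1} (\<lambda>v. of_real v powr (b - 1) * hh a b d (\<rho> n) (\<omega> n) (of_real v))"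
          by (rule continuous_on_mult[OF 2 1])
        show "norm (of_real v powr (b - 1) * hh a b d (\<rho> n) (\<omega> n) (of_real v)) \<le> C" if "v \<in> {r n..1}" for v
        proof -
          have v: "1/2 \<le> v" "v \<le> 1" using that r(1)[of n] by auto
          have "norm (complex_of_real v powr (b - 1)) \<le> 2 powr \<bar>Re (b - 1)\<bar> * exp (pi * \<bar>Im (b - 1)\<bar>)"
            by (rule norm_powr_between) (use v in auto)
          moreover have "norm (hh a b d (\<rho> n) (\<omega> n) (of_real v)) \<le> B"
            unfolding B_def by (rule hh_bound[OF e R(3) O(1)]) (use v in simp)
          ultimately show ?thesis unfolding C_def norm_mult by (intro mult_mono) auto
        qed
      qed
    qed
    have "(\<lambda>n. C * (1 - r n)) \<longlonglongrightarrow> C * (1 - 1)" by (intro tendsto_intros r(3))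
    then show "(\<lambda>n. C * (1 - r n)) \<longlonglongrightarrow> 0" by simp
  qed
  have 3: "(\<lambda>n. complex_of_real (r n) powr b) \<longlonglongrightarrow> 1 powr b" by (rule tendsto_powr_slit[OF rc]) simp
  have "(\<lambda>n. \<i> * of_real (r n) powr b * integral {0..2 * pi} (F n) + (exp (2 * of_real pi * \<i> * b) - 1) * J n)
     \<longlonglongrightarrow> \<i> * 1 powr b * integral {0..2 * pi} G + (exp (2 * of_real pi * \<i> * b) - 1) * 0"
    by (intro tendsto_add tendsto_mult tendsto_const 1 2 3)
  then show ?thesis unfolding keyhole_def F_def[abs_def] J_def G_def[abs_def] by simp
qed

lemma circle_moment:
  assumes pq: "Re p > 0" "Re q > 0"
  shows "integral {0..2 * pi} (\<lambda>\<theta>. exp (\<i> * l * of_real \<theta>) * ((1 + cis \<theta>) powr q * (1 - cis \<theta>) powr p))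
    = exp (- (\<i> * p * of_real pi / 2)) * Vint (\<i> * (l + (p + q)/2)) p q + exp (2 * of_real pi * \<i> * l + \<i> * p * of_real pi / 2) * Vint (- (\<i> * (l + (p + q)/2))) p q"
proof (rule integral_circle_fold[OF pq])
  fix \<theta> assume t: "\<theta> \<in> {0..pi}"
  have g: "x * ((c * y) * (s * z)) = k * (c * s * w)" if "x * y * z = k * w" for x y z k w c s :: complex
  proof -
    have "x * ((c * y) * (s * z)) = (x * y * z) * (c * s)" by (simp only: mult_ac)
    then show ?thesis unfolding that by (simp only: mult_ac)
  qed
  have e1: "exp (\<i> * l * of_real \<theta>) * exp (\<i> * q * of_real \<theta> / 2) * exp (\<i> * p * of_real (\<theta> - pi) / 2) = exp (- (\<i> * p * of_real pi / 2)) * exp (\<i> * (l + (p + q)/2) * of_real \<theta>)"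
    unfolding exp_add[symmetric] by (rule arg_cong[where f = exp]) (simp add: field_simps)
  show "exp (\<i> * l * of_real \<theta>) * ((1 + cis \<theta>) powr q * (1 - cis \<theta>) powr p) = exp (- (\<i> * p * of_real pi / 2)) *
     (of_real (2 * cos (\<theta>/2)) powr q * of_real (2 * sin (\<theta>/2)) powr p * exp (\<i> * (l + (p + q)/2) * of_real \<theta>))"
    unfolding one_minus_cis_powr(1)[OF t] one_plus_cis_powr(1)[OF t] by (rule g[OF e1])
  have e2: "exp (\<i> * l * of_real (2 * pi - \<theta>)) * exp (- (\<i> * q * of_real \<theta> / 2)) * exp (- (\<i> * p * of_real (\<theta> - pi) / 2)) = exp (2 * of_real pi * \<i> * l + \<i> * p * of_real pi / 2) * exp (- (\<i> * (l + (p + q)/2)) * of_real \<theta>)"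
    unfolding exp_add[symmetric] by (rule arg_cong[where f = exp]) (simp add: field_simps)
  show "exp (\<i> * l * of_real (2 * pi - \<theta>)) * ((1 + cis (2 * pi - \<theta>)) powr q * (1 - cis (2 * pi - \<theta>)) powr p) = exp (2 * of_real pi * \<i> * l + \<i> * p * of_real pi / 2) *
     (of_real (2 * cos (\<theta>/2)) powr q * of_real (2 * sin (\<theta>/2)) powr p * exp (- (\<i> * (l + (p + q)/2)) * of_real \<theta>))"
    unfolding cis_2pi_minus one_minus_cis_powr(2)[OF t] one_plus_cis_powr(2)[OF t] by (rule g[OF e2])
qed

text \<open>The limit of \<open>keyrep\<close>; \<open>p = -a\<close> and \<open>q = -b\<close> have positive real part.\<close>
definition Hlim :: "complex \<Rightarrow> complex \<Rightarrow> complex" where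
  "Hlim p q = \<i> * integral {0..2 * pi} (\<lambda>\<theta>. exp (\<i> * (- q) * of_real \<theta>) * ((1 + cis \<theta>) powr q * (1 - cis \<theta>) powr p)) / (exp (2 * of_real pi * \<i> * (- q)) - 1)
   + exp (- (\<i> * of_real pi * p)) * (\<i> * integral {0..2 * pi} (\<lambda>\<theta>. exp (\<i> * (- p) * of_real \<theta>) * ((1 + cis \<theta>) powr q * (1 - cis \<theta>) powr p)) / (exp (2 * of_real pi * \<i> * (- p)) - 1))"

text \<open>As \<open>z\<close> approaches 2 from above, \<open>1 - z\<close> approaches the negative axis from below; hence the sign of the phase.\<close>
lemma one_minus_powr_upper:
  assumes "Im z > 0" shows "(1 - z) powr p = exp (- (\<i> * of_real pi * p)) * (z - 1) powr p"
proof -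
  have z: "z - 1 \<noteq> 0" "1 - z \<noteq> 0" "Im (z - 1) > 0" using assms by auto
  have "Ln (- (z - 1)) = Ln (z - 1) - \<i> * of_real pi" using z Ln_minus[of "z - 1"] by auto
  then have "Ln (1 - z) = Ln (z - 1) - \<i> * of_real pi" by simp
  then have "(1 - z) powr p = exp (p * (Ln (z - 1) - \<i> * of_real pi))" using z by (simp add: powr_def)
  also have "p * (Ln (z - 1) - \<i> * of_real pi) = - (\<i> * of_real pi * p) + p * Ln (z - 1)" by (simp add: algebra_simps)
  finally have "(1 - z) powr p = exp (- (\<i> * of_real pi * p)) * exp (p * Ln (z - 1))" unfolding exp_add .
  then show ?thesis using z by (simp only: powr_def[of "z - 1"]) simp
qed

lemma keyrep_tendsto:
  fixes z :: "nat \<Rightarrow> complex"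
  assumes pq: "Re p > 0" "Re q > 0" "p \<notin> \<int>" "q \<notin> \<int>"
    and z: "\<And>n. Im (z n) > 0" "z \<longlonglongrightarrow> 2" and R: "\<And>n. \<bar>1 - 2 * Re (1 / z n)\<bar> \<le> 1/2"
    and r: "\<And>n. 1/2 \<le> r n" "\<And>n. r n < 1" "r \<longlonglongrightarrow> 1"
  shows "(\<lambda>n. keyrep (- p) (- q) (- p) (z n) (r n)) \<longlonglongrightarrow> Hlim p q"
proof -
  define \<rho> where "\<rho> n = Re (1 / z n)" for n
  define z' where "z' n = z n / (z n - 1)" for n
  have zz: "z n \<noteq> 0" "z n - 1 \<noteq> 0" for n using z(1)[of n] by auto
  have iz: "Im (z' n) < 0" for n unfolding z'_def by (rule Im_pfaff_neg[OF z(1)])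
  have rz': "Re (1 / z' n) = 1 - \<rho> n" for n
  proof -
    have "1 / z' n = 1 - 1 / z n" using zz by (simp add: z'_def diff_divide_distrib)
    then show ?thesis by (simp add: \<rho>_def)
  qed
  have b: "1/4 \<le> \<rho> n" "\<rho> n \<le> 3/4" for n using R[of n] unfolding \<rho>_def by linarith+
  have R1: "0 < \<rho> n" "\<rho> n < 1" for n using b[of n] by linarith+
  have R2: "0 < 1 - \<rho> n" "1 - \<rho> n < 1" for n using b[of n] by linarith+
  have A1: "\<bar>1 - 2 * \<rho> n\<bar> \<le> 1/2" for n by (rule abs_leI) (use b[of n] in linarith)+
  have A2: "\<bar>1 - 2 * (1 - \<rho> n)\<bar> \<le> 1/2" for n
  proof -
    have "1 - 2 * (1 - \<rho> n) = - (1 - 2 * \<rho> n)" by simp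
    then show ?thesis using A1[of n] by (simp only: abs_minus_cancel)
  qed
  have o1: "norm (2 * of_real (\<rho> n) * z n - 1) = 1" "2 * of_real (\<rho> n) * z n - 1 \<noteq> 1" for n
    using omega_unit[OF _ \<rho>_def[symmetric] R1(1)] z(1)[of n] by auto
  have o2: "norm (2 * of_real (1 - \<rho> n) * z' n - 1) = 1" "2 * of_real (1 - \<rho> n) * z' n - 1 \<noteq> 1" for n
    using omega_unit[OF _ rz' R2(1)] iz[of n] by auto
  have \<rho>l: "\<rho> \<longlonglongrightarrow> 1/2"
  proof -
    have "(\<lambda>n. Re (1 / z n)) \<longlonglongrightarrow> Re (1 / 2)" by (intro tendsto_intros z(2)) auto
    then show ?thesis by (simp add: \<rho>_def[abs_def])
  qed
  have \<rho>l': "(\<lambda>n. 1 - \<rho> n) \<longlonglongrightarrow> 1/2" using tendsto_diff[OF tendsto_const[of 1] \<rho>l] by simp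
  have zl: "z' \<longlonglongrightarrow> 2"
  proof -
    have "(\<lambda>n. z n / (z n - 1)) \<longlonglongrightarrow> 2 / (2 - 1)" by (intro tendsto_intros z(2)) auto
    then show ?thesis by (simp add: z'_def[abs_def])
  qed
  have ol: "(\<lambda>n. 2 * of_real (x n) * y n - 1) \<longlonglongrightarrow> 1" if "x \<longlonglongrightarrow> 1/2" "y \<longlonglongrightarrow> 2" for x :: "nat \<Rightarrow> real" and y :: "nat \<Rightarrow> complex"
  proof -
    have "(\<lambda>n. 2 * of_real (x n) * y n - 1) \<longlonglongrightarrow> 2 * of_real (1/2) * 2 - 1" by (intro tendsto_intros that)
    then show ?thesis by simp
  qed
  have k1: "(\<lambda>n. keyhole (- p) (- q) (- p) (\<rho> n) (2 * of_real (\<rho> n) * z n - 1) (r n)) \<longlonglongrightarrow>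
     \<i> * integral {0..2 * pi} (\<lambda>\<theta>. exp (\<i> * (- q) * of_real \<theta>) * ((1 + cis \<theta>) powr q * (1 - cis \<theta>) powr (- (- p))))"
    by (rule keyhole_tendsto[OF _ _ _ R1 A1 \<rho>l o1 ol[OF \<rho>l z(2)] r]) (use pq in auto)
  have k2: "(\<lambda>n. keyhole (- p) (- p) (- q) (1 - \<rho> n) (2 * of_real (1 - \<rho> n) * z' n - 1) (r n)) \<longlonglongrightarrow>
     \<i> * integral {0..2 * pi} (\<lambda>\<theta>. exp (\<i> * (- p) * of_real \<theta>) * ((1 + cis \<theta>) powr q * (1 - cis \<theta>) powr (- (- p))))"
    by (rule keyhole_tendsto[OF _ _ _ R2 A2 \<rho>l' o2 ol[OF \<rho>l' zl] r]) (use pq in auto)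
  have pw: "(\<lambda>n. of_real (2 * x n) powr c) \<longlonglongrightarrow> (1 :: complex)" if "x \<longlonglongrightarrow> 1/2" for x :: "nat \<Rightarrow> real" and c :: complex
  proof -
    have "(\<lambda>n. complex_of_real (2 * x n)) \<longlonglongrightarrow> of_real (2 * (1/2))" by (intro tendsto_intros that)
    then have "(\<lambda>n. of_real (2 * x n) powr c) \<longlonglongrightarrow> of_real (2 * (1/2)) powr c" by (rule tendsto_powr_slit) simp
    then show ?thesis by simp
  qed
  have z1: "(\<lambda>n. (1 - z n) powr p) \<longlonglongrightarrow> exp (- (\<i> * of_real pi * p))"
  proof -
    have "(\<lambda>n. z n - 1) \<longlonglongrightarrow> 2 - 1" by (intro tendsto_intros z(2))
    then have "(\<lambda>n. (z n - 1) powr p) \<longlonglongrightarrow> (2 - 1) powr p" by (rule tendsto_powr_slit) simp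
    from tendsto_mult[OF tendsto_const[of "exp (- (\<i> * of_real pi * p))"] this] show ?thesis
      unfolding one_minus_powr_upper[OF z(1)] by simp
  qed
  have "(\<lambda>n. of_real (2 * \<rho> n) powr (- q) * keyhole (- p) (- q) (- p) (\<rho> n) (2 * of_real (\<rho> n) * z n - 1) (r n) / (exp (2 * of_real pi * \<i> * (- q)) - 1)
    + (1 - z n) powr p * (of_real (2 * (1 - \<rho> n)) powr (- p) * keyhole (- p) (- p) (- q) (1 - \<rho> n) (2 * of_real (1 - \<rho> n) * z' n - 1) (r n) / (exp (2 * of_real pi * \<i> * (- p)) - 1)))
    \<longlonglongrightarrow> 1 * (\<i> * integral {0..2 * pi} (\<lambda>\<theta>. exp (\<i> * (- q) * of_real \<theta>) * ((1 + cis \<theta>) powr q * (1 - cis \<theta>) powr (- (- p))))) / (exp (2 * of_real pi * \<i> * (- q)) - 1)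
     + exp (- (\<i> * of_real pi * p)) * (1 * (\<i> * integral {0..2 * pi} (\<lambda>\<theta>. exp (\<i> * (- p) * of_real \<theta>) * ((1 + cis \<theta>) powr q * (1 - cis \<theta>) powr (- (- p))))) / (exp (2 * of_real pi * \<i> * (- p)) - 1))"
    by (intro tendsto_add tendsto_mult tendsto_divide tendsto_const k1 k2 pw \<rho>l \<rho>l' z1 exp_2pi_i_neq_1) (use pq in \<open>auto simp: minus_in_Ints_iff\<close>)
  then show ?thesis unfolding keyrep_def Let_def Hlim_def \<rho>_def[symmetric] z'_def[symmetric] by (simp only: minus_minus mult_1_left)
qed

lemma upper_half_limit_nontrivial: "at (2::complex) within {z. Im z > 0} \<noteq> bot"
  unfolding trivial_limit_within islimpt_approachable not_not
proof (intro allI impI)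
  fix e :: real assume e: "e > 0"
  show "\<exists>x'\<in>{z. Im z > 0}. x' \<noteq> 2 \<and> dist x' (2::complex) < e"
    by (rule bexI[of _ "2 + \<i> * of_real (e/2)"]) (use e in \<open>auto simp: dist_norm norm_mult complex_eq_iff\<close>)
qed

theorem hyp2F1_boundary_value:
  assumes pq: "Re p > 0" "Re q > 0" "p \<notin> \<int>" "q \<notin> \<int>" "p + q \<notin> \<int>"
  shows "(hyp2F1 (- p) (- q) (- p - q) \<longlongrightarrow> Gamma (- p - q) * rGamma (- p) * rGamma (- q) * Hlim p q) (at 2 within {z. Im z > 0})"
  unfolding tendsto_at_iff_sequentially
proof (intro allI impI)
  fix X :: "nat \<Rightarrow> complex" assume X: "\<forall>i. X i \<in> {z. Im z > 0} - {2}" "X \<longlonglongrightarrow> 2"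
  have ni: "- p \<notin> \<int>" "- q \<notin> \<int>" "- q + - p \<notin> \<int>"
  proof -
    have "- q + - p = - (p + q)" by simp
    then show "- p \<notin> \<int>" "- q \<notin> \<int>" "- q + - p \<notin> \<int>" using pq by (simp_all only: minus_in_Ints_iff) auto
  qed
  have "(\<lambda>n. \<bar>1 - 2 * Re (1 / X n)\<bar>) \<longlonglongrightarrow> \<bar>1 - 2 * Re (1 / 2)\<bar>" by (intro tendsto_intros X(2)) auto
  then have "\<forall>\<^sub>F n in sequentially. \<bar>1 - 2 * Re (1 / X n)\<bar> < 1/2" by (rule order_tendstoD) simp
  then obtain N where N: "\<And>n. n \<ge> N \<Longrightarrow> \<bar>1 - 2 * Re (1 / X n)\<bar> < 1/2" unfolding eventually_sequentially by blast
  define z where "z n = X (n + N)" for n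
  define r where "r n = 1 - 1 / (real n + 2)" for n
  have z: "Im (z n) > 0" "\<bar>1 - 2 * Re (1 / z n)\<bar> \<le> 1/2" for n using X(1) N[of "n + N"] by (auto simp: z_def)
  have zl: "z \<longlonglongrightarrow> 2" unfolding z_def[abs_def] by (rule LIMSEQ_ignore_initial_segment[OF X(2)])
  have r: "1/2 \<le> r n" "r n < 1" for n by (auto simp: r_def field_simps)
  have rl: "r \<longlonglongrightarrow> 1" unfolding r_def[abs_def] by real_asymp
  have kl: "(\<lambda>n. keyrep (- p) (- q) (- p) (z n) (r n)) \<longlonglongrightarrow> Hlim p q"
    by (rule keyrep_tendsto[OF pq(1-4) z(1) zl z(2) r rl])
  define G where "G = Gamma (- p - q) * rGamma (- p) * rGamma (- q)"
  have GG: "G * (Gamma (- q) * Gamma (- p) / Gamma (- q + - p)) = 1"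
  proof -
    have "Gamma (- p) \<noteq> 0" "Gamma (- q) \<noteq> 0" "Gamma (- q + - p) \<noteq> 0"
      using ni nonpos_Ints_subset_Ints by (auto simp: Gamma_eq_zero_iff)
    moreover have "- p - q = - q + - p" by simp
    moreover have "(g * inverse x * inverse y) * (y * x / g) = 1" if "x \<noteq> 0" "y \<noteq> 0" "g \<noteq> 0" for x y g :: complex
      using that by (simp add: field_simps)
    ultimately show ?thesis unfolding G_def rGamma_inverse_Gamma by metis
  qed
  have h: "hyp2F1 (- p) (- q) (- p - q) (z n) = G * keyrep (- p) (- q) (- p) (z n) (r n)" for n
  proof -
    have "0 < Re (1 / z n)" "Re (1 / z n) < 1" using z(2)[of n] by linarith+
    moreover have "0 < r n" using r(1)[of n] by linarith
    ultimately have "Gamma (- q) * Gamma (- p) / Gamma (- q + - p) * hyp2F1 (- p) (- q) (- q + - p) (z n) = keyrep (- p) (- q) (- p) (z n) (r n)"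
      by (intro keyrep_eq ni z r(2))
    then have "G * keyrep (- p) (- q) (- p) (z n) (r n) = (G * (Gamma (- q) * Gamma (- p) / Gamma (- q + - p))) * hyp2F1 (- p) (- q) (- q + - p) (z n)"
      by (simp only: mult.assoc)
    also have "- q + - p = - p - q" by simp
    finally show ?thesis using GG by (simp add: add.commute)
  qed
  have "(\<lambda>n. G * keyrep (- p) (- q) (- p) (z n) (r n)) \<longlonglongrightarrow> G * Hlim p q" by (intro tendsto_mult tendsto_const kl)
  then have "(\<lambda>n. hyp2F1 (- p) (- q) (- p - q) (z n)) \<longlonglongrightarrow> G * Hlim p q" by (simp only: h)
  then have "(\<lambda>n. hyp2F1 (- p) (- q) (- p - q) (X (n + N))) \<longlonglongrightarrow> G * Hlim p q" unfolding z_def .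
  then have "(\<lambda>n. hyp2F1 (- p) (- q) (- p - q) (X n)) \<longlonglongrightarrow> G * Hlim p q" by (rule LIMSEQ_offset)
  then show "(hyp2F1 (- p) (- q) (- p - q) \<circ> X) \<longlonglongrightarrow> Gamma (- p - q) * rGamma (- p) * rGamma (- q) * Hlim p q"
    unfolding G_def o_def .
qed

lemma inverse_exp_cot:
  assumes "b \<notin> \<int>" shows "1 / (exp (2 * of_real pi * \<i> * b) - 1) = cot (of_real pi * b) / (2 * \<i>) - 1/2"
proof -
  define w where "w = exp (\<i> * (of_real pi * b))"
  have E: "exp (2 * of_real pi * \<i> * b) = w * w" unfolding w_def exp_add[symmetric] by (rule arg_cong[where f = exp]) simp
  have w0: "w \<noteq> 0" by (simp add: w_def)
  have n: "w * w - 1 \<noteq> 0" using exp_2pi_i_neq_1[OF assms] unfolding E .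
  have i: "exp (- (\<i> * (of_real pi * b))) = 1 / w" unfolding w_def exp_minus by (simp add: inverse_eq_divide)
  have s: "sin (of_real pi * b) = (w - 1/w) / (2 * \<i>)" unfolding sin_exp_eq i w_def[symmetric] ..
  have c: "cos (of_real pi * b) = (w + 1/w) / 2" unfolding cos_exp_eq i w_def[symmetric] ..
  have s2: "sin (of_real pi * b) = (w * w - 1) / (2 * \<i> * w)" unfolding s using w0 by (simp add: field_simps)
  have c2: "cos (of_real pi * b) = (w * w + 1) / (2 * w)" unfolding c using w0 by (simp add: field_simps)
  have "cot (of_real pi * b) = \<i> * (w * w + 1) / (w * w - 1)"
    unfolding cot_def s2 c2 using w0 n by simp
  moreover have alg: "\<i> * (x + 1) / (x - 1) / (2 * \<i>) - 1/2 = 1 / (x - 1)" if "x - 1 \<noteq> 0" for x :: complex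
  proof -
    have "\<i> * A / B / (2 * \<i>) = A / (2 * B)" for A B :: complex by simp
    then have "\<i> * (x + 1) / (x - 1) / (2 * \<i>) = (x + 1) / (2 * (x - 1))" .
    also have "(x + 1) / (2 * (x - 1)) - 1/2 = 1 / (x - 1)" using that by (simp add: divide_simps)
    finally show ?thesis .
  qed
  ultimately show ?thesis unfolding E by (simp only: alg[OF n])
qed

text \<open>The two circle integrals are combinations of the same two arc integrals. Their coefficients add up to those of the value at \<open>-1\<close>, times the
  sum of the cotangents, and one arc integral is left over.\<close>
lemma Hlim_eq:
  assumes pq: "Re p > 0" "Re q > 0" "p \<notin> \<int>" "q \<notin> \<int>"
  shows "Hlim p q = of_real pi * (cot (of_real pi * (- p)) + cot (of_real pi * (- q))) * hyp2F1 (- p) (- q) 1 (-1)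
     + \<i> * (exp (\<i> * p * of_real pi / 2) * Vint (- (\<i> * (p - q) / 2)) p q)"
proof -
  define y where "y = exp (\<i> * p * of_real pi / 2)"
  define Vp where "Vp = Vint (\<i> * (p - q) / 2) p q"
  define Vm where "Vm = Vint (- (\<i> * (p - q) / 2)) p q"
  define Ea where "Ea = exp (2 * of_real pi * \<i> * (- p))"
  define Eb where "Eb = exp (2 * of_real pi * \<i> * (- q))"
  have y0: "y \<noteq> 0" by (simp add: y_def)
  have iy: "exp (- (\<i> * p * of_real pi / 2)) = 1 / y" unfolding y_def exp_minus by (simp add: inverse_eq_divide)
  have iy2: "exp (- (\<i> * of_real pi * p)) = 1/y * (1/y)" unfolding iy[symmetric] exp_add[symmetric] by (rule arg_cong[where f = exp]) simp
  have Ea: "Ea = (1/y * (1/y)) * (1/y * (1/y))" unfolding iy2[symmetric] Ea_def exp_add[symmetric] by (rule arg_cong[where f = exp]) simp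
  have np: "- p \<notin> \<int>" "- q \<notin> \<int>" using pq by (auto simp: minus_in_Ints_iff)
  have nE: "Ea - 1 \<noteq> 0" "Eb - 1 \<noteq> 0" unfolding Ea_def Eb_def by (rule exp_2pi_i_neq_1[OF np(1)], rule exp_2pi_i_neq_1[OF np(2)])
  define S where "S = cot (of_real pi * (- p)) + cot (of_real pi * (- q))"
  have alg: "(x / (2 * \<i>) - 1/2) + (y / (2 * \<i>) - 1/2) + 1 = (x + y) / (2 * \<i>)" for x y
    by (simp add: field_simps)
  have S: "1 / (Ea - 1) + 1 / (Eb - 1) + 1 = S / (2 * \<i>)"
    unfolding Ea_def Eb_def inverse_exp_cot[OF np(1)] inverse_exp_cot[OF np(2)] S_def by (rule alg)
  have h1: "\<i> * (- q + (p + q)/2) = \<i> * (p - q) / 2" "\<i> * (- p + (p + q)/2) = - (\<i> * (p - q) / 2)" by (simp_all add: field_simps)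
  have M1: "integral {0..2 * pi} (\<lambda>\<theta>. exp (\<i> * (- q) * of_real \<theta>) * ((1 + cis \<theta>) powr q * (1 - cis \<theta>) powr p)) = 1/y * Vp + Eb * y * Vm"
    unfolding circle_moment[OF pq(1,2)] h1 iy exp_add Eb_def[symmetric] y_def[symmetric] Vp_def Vm_def ..
  have M2: "integral {0..2 * pi} (\<lambda>\<theta>. exp (\<i> * (- p) * of_real \<theta>) * ((1 + cis \<theta>) powr q * (1 - cis \<theta>) powr p)) = 1/y * Vm + Ea * y * Vp"
    unfolding circle_moment[OF pq(1,2)] h1 iy exp_add Ea_def[symmetric] y_def[symmetric] Vp_def Vm_def minus_minus ..
  have K: "of_real (2 * pi) * hyp2F1 (- p) (- q) 1 (-1) = 1/y * Vp + y * Vm"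
    unfolding hyp2F1_minus_one_Vint[OF pq(1,2)] iy y_def[symmetric] Vp_def Vm_def ..
  have "Hlim p q = \<i> * (1/y * Vp + Eb * y * Vm) / (Eb - 1) + 1/y * (1/y) * (\<i> * (1/y * Vm + Ea * y * Vp) / (Ea - 1))"
    unfolding Hlim_def M1 M2 iy2 Ea_def[symmetric] Eb_def[symmetric] ..
  also have "\<dots> = \<i> * ((1/(Ea - 1) + 1/(Eb - 1) + 1) * (1/y * Vp + y * Vm)) + \<i> * (y * Vm)"
  proof -
    have t1: "\<i> * (A + Eb * B) / (Eb - 1) = \<i> * (1/(Eb - 1) * A + (1 + 1/(Eb - 1)) * B)" for A B
      using nE(2) by (simp add: divide_simps)
    have t2: "1/y * (1/y) * (\<i> * (1/y * Vm + Ea * y * Vp) / (Ea - 1)) = \<i> * (Ea / (Ea - 1) * (1/y * Vp + y * Vm))"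
    proof -
      have "1/y * (1/y) * (1/y * Vm) = Ea * (y * Vm)" unfolding Ea using y0 by simp
      moreover have "1/y * (1/y) * (Ea * y * Vp) = Ea * (1/y * Vp)" using y0 by simp
      ultimately have "1/y * (1/y) * (1/y * Vm + Ea * y * Vp) = Ea * (1/y * Vp + y * Vm)" by (simp only: distrib_left)
        (simp only: add.commute)
      then have "\<i> * (1/y * (1/y) * (1/y * Vm + Ea * y * Vp)) / (Ea - 1) = \<i> * (Ea * (1/y * Vp + y * Vm)) / (Ea - 1)" by (simp only:)
      then show ?thesis by (simp only: times_divide_eq_right times_divide_eq_left mult_ac)
    qed
    have t3: "Ea / (Ea - 1) = 1 + 1/(Ea - 1)" using nE(1) by (simp add: divide_simps)
    have "\<i> * (1/y * Vp + Eb * y * Vm) / (Eb - 1) = \<i> * (1/(Eb - 1) * (1/y * Vp) + (1 + 1/(Eb - 1)) * (y * Vm))"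
      using t1[of "1/y * Vp" "y * Vm"] by (simp only: mult.assoc)
    moreover have "\<i> * (b * A + (1 + b) * B) + \<i> * ((1 + a) * (A + B)) = \<i> * ((a + b + 1) * (A + B)) + \<i> * B" for a b A B :: complex
      by (simp add: algebra_simps)
    ultimately show ?thesis unfolding t2 t3 by (simp only:)
  qed
  also have "\<dots> = of_real pi * S * hyp2F1 (- p) (- q) 1 (-1) + \<i> * (y * Vm)"
    unfolding S K[symmetric] by simp
  finally show ?thesis unfolding S_def y_def Vm_def .
qed

theorem Hfun_neg:
  assumes \<nu>: "\<nu> > 0" "2 * \<nu> \<notin> \<int>" and \<alpha>: "norm \<alpha> < 2 * \<nu>" and ni: "- of_real \<nu> - \<alpha>/2 \<notin> \<int>" "- of_real \<nu> + \<alpha>/2 \<notin> \<int>"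
  shows "Hfun \<alpha> (1 - 2 * (- of_real \<nu>)) = Gamma (of_real (- (2 * \<nu>))) * rGamma (- of_real \<nu> - \<alpha>/2) * rGamma (- of_real \<nu> + \<alpha>/2) *
    (of_real pi * (cot (of_real pi * (- of_real \<nu> - \<alpha>/2)) + cot (of_real pi * (- of_real \<nu> + \<alpha>/2))) * Kfun \<alpha> (- of_real \<nu>)
     + \<i> * (exp (\<i> * of_real (pi * \<nu>) / 2) * Wint (-1) \<nu> \<alpha>))"
proof -
  define p where "p = of_real \<nu> + \<alpha>/2"
  define q where "q = of_real \<nu> - \<alpha>/2"
  have mp: "- of_real \<nu> - \<alpha>/2 = - p" "- of_real \<nu> + \<alpha>/2 = - q" by (simp_all add: p_def q_def)
  have s: "p + q = of_real (2 * \<nu>)" "- p - q = of_real (- (2 * \<nu>))" "2 * (- of_real \<nu>) = - p - q" by (simp_all add: p_def q_def)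
  have "\<bar>Re \<alpha>\<bar> < 2 * \<nu>" using \<alpha> abs_Re_le_cmod[of \<alpha>] by linarith
  then have pq: "Re p > 0" "Re q > 0" by (auto simp: p_def q_def abs_if split: if_splits)
  have n: "p \<notin> \<int>" "q \<notin> \<int>" "p + q \<notin> \<int>"
    using ni unfolding mp minus_in_Ints_iff s of_real_in_Ints_iff using \<nu> by auto
  have "Hfun \<alpha> (1 - 2 * (- of_real \<nu>)) = Lim (at 2 within {z. Im z > 0}) (hyp2F1 (- p) (- q) (- p - q))"
  proof -
    have "(1 - (1 - 2 * (- complex_of_real \<nu>)))/2 = - of_real \<nu>" by simp
    then show ?thesis unfolding Hfun_def Let_def by (simp only: mp s(3))
  qed
  also have "\<dots> = Gamma (- p - q) * rGamma (- p) * rGamma (- q) * Hlim p q"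
    by (rule tendsto_Lim[OF upper_half_limit_nontrivial hyp2F1_boundary_value[OF pq n]])
  finally have H: "Hfun \<alpha> (1 - 2 * (- of_real \<nu>)) = Gamma (- p - q) * rGamma (- p) * rGamma (- q) * Hlim p q" .
  have K: "hyp2F1 (- p) (- q) 1 (-1) = Kfun \<alpha> (- of_real \<nu>)" unfolding Kfun_def mp ..
  have V: "exp (\<i> * p * of_real pi / 2) * Vint (- (\<i> * (p - q) / 2)) p q = exp (\<i> * of_real (pi * \<nu>) / 2) * Wint (-1) \<nu> \<alpha>"
  proof -
    have d: "p - q = \<alpha>" by (simp add: p_def q_def)
    have "Vint (- (\<i> * \<alpha> / 2)) p q = exp (- (\<i> * of_real pi * \<alpha> / 4)) * Wint (-1) \<nu> \<alpha>"
      using Vint_Wint[OF \<alpha>, of "-1"] by (simp add: p_def q_def)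
    moreover have "exp (\<i> * p * of_real pi / 2) * (exp (- (\<i> * of_real pi * \<alpha> / 4)) * Wint (-1) \<nu> \<alpha>) = exp (\<i> * of_real (pi * \<nu>) / 2) * Wint (-1) \<nu> \<alpha>"
      unfolding mult.assoc[symmetric] exp_add[symmetric] by (simp add: p_def field_simps)
    ultimately show ?thesis unfolding d by (simp only:)
  qed
  show ?thesis unfolding mp s(2)[symmetric] H Hlim_eq[OF pq n(1,2)] K V ..
qed

section \<open>The quotient N/D\<close>

lemma second_deriv_at:
  fixes f :: "complex \<Rightarrow> complex"
  assumes "open U" "z \<in> U" "\<And>x. x \<in> U \<Longrightarrow> (f has_field_derivative f' x) (at x)" "(f' has_field_derivative d) (at z)"
  shows "deriv f z = f' z" "(deriv ^^ 2) f z = d"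
proof -
  have d: "deriv f x = f' x" if "x \<in> U" for x by (rule DERIV_imp_deriv[OF assms(3)[OF that]])
  then show "deriv f z = f' z" using assms(2) by blast
  have "(deriv f has_field_derivative d) (at z)"
    by (rule has_field_derivative_transform_within_open[OF assms(4,1,2)]) (simp add: d)
  then have "deriv (deriv f) z = d" by (rule DERIV_imp_deriv)
  then show "(deriv ^^ 2) f z = d" by (simp add: numeral_2_eq_2)
qed

text \<open>The factors that are even in \<open>\<alpha>\<close> are stationary at 0, so no mixed term arises.\<close>
lemma second_deriv_mult_stationary:
  assumes "open U" "z \<in> U" "f holomorphic_on U" "g holomorphic_on U" "deriv f z = 0"
  shows "(deriv ^^ 2) (\<lambda>x. f x * g x) z = (deriv ^^ 2) f z * g z + f z * (deriv ^^ 2) g z"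
  using higher_deriv_mult[OF assms(3,4,1,2), of 2] assms(5) by (simp add: numeral_2_eq_2)

text \<open>The logarithmic derivative of the product is \<open>(\<psi>(s - \<alpha>/2) - \<psi>(s + \<alpha>/2))/2\<close>.\<close>
lemma rGamma_product_second_deriv:
  fixes s :: complex
  assumes "s \<notin> \<int>"
  shows "deriv (\<lambda>\<alpha>. rGamma (s - \<alpha>/2) * rGamma (s + \<alpha>/2)) 0 = 0"
    "(deriv ^^ 2) (\<lambda>\<alpha>. rGamma (s - \<alpha>/2) * rGamma (s + \<alpha>/2)) 0 = rGamma s * rGamma s * (- Polygamma 1 s / 2)"
proof -
  define U where "U = (\<lambda>\<alpha>::complex. s - \<alpha>/2) -` (- \<int>) \<inter> (\<lambda>\<alpha>. s + \<alpha>/2) -` (- \<int>)"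
  have oU: "open U" unfolding U_def by (intro open_Int open_vimage open_compl_Ints continuous_intros) auto
  have zU: "0 \<in> U" using assms by (simp add: U_def)
  have np: "s - \<alpha>/2 \<notin> \<int>\<^sub>\<le>\<^sub>0" "s + \<alpha>/2 \<notin> \<int>\<^sub>\<le>\<^sub>0" if "\<alpha> \<in> U" for \<alpha>
    using that nonpos_Ints_subset_Ints by (auto simp: U_def)
  define f' where "f' \<alpha> = rGamma (s - \<alpha>/2) * rGamma (s + \<alpha>/2) * ((Digamma (s - \<alpha>/2) - Digamma (s + \<alpha>/2)) / 2)" for \<alpha>
  have m: "((\<lambda>\<alpha>. s - \<alpha>/2) has_field_derivative (- (1/2))) (at \<alpha>)" "((\<lambda>\<alpha>. s + \<alpha>/2) has_field_derivative (1/2)) (at \<alpha>)" for \<alpha>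
    by (auto intro!: derivative_eq_intros)
  have rG: "((\<lambda>\<alpha>. rGamma (s - \<alpha>/2)) has_field_derivative (- rGamma (s - \<alpha>/2) * Digamma (s - \<alpha>/2)) * (- (1/2))) (at \<alpha>)"
    "((\<lambda>\<alpha>. rGamma (s + \<alpha>/2)) has_field_derivative (- rGamma (s + \<alpha>/2) * Digamma (s + \<alpha>/2)) * (1/2)) (at \<alpha>)" if "\<alpha> \<in> U" for \<alpha>
    by (rule DERIV_chain2[OF has_field_derivative_rGamma_no_nonpos_int m(1)] DERIV_chain2[OF has_field_derivative_rGamma_no_nonpos_int m(2)], rule np[OF that])+
  have 1: "((\<lambda>\<alpha>. rGamma (s - \<alpha>/2) * rGamma (s + \<alpha>/2)) has_field_derivative f' \<alpha>) (at \<alpha>)" if "\<alpha> \<in> U" for \<alpha>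
  proof -
    have g: "(- a * x) * (- (1/2)) * b + (- b * y) * (1/2) * a = a * b * ((x - y) / 2)" for a b x y :: complex
      by (simp add: field_simps)
    show ?thesis using DERIV_mult[OF rG[OF that]] unfolding f'_def g .
  qed
  have ps: "(Digamma has_field_derivative Polygamma 1 x) (at x)" if "x \<notin> \<int>\<^sub>\<le>\<^sub>0" for x :: complex
    using has_field_derivative_Polygamma[OF that, of 0 UNIV] by simp
  have D: "((\<lambda>\<alpha>. Digamma (s - \<alpha>/2)) has_field_derivative Polygamma 1 (s - 0/2) * (- (1/2))) (at 0)"
    "((\<lambda>\<alpha>. Digamma (s + \<alpha>/2)) has_field_derivative Polygamma 1 (s + 0/2) * (1/2)) (at 0)"
    by (rule DERIV_chain2[OF ps m(1)] DERIV_chain2[OF ps m(2)], rule np[OF zU])+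
  have D2: "((\<lambda>\<alpha>. (Digamma (s - \<alpha>/2) - Digamma (s + \<alpha>/2)) / 2) has_field_derivative (Polygamma 1 (s - 0/2) * (- (1/2)) - Polygamma 1 (s + 0/2) * (1/2)) / 2) (at 0)"
    by (rule DERIV_cdivide[OF DERIV_diff[OF D]])
  have 2: "(f' has_field_derivative rGamma s * rGamma s * (- Polygamma 1 s / 2)) (at 0)"
    using DERIV_mult[OF 1[OF zU] D2] unfolding f'_def[abs_def] by (simp add: mult_ac)
  show "deriv (\<lambda>\<alpha>. rGamma (s - \<alpha>/2) * rGamma (s + \<alpha>/2)) 0 = 0"
    using second_deriv_at(1)[OF oU zU 1 2] by (simp add: f'_def)
  show "(deriv ^^ 2) (\<lambda>\<alpha>. rGamma (s - \<alpha>/2) * rGamma (s + \<alpha>/2)) 0 = rGamma s * rGamma s * (- Polygamma 1 s / 2)"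
    by (rule second_deriv_at(2)[OF oU zU 1 2])
qed

lemma cot_sum_second_deriv:
  fixes s :: complex
  assumes "s \<notin> \<int>"
  defines "c \<equiv> of_real pi"
  shows "deriv (\<lambda>\<alpha>. cot (c * (s - \<alpha>/2)) + cot (c * (s + \<alpha>/2))) 0 = 0"
    "(deriv ^^ 2) (\<lambda>\<alpha>. cot (c * (s - \<alpha>/2)) + cot (c * (s + \<alpha>/2))) 0 = c * c * cos (c * s) / (sin (c * s)) ^ 3"
proof -
  define U where "U = (\<lambda>\<alpha>::complex. s - \<alpha>/2) -` (- \<int>) \<inter> (\<lambda>\<alpha>. s + \<alpha>/2) -` (- \<int>)"
  have oU: "open U" unfolding U_def by (intro open_Int open_vimage open_compl_Ints continuous_intros) auto
  have zU: "0 \<in> U" using assms by (simp add: U_def)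
  have np: "sin (c * (s - \<alpha>/2)) \<noteq> 0" "sin (c * (s + \<alpha>/2)) \<noteq> 0" if "\<alpha> \<in> U" for \<alpha>
    using that sin_pi_neq_0 unfolding c_def by (auto simp: U_def)
  have m: "((\<lambda>\<alpha>. c * (s - \<alpha>/2)) has_field_derivative (- (c/2))) (at \<alpha>)" "((\<lambda>\<alpha>. c * (s + \<alpha>/2)) has_field_derivative (c/2)) (at \<alpha>)" for \<alpha>
    by (auto intro!: derivative_eq_intros)
  have ct: "(cot has_field_derivative - inverse ((sin x)\<^sup>2)) (at x)" if "sin x \<noteq> 0" for x :: complex by (rule DERIV_cot[OF that])
  have cs: "((\<lambda>x. inverse ((sin x)\<^sup>2)) has_field_derivative - (2 * cos x / (sin x) ^ 3)) (at x)" if "sin x \<noteq> 0" for x :: complex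
    using that by (auto intro!: derivative_eq_intros simp: power2_eq_square power3_eq_cube field_simps)
  define f' where "f' \<alpha> = (c/2) * (inverse ((sin (c * (s - \<alpha>/2)))\<^sup>2) - inverse ((sin (c * (s + \<alpha>/2)))\<^sup>2))" for \<alpha>
  have 1: "((\<lambda>\<alpha>. cot (c * (s - \<alpha>/2)) + cot (c * (s + \<alpha>/2))) has_field_derivative f' \<alpha>) (at \<alpha>)" if "\<alpha> \<in> U" for \<alpha>
  proof -
    have "- x * (- (c/2)) + - y * (c/2) = (c/2) * (x - y)" for x y by (simp add: algebra_simps)
    then show ?thesis using DERIV_add[OF DERIV_chain2[OF ct[OF np(1)[OF that]] m(1)] DERIV_chain2[OF ct[OF np(2)[OF that]] m(2)]]
      unfolding f'_def by (simp only:)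
  qed
  have 2: "(f' has_field_derivative c * c * cos (c * s) / (sin (c * s)) ^ 3) (at 0)"
  proof -
    have "(c/2) * (- (2 * k / t) * (- (c/2)) - - (2 * k / t) * (c/2)) = c * c * k / t" for k t by (simp add: algebra_simps)
    then show ?thesis
      using DERIV_cmult[OF DERIV_diff[OF DERIV_chain2[OF cs[OF np(1)[OF zU]] m(1)] DERIV_chain2[OF cs[OF np(2)[OF zU]] m(2)]], of "c/2"]
      unfolding f'_def[abs_def] by (simp only: div_0 add_0_right diff_0_right)
  qed
  show "deriv (\<lambda>\<alpha>. cot (c * (s - \<alpha>/2)) + cot (c * (s + \<alpha>/2))) 0 = 0"
    using second_deriv_at(1)[OF oU zU 1 2] by (simp add: f'_def)
  show "(deriv ^^ 2) (\<lambda>\<alpha>. cot (c * (s - \<alpha>/2)) + cot (c * (s + \<alpha>/2))) 0 = c * c * cos (c * s) / (sin (c * s)) ^ 3"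
    by (rule second_deriv_at(2)[OF oU zU 1 2])
qed

text \<open>Here \<open>C\<close> and \<open>S\<close> stand for the cosine and sine of \<open>\<pi>\<nu>/2\<close>, so \<open>E = C + iS\<close> is unimodular with inverse \<open>m = C - iS\<close>. Each of the three
  bracketed coefficients is a multiple of \<open>m\<close>, hence of \<open>Y0\<close>, and the quotient becomes elementary.\<close>
lemma ND_algebra:
  fixes C S I D J P p E S0 S2 W :: complex
  assumes nz: "C \<noteq> 0" "S \<noteq> 0" "I \<noteq> 0" "P \<noteq> 0" "p \<noteq> 0" and CS: "C * C + S * S = 1"
    and E: "E = C + \<i> * S" and S0: "S0 = - ((C * C - S * S) / (S * C))"
    and S2: "S2 = - (p * p * (C * C - S * S) / (8 * (S * S * S) * (C * C * C)))"
    and W: "W = p * p * (C * C - S * S) / (8 * (S * S) * (C * C))"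
    and X0: "X0 = p * S0 * (C * P * I / p) + \<i> * (E * (P * I))"
    and X2: "X2 = p * (S2 * (C * P * I / p) + S0 * (P / (4 * p) * (C * D + 2 * S * J))) + \<i> * (E * (P / 4 * (D - \<i> * (2 * J))))"
  shows "X0 \<noteq> 0" "X2 / X0 = D / I / 4 - \<i> * ((S / C) * (S / C) * (J / I) / 2) + W * (1 + \<i> * (S / C))"
proof -
  define m where "m = C - \<i> * S"
  define Y0 where "Y0 = S0 * C + \<i> * E"
  have mE: "m * E = 1"
  proof -
    have "m * E = C * C - (\<i> * \<i>) * (S * S)" unfolding m_def E by (simp only: algebra_simps)
    then show ?thesis using CS by simp
  qed
  have iE: "\<i> * E = \<i> * C - S"
  proof -
    have "\<i> * E = \<i> * C + (\<i> * \<i>) * S" unfolding E by (simp only: algebra_simps)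
    then show ?thesis by simp
  qed
  have Y0: "Y0 = - (C / S) * m"
  proof -
    have "S0 * C - S = - (C * C / S)" unfolding S0 using nz by (simp add: field_simps)
    then have "Y0 = - (C * C / S) + \<i> * C" unfolding Y0_def iE by (simp add: algebra_simps)
    also have "\<dots> = - (C / S) * m" unfolding m_def using nz by (simp add: algebra_simps)
    finally show ?thesis .
  qed
  have Y1: "S0 * S + E = - (\<i> * ((S / C) * (S / C))) * Y0"
  proof -
    have "S0 * S + C = S * S / C" unfolding S0 using nz by (simp add: field_simps)
    then have a: "S0 * S + E = S * S / C + \<i> * S" unfolding E by (simp add: algebra_simps)
    have "- (\<i> * ((S / C) * (S / C))) * Y0 = \<i> * (S / C) * m" unfolding Y0 using nz by simp
    also have "\<dots> = \<i> * S - (\<i> * \<i>) * (S * S / C)" unfolding m_def using nz by (simp only: algebra_simps) simp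
    finally show ?thesis unfolding a by simp
  qed
  have m0: "m \<noteq> 0" using mE by auto
  have Y0n: "Y0 \<noteq> 0" unfolding Y0 using nz m0 by simp
  have t: "Y0 * (1 + \<i> * (S / C)) = - (1 / S)"
  proof -
    have "1 + \<i> * (S / C) = E / C" unfolding E using nz by (simp add: add_divide_distrib)
    then have "Y0 * (1 + \<i> * (S / C)) = - ((m * E) / S)" unfolding Y0 using nz by simp
    then show ?thesis unfolding mE .
  qed
  have Y2: "S2 * C = Y0 * (W * (1 + \<i> * (S / C)))"
  proof -
    have "Y0 * (W * (1 + \<i> * (S / C))) = W * - (1 / S)" unfolding t[symmetric] by (simp only: mult_ac)
    also have "\<dots> = S2 * C" unfolding W S2 using nz by (simp add: mult_ac)
    finally show ?thesis ..
  qed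
  have X0': "X0 = P * I * Y0" unfolding X0 Y0_def using nz by (simp add: algebra_simps)
  show X0n: "X0 \<noteq> 0" unfolding X0' using nz Y0n by simp
  have "X2 = P * I * (S2 * C) + P * (D/4) * Y0 + P * (J/2) * (S0 * S + E)"
  proof -
    have "\<i> * (E * (P / 4 * (D - \<i> * (2 * J)))) = \<i> * E * (P * (D/4)) - (\<i> * \<i>) * (E * (P * (J/2)))" by (simp add: algebra_simps)
    also have "\<dots> = \<i> * E * (P * (D/4)) + E * (P * (J/2))" by simp
    finally have a: "\<i> * (E * (P / 4 * (D - \<i> * (2 * J)))) = \<i> * E * (P * (D/4)) + E * (P * (J/2))" .
    have b: "p * (S2 * (C * P * I / p) + S0 * (P / (4 * p) * (C * D + 2 * S * J))) = P * I * (S2 * C) + (S0 * C) * (P * (D/4)) + (S0 * S) * (P * (J/2))"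
      using nz by (simp add: field_simps)
    show ?thesis unfolding X2 a b Y0_def by (simp only: algebra_simps)
  qed
  also have "\<dots> = X0 * (D / I / 4 - \<i> * ((S / C) * (S / C) * (J / I) / 2) + W * (1 + \<i> * (S / C)))"
  proof -
    have "P * I * (y * V) + P * (D/4) * y + P * (J/2) * (- (\<i> * u) * y) = P * I * y * (D / I / 4 - \<i> * (u * (J / I) / 2) + V)" for y V u
      using nz by (simp add: field_simps)
    then show ?thesis unfolding Y2 Y1 X0' .
  qed
  finally show "X2 / X0 = D / I / 4 - \<i> * ((S / C) * (S / C) * (J / I) / 2) + W * (1 + \<i> * (S / C))"
    using X0n by simp
qed

text \<open>The logarithmic second derivative of the Gamma prefactor contributes the trigamma term, \<open>K\<close> and \<open>W\<close> contribute \<open>Q_rat - i T\<close>, and the curvature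
  of the cotangents the last term, which cancels between \<open>Im\<close> and \<open>Re\<close> in the final identity.\<close>
lemma ND_neg:
  assumes \<nu>: "\<nu> > 0" "2 * \<nu> \<notin> \<int>"
  defines "C \<equiv> cos (pi * \<nu> / 2)" and "S \<equiv> sin (pi * \<nu> / 2)"
  shows "ND (- of_real \<nu>) = (1/2) * (- Polygamma 1 (- of_real \<nu>) / 2 + Qrat (- of_real \<nu>) - \<i> * Tfun (- of_real \<nu>)
     + of_real (pi * pi * (C * C - S * S) / (8 * (S * S) * (C * C))) * (1 + \<i> * of_real (S / C)))"
proof -
  define s where "s = - complex_of_real \<nu>"
  have \<nu>2: "\<nu> \<notin> \<int>"
  proof
    assume "\<nu> \<in> \<int>"
    then have "2 * \<nu> \<in> \<int>" by (intro Ints_mult) auto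
    with \<nu> show False by simp
  qed
  then have si: "s \<notin> \<int>" by (simp add: s_def minus_in_Ints_iff)
  define c where "c = complex_of_real pi"
  define U where "U = ball 0 (2 * \<nu>) \<inter> ((\<lambda>\<alpha>::complex. s - \<alpha>/2) -` (- \<int>) \<inter> (\<lambda>\<alpha>. s + \<alpha>/2) -` (- \<int>))"
  have oU: "open U" unfolding U_def by (intro open_Int open_ball open_vimage open_compl_Ints continuous_intros) auto
  have zU: "0 \<in> U" using si \<nu> by (simp add: U_def)
  define G where "G = Gamma (complex_of_real (- (2 * \<nu>)))"
  define f where "f \<alpha> = rGamma (s - \<alpha>/2) * rGamma (s + \<alpha>/2)" for \<alpha>
  define k where "k \<alpha> = cot (c * (s - \<alpha>/2)) + cot (c * (s + \<alpha>/2))" for \<alpha>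
  define E where "E = exp (\<i> * of_real (pi * \<nu>) / 2)"
  define X where "X \<alpha> = c * (k \<alpha> * Kfun \<alpha> s) + \<i> * (E * Wint (-1) \<nu> \<alpha>)" for \<alpha>
  have H: "Hfun \<alpha> (1 - 2 * s) = G * (f \<alpha> * X \<alpha>)" if "\<alpha> \<in> U" for \<alpha>
    using Hfun_neg[OF \<nu>, of \<alpha>] that unfolding s_def[symmetric] U_def G_def f_def X_def k_def E_def c_def by (simp add: mult_ac)
  have hf: "f holomorphic_on U" unfolding f_def[abs_def] by (intro holomorphic_intros) auto
  have hk: "k holomorphic_on U" unfolding k_def[abs_def] cot_def
    by (intro holomorphic_intros) (use sin_pi_neq_0 in \<open>auto simp: U_def c_def\<close>)
  have hK: "(\<lambda>\<alpha>. Kfun \<alpha> s) holomorphic_on U" by (rule Kfun_holomorphic[OF oU]) (intro holomorphic_intros)+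
  have hW: "Wint (-1) \<nu> holomorphic_on U" using Wint_holomorphic[OF \<nu>(1)] by (rule holomorphic_on_subset) (auto simp: U_def)
  have hkK: "(\<lambda>\<alpha>. k \<alpha> * Kfun \<alpha> s) holomorphic_on U" by (intro holomorphic_on_mult hk hK)
  have hX: "X holomorphic_on U" unfolding X_def[abs_def] by (intro holomorphic_intros hkK hW)
  have hfX: "(\<lambda>\<alpha>. f \<alpha> * X \<alpha>) holomorphic_on U" by (intro holomorphic_on_mult hf hX)
  have dH: "(deriv ^^ 2) (\<lambda>\<alpha>. Hfun \<alpha> (1 - 2 * s)) 0 = G * ((deriv ^^ 2) f 0 * X 0 + f 0 * (deriv ^^ 2) X 0)"
  proof -
    have "\<forall>\<^sub>F \<alpha> in nhds 0. \<alpha> \<in> U" using oU zU by (rule eventually_nhds_in_open)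
    then have "\<forall>\<^sub>F \<alpha> in nhds 0. Hfun \<alpha> (1 - 2 * s) = G * (f \<alpha> * X \<alpha>)" by (rule eventually_mono) (rule H)
    then have "(deriv ^^ 2) (\<lambda>\<alpha>. Hfun \<alpha> (1 - 2 * s)) 0 = (deriv ^^ 2) (\<lambda>\<alpha>. G * (f \<alpha> * X \<alpha>)) 0"
      by (rule higher_deriv_cong_ev) simp
    also have "\<dots> = G * (deriv ^^ 2) (\<lambda>\<alpha>. f \<alpha> * X \<alpha>) 0" by (rule higher_deriv_cmult[OF hfX zU oU])
    also have "(deriv ^^ 2) (\<lambda>\<alpha>. f \<alpha> * X \<alpha>) 0 = (deriv ^^ 2) f 0 * X 0 + f 0 * (deriv ^^ 2) X 0"
      by (rule second_deriv_mult_stationary[OF oU zU hf hX]) (simp add: f_def[abs_def] rGamma_product_second_deriv(1)[OF si])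
    finally show ?thesis .
  qed
  have dX: "(deriv ^^ 2) X 0 = c * ((deriv ^^ 2) k 0 * Kfun0 s + k 0 * Kfun2 s) + \<i> * (E * (deriv ^^ 2) (Wint (-1) \<nu>) 0)"
  proof -
    have "(deriv ^^ 2) X 0 = (deriv ^^ 2) (\<lambda>\<alpha>. c * (k \<alpha> * Kfun \<alpha> s)) 0 + (deriv ^^ 2) (\<lambda>\<alpha>. \<i> * (E * Wint (-1) \<nu> \<alpha>)) 0"
      unfolding X_def[abs_def] by (rule higher_deriv_add[OF _ _ oU zU]) (intro holomorphic_intros hkK hW)+
    also have "(deriv ^^ 2) (\<lambda>\<alpha>. c * (k \<alpha> * Kfun \<alpha> s)) 0 = c * (deriv ^^ 2) (\<lambda>\<alpha>. k \<alpha> * Kfun \<alpha> s) 0"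
      by (rule higher_deriv_cmult[OF hkK zU oU])
    also have "(deriv ^^ 2) (\<lambda>\<alpha>. k \<alpha> * Kfun \<alpha> s) 0 = (deriv ^^ 2) k 0 * Kfun 0 s + k 0 * (deriv ^^ 2) (\<lambda>\<alpha>. Kfun \<alpha> s) 0"
      by (rule second_deriv_mult_stationary[OF oU zU hk hK]) (simp add: k_def[abs_def] c_def cot_sum_second_deriv(1)[OF si])
    also have "(deriv ^^ 2) (\<lambda>\<alpha>. \<i> * (E * Wint (-1) \<nu> \<alpha>)) 0 = \<i> * (E * (deriv ^^ 2) (Wint (-1) \<nu>) 0)"
      using higher_deriv_cmult[OF hW zU oU, of 2 "\<i> * E"] by (simp only: mult.assoc)
    finally show ?thesis unfolding Kfun0_def Kfun2_def .
  qed
  have f0: "f 0 = rGamma s * rGamma s" "f 0 \<noteq> 0" and G0: "G \<noteq> 0"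
  proof -
    have "s \<notin> \<int>\<^sub>\<le>\<^sub>0" using si nonpos_Ints_subset_Ints by auto
    then show "f 0 = rGamma s * rGamma s" "f 0 \<noteq> 0" by (simp_all add: f_def rGamma_eq_zero_iff)
    have "complex_of_real (- (2 * \<nu>)) \<notin> \<int>" unfolding of_real_in_Ints_iff minus_in_Ints_iff using \<nu> by simp
    then show "G \<noteq> 0" using nonpos_Ints_subset_Ints by (auto simp: G_def Gamma_eq_zero_iff)
  qed
  have df: "(deriv ^^ 2) f 0 = f 0 * (- Polygamma 1 s / 2)"
    unfolding f0(1) unfolding f_def[abs_def] by (rule rGamma_product_second_deriv(2)[OF si])
  have CS0: "C \<noteq> 0" "S \<noteq> 0" unfolding C_def S_def by (rule cos_half_neq_0[OF \<nu>2])+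
  have I0: "sinint \<nu> \<noteq> 0" using sinint_pos[OF \<nu>(1)] by simp
  have y: "c * s = - (2 * complex_of_real (pi * \<nu> / 2))" by (simp add: c_def s_def)
  have cS: "cos (complex_of_real (pi * \<nu> / 2)) = of_real C" "sin (complex_of_real (pi * \<nu> / 2)) = of_real S"
    unfolding C_def S_def by (simp_all only: cos_of_real sin_of_real)
  have tr: "cos (c * s) = of_real C * of_real C - of_real S * of_real S" "sin (c * s) = - (2 * (of_real S * of_real C))"
    unfolding y cos_minus sin_minus cos_double sin_double cS by (simp_all add: power2_eq_square)
  have E': "E = of_real C + \<i> * of_real S"
  proof -
    have "\<i> * of_real (pi * \<nu>) / 2 = \<i> * complex_of_real (pi * \<nu> / 2)" by simp
    then show ?thesis unfolding E_def by (simp only: exp_Euler cS)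
  qed
  have k0: "k 0 = - ((of_real C * of_real C - of_real S * of_real S) / (of_real S * of_real C))"
  proof -
    have "A / (- (2 * B)) + A / (- (2 * B)) = - (A / B)" for A B :: complex
      by (cases "B = 0") (simp_all add: field_simps)
    then show ?thesis unfolding k_def cot_def div_0 diff_0_right add_0_right tr .
  qed
  have k2: "(deriv ^^ 2) k 0 = - (c * c * (of_real C * of_real C - of_real S * of_real S) / (8 * (of_real S * of_real S * of_real S) * (of_real C * of_real C * of_real C)))"
  proof -
    have "(deriv ^^ 2) k 0 = c * c * cos (c * s) / (sin (c * s)) ^ 3"
      unfolding k_def[abs_def] c_def by (rule cot_sum_second_deriv(2)[OF si])
    moreover have "(- (2 * (x * y))) ^ 3 = - (8 * (x * x * x) * (y * y * y))" for x y :: complex by (simp add: power3_eq_cube)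
    ultimately show ?thesis unfolding tr by simp
  qed
  have cc: "complex_of_real C * of_real C + of_real S * of_real S = 1"
  proof -
    have "C * C + S * S = 1" unfolding C_def S_def using sin_cos_squared_add3[of "pi * \<nu> / 2"] by simp
    then have "complex_of_real (C * C + S * S) = of_real 1" by (rule arg_cong)
    then show ?thesis by simp
  qed
  define I where "I = complex_of_real (sinint \<nu>)"
  define D where "D = complex_of_real (lam2int \<nu> - ph2int \<nu>)"
  define J where "J = complex_of_real (lamphint \<nu>)"
  define P where "P = complex_of_real (2 powr \<nu>)"
  have K0: "Kfun0 s = of_real C * P * I / c" unfolding s_def Kfun0_neg[OF \<nu>(1)] C_def P_def I_def c_def by simp
  have K2: "Kfun2 s = P / (4 * c) * (of_real C * D + 2 * of_real S * J)"
    unfolding s_def Kfun_second_deriv_neg[OF \<nu>(1)] C_def S_def P_def D_def J_def c_def by simp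
  have W0: "Wint (-1) \<nu> 0 = P * I" unfolding Wint_0[OF \<nu>(1)] P_def I_def by simp
  have W2: "(deriv ^^ 2) (Wint (-1) \<nu>) 0 = P / 4 * (D - \<i> * (2 * J))"
    by (subst Wint_second_deriv[OF \<nu>(1)]) (simp_all add: P_def D_def J_def)
  have nz: "complex_of_real C \<noteq> 0" "complex_of_real S \<noteq> 0" "I \<noteq> 0" "P \<noteq> 0" "c \<noteq> 0"
    using CS0 I0 by (simp_all add: I_def P_def c_def)
  have X0: "X 0 = c * k 0 * (of_real C * P * I / c) + \<i> * (E * (P * I))"
    unfolding X_def W0 Kfun0_def[symmetric] K0 by (simp only: mult.assoc)
  note alg = ND_algebra[OF nz cc E' k0 k2 refl X0 dX[unfolded K0 K2 W2]]
  have "ND s = (1/2) * (G * ((deriv ^^ 2) f 0 * X 0 + f 0 * (deriv ^^ 2) X 0) / (G * (f 0 * X 0)))"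
    unfolding ND_def dH H[OF zU] ..
  also have "\<dots> = (1/2) * (- Polygamma 1 s / 2 + (deriv ^^ 2) X 0 / X 0)"
  proof -
    have gen: "(G * (f * L * x + f * x2)) / (G * (f * x)) = L + x2 / x" if "G \<noteq> 0" "f \<noteq> 0" "x \<noteq> 0" for G f L x x2 :: complex
      using that by (simp add: field_simps)
    show ?thesis unfolding df by (simp only: gen[OF G0 f0(2) alg(1)])
  qed
  also have "D / I / 4 = Qrat s" unfolding s_def Qrat_neg[OF \<nu>(1)] D_def I_def by (simp add: diff_divide_distrib)
  note q = this
  have T: "of_real S / of_real C * (of_real S / of_real C) * (J / I) / 2 = Tfun s"
    unfolding s_def Tfun_neg[OF \<nu>(1) \<nu>2] J_def I_def by (simp add: tan_def C_def[symmetric] S_def[symmetric] power2_eq_square)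
  show ?thesis
    unfolding s_def[symmetric] using calculation unfolding alg(2) q T
    by (simp add: c_def add.assoc)
qed

theorem ND_identity:
  fixes x :: real
  assumes "x < 0" "2 * x \<notin> \<int>"
  shows "complex_of_real (Im (ND (of_real x))) =
         - (1/2) * Tfun (of_real x) + tan (of_real pi * of_real x / 2) * Efun 0 (of_real x)"
proof -
  define \<nu> where "\<nu> = - x"
  have "2 * \<nu> = - (2 * x)" by (simp add: \<nu>_def)
  then have \<nu>: "\<nu> > 0" "2 * \<nu> \<notin> \<int>" using assms by (simp_all only: minus_in_Ints_iff) (auto simp: \<nu>_def)
  have \<nu>2: "\<nu> \<notin> \<int>"
  proof
    assume "\<nu> \<in> \<int>"
    then have "2 * \<nu> \<in> \<int>" by (intro Ints_mult) auto
    with \<nu> show False by simp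
  qed
  have x: "complex_of_real x = - of_real \<nu>" by (simp add: \<nu>_def)
  define C where "C = cos (pi * \<nu> / 2)"
  define S where "S = sin (pi * \<nu> / 2)"
  define W where "W = pi * pi * (C * C - S * S) / (8 * (S * S) * (C * C))"
  define T where "T = (tan (pi * \<nu> / 2))\<^sup>2 * (lamphint \<nu> / sinint \<nu>) / 2"
  define q where "q = (lam2int \<nu> / sinint \<nu> - ph2int \<nu> / sinint \<nu>) / 4"
  have T: "Tfun (- of_real \<nu>) = of_real T" unfolding T_def by (rule Tfun_neg[OF \<nu>(1) \<nu>2])
  have q: "Qrat (- of_real \<nu>) = of_real q" unfolding q_def by (rule Qrat_neg[OF \<nu>(1)])
  obtain \<psi> :: real where \<psi>: "Polygamma 1 (- complex_of_real \<nu>) = of_real \<psi>"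
  proof -
    have "- \<nu> \<noteq> 0" using \<nu>(1) by simp
    then have "Polygamma 1 (complex_of_real (- \<nu>)) = of_real (Polygamma 1 (- \<nu>))" by (rule Polygamma_of_real)
    then show ?thesis by (intro that) simp
  qed
  have N: "ND (- of_real \<nu>) = (1/2) * (- of_real \<psi> / 2 + of_real q - \<i> * of_real T + of_real W * (1 + \<i> * of_real (S / C)))"
    unfolding ND_neg[OF \<nu>] \<psi> q T W_def C_def S_def ..
  have R: "Re (ND (- of_real \<nu>)) = (- \<psi> / 2 + q + W) / 2" and Im: "Im (ND (- of_real \<nu>)) = (- T + W * (S / C)) / 2"
    unfolding N by (simp_all add: field_simps)
  have t: "tan (of_real pi * (- of_real \<nu>) / 2) = complex_of_real (- (S / C))"
  proof -
    have "of_real pi * (- of_real \<nu>) / 2 = complex_of_real (- (pi * \<nu> / 2))" by simp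
    then have "tan (of_real pi * (- of_real \<nu>) / 2) = complex_of_real (tan (- (pi * \<nu> / 2)))" by (simp only: tan_of_real)
    then show ?thesis by (simp add: tan_def C_def S_def)
  qed
  have "Efun 0 (- of_real \<nu>) = of_real (- W / 2)"
    unfolding Efun_def R q \<psi> by (simp add: field_simps)
  then show ?thesis unfolding x Im T t by (simp add: field_simps)
qed

section \<open>Meromorphy and the theorem\<close>

lemma eventually_not_Ints: "\<forall>\<^sub>F z in at (w :: complex). z \<notin> \<int>"
proof -
  have "open (- (\<int> - {w}))" by (intro open_Compl closed_subset_Ints) auto
  then show ?thesis unfolding eventually_at_topological by (intro exI[of _ "- (\<int> - {w})"]) auto
qed

text \<open>The trigamma function is minus the second logarithmic derivative of the entire function \<open>rGamma\<close>, off the integers.\<close>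
lemma Polygamma_1_meromorphic: "(Polygamma 1 :: complex \<Rightarrow> complex) meromorphic_on UNIV"
proof -
  define r where "r = (rGamma :: complex \<Rightarrow> complex)"
  have h: "r holomorphic_on UNIV" "deriv r holomorphic_on UNIV" "deriv (deriv r) holomorphic_on UNIV"
    unfolding r_def by (auto intro!: holomorphic_deriv holomorphic_intros)
  have eq: "Polygamma 1 z = - (deriv (deriv r) z * r z - deriv r z * deriv r z) / (r z * r z)" if z: "z \<notin> \<int>" for z
  proof -
    have np: "w \<notin> \<int>\<^sub>\<le>\<^sub>0" if "w \<in> - \<int>" for w :: complex using that nonpos_Ints_subset_Ints by auto
    have r0: "r w \<noteq> 0" if "w \<in> - \<int>" for w using np[OF that] by (simp add: r_def rGamma_eq_zero_iff)
    have dg: "Digamma w = - deriv r w / r w" if "w \<in> - \<int>" for w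
    proof -
      have "deriv r w = - r w * Digamma w"
        unfolding r_def by (rule DERIV_imp_deriv[OF has_field_derivative_rGamma_no_nonpos_int[OF np[OF that]]])
      then show ?thesis using r0[OF that] by simp
    qed
    have d: "(r has_field_derivative deriv r z) (at z)" "(deriv r has_field_derivative deriv (deriv r) z) (at z)"
      using h by (auto intro!: holomorphic_derivI[of _ UNIV])
    have "((\<lambda>w. - deriv r w / r w) has_field_derivative ((- deriv (deriv r) z) * r z - (- deriv r z) * deriv r z) / (r z * r z)) (at z)"
      by (rule DERIV_divide[OF DERIV_minus[OF d(2)] d(1)]) (use r0 z in auto)
    then have "(Digamma has_field_derivative ((- deriv (deriv r) z) * r z - (- deriv r z) * deriv r z) / (r z * r z)) (at z)"
      by (rule has_field_derivative_transform_within_open[OF _ open_compl_Ints]) (use z dg in auto)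
    moreover have "(Digamma has_field_derivative Polygamma 1 z) (at z)"
      using has_field_derivative_Polygamma[OF np[of z], of 0 UNIV] z by simp
    ultimately have "Polygamma 1 z = ((- deriv (deriv r) z) * r z - (- deriv r z) * deriv r z) / (r z * r z)" by (rule DERIV_unique[rotated])
    then show ?thesis by simp
  qed
  have a: "r meromorphic_on UNIV" "deriv r meromorphic_on UNIV" "deriv (deriv r) meromorphic_on UNIV"
    using h by (auto intro!: analytic_on_imp_meromorphic_on simp: analytic_on_open)
  have m: "(\<lambda>z. - (deriv (deriv r) z * r z - deriv r z * deriv r z) / (r z * r z)) meromorphic_on UNIV"
    by (intro meromorphic_intros a)
  have ev: "\<forall>\<^sub>F z in at w. Polygamma 1 z = - (deriv (deriv r) z * r z - deriv r z * deriv r z) / (r z * r z)" for w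
    using eventually_not_Ints by (rule eventually_mono) (rule eq)
  show ?thesis by (rule meromorphic_on_cong[THEN iffD2, OF ev refl m])
qed

lemma Qrat_meromorphic: "Qrat meromorphic_on UNIV"
proof -
  have "(\<lambda>s. Polygamma 1 ((1 - s)/2)) meromorphic_on UNIV" "(\<lambda>s. Polygamma 1 (1 - s/2)) meromorphic_on UNIV"
    by (rule meromorphic_on_compose[OF Polygamma_1_meromorphic]; auto intro!: analytic_intros)+
  then show ?thesis unfolding Qrat_def[abs_def] by (intro meromorphic_intros)
qed

lemma Qfun_meromorphic: "Qfun meromorphic_on UNIV"
proof -
  have "Kfun2 meromorphic_on UNIV" "Kfun0 meromorphic_on UNIV"
    using Kfun2_holomorphic Kfun0_holomorphic by (auto intro!: analytic_on_imp_meromorphic_on simp: analytic_on_open)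
  then show ?thesis unfolding Qfun_def[abs_def] by (intro meromorphic_intros)
qed

lemma meromorphic_not_pole_tendsto:
  assumes "f meromorphic_on UNIV" "\<not> is_pole f z" obtains l where "f \<midarrow>z\<rightarrow> l"
proof -
  have "f meromorphic_on {z}" using assms(1) by (rule meromorphic_on_subset) simp
  then have "not_essential f z" by (simp add: meromorphic_at_iff)
  then show ?thesis using assms(2) that unfolding not_essential_def by blast
qed

lemma lattice2_not_Ints: assumes "s0 \<notin> \<int>" "s \<in> lattice2 s0" shows "s \<notin> \<int>"
proof
  assume s: "s \<in> \<int>"
  from assms(2) obtain k :: nat where k: "s = s0 - 2 * of_nat k" unfolding lattice2_def by blast
  have "s + 2 * of_nat k \<in> \<int>" using s by (intro Ints_add Ints_mult) auto
  with k assms(1) show False by simp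
qed

text \<open>Near \<open>s\<close> the function \<open>cotT\<close> equals \<open>Qrat - Qfun\<close>, so its limit exists as soon as the other two do.\<close>
lemma remove_sings_relation:
  assumes "\<not> is_pole Qfun s" "\<not> is_pole Qrat s"
  shows "remove_sings Qfun s = remove_sings Qrat s - remove_sings cotT s"
proof -
  obtain l m where l: "Qfun \<midarrow>s\<rightarrow> l" and m: "Qrat \<midarrow>s\<rightarrow> m"
    using meromorphic_not_pole_tendsto[OF Qfun_meromorphic assms(1)] meromorphic_not_pole_tendsto[OF Qrat_meromorphic assms(2)] by metis
  have "\<forall>\<^sub>F z in at s. Qrat z - Qfun z = cotT z"
    using eventually_not_Ints
  proof (rule eventually_mono)
    fix z :: complex assume "z \<notin> \<int>"
    then have "Cfun z = 0" by (rule Cfun_eq_0)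
    then have "Qfun z - Qrat z + cotT z = 0" unfolding Cfun_def .
    then show "Qrat z - Qfun z = cotT z" by (metis add.commute add_eq_0_iff minus_diff_eq)
  qed
  then have "cotT \<midarrow>s\<rightarrow> m - l" using tendsto_diff[OF m l] by (rule Lim_transform_eventually[rotated])
  then show ?thesis using remove_sings_eqI[OF l] remove_sings_eqI[OF m] remove_sings_eqI[of cotT] by simp
qed

theorem theoremA12:
  shows "Cfun meromorphic_on UNIV \<and> remove_sings Cfun = (\<lambda>_. 0) \<and>
    (\<forall>s. s \<notin> \<int> \<longrightarrow> Cfun s = 0) \<and>
    (\<forall>s0 c. s0 \<notin> \<int> \<longrightarrow>
       ((\<forall>s\<in>lattice2 s0. Qfun s = c + Qrat s - cot (of_real pi * s / 2) * Tfun s) \<longleftrightarrow> c = 0)) \<and>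
    (\<forall>s0 c. (\<forall>s\<in>lattice2 s0. \<not> is_pole Qfun s \<and> \<not> is_pole Qrat s \<and> \<not> is_pole cotT s) \<longrightarrow>
       ((\<forall>s\<in>lattice2 s0. remove_sings Qfun s = c + remove_sings Qrat s - remove_sings cotT s)
         \<longleftrightarrow> c = 0)) \<and>
    (\<forall>x::real. x < 0 \<and> 2 * x \<notin> \<int> \<longrightarrow>
       complex_of_real (Im (ND (of_real x))) =
         - (1/2) * Tfun (of_real x) + tan (of_real pi * of_real x / 2) * Efun 0 (of_real x))"
proof (intro conjI allI impI)
  have ev: "\<forall>\<^sub>F z in at w. Cfun z = 0" for w
    using eventually_not_Ints by (rule eventually_mono) (rule Cfun_eq_0)
  have "(\<lambda>_::complex. 0::complex) meromorphic_on UNIV" by (intro meromorphic_intros)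
  then show "Cfun meromorphic_on UNIV" using meromorphic_on_cong[of UNIV Cfun "\<lambda>_. 0"] ev by blast
  show "remove_sings Cfun = (\<lambda>_. 0)"
  proof (rule ext, rule remove_sings_eqI)
    show "Cfun \<midarrow>z\<rightarrow> 0" for z using ev by (rule tendsto_eventually)
  qed
  show "Cfun s = 0" if "s \<notin> \<int>" for s by (rule Cfun_eq_0[OF that])
  have mem: "s0 \<in> lattice2 s0" for s0 unfolding lattice2_def by (rule CollectI, rule exI[of _ 0]) simp
  show "(\<forall>s\<in>lattice2 s0. Qfun s = c + Qrat s - cot (of_real pi * s / 2) * Tfun s) \<longleftrightarrow> c = 0" if "s0 \<notin> \<int>" for s0 c
  proof -
    have Q: "Qfun s = Qrat s - cot (of_real pi * s / 2) * Tfun s" if s: "s \<in> lattice2 s0" for s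
    proof -
      have "Qfun s - Qrat s + cot (of_real pi * s / 2) * Tfun s = 0"
        using Cfun_eq_0[OF lattice2_not_Ints[OF \<open>s0 \<notin> \<int>\<close> s]] unfolding Cfun_def cotT_def .
      then show ?thesis by (simp add: algebra_simps add_eq_0_iff2)
    qed
    show ?thesis using Q mem[of s0] by auto
  qed
  show "(\<forall>s\<in>lattice2 s0. remove_sings Qfun s = c + remove_sings Qrat s - remove_sings cotT s) \<longleftrightarrow> c = 0"
    if "\<forall>s\<in>lattice2 s0. \<not> is_pole Qfun s \<and> \<not> is_pole Qrat s \<and> \<not> is_pole cotT s" for s0 c
    using that remove_sings_relation mem[of s0] by auto
  show "complex_of_real (Im (ND (of_real x))) =
         - (1/2) * Tfun (of_real x) + tan (of_real pi * of_real x / 2) * Efun 0 (of_real x)"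
    if "x < 0 \<and> 2 * x \<notin> \<int>" for x :: real
    using that by (intro ND_identity) auto
qed

end
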